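(* Let $\mathcal{K}$ be an $\infty$-cosmos and let $\mathcal{A}$ be a small simplicial category. (i) For any diagram (simplicial functor) $F\colon\mathcal{A}\to\mathcal{K}$ and flexible weight $W\colon\mathcal{A}\to\mathbf{SSet}$, the weighted limit $\{W,F\}$ exists in $\mathcal{K}$. (ii) For any diagram $F\colon\mathcal{A}\to\mathcal{K}$, flexible weights $W,W'\colon\mathcal{A}\to\mathbf{SSet}$, and projective cell complex $i\colon W\hookrightarrow W'$, the induced map $\{i,F\}\colon\{W',F\}\to\{W,F\}$ is an isofibration. It follows that the construction of these flexible limits may be extended to a simplicial bifunctor $\{-,-\}_{\mathcal{A}}\colon(\mathbf{Flex}^{\mathcal{A}})^{\mathrm{op}}\times\mathcal{K}^{\mathcal{A}}\to\mathcal{K}$ which carries projective cell complexes to isofibrations. (iii) If $\kappa\colon F\Rightarrow G$ is a simplicial natural transformation between diagrams $F,G\colon\mathcal{A}\to\mathcal{K}$ whose components are equivalences, isofibrations, or trivial fibrations in $\mathcal{K}$, and $W$ is a flexible weight, then the induced map $\{W,\kappa\}\colon\{W,F\}\to\{W,G\}$ is an equivalence, isofibration, or trivial fibration (respectively) in $\mathcal{K}$.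
   Context: An $\infty$-cosmos is a (possibly large) simplicially enriched category $\mathcal{K}$, whose objects are called $\infty$-categories, whose hom simplicial sets $\mathrm{Fun}_{\mathcal{K}}(A,B)$ are quasi-categories, equipped with a specified subcategory of isofibrations (denoted $\twoheadrightarrow$) such that: (a) as a simplicially enriched category, $\mathcal{K}$ has a terminal object $1$, small products, cotensors $A^U$ by all small simplicial sets $U$, inverse limits of countable sequences of isofibrations, and pullbacks of isofibrations along any functor; (b) isofibrations contain the isomorphisms and all $A\to1$, are stable under pullback along all functors, are closed under small products and under inverse limits of countable sequences, and if $p\colon E\twoheadrightarrow B$ is an isofibration and $U\hookrightarrow V$ is an inclusion of simplicial sets then the Leibniz cotensor $E^V\to E^U\times_{B^U}B^V$ is an isofibration; moreover $\mathrm{Fun}_{\mathcal{K}}(X,p)$ is an isofibration of quasi-categories for every object $X$ and isofibration $p$. (An isofibration of quasi-categories is an inner fibration with the right lifting property against the inclusion of an endpoint into the nerve $\mathbb{I}$ of the free-standing isomorphism.) A functor $f\colon A\to B$ in $\mathcal{K}$ is an equivalence if $\mathrm{Fun}_{\mathcal{K}}(X,f)$ is an equivalence of quasi-categories for all $X\in\mathcal{K}$; a trivial fibration is a functor that is both an equivalence and an isofibration. $\mathbf{SSet}$ is the simplicially enriched category of simplicial sets. A weight is a simplicial functor $W\colon\mathcal{A}\to\mathbf{SSet}$. A $W$-weighted limit of $F\colon\mathcal{A}\to\mathcal{K}$ is an object $\{W,F\}$ with a simplicial natural transformation $W\to\mathrm{Fun}_{\mathcal{K}}(\{W,F\},F-)$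 inducing isomorphisms of simplicial sets $\mathrm{Fun}_{\mathcal{K}}(X,\{W,F\})\cong\mathrm{Map}_{\mathbf{SSet}^{\mathcal{A}}}(W,\mathrm{Fun}_{\mathcal{K}}(X,F-))$ for all $X\in\mathcal{K}$. A projective $n$-cell is a map $\partial\Delta^n\times\mathrm{Map}_{\mathcal{A}}(A,-)\hookrightarrow\Delta^n\times\mathrm{Map}_{\mathcal{A}}(A,-)$ in $\mathbf{SSet}^{\mathcal{A}}$, for $n\ge0$ and $A\in\mathcal{A}$. A monomorphism of weights $V\hookrightarrow W$ is a projective cell complex if it may be expressed as a countable composite of pushouts of coproducts of projective cells. $W$ is flexible if $\emptyset\hookrightarrow W$ is a projective cell complex. $\mathbf{Flex}^{\mathcal{A}}\subseteq\mathbf{SSet}^{\mathcal{A}}$ is the full simplicial subcategory of flexible weights. *)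

theory Defs
  imports "HOL-Library.FuncSet"
begin

section \<open>Size\<close>

text \<open>
  HOL has no universe of small sets. Smallness is cardinality below a fixed regular uncountable
  cardinal \<open>\<kappa>\<close>; a Grothendieck universe is the case of an inaccessible \<open>\<kappa>\<close>. All simplicial sets
  that occur, small or not, have their simplices in one type \<open>'u\<close>, which has to be large enough
  to contain a copy of every small set.
\<close>

context includes cardinal_syntax
begin

definition size_cardinal :: "'k rel \<Rightarrow> 'u itself \<Rightarrow> bool" where
  "size_cardinal \<kappa> (_ :: 'u itself) \<longleftrightarrow>
     Card_order \<kappa> \<and> regularCard \<kappa> \<and> natLeq <o \<kappa> \<and> \<kappa> \<le>o |UNIV :: 'u set|"

definition small :: "'k rel \<Rightarrow> 'x set \<Rightarrow> bool" where
  "small \<kappa> S \<longleftrightarrow> |S| <o \<kappa>"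

end


section \<open>Simplicial sets\<close>

definition Delta_hom :: "nat \<Rightarrow> nat \<Rightarrow> (nat \<Rightarrow> nat) set" where
  "Delta_hom m n = {\<theta> \<in> {..m} \<rightarrow>\<^sub>E {..n}. mono_on {..m} \<theta>}"

text \<open>
  \<open>act X m n \<theta>\<close> is the map from \<open>n\<close>-simplices to \<open>m\<close>-simplices given by \<open>\<theta> : [m] \<rightarrow> [n]\<close>. Its values
  outside the \<open>n\<close>-simplices are irrelevant; maps of simplicial sets, in contrast, are required to
  be extensional, so that hom-sets have the right equality.
\<close>

record 'x sset =
  simplices :: "nat \<Rightarrow> 'x set"
  act :: "nat \<Rightarrow> nat \<Rightarrow> (nat \<Rightarrow> nat) \<Rightarrow> 'x \<Rightarrow> 'x"

locale simplicial_set =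
  fixes X :: "'x sset"
  assumes act_closed: "\<theta> \<in> Delta_hom m n \<Longrightarrow> x \<in> simplices X n \<Longrightarrow> act X m n \<theta> x \<in> simplices X m"
    and act_id: "x \<in> simplices X n \<Longrightarrow> act X n n (\<lambda>i\<in>{..n}. i) x = x"
    and act_comp: "\<sigma> \<in> Delta_hom k m \<Longrightarrow> \<theta> \<in> Delta_hom m n \<Longrightarrow> x \<in> simplices X n \<Longrightarrow>
      act X k n (compose {..k} \<theta> \<sigma>) x = act X k m \<sigma> (act X m n \<theta> x)"

definition smap :: "'x sset \<Rightarrow> 'y sset \<Rightarrow> (nat \<Rightarrow> 'x \<Rightarrow> 'y) set" where
  "smap X Y = {f. (\<forall>n. f n \<in> simplices X n \<rightarrow>\<^sub>E simplices Y n) \<and>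
     (\<forall>m n. \<forall>\<theta>\<in>Delta_hom m n. \<forall>x\<in>simplices X n. f m (act X m n \<theta> x) = act Y m n \<theta> (f n x))}"

definition const_map :: "nat \<Rightarrow> nat \<Rightarrow> nat \<Rightarrow> nat" where
  "const_map e n = (\<lambda>i\<in>{..n}. e)"

definition degen :: "'x sset \<Rightarrow> nat \<Rightarrow> 'x \<Rightarrow> 'x" where
  "degen X n x = act X n 0 (const_map 0 n) x"

definition prod_sset :: "'x sset \<Rightarrow> 'y sset \<Rightarrow> ('x \<times> 'y) sset" where
  "prod_sset X Y = \<lparr>simplices = (\<lambda>n. simplices X n \<times> simplices Y n),
     act = (\<lambda>m n \<theta> (x, y). (act X m n \<theta> x, act Y m n \<theta> y))\<rparr>"

definition empty_sset :: "'x sset" where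
  "empty_sset = \<lparr>simplices = (\<lambda>n. {}), act = (\<lambda>m n \<theta> x. x)\<rparr>"

definition simplex :: "nat \<Rightarrow> (nat \<Rightarrow> nat) sset" where
  "simplex n = \<lparr>simplices = (\<lambda>m. Delta_hom m n), act = (\<lambda>k m \<sigma> \<theta>. compose {..k} \<theta> \<sigma>)\<rparr>"

definition boundary :: "nat \<Rightarrow> (nat \<Rightarrow> nat) sset" where
  "boundary n = simplex n \<lparr>simplices := (\<lambda>m. {\<theta> \<in> Delta_hom m n. \<theta> ` {..m} \<noteq> {..n}})\<rparr>"

definition horn :: "nat \<Rightarrow> nat \<Rightarrow> (nat \<Rightarrow> nat) sset" where
  "horn n k = simplex n \<lparr>simplices := (\<lambda>m. {\<theta> \<in> Delta_hom m n. \<not> {..n} - {k} \<subseteq> \<theta> ` {..m}})\<rparr>"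

text \<open>
  The nerve of the free-standing isomorphism: between any two of its objects \<open>0\<close>, \<open>1\<close> there is
  exactly one morphism, so a functor from \<open>[m]\<close> is an arbitrary function \<open>[m] \<rightarrow> {0, 1}\<close>.
\<close>

definition iso_nerve :: "(nat \<Rightarrow> nat) sset" where
  "iso_nerve = \<lparr>simplices = (\<lambda>m. {..m} \<rightarrow>\<^sub>E {0, 1}), act = (\<lambda>k m \<sigma> \<theta>. compose {..k} \<theta> \<sigma>)\<rparr>"

definition iso_nerve_endpoint :: "nat \<Rightarrow> (nat \<Rightarrow> nat) sset" where
  "iso_nerve_endpoint e = iso_nerve \<lparr>simplices := (\<lambda>m. {const_map e m})\<rparr>"


section \<open>Quasi-categories\<close>

definition quasi_category :: "'x sset \<Rightarrow> bool" where
  "quasi_category X \<longleftrightarrow> simplicial_set X \<and>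
     (\<forall>n k. 0 < k \<and> k < n \<longrightarrow>
       (\<forall>u\<in>smap (horn n k) X. \<exists>w\<in>smap (simplex n) X.
          \<forall>m. \<forall>\<theta>\<in>simplices (horn n k) m. w m \<theta> = u m \<theta>))"

text \<open>The right lifting property of \<open>p : E \<rightarrow> B\<close> against the inclusion of a simplicial subset
  \<open>S\<close> of \<open>T\<close>.\<close>

definition rlp :: "'s sset \<Rightarrow> 's sset \<Rightarrow> 'x sset \<Rightarrow> 'y sset \<Rightarrow> (nat \<Rightarrow> 'x \<Rightarrow> 'y) \<Rightarrow> bool" where
  "rlp S T E B p \<longleftrightarrow>
     (\<forall>u\<in>smap S E. \<forall>v\<in>smap T B.
        (\<forall>m. \<forall>s\<in>simplices S m. p m (u m s) = v m s) \<longrightarrow>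
        (\<exists>w\<in>smap T E. (\<forall>m. \<forall>s\<in>simplices S m. w m s = u m s) \<and>
                      (\<forall>m. \<forall>t\<in>simplices T m. p m (w m t) = v m t)))"

definition qcat_isofibration :: "'x sset \<Rightarrow> 'y sset \<Rightarrow> (nat \<Rightarrow> 'x \<Rightarrow> 'y) \<Rightarrow> bool" where
  "qcat_isofibration E B p \<longleftrightarrow> quasi_category E \<and> quasi_category B \<and> p \<in> smap E B \<and>
     (\<forall>n k. 0 < k \<and> k < n \<longrightarrow> rlp (horn n k) (simplex n) E B p) \<and>
     (\<forall>e\<in>{0, 1}. rlp (iso_nerve_endpoint e) iso_nerve E B p)"

text \<open>Equivalences of quasi-categories are the homotopy equivalences with respect to the
  interval \<open>iso_nerve\<close>.\<close>

definition qcat_equivalence :: "'x sset \<Rightarrow> 'y sset \<Rightarrow> (nat \<Rightarrow> 'x \<Rightarrow> 'y) \<Rightarrow> bool" where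
  "qcat_equivalence X Y f \<longleftrightarrow> quasi_category X \<and> quasi_category Y \<and> f \<in> smap X Y \<and>
     (\<exists>g\<in>smap Y X. \<exists>H\<in>smap (prod_sset iso_nerve X) X. \<exists>H'\<in>smap (prod_sset iso_nerve Y) Y.
        (\<forall>n. \<forall>x\<in>simplices X n. H n (const_map 0 n, x) = x \<and> H n (const_map 1 n, x) = g n (f n x)) \<and>
        (\<forall>n. \<forall>y\<in>simplices Y n. H' n (const_map 0 n, y) = f n (g n y) \<and> H' n (const_map 1 n, y) = y))"


section \<open>Simplicially enriched categories\<close>

text \<open>\<open>Comp C a b c n g f\<close> is the composite of \<open>n\<close>-simplices \<open>f\<close> of \<open>Hom C a b\<close> and \<open>g\<close> of
  \<open>Hom C b c\<close>. The functors \<open>a \<rightarrow> b\<close> of an \<open>\<infinity>\<close>-cosmos are the vertices of \<open>Hom C a b\<close>.\<close>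

record ('o, 'm) scat =
  Obj :: "'o set"
  Hom :: "'o \<Rightarrow> 'o \<Rightarrow> 'm sset"
  Comp :: "'o \<Rightarrow> 'o \<Rightarrow> 'o \<Rightarrow> nat \<Rightarrow> 'm \<Rightarrow> 'm \<Rightarrow> 'm"
  Ident :: "'o \<Rightarrow> 'm"

locale simplicial_category =
  fixes C :: "('o, 'm) scat"
  assumes hom_sset: "a \<in> Obj C \<Longrightarrow> b \<in> Obj C \<Longrightarrow> simplicial_set (Hom C a b)"
    and comp_closed: "a \<in> Obj C \<Longrightarrow> b \<in> Obj C \<Longrightarrow> c \<in> Obj C \<Longrightarrow>
      g \<in> simplices (Hom C b c) n \<Longrightarrow> f \<in> simplices (Hom C a b) n \<Longrightarrow>
      Comp C a b c n g f \<in> simplices (Hom C a c) n"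
    and comp_act: "a \<in> Obj C \<Longrightarrow> b \<in> Obj C \<Longrightarrow> c \<in> Obj C \<Longrightarrow> \<theta> \<in> Delta_hom m n \<Longrightarrow>
      g \<in> simplices (Hom C b c) n \<Longrightarrow> f \<in> simplices (Hom C a b) n \<Longrightarrow>
      act (Hom C a c) m n \<theta> (Comp C a b c n g f) =
        Comp C a b c m (act (Hom C b c) m n \<theta> g) (act (Hom C a b) m n \<theta> f)"
    and comp_assoc: "a \<in> Obj C \<Longrightarrow> b \<in> Obj C \<Longrightarrow> c \<in> Obj C \<Longrightarrow> d \<in> Obj C \<Longrightarrow>
      h \<in> simplices (Hom C c d) n \<Longrightarrow> g \<in> simplices (Hom C b c) n \<Longrightarrow> f \<in> simplices (Hom C a b) n \<Longrightarrow>
      Comp C a c d n h (Comp C a b c n g f) = Comp C a b d n (Comp C b c d n h g) f"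
    and ident_closed: "a \<in> Obj C \<Longrightarrow> Ident C a \<in> simplices (Hom C a a) 0"
    and ident_left: "a \<in> Obj C \<Longrightarrow> b \<in> Obj C \<Longrightarrow> f \<in> simplices (Hom C a b) n \<Longrightarrow>
      Comp C a b b n (degen (Hom C b b) n (Ident C b)) f = f"
    and ident_right: "a \<in> Obj C \<Longrightarrow> b \<in> Obj C \<Longrightarrow> f \<in> simplices (Hom C a b) n \<Longrightarrow>
      Comp C a a b n f (degen (Hom C a a) n (Ident C a)) = f"

definition op_scat :: "('o, 'm) scat \<Rightarrow> ('o, 'm) scat" where
  "op_scat C = \<lparr>Obj = Obj C, Hom = (\<lambda>a b. Hom C b a),
     Comp = (\<lambda>a b c n g f. Comp C c b a n f g), Ident = Ident C\<rparr>"

definition prod_scat :: "('o, 'm) scat \<Rightarrow> ('p, 'n) scat \<Rightarrow> ('o \<times> 'p, 'm \<times> 'n) scat" where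
  "prod_scat C D = \<lparr>Obj = Obj C \<times> Obj D,
     Hom = (\<lambda>(a, a') (b, b'). prod_sset (Hom C a b) (Hom D a' b')),
     Comp = (\<lambda>(a, a') (b, b') (c, c') n (g, g') (f, f'). (Comp C a b c n g f, Comp D a' b' c' n g' f')),
     Ident = (\<lambda>(a, a'). (Ident C a, Ident D a'))\<rparr>"

definition full_sub :: "('o, 'm) scat \<Rightarrow> 'o set \<Rightarrow> ('o, 'm) scat" where
  "full_sub C S = C \<lparr>Obj := Obj C \<inter> S\<rparr>"

record ('o, 'm, 'p, 'n) sfun =
  fobj :: "'o \<Rightarrow> 'p"
  fmap :: "'o \<Rightarrow> 'o \<Rightarrow> nat \<Rightarrow> 'm \<Rightarrow> 'n"

locale simplicial_functor =
  fixes C :: "('o, 'm) scat" and D :: "('p, 'n) scat" and F :: "('o, 'm, 'p, 'n) sfun"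
  assumes fobj_closed: "a \<in> Obj C \<Longrightarrow> fobj F a \<in> Obj D"
    and fmap_closed: "a \<in> Obj C \<Longrightarrow> b \<in> Obj C \<Longrightarrow> f \<in> simplices (Hom C a b) n \<Longrightarrow>
      fmap F a b n f \<in> simplices (Hom D (fobj F a) (fobj F b)) n"
    and fmap_act: "a \<in> Obj C \<Longrightarrow> b \<in> Obj C \<Longrightarrow> \<theta> \<in> Delta_hom m n \<Longrightarrow>
      f \<in> simplices (Hom C a b) n \<Longrightarrow>
      fmap F a b m (act (Hom C a b) m n \<theta> f) =
        act (Hom D (fobj F a) (fobj F b)) m n \<theta> (fmap F a b n f)"
    and fmap_ident: "a \<in> Obj C \<Longrightarrow> fmap F a a 0 (Ident C a) = Ident D (fobj F a)"
    and fmap_comp: "a \<in> Obj C \<Longrightarrow> b \<in> Obj C \<Longrightarrow> c \<in> Obj C \<Longrightarrow>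
      g \<in> simplices (Hom C b c) n \<Longrightarrow> f \<in> simplices (Hom C a b) n \<Longrightarrow>
      fmap F a c n (Comp C a b c n g f) =
        Comp D (fobj F a) (fobj F b) (fobj F c) n (fmap F b c n g) (fmap F a b n f)"

definition comp_sfun :: "('p, 'n, 'q, 'r) sfun \<Rightarrow> ('o, 'm, 'p, 'n) sfun \<Rightarrow> ('o, 'm, 'q, 'r) sfun" where
  "comp_sfun G F = \<lparr>fobj = (\<lambda>a. fobj G (fobj F a)),
     fmap = (\<lambda>a b n f. fmap G (fobj F a) (fobj F b) n (fmap F a b n f))\<rparr>"

text \<open>
  The hom simplicial sets of the category of simplicial functors are the ends of
  \<open>Hom C (F a) (G a)\<close>: an \<open>n\<close>-simplex is a family of \<open>n\<close>-simplices \<open>\<alpha> a\<close> whose images under the two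
  maps to the internal hom from \<open>Hom A a b\<close> to \<open>Hom C (F a) (G b)\<close> agree; the \<open>n\<close>-simplices of that
  internal hom are maps out of \<open>simplex n \<times> Hom A a b\<close>, whence the quantification over \<open>\<theta>\<close>.
  The vertices are the simplicial natural transformations.
\<close>

definition nat_sset ::
  "('a, 'm) scat \<Rightarrow> ('o, 'n) scat \<Rightarrow> ('a, 'm, 'o, 'n) sfun \<Rightarrow> ('a, 'm, 'o, 'n) sfun \<Rightarrow> ('a \<Rightarrow> 'n) sset" where
  "nat_sset A C F G =
     \<lparr>simplices = (\<lambda>n. {\<alpha> \<in> (\<Pi>\<^sub>E a\<in>Obj A. simplices (Hom C (fobj F a) (fobj G a)) n).
        \<forall>a\<in>Obj A. \<forall>b\<in>Obj A. \<forall>k. \<forall>\<theta>\<in>Delta_hom k n. \<forall>f\<in>simplices (Hom A a b) k.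
          Comp C (fobj F a) (fobj G a) (fobj G b) k
            (fmap G a b k f) (act (Hom C (fobj F a) (fobj G a)) k n \<theta> (\<alpha> a)) =
          Comp C (fobj F a) (fobj F b) (fobj G b) k
            (act (Hom C (fobj F b) (fobj G b)) k n \<theta> (\<alpha> b)) (fmap F a b k f)}),
      act = (\<lambda>m n \<theta> \<alpha>. \<lambda>a\<in>Obj A. act (Hom C (fobj F a) (fobj G a)) m n \<theta> (\<alpha> a))\<rparr>"

definition fun_scat :: "('a, 'm) scat \<Rightarrow> ('o, 'n) scat \<Rightarrow> (('a, 'm, 'o, 'n) sfun, 'a \<Rightarrow> 'n) scat" where
  "fun_scat A C = \<lparr>Obj = {F. simplicial_functor A C F}, Hom = nat_sset A C,
     Comp = (\<lambda>F G H n \<beta> \<alpha>. \<lambda>a\<in>Obj A. Comp C (fobj F a) (fobj G a) (fobj H a) n (\<beta> a) (\<alpha> a)),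
     Ident = (\<lambda>F. \<lambda>a\<in>Obj A. Ident C (fobj F a))\<rparr>"


section \<open>The simplicial category of simplicial sets\<close>

text \<open>The \<open>n\<close>-simplices of the internal hom are the simplicial maps \<open>simplex n \<times> X \<rightarrow> Y\<close>.\<close>

definition map_sset :: "'x sset \<Rightarrow> 'y sset \<Rightarrow> (nat \<Rightarrow> (nat \<Rightarrow> nat) \<times> 'x \<Rightarrow> 'y) sset" where
  "map_sset X Y = \<lparr>simplices = (\<lambda>n. smap (prod_sset (simplex n) X) Y),
     act = (\<lambda>m n \<theta> \<phi> k. \<lambda>(\<sigma>, x)\<in>simplices (prod_sset (simplex m) X) k. \<phi> k (compose {..k} \<theta> \<sigma>, x))\<rparr>"

definition SSET :: "('x sset, nat \<Rightarrow> (nat \<Rightarrow> nat) \<times> 'x \<Rightarrow> 'x) scat" where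
  "SSET = \<lparr>Obj = {X. simplicial_set X}, Hom = map_sset,
     Comp = (\<lambda>X Y Z n \<psi> \<phi> k. \<lambda>(\<sigma>, x)\<in>simplices (prod_sset (simplex n) X) k. \<psi> k (\<sigma>, \<phi> k (\<sigma>, x))),
     Ident = (\<lambda>X k. \<lambda>(\<sigma>, x)\<in>simplices (prod_sset (simplex 0) X) k. x)\<rparr>"

definition SSet :: "'k rel \<Rightarrow> ('x sset, nat \<Rightarrow> (nat \<Rightarrow> nat) \<times> 'x \<Rightarrow> 'x) scat" where
  "SSet \<kappa> = full_sub SSET {X. \<forall>n. small \<kappa> (simplices X n)}"

definition small_simplicial_category :: "'k rel \<Rightarrow> ('a, 'u) scat \<Rightarrow> bool" where
  "small_simplicial_category \<kappa> A \<longleftrightarrow> simplicial_category A \<and> small \<kappa> (Obj A) \<and>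
     (\<forall>a\<in>Obj A. \<forall>b\<in>Obj A. Hom A a b \<in> Obj (SSet \<kappa>))"

text \<open>The covariant representable functor \<open>Hom C a -\<close>.\<close>

definition repr ::
  "('o, 'm) scat \<Rightarrow> 'o \<Rightarrow> ('o, 'm, 'm sset, nat \<Rightarrow> (nat \<Rightarrow> nat) \<times> 'm \<Rightarrow> 'm) sfun" where
  "repr C a = \<lparr>fobj = (\<lambda>b. Hom C a b),
     fmap = (\<lambda>b c n f k. \<lambda>(\<theta>, g)\<in>simplices (prod_sset (simplex n) (Hom C a b)) k.
        Comp C a b c k (act (Hom C b c) k n \<theta> f) g)\<rparr>"

definition post_map :: "('o, 'm) scat \<Rightarrow> 'o \<Rightarrow> 'o \<Rightarrow> 'o \<Rightarrow> 'm \<Rightarrow> nat \<Rightarrow> 'm \<Rightarrow> 'm" where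
  "post_map C x a b f n = (\<lambda>g\<in>simplices (Hom C x a) n. Comp C x a b n (degen (Hom C a b) n f) g)"


section \<open>Limits in simplicially enriched categories\<close>

text \<open>All universal properties are enriched, that is, they concern simplices of every dimension
  of the hom simplicial sets. Dually, colimits in \<open>C\<close> are limits in \<open>op_scat C\<close>.\<close>

definition is_iso :: "('o, 'm) scat \<Rightarrow> 'o \<Rightarrow> 'o \<Rightarrow> 'm \<Rightarrow> bool" where
  "is_iso C a b f \<longleftrightarrow> f \<in> simplices (Hom C a b) 0 \<and>
     (\<exists>g\<in>simplices (Hom C b a) 0. Comp C a b a 0 g f = Ident C a \<and> Comp C b a b 0 f g = Ident C b)"

definition is_terminal :: "('o, 'm) scat \<Rightarrow> 'o \<Rightarrow> bool" where
  "is_terminal C t \<longleftrightarrow> t \<in> Obj C \<and> (\<forall>x\<in>Obj C. \<forall>n. \<exists>!h. h \<in> simplices (Hom C x t) n)"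

definition is_product :: "('o, 'm) scat \<Rightarrow> 'i set \<Rightarrow> ('i \<Rightarrow> 'o) \<Rightarrow> 'o \<Rightarrow> ('i \<Rightarrow> 'm) \<Rightarrow> bool" where
  "is_product C I a p \<pi> \<longleftrightarrow> p \<in> Obj C \<and> (\<forall>i\<in>I. a i \<in> Obj C \<and> \<pi> i \<in> simplices (Hom C p (a i)) 0) \<and>
     (\<forall>x\<in>Obj C. \<forall>n. bij_betw (\<lambda>h. \<lambda>i\<in>I. post_map C x p (a i) (\<pi> i) n h)
        (simplices (Hom C x p) n) (\<Pi>\<^sub>E i\<in>I. simplices (Hom C x (a i)) n))"

text \<open>\<open>p\<close> with \<open>q : p \<rightarrow> a\<close> and \<open>r : p \<rightarrow> e\<close> is the pullback of \<open>f : a \<rightarrow> b\<close> and \<open>g : e \<rightarrow> b\<close>.\<close>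

definition is_pullback ::
  "('o, 'm) scat \<Rightarrow> 'o \<Rightarrow> 'o \<Rightarrow> 'o \<Rightarrow> 'm \<Rightarrow> 'm \<Rightarrow> 'o \<Rightarrow> 'm \<Rightarrow> 'm \<Rightarrow> bool" where
  "is_pullback C a e b f g p q r \<longleftrightarrow> a \<in> Obj C \<and> e \<in> Obj C \<and> b \<in> Obj C \<and> p \<in> Obj C \<and>
     f \<in> simplices (Hom C a b) 0 \<and> g \<in> simplices (Hom C e b) 0 \<and>
     q \<in> simplices (Hom C p a) 0 \<and> r \<in> simplices (Hom C p e) 0 \<and>
     Comp C p a b 0 f q = Comp C p e b 0 g r \<and>
     (\<forall>x\<in>Obj C. \<forall>n. bij_betw (\<lambda>h. (post_map C x p a q n h, post_map C x p e r n h))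
        (simplices (Hom C x p) n)
        {(u, v) \<in> simplices (Hom C x a) n \<times> simplices (Hom C x e) n.
           post_map C x a b f n u = post_map C x e b g n v})"

text \<open>The inverse limit of \<open>\<dots> \<rightarrow> e 2 \<rightarrow> e 1 \<rightarrow> e 0\<close>.\<close>

definition is_sequential_limit ::
  "('o, 'm) scat \<Rightarrow> (nat \<Rightarrow> 'o) \<Rightarrow> (nat \<Rightarrow> 'm) \<Rightarrow> 'o \<Rightarrow> (nat \<Rightarrow> 'm) \<Rightarrow> bool" where
  "is_sequential_limit C e p l \<pi> \<longleftrightarrow> l \<in> Obj C \<and>
     (\<forall>j. e j \<in> Obj C \<and> p j \<in> simplices (Hom C (e (Suc j)) (e j)) 0 \<and>
        \<pi> j \<in> simplices (Hom C l (e j)) 0 \<and> Comp C l (e (Suc j)) (e j) 0 (p j) (\<pi> (Suc j)) = \<pi> j) \<and>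
     (\<forall>x\<in>Obj C. \<forall>n. bij_betw (\<lambda>h j. post_map C x l (e j) (\<pi> j) n h)
        (simplices (Hom C x l) n)
        {u. \<forall>j. u j \<in> simplices (Hom C x (e j)) n \<and>
           post_map C x (e (Suc j)) (e j) (p j) n (u (Suc j)) = u j})"

text \<open>The cotensor \<open>c = a\<^sup>U\<close> with its universal map \<open>e\<close> from \<open>U\<close> to \<open>Hom C c a\<close>.\<close>

definition is_cotensor ::
  "('o, 'm) scat \<Rightarrow> 'x sset \<Rightarrow> 'o \<Rightarrow> 'o \<Rightarrow> (nat \<Rightarrow> 'x \<Rightarrow> 'm) \<Rightarrow> bool" where
  "is_cotensor C U a c e \<longleftrightarrow> a \<in> Obj C \<and> c \<in> Obj C \<and> e \<in> smap U (Hom C c a) \<and>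
     (\<forall>x\<in>Obj C. \<forall>n. bij_betw
        (\<lambda>h k. \<lambda>(\<theta>, u)\<in>simplices (prod_sset (simplex n) U) k.
           Comp C x c a k (e k u) (act (Hom C x c) k n \<theta> h))
        (simplices (Hom C x c) n) (simplices (map_sset U (Hom C x a)) n))"

text \<open>For \<open>i : U \<rightarrow> V\<close> and \<open>f : a \<rightarrow> b\<close>, \<open>m\<close> is the induced map \<open>f\<^sup>i : a\<^sup>V \<rightarrow> b\<^sup>U\<close> of cotensors
  \<open>(aV, eaV)\<close> and \<open>(bU, ebU)\<close>.\<close>

definition is_cotensor_map ::
  "('o, 'm) scat \<Rightarrow> 'x sset \<Rightarrow> (nat \<Rightarrow> 'x \<Rightarrow> 'y) \<Rightarrow> 'o \<Rightarrow> 'o \<Rightarrow> 'm \<Rightarrow>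
   'o \<Rightarrow> (nat \<Rightarrow> 'y \<Rightarrow> 'm) \<Rightarrow> 'o \<Rightarrow> (nat \<Rightarrow> 'x \<Rightarrow> 'm) \<Rightarrow> 'm \<Rightarrow> bool" where
  "is_cotensor_map C U i a b f aV eaV bU ebU m \<longleftrightarrow> m \<in> simplices (Hom C aV bU) 0 \<and>
     (\<forall>k. \<forall>u\<in>simplices U k.
        Comp C aV bU b k (ebU k u) (degen (Hom C aV bU) k m) = post_map C aV a b f k (eaV k (i k u)))"


section \<open>Infinity-cosmoi\<close>

text \<open>\<open>isof a b\<close> is the set of isofibrations from \<open>a\<close> to \<open>b\<close>. The closure conditions are
  required for every choice of the limits involved.\<close>

locale infinity_cosmos = simplicial_category K
  for K :: "('o, 'u) scat" +
  fixes \<kappa> :: "'k rel" and isof :: "'o \<Rightarrow> 'o \<Rightarrow> 'u set"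
  assumes hom_quasi_category: "a \<in> Obj K \<Longrightarrow> b \<in> Obj K \<Longrightarrow> quasi_category (Hom K a b)"
    and isof_vertex: "a \<in> Obj K \<Longrightarrow> b \<in> Obj K \<Longrightarrow> isof a b \<subseteq> simplices (Hom K a b) 0"
    and isof_comp: "a \<in> Obj K \<Longrightarrow> b \<in> Obj K \<Longrightarrow> c \<in> Obj K \<Longrightarrow> g \<in> isof b c \<Longrightarrow> f \<in> isof a b \<Longrightarrow>
      Comp K a b c 0 g f \<in> isof a c"
    and ex_terminal: "\<exists>t. is_terminal K t"
    and ex_product: "\<And>(I :: 'u set) a. small \<kappa> I \<Longrightarrow> (\<And>i. i \<in> I \<Longrightarrow> a i \<in> Obj K) \<Longrightarrow>
      \<exists>p \<pi>. is_product K I a p \<pi>"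
    and ex_cotensor: "\<And>(U :: 'u sset) a. U \<in> Obj (SSet \<kappa>) \<Longrightarrow> a \<in> Obj K \<Longrightarrow> \<exists>c e. is_cotensor K U a c e"
    and ex_sequential_limit: "\<And>e p. (\<And>j. e j \<in> Obj K) \<Longrightarrow> (\<And>j. p j \<in> isof (e (Suc j)) (e j)) \<Longrightarrow>
      \<exists>l \<pi>. is_sequential_limit K e p l \<pi>"
    and ex_pullback: "\<And>a e b f g. a \<in> Obj K \<Longrightarrow> e \<in> Obj K \<Longrightarrow> b \<in> Obj K \<Longrightarrow>
      f \<in> simplices (Hom K a b) 0 \<Longrightarrow> g \<in> isof e b \<Longrightarrow> \<exists>p q r. is_pullback K a e b f g p q r"
    and isof_iso: "\<And>a b f. a \<in> Obj K \<Longrightarrow> b \<in> Obj K \<Longrightarrow> is_iso K a b f \<Longrightarrow> f \<in> isof a b"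
    and isof_terminal: "\<And>a t f. a \<in> Obj K \<Longrightarrow> is_terminal K t \<Longrightarrow> f \<in> simplices (Hom K a t) 0 \<Longrightarrow>
      f \<in> isof a t"
    and isof_pullback: "\<And>a e b f g p q r. is_pullback K a e b f g p q r \<Longrightarrow> g \<in> isof e b \<Longrightarrow>
      q \<in> isof p a"
    and isof_product: "\<And>(I :: 'u set) a b f p \<pi> q \<rho> h. small \<kappa> I \<Longrightarrow>
      is_product K I a p \<pi> \<Longrightarrow> is_product K I b q \<rho> \<Longrightarrow> (\<And>i. i \<in> I \<Longrightarrow> f i \<in> isof (a i) (b i)) \<Longrightarrow>
      h \<in> simplices (Hom K p q) 0 \<Longrightarrow>
      (\<And>i. i \<in> I \<Longrightarrow> Comp K p q (b i) 0 (\<rho> i) h = Comp K p (a i) (b i) 0 (f i) (\<pi> i)) \<Longrightarrow>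
      h \<in> isof p q"
    and isof_sequential_limit: "\<And>e p l \<pi> j. is_sequential_limit K e p l \<pi> \<Longrightarrow>
      (\<And>k. p k \<in> isof (e (Suc k)) (e k)) \<Longrightarrow> \<pi> j \<in> isof l (e j)"
    and isof_leibniz_cotensor:
      "\<And>(U :: 'u sset) (V :: 'u sset) i e b g eU ueU eV ueV bU ubU bV ubV ei gU bi gV p q r h.
        U \<in> Obj (SSet \<kappa>) \<Longrightarrow> V \<in> Obj (SSet \<kappa>) \<Longrightarrow> i \<in> smap U V \<Longrightarrow>
        (\<And>n. inj_on (i n) (simplices U n)) \<Longrightarrow>
        e \<in> Obj K \<Longrightarrow> b \<in> Obj K \<Longrightarrow> g \<in> isof e b \<Longrightarrow>
        is_cotensor K U e eU ueU \<Longrightarrow> is_cotensor K V e eV ueV \<Longrightarrow>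
        is_cotensor K U b bU ubU \<Longrightarrow> is_cotensor K V b bV ubV \<Longrightarrow>
        is_cotensor_map K U i e e (Ident K e) eV ueV eU ueU ei \<Longrightarrow>
        is_cotensor_map K U i b b (Ident K b) bV ubV bU ubU bi \<Longrightarrow>
        is_cotensor_map K U (\<lambda>n u. u) e b g eU ueU bU ubU gU \<Longrightarrow>
        is_cotensor_map K V (\<lambda>n v. v) e b g eV ueV bV ubV gV \<Longrightarrow>
        is_pullback K eU bV bU gU bi p q r \<Longrightarrow>
        h \<in> simplices (Hom K eV p) 0 \<Longrightarrow>
        Comp K eV p eU 0 q h = ei \<Longrightarrow> Comp K eV p bV 0 r h = gV \<Longrightarrow>
        h \<in> isof eV p"
    and isof_hom: "\<And>x e b g. x \<in> Obj K \<Longrightarrow> e \<in> Obj K \<Longrightarrow> b \<in> Obj K \<Longrightarrow> g \<in> isof e b \<Longrightarrow>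
      qcat_isofibration (Hom K x e) (Hom K x b) (post_map K x e b g)"

definition equivs :: "('o, 'u) scat \<Rightarrow> 'o \<Rightarrow> 'o \<Rightarrow> 'u set" where
  "equivs K a b = {f \<in> simplices (Hom K a b) 0.
     \<forall>x\<in>Obj K. qcat_equivalence (Hom K x a) (Hom K x b) (post_map K x a b f)}"

definition triv_fibs :: "('o, 'u) scat \<Rightarrow> ('o \<Rightarrow> 'o \<Rightarrow> 'u set) \<Rightarrow> 'o \<Rightarrow> 'o \<Rightarrow> 'u set" where
  "triv_fibs K isof a b = equivs K a b \<inter> isof a b"


section \<open>Weights and weighted limits\<close>

type_synonym ('a, 'u) weight = "('a, 'u, 'u sset, nat \<Rightarrow> (nat \<Rightarrow> nat) \<times> 'u \<Rightarrow> 'u) sfun"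

type_synonym ('a, 'u) weight_map = "'a \<Rightarrow> nat \<Rightarrow> (nat \<Rightarrow> nat) \<times> 'u \<Rightarrow> 'u"

abbreviation weights :: "'k rel \<Rightarrow> ('a, 'u) scat \<Rightarrow> (('a, 'u) weight, ('a, 'u) weight_map) scat" where
  "weights \<kappa> A \<equiv> fun_scat A (SSet \<kappa>)"

text \<open>
  For \<open>\<lambda> : W \<rightarrow> Hom K l (F -)\<close>, the induced map from \<open>n\<close>-simplices of \<open>Hom K x l\<close> to \<open>n\<close>-simplices of
  maps \<open>W \<rightarrow> Hom K x (F -)\<close>: it sends \<open>h\<close> to \<open>\<lambda>\<close> followed by precomposition with \<open>h\<close>.
  The component \<open>lam a\<close> is a vertex of the internal hom, hence a map on \<open>simplex 0 \<times> W a\<close>, and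
  \<open>const_map 0 k\<close> is the only \<open>k\<close>-simplex of \<open>simplex 0\<close>.
\<close>

definition cone_map ::
  "('o, 'u) scat \<Rightarrow> ('a, 'u) scat \<Rightarrow> ('a, 'u) weight \<Rightarrow> ('a, 'u, 'o, 'u) sfun \<Rightarrow>
   'o \<Rightarrow> ('a, 'u) weight_map \<Rightarrow> 'o \<Rightarrow> nat \<Rightarrow> 'u \<Rightarrow> ('a, 'u) weight_map" where
  "cone_map K A W F l lam x n h = (\<lambda>a\<in>Obj A. \<lambda>k.
     \<lambda>(\<theta>, w)\<in>simplices (prod_sset (simplex n) (fobj W a)) k.
       Comp K x l (fobj F a) k (lam a k (const_map 0 k, w)) (act (Hom K x l) k n \<theta> h))"

definition is_weighted_limit ::
  "('o, 'u) scat \<Rightarrow> ('a, 'u) scat \<Rightarrow> ('a, 'u) weight \<Rightarrow> ('a, 'u, 'o, 'u) sfun \<Rightarrow>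
   'o \<Rightarrow> ('a, 'u) weight_map \<Rightarrow> bool" where
  "is_weighted_limit K A W F l lam \<longleftrightarrow> l \<in> Obj K \<and>
     lam \<in> simplices (Hom (fun_scat A SSET) W (comp_sfun (repr K l) F)) 0 \<and>
     (\<forall>x\<in>Obj K. \<forall>n. bij_betw (cone_map K A W F l lam x n) (simplices (Hom K x l) n)
        (simplices (Hom (fun_scat A SSET) W (comp_sfun (repr K x) F)) n))"

definition factor_cone ::
  "('o, 'u) scat \<Rightarrow> ('a, 'u) scat \<Rightarrow> ('a, 'u) weight \<Rightarrow> ('a, 'u, 'o, 'u) sfun \<Rightarrow>
   'o \<Rightarrow> ('a, 'u) weight_map \<Rightarrow> 'o \<Rightarrow> nat \<Rightarrow> ('a, 'u) weight_map \<Rightarrow> 'u" where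
  "factor_cone K A W F l lam x n =
     the_inv_into (simplices (Hom K x l) n) (cone_map K A W F l lam x n)"

text \<open>The map \<open>Hom K x (F -) \<rightarrow> Hom K x (G -)\<close> given by \<open>\<alpha> : F \<rightarrow> G\<close>.\<close>

definition whisker ::
  "('o, 'u) scat \<Rightarrow> ('a, 'u) scat \<Rightarrow> ('a, 'u, 'o, 'u) sfun \<Rightarrow> ('a, 'u, 'o, 'u) sfun \<Rightarrow>
   'o \<Rightarrow> nat \<Rightarrow> ('a \<Rightarrow> 'u) \<Rightarrow> ('a, 'u) weight_map" where
  "whisker K A F G x n \<alpha> = (\<lambda>a\<in>Obj A. fmap (repr K x) (fobj F a) (fobj G a) n (\<alpha> a))"

text \<open>\<open>{i, F} : {W', F} \<rightarrow> {W, F}\<close> for \<open>i : W \<rightarrow> W'\<close>.\<close>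

definition lim_weight_map ::
  "('o, 'u) scat \<Rightarrow> ('a, 'u) scat \<Rightarrow> ('a, 'u, 'o, 'u) sfun \<Rightarrow>
   ('a, 'u) weight \<Rightarrow> 'o \<Rightarrow> ('a, 'u) weight_map \<Rightarrow>
   ('a, 'u) weight \<Rightarrow> 'o \<Rightarrow> ('a, 'u) weight_map \<Rightarrow> ('a, 'u) weight_map \<Rightarrow> 'u" where
  "lim_weight_map K A F W l lam W' l' lam' i =
     factor_cone K A W F l lam l' 0
       (Comp (fun_scat A SSET) W W' (comp_sfun (repr K l') F) 0 lam' i)"

text \<open>\<open>{W, \<alpha>} : {W, F} \<rightarrow> {W, G}\<close> for \<open>\<alpha> : F \<rightarrow> G\<close>.\<close>

definition lim_diagram_map ::
  "('o, 'u) scat \<Rightarrow> ('a, 'u) scat \<Rightarrow> ('a, 'u) weight \<Rightarrow>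
   ('a, 'u, 'o, 'u) sfun \<Rightarrow> 'o \<Rightarrow> ('a, 'u) weight_map \<Rightarrow>
   ('a, 'u, 'o, 'u) sfun \<Rightarrow> 'o \<Rightarrow> ('a, 'u) weight_map \<Rightarrow> ('a \<Rightarrow> 'u) \<Rightarrow> 'u" where
  "lim_diagram_map K A W F l lam G l' lam' \<alpha> =
     factor_cone K A W G l' lam' l 0
       (Comp (fun_scat A SSET) W (comp_sfun (repr K l) F) (comp_sfun (repr K l) G) 0
          (whisker K A F G l 0 \<alpha>) lam)"

text \<open>\<open>{i, \<alpha>} : {W', F} \<rightarrow> {W, G}\<close> for \<open>n\<close>-simplices \<open>i : W \<rightarrow> W'\<close> and \<open>\<alpha> : F \<rightarrow> G\<close>, with respect to
  limits \<open>(l', lam')\<close> of \<open>(W', F)\<close> and \<open>(l, lam)\<close> of \<open>(W, G)\<close>.\<close>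

definition lim_bimap ::
  "('o, 'u) scat \<Rightarrow> ('a, 'u) scat \<Rightarrow>
   ('a, 'u) weight \<Rightarrow> ('a, 'u, 'o, 'u) sfun \<Rightarrow> 'o \<Rightarrow> ('a, 'u) weight_map \<Rightarrow>
   ('a, 'u) weight \<Rightarrow> ('a, 'u, 'o, 'u) sfun \<Rightarrow> 'o \<Rightarrow> ('a, 'u) weight_map \<Rightarrow>
   nat \<Rightarrow> ('a, 'u) weight_map \<Rightarrow> ('a \<Rightarrow> 'u) \<Rightarrow> 'u" where
  "lim_bimap K A W' F l' lam' W G l lam n i \<alpha> =
     (let M = fun_scat A SSET; F' = comp_sfun (repr K l') F; G' = comp_sfun (repr K l') G in
      factor_cone K A W G l lam l' n
        (Comp M W F' G' n (whisker K A F G l' n \<alpha>)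
           (Comp M W W' F' n (degen (Hom M W' F') n lam') i)))"


section \<open>Projective cell complexes and flexible weights\<close>

text \<open>The weight \<open>X \<times> W -\<close> for a constant simplicial set \<open>X\<close>.\<close>

definition times_weight ::
  "'x sset \<Rightarrow> ('a, 'm, 'y sset, nat \<Rightarrow> (nat \<Rightarrow> nat) \<times> 'y \<Rightarrow> 'y) sfun \<Rightarrow>
   ('a, 'm, ('x \<times> 'y) sset, nat \<Rightarrow> (nat \<Rightarrow> nat) \<times> 'x \<times> 'y \<Rightarrow> 'x \<times> 'y) sfun" where
  "times_weight X W = \<lparr>fobj = (\<lambda>a. prod_sset X (fobj W a)),
     fmap = (\<lambda>a b n f k. \<lambda>(\<theta>, x, w)\<in>simplices (prod_sset (simplex n) (prod_sset X (fobj W a))) k.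
        (x, fmap W a b n f k (\<theta>, w)))\<rparr>"

text \<open>Natural isomorphism of weights whose simplices may have different types.\<close>

definition is_weight_iso ::
  "('a, 'm) scat \<Rightarrow> ('a, 'm, 'x sset, nat \<Rightarrow> (nat \<Rightarrow> nat) \<times> 'x \<Rightarrow> 'x) sfun \<Rightarrow>
   ('a, 'm, 'y sset, nat \<Rightarrow> (nat \<Rightarrow> nat) \<times> 'y \<Rightarrow> 'y) sfun \<Rightarrow> ('a \<Rightarrow> nat \<Rightarrow> 'x \<Rightarrow> 'y) \<Rightarrow> bool" where
  "is_weight_iso A W V \<tau> \<longleftrightarrow>
     (\<forall>a\<in>Obj A. \<tau> a \<in> smap (fobj W a) (fobj V a) \<and>
        (\<forall>k. bij_betw (\<tau> a k) (simplices (fobj W a) k) (simplices (fobj V a) k))) \<and>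
     (\<forall>a\<in>Obj A. \<forall>b\<in>Obj A. \<forall>n. \<forall>f\<in>simplices (Hom A a b) n. \<forall>k. \<forall>\<theta>\<in>Delta_hom k n.
        \<forall>w\<in>simplices (fobj W a) k.
          \<tau> b k (fmap W a b n f k (\<theta>, w)) = fmap V a b n f k (\<theta>, \<tau> a k w))"

text \<open>
  The simplices of \<open>simplex n \<times> Hom A a -\<close> are pairs, whereas weights take values in simplicial
  sets over \<open>'u\<close>. A map \<open>d : D \<rightarrow> E\<close> of weights is therefore a projective \<open>n\<close>-cell if it is isomorphic
  to the inclusion of \<open>boundary n \<times> Hom A a -\<close> into \<open>simplex n \<times> Hom A a -\<close>.
\<close>

definition is_projective_cell ::
  "'k rel \<Rightarrow> ('a, 'u) scat \<Rightarrow> nat \<Rightarrow> 'a \<Rightarrow> ('a, 'u) weight \<Rightarrow> ('a, 'u) weight \<Rightarrow>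
   ('a, 'u) weight_map \<Rightarrow> bool" where
  "is_projective_cell \<kappa> A n a D E d \<longleftrightarrow>
     D \<in> Obj (weights \<kappa> A) \<and> E \<in> Obj (weights \<kappa> A) \<and> d \<in> simplices (Hom (weights \<kappa> A) D E) 0 \<and>
     (\<exists>\<phi> \<psi>. is_weight_iso A D (times_weight (boundary n) (repr A a)) \<phi> \<and>
            is_weight_iso A E (times_weight (simplex n) (repr A a)) \<psi> \<and>
            (\<forall>b\<in>Obj A. \<forall>k. \<forall>w\<in>simplices (fobj D b) k. \<psi> b k (d b k (const_map 0 k, w)) = \<phi> b k w))"

definition is_coproduct_of_cells ::
  "'k rel \<Rightarrow> ('a, 'u) scat \<Rightarrow> ('a, 'u) weight \<Rightarrow> ('a, 'u) weight \<Rightarrow> ('a, 'u) weight_map \<Rightarrow> bool" where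
  "is_coproduct_of_cells \<kappa> A D E d \<longleftrightarrow>
     d \<in> simplices (Hom (weights \<kappa> A) D E) 0 \<and>
     (\<exists>(I :: 'u set) n a D' E' d' \<iota>D \<iota>E. small \<kappa> I \<and>
        (\<forall>j\<in>I. a j \<in> Obj A \<and> is_projective_cell \<kappa> A (n j) (a j) (D' j) (E' j) (d' j)) \<and>
        is_product (op_scat (weights \<kappa> A)) I D' D \<iota>D \<and>
        is_product (op_scat (weights \<kappa> A)) I E' E \<iota>E \<and>
        (\<forall>j\<in>I. Comp (weights \<kappa> A) (D' j) D E 0 d (\<iota>D j) =
                Comp (weights \<kappa> A) (D' j) (E' j) E 0 (\<iota>E j) (d' j)))"

definition is_cell_attachment ::
  "'k rel \<Rightarrow> ('a, 'u) scat \<Rightarrow> ('a, 'u) weight \<Rightarrow> ('a, 'u) weight \<Rightarrow> ('a, 'u) weight_map \<Rightarrow> bool" where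
  "is_cell_attachment \<kappa> A V W s \<longleftrightarrow>
     (\<exists>D E d g h. is_coproduct_of_cells \<kappa> A D E d \<and>
        is_pullback (op_scat (weights \<kappa> A)) V E D g d W s h)"

text \<open>Finite composites are included, since identities are attachments of no cells.\<close>

definition projective_cell_complex ::
  "'k rel \<Rightarrow> ('a, 'u) scat \<Rightarrow> ('a, 'u) weight \<Rightarrow> ('a, 'u) weight \<Rightarrow> ('a, 'u) weight_map \<Rightarrow> bool" where
  "projective_cell_complex \<kappa> A V W i \<longleftrightarrow>
     V \<in> Obj (weights \<kappa> A) \<and> W \<in> Obj (weights \<kappa> A) \<and> i \<in> simplices (Hom (weights \<kappa> A) V W) 0 \<and>
     (\<forall>a\<in>Obj A. \<forall>k. inj_on (\<lambda>v. i a k (const_map 0 k, v)) (simplices (fobj V a) k)) \<and>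
     (\<exists>S s c. S 0 = V \<and> c 0 = i \<and> (\<forall>j. is_cell_attachment \<kappa> A (S j) (S (Suc j)) (s j)) \<and>
        is_sequential_limit (op_scat (weights \<kappa> A)) S s W c)"

definition empty_weight :: "('a, 'u) weight" where
  "empty_weight = \<lparr>fobj = (\<lambda>a. empty_sset), fmap = (\<lambda>a b n f k x. undefined)\<rparr>"

definition flexible :: "'k rel \<Rightarrow> ('a, 'u) scat \<Rightarrow> ('a, 'u) weight \<Rightarrow> bool" where
  "flexible \<kappa> A W \<longleftrightarrow> (\<exists>i. projective_cell_complex \<kappa> A empty_weight W i)"

definition Flex :: "'k rel \<Rightarrow> ('a, 'u) scat \<Rightarrow> (('a, 'u) weight, ('a, 'u) weight_map) scat" where
  "Flex \<kappa> A = full_sub (weights \<kappa> A) {W. flexible \<kappa> A W}"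

end

theory Submission
  imports Defs
begin

text \<open>
  Consider a class of maps that is closed under composition, pullback, products and countable inverse
  limits and is stable under Leibniz cotensors: isofibrations or trivial fibrations. For a map of
  diagrams \<open>F \<rightarrow> G\<close> with components in the class and a projective cell complex \<open>V \<rightarrow> W\<close>, every
  base change of the Leibniz map \<open>{W, F} \<rightarrow> {V, F} \<times> {W, G}\<close> over \<open>{V, G}\<close> exists and is in the class.
  Such a base change is described by the functor that it represents, so that none of the limits in the
  formula needs to exist, and the claim is preserved by countable composites, pushouts and coproducts of
  \<open>V \<rightarrow> W\<close>; for a projective cell it is the Leibniz cotensor by \<open>\<partial>\<Delta>\<^sup>n \<rightarrow> \<Delta>\<^sup>n\<close>. The case in which \<open>G\<close> is
  terminal gives existence and the isofibrations between limits, and the case of the empty \<open>V\<close> gives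
  isofibrations and trivial fibrations of diagrams.

  Trivial fibrations form such a class because they are the isofibrations with the right lifting
  property against all small inclusions: an isofibration that is an equivalence has a section and a
  fibrewise homotopy from the identity to its composite with the section. Equivalences of diagrams
  factor as in Ken Brown's lemma through the path objects of their components.
\<close>

text \<open>The cones to be represented take values in \<open>Hom K x (F -)\<close>, which need not
  be small, whereas a flexible weight is built by colimits of small weights; their universal
  property has to be enlarged before any induction on cells. Pullbacks and limits of towers are
  granted only along isofibrations, so the existence of a limit and the membership of its structure
  map in the class have to be proved in one induction, and over all bases, since each stage of a
  composite becomes the base of the next. The definition of trivial fibrations is unsuited to this:
  homotopy inverses of the members of a limit diagram need not be compatible, while lifts can be
  chosen so. Cotensors transpose a lifting problem into one against a pushout product, which is why
  all small inclusions are considered, though two of them suffice as a test. Equivalences need not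
  be stable under pullback, hence the detour through path objects, which may be chosen objectwise
  because their universal property makes them functorial. The interval is the nerve of the
  free-standing isomorphism, whose reversal and multiplication give explicit homotopies.\<close>

lemma bij_betw_iff_ex1:
  assumes "f ` S \<subseteq> T"
  shows "bij_betw f S T \<longleftrightarrow> (\<forall>y\<in>T. \<exists>!x. x \<in> S \<and> f x = y)"
proof
  show "bij_betw f S T \<Longrightarrow> \<forall>y\<in>T. \<exists>!x. x \<in> S \<and> f x = y"
    unfolding bij_betw_def inj_on_def by blast
  assume r: "\<forall>y\<in>T. \<exists>!x. x \<in> S \<and> f x = y"
  have "inj_on f S" using r assms by (intro inj_onI) blast
  moreover have "T \<subseteq> f ` S" using r by blast
  ultimately show "bij_betw f S T" using assms by (auto simp: bij_betw_def)
qed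

lemma bij_betw_ex1: "bij_betw f S T \<Longrightarrow> y \<in> T \<Longrightarrow> \<exists>!x. x \<in> S \<and> y = f x"
  unfolding bij_betw_def inj_on_def by blast

section \<open>Simplicial sets\<close>

subsection \<open>The simplex category\<close>

lemma id_Delta_hom [simp]: "(\<lambda>i\<in>{..n}. i) \<in> Delta_hom n n"
  by (auto simp: Delta_hom_def mono_on_def)

lemma compose_Delta_hom [simp]:
  "\<sigma> \<in> Delta_hom k m \<Longrightarrow> \<theta> \<in> Delta_hom m n \<Longrightarrow> compose {..k} \<theta> \<sigma> \<in> Delta_hom k n"
  by (force simp: Delta_hom_def mono_on_def compose_def PiE_iff Pi_iff)

lemma Delta_hom_extensional: "\<theta> \<in> Delta_hom m n \<Longrightarrow> \<theta> \<in> extensional {..m}"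
  by (auto simp: Delta_hom_def PiE_iff)

lemma Delta_hom_le: "\<theta> \<in> Delta_hom m n \<Longrightarrow> i \<le> m \<Longrightarrow> \<theta> i \<le> n"
  by (auto simp: Delta_hom_def PiE_iff)

lemma compose_id_right [simp]: "\<theta> \<in> Delta_hom m n \<Longrightarrow> compose {..m} \<theta> (\<lambda>i\<in>{..m}. i) = \<theta>"
  by (auto simp: compose_def fun_eq_iff restrict_def dest!: Delta_hom_extensional extensional_arb)

lemma compose_id_left [simp]: "\<sigma> \<in> Delta_hom k m \<Longrightarrow> compose {..k} (\<lambda>i\<in>{..m}. i) \<sigma> = \<sigma>"
  by (auto simp: compose_def fun_eq_iff restrict_def Delta_hom_le dest: extensional_arb[OF Delta_hom_extensional])

lemma compose_Delta_assoc:
  "\<sigma> \<in> Delta_hom k m \<Longrightarrow> compose {..k} (compose {..m} \<theta> \<rho>) \<sigma> = compose {..k} \<theta> (compose {..k} \<rho> \<sigma>)"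
  by (auto simp: compose_def fun_eq_iff restrict_def Delta_hom_le)

lemma const_map_apply [simp]: "i \<le> n \<Longrightarrow> const_map e n i = e"
  by (simp add: const_map_def)

lemma const_map_Delta_hom [simp]: "e \<le> m \<Longrightarrow> const_map e n \<in> Delta_hom n m"
  by (auto simp: Delta_hom_def const_map_def mono_on_def)

lemma compose_const_map [simp]:
  "\<sigma> \<in> Delta_hom k m \<Longrightarrow> compose {..k} (const_map e m) \<sigma> = const_map e k"
  by (auto simp: compose_def fun_eq_iff restrict_def const_map_def Delta_hom_le)

lemma Delta_hom_0: "\<theta> \<in> Delta_hom n 0 \<longleftrightarrow> \<theta> = const_map 0 n"
  by (auto simp: Delta_hom_def const_map_def mono_on_def fun_eq_iff PiE_iff extensional_def)

lemma const_map_0_0: "const_map 0 0 = (\<lambda>i\<in>{..0}. i)"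
  by (auto simp: const_map_def fun_eq_iff)

lemma finite_Delta_hom: "finite (Delta_hom m n)"
  unfolding Delta_hom_def by (rule finite_subset[of _ "{..m} \<rightarrow>\<^sub>E {..n}"]) (auto intro: finite_PiE)

subsection \<open>Maps of simplicial sets\<close>

declare simplicial_set.act_closed [simp] simplicial_set.act_id [simp]

lemma smap_closed [simp]: "f \<in> smap X Y \<Longrightarrow> x \<in> simplices X n \<Longrightarrow> f n x \<in> simplices Y n"
  by (simp add: smap_def Pi_iff PiE_iff)

lemma smap_act:
  "f \<in> smap X Y \<Longrightarrow> \<theta> \<in> Delta_hom m n \<Longrightarrow> x \<in> simplices X n \<Longrightarrow> f m (act X m n \<theta> x) = act Y m n \<theta> (f n x)"
  unfolding smap_def by blast

lemma smap_extensional: "f \<in> smap X Y \<Longrightarrow> f n \<in> extensional (simplices X n)"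
  unfolding smap_def PiE_iff by blast

lemma smapI:
  assumes "\<And>n x. x \<in> simplices X n \<Longrightarrow> f n x \<in> simplices Y n"
    and "\<And>n. f n \<in> extensional (simplices X n)"
    and "\<And>m n \<theta> x. \<theta> \<in> Delta_hom m n \<Longrightarrow> x \<in> simplices X n \<Longrightarrow>
      f m (act X m n \<theta> x) = act Y m n \<theta> (f n x)"
  shows "f \<in> smap X Y"
  using assms unfolding smap_def PiE_iff by blast

lemma smap_restrictI:
  assumes X: "simplicial_set X"
    and "\<And>n x. x \<in> simplices X n \<Longrightarrow> f n x \<in> simplices Y n"
    and "\<And>m n \<theta> x. \<theta> \<in> Delta_hom m n \<Longrightarrow> x \<in> simplices X n \<Longrightarrow>
      f m (act X m n \<theta> x) = act Y m n \<theta> (f n x)"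
  shows "(\<lambda>n. \<lambda>x\<in>simplices X n. f n x) \<in> smap X Y"
  using assms by (intro smapI) (auto simp: simplicial_set.act_closed)

lemma smap_eqI:
  assumes "f \<in> smap X Y" "g \<in> smap X Y" "\<And>n x. x \<in> simplices X n \<Longrightarrow> f n x = g n x"
  shows "f = g"
  using assms by (intro ext[of f g] extensionalityI[OF smap_extensional smap_extensional])

lemma simplicial_set_prod:
  assumes X: "simplicial_set X" and Y: "simplicial_set Y"
  shows "simplicial_set (prod_sset X Y)"
proof -
  interpret X: simplicial_set X by fact
  interpret Y: simplicial_set Y by fact
  show ?thesis
    by unfold_locales (auto simp: prod_sset_def X.act_closed Y.act_closed X.act_id Y.act_id X.act_comp Y.act_comp)
qed

lemma simplices_prod [simp]: "simplices (prod_sset X Y) n = simplices X n \<times> simplices Y n"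
  by (simp add: prod_sset_def)

lemma act_prod [simp]: "act (prod_sset X Y) m n \<theta> (x, y) = (act X m n \<theta> x, act Y m n \<theta> y)"
  by (simp add: prod_sset_def)

lemma simplices_simplex [simp]: "simplices (simplex n) m = Delta_hom m n"
  by (simp add: simplex_def)

lemma act_simplex [simp]: "act (simplex n) k m \<sigma> \<theta> = compose {..k} \<theta> \<sigma>"
  by (simp add: simplex_def)

lemma simplicial_set_simplex [simp]: "simplicial_set (simplex n)"
  by unfold_locales (auto simp: compose_Delta_assoc)

lemma simplices_iso_nerve: "simplices iso_nerve m = ({..m} \<rightarrow>\<^sub>E {0, 1})"
  by (simp add: iso_nerve_def)

lemma act_iso_nerve [simp]: "act iso_nerve k m \<sigma> \<theta> = compose {..k} \<theta> \<sigma>"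
  by (simp add: iso_nerve_def)

lemma simplicial_set_iso_nerve [simp]: "simplicial_set iso_nerve"
proof
  show "\<theta> \<in> Delta_hom m n \<Longrightarrow> x \<in> simplices iso_nerve n \<Longrightarrow> act iso_nerve m n \<theta> x \<in> simplices iso_nerve m" for \<theta> m n x
    unfolding simplices_iso_nerve act_iso_nerve
    by (rule PiE_I, simp only: compose_def restrict_apply if_True, erule PiE_mem)
      (simp_all add: compose_def Delta_hom_le)
  show "x \<in> simplices iso_nerve n \<Longrightarrow> act iso_nerve n n (\<lambda>i\<in>{..n}. i) x = x" for x n
    unfolding simplices_iso_nerve act_iso_nerve
    by (rule extensionalityI[of _ "{..n}"]) (simp_all add: compose_def PiE_iff)
qed (simp add: compose_Delta_assoc)

lemma const_map_iso_nerve: "e \<in> {0, 1} \<Longrightarrow> const_map e n \<in> simplices iso_nerve n"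
  by (auto simp: const_map_def simplices_iso_nerve)

text \<open>Sharing \<open>act\<close> on the nose, and not only on simplices, suits subobjects that
  arise as record updates of the larger object, such as boundaries, endpoints and pushout products.
  Restricting a map to such a subobject is then plain evaluation.\<close>

definition subsset :: "'x sset \<Rightarrow> 'x sset \<Rightarrow> bool" where
  "subsset S T \<longleftrightarrow> act S = act T \<and> (\<forall>n. simplices S n \<subseteq> simplices T n) \<and>
     (\<forall>m n. \<forall>\<theta>\<in>Delta_hom m n. \<forall>x\<in>simplices S n. act T m n \<theta> x \<in> simplices S m)"

lemma subsset_simplicial_set:
  assumes "subsset S T" "simplicial_set T"
  shows "simplicial_set S"
proof -
  interpret T: simplicial_set T by fact
  show ?thesis
  proof
    show "\<sigma> \<in> Delta_hom k m \<Longrightarrow> \<theta> \<in> Delta_hom m n \<Longrightarrow> x \<in> simplices S n \<Longrightarrow>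
      act S k n (compose {..k} \<theta> \<sigma>) x = act S k m \<sigma> (act S m n \<theta> x)" for \<sigma> k m \<theta> n x
      using assms(1) T.act_comp[of \<sigma> k m \<theta> n x] by (auto simp: subsset_def subset_iff)
  qed (use assms(1) in \<open>auto simp: subsset_def subset_iff T.act_id\<close>)
qed

lemma subsset_closed: "subsset S T \<Longrightarrow> x \<in> simplices S n \<Longrightarrow> x \<in> simplices T n"
  unfolding subsset_def by blast

lemma subsset_act: "subsset S T \<Longrightarrow> act S = act T"
  by (simp add: subsset_def)

lemma subsset_act_closed:
  "subsset S T \<Longrightarrow> \<theta> \<in> Delta_hom m n \<Longrightarrow> x \<in> simplices S n \<Longrightarrow> act T m n \<theta> x \<in> simplices S m"
  unfolding subsset_def by blast

lemma subsset_incl: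
  assumes "subsset S T"
  shows "(\<lambda>n. \<lambda>x\<in>simplices S n. x) \<in> smap S T"
  using assms by (intro smapI) (auto simp: subsset_closed[OF assms] subsset_act subsset_act_closed)

lemma smap_restrict_subsset:
  assumes "subsset S T" "f \<in> smap T X"
  shows "(\<lambda>n. \<lambda>x\<in>simplices S n. f n x) \<in> smap S X"
  using assms by (intro smapI) (auto simp: subsset_closed[OF assms(1)] subsset_act subsset_act_closed smap_act)

lemma smap_compose:
  assumes "f \<in> smap X Y" "g \<in> smap Y Z" "simplicial_set X"
  shows "(\<lambda>n. \<lambda>x\<in>simplices X n. g n (f n x)) \<in> smap X Z"
  using assms by (intro smap_restrictI) (auto simp: smap_act)

subsection \<open>Small sets\<close>

context includes cardinal_syntax
begin

lemma small_subset: "small \<kappa> S \<Longrightarrow> S' \<subseteq> S \<Longrightarrow> small \<kappa> S'"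
  unfolding small_def using card_of_mono1 ordLeq_ordLess_trans by blast

lemma small_image: "small \<kappa> S \<Longrightarrow> small \<kappa> (f ` S)"
  unfolding small_def using card_of_image ordLeq_ordLess_trans by blast

lemma size_cardinal_Cinfinite: "size_cardinal \<kappa> TYPE('u) \<Longrightarrow> Cinfinite \<kappa>"
  unfolding size_cardinal_def cinfinite_def
  using card_of_ordLeq_infinite cinfinite_def cinfinite_mono natLeq_cinfinite ordLess_imp_ordLeq by blast

lemma small_nat:
  assumes "size_cardinal \<kappa> TYPE('u)"
  shows "small \<kappa> (UNIV :: nat set)"
  using assms unfolding size_cardinal_def small_def
  using card_of_nat ordIso_ordLess_trans by blast

lemma small_finite:
  assumes "size_cardinal \<kappa> TYPE('u)" "finite S"
  shows "small \<kappa> S"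
  using assms unfolding size_cardinal_def small_def finite_iff_ordLess_natLeq
  using ordLess_transitive by blast

text \<open>Regularity of \<open>\<kappa>\<close> is used here; through this closure the image of a
  small family of weight maps is small again.\<close>

lemma small_UN:
  assumes "size_cardinal \<kappa> TYPE('u)" "small \<kappa> I" "\<And>i. i \<in> I \<Longrightarrow> small \<kappa> (S i)"
  shows "small \<kappa> (\<Union>i\<in>I. S i)"
  using card_of_UNION_ordLess_infinite_Field_regularCard[of \<kappa> I S] size_cardinal_Cinfinite[OF assms(1)] assms
  unfolding small_def size_cardinal_def by blast

lemma small_Times:
  assumes "size_cardinal \<kappa> TYPE('u)" "small \<kappa> S" "small \<kappa> T"
  shows "small \<kappa> (S \<times> T)"
proof -
  have "S \<times> T = (\<Union>x\<in>S. (\<lambda>y. (x, y)) ` T)" by auto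
  then show ?thesis using small_UN[OF assms(1,2)] small_image[OF assms(3)] by metis
qed

lemma small_embeds:
  assumes "size_cardinal \<kappa> TYPE('u)" "small \<kappa> S"
  shows "\<exists>f :: _ \<Rightarrow> 'u. inj_on f S"
proof -
  have "|S| \<le>o |UNIV :: 'u set|"
    using assms unfolding size_cardinal_def small_def by (meson ordLess_imp_ordLeq ordLeq_transitive)
  then show ?thesis using card_of_ordLeq[of S "UNIV :: 'u set"] by blast
qed

end

definition small_sset :: "'k rel \<Rightarrow> 'x sset \<Rightarrow> bool" where
  "small_sset \<kappa> T \<longleftrightarrow> simplicial_set T \<and> (\<forall>n. small \<kappa> (simplices T n))"

text \<open>The axioms of a cosmos provide cotensors by simplicial sets over \<open>'u\<close>,
  whereas \<open>simplex n\<close> and \<open>iso_nerve\<close> live over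
  \<open>nat \<Rightarrow> nat\<close>. Smallness below a cardinal that embeds in \<open>'u\<close>
  gives an injection in each dimension, and the action is transported along it.\<close>

lemma small_sset_copy:
  assumes \<kappa>: "size_cardinal \<kappa> TYPE('u)" and T: "small_sset \<kappa> T"
  shows "\<exists>(T' :: 'u sset) e d. small_sset \<kappa> T' \<and> e \<in> smap T T' \<and> d \<in> smap T' T \<and>
    (\<forall>n. \<forall>x\<in>simplices T n. d n (e n x) = x) \<and> (\<forall>n. \<forall>y\<in>simplices T' n. e n (d n y) = y)"
proof -
  interpret simplicial_set T using T by (simp add: small_sset_def)
  have "\<forall>n. \<exists>f :: _ \<Rightarrow> 'u. inj_on f (simplices T n)"
    using T small_embeds[OF \<kappa>] unfolding small_sset_def by blast
  then obtain f where f: "\<And>n. inj_on (f n :: _ \<Rightarrow> 'u) (simplices T n)" using choice by metis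
  define g where "g n = the_inv_into (simplices T n) (f n)" for n
  have g [simp]: "x \<in> simplices T n \<Longrightarrow> g n (f n x) = x" for n x
    by (simp add: g_def the_inv_into_f_f[OF f])
  define T' where "T' = \<lparr>simplices = (\<lambda>n. f n ` simplices T n), act = (\<lambda>m n \<theta> y. f m (act T m n \<theta> (g n y)))\<rparr>"
  have S [simp]: "simplices T' n = f n ` simplices T n" and A [simp]: "act T' m n \<theta> y = f m (act T m n \<theta> (g n y))" for m n \<theta> y
    by (auto simp: T'_def)
  have T': "simplicial_set T'"
    by unfold_locales (auto simp: act_closed act_comp act_id)
  have "small_sset \<kappa> T'" using T' T by (auto simp: small_sset_def small_image)
  moreover have "(\<lambda>n. \<lambda>x\<in>simplices T n. f n x) \<in> smap T T'"
    by (rule smap_restrictI) (auto simp: act_closed simplicial_set_axioms)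
  moreover have "(\<lambda>n. \<lambda>x\<in>simplices T' n. g n x) \<in> smap T' T"
    by (rule smap_restrictI) (auto simp: T' act_closed)
  ultimately show ?thesis by (intro exI[of _ T'] exI conjI) auto
qed

section \<open>Set-valued functors and their natural transformations\<close>

lemma SSET_simps [simp]: "Obj SSET = {X. simplicial_set X}" "Hom SSET = map_sset"
  "Obj (SSet \<kappa>) = {X. simplicial_set X \<and> (\<forall>n. small \<kappa> (simplices X n))}" "Hom (SSet \<kappa>) = map_sset"
  "Comp (SSet \<kappa>) = Comp SSET" "Ident (SSet \<kappa>) = Ident SSET"
  by (auto simp: SSET_def SSet_def full_sub_def)

lemma simplices_map_sset [simp]: "simplices (map_sset X Y) n = smap (prod_sset (simplex n) X) Y"
  by (simp add: map_sset_def)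

lemma act_map_sset_apply [simp]:
  "\<sigma> \<in> Delta_hom k m \<Longrightarrow> x \<in> simplices X k \<Longrightarrow>
     act (map_sset X Y) m n \<theta> \<phi> k (\<sigma>, x) = \<phi> k (compose {..k} \<theta> \<sigma>, x)"
  by (simp add: map_sset_def)

lemma Comp_SSET_apply [simp]:
  "\<sigma> \<in> Delta_hom k n \<Longrightarrow> x \<in> simplices X k \<Longrightarrow> Comp SSET X Y Z n \<psi> \<phi> k (\<sigma>, x) = \<psi> k (\<sigma>, \<phi> k (\<sigma>, x))"
  by (simp add: SSET_def)

lemma Ident_SSET_apply [simp]:
  "\<sigma> \<in> Delta_hom k 0 \<Longrightarrow> x \<in> simplices X k \<Longrightarrow> Ident SSET X k (\<sigma>, x) = x"
  by (simp add: SSET_def)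

lemma Comp_SSET_extensional: "Comp SSET X Y Z n \<psi> \<phi> k \<in> extensional (Delta_hom k n \<times> simplices X k)"
  by (simp add: SSET_def)

text \<open>The action of \<open>k\<close>-simplices of \<open>Hom A a b\<close> on \<open>k\<close>-simplices of \<open>W a\<close>; it determines \<open>W\<close>.\<close>

definition wact where "wact W a b k f w = fmap W a b k f k (\<lambda>i\<in>{..k}. i, w)"

locale sset_functor = source: simplicial_category A + simplicial_functor A SSET W
  for A :: "('a, 'm) scat" and W :: "('a, 'm, 'x sset, nat \<Rightarrow> (nat \<Rightarrow> nat) \<times> 'x \<Rightarrow> 'x) sfun"
begin

lemma fobj_sset [simp]: "a \<in> Obj A \<Longrightarrow> simplicial_set (fobj W a)"
  using fobj_closed by simp

lemma fmap_smap: "a \<in> Obj A \<Longrightarrow> b \<in> Obj A \<Longrightarrow> f \<in> simplices (Hom A a b) n \<Longrightarrow>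
   fmap W a b n f \<in> smap (prod_sset (simplex n) (fobj W a)) (fobj W b)"
  using fmap_closed by simp

lemma wact_closed [simp]: "a \<in> Obj A \<Longrightarrow> b \<in> Obj A \<Longrightarrow> f \<in> simplices (Hom A a b) k \<Longrightarrow>
   w \<in> simplices (fobj W a) k \<Longrightarrow> wact W a b k f w \<in> simplices (fobj W b) k"
  unfolding wact_def by (rule smap_closed[OF fmap_smap]) auto

lemma fmap_eq_wact: "a \<in> Obj A \<Longrightarrow> b \<in> Obj A \<Longrightarrow> f \<in> simplices (Hom A a b) n \<Longrightarrow>
   \<theta> \<in> Delta_hom k n \<Longrightarrow> w \<in> simplices (fobj W a) k \<Longrightarrow>
   fmap W a b n f k (\<theta>, w) = wact W a b k (act (Hom A a b) k n \<theta> f) w"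
  by (simp add: wact_def fmap_act)

lemma act_wact: "a \<in> Obj A \<Longrightarrow> b \<in> Obj A \<Longrightarrow> f \<in> simplices (Hom A a b) k \<Longrightarrow>
   \<sigma> \<in> Delta_hom j k \<Longrightarrow> w \<in> simplices (fobj W a) k \<Longrightarrow>
   act (fobj W b) j k \<sigma> (wact W a b k f w) =
     wact W a b j (act (Hom A a b) j k \<sigma> f) (act (fobj W a) j k \<sigma> w)"
  unfolding wact_def
  using smap_act[OF fmap_smap[of a b f k], of \<sigma> j k "(\<lambda>i\<in>{..k}. i, w)"]
  by (simp add: fmap_act)

lemma wact_Comp: "a \<in> Obj A \<Longrightarrow> b \<in> Obj A \<Longrightarrow> c \<in> Obj A \<Longrightarrow> f \<in> simplices (Hom A a b) k \<Longrightarrow>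
   g \<in> simplices (Hom A b c) k \<Longrightarrow> w \<in> simplices (fobj W a) k \<Longrightarrow>
   wact W a c k (Comp A a b c k g f) w = wact W b c k g (wact W a b k f w)"
  by (simp add: wact_def fmap_comp)

lemma wact_Ident: "a \<in> Obj A \<Longrightarrow> w \<in> simplices (fobj W a) k \<Longrightarrow>
   wact W a a k (degen (Hom A a a) k (Ident A a)) w = w"
  by (simp add: wact_def degen_def fmap_act fmap_ident source.ident_closed)

end

abbreviation "nats A W Z n \<equiv> simplices (nat_sset A SSET W Z) n"

lemma nat_sset_SSet [simp]: "nat_sset A (SSet \<kappa>) = nat_sset A SSET"
  by (simp add: nat_sset_def fun_eq_iff)

text \<open>By Yoneda the condition of the end, an equation between maps on
  \<open>simplex k \<times> W a\<close>, need only be tested at the identity of \<open>[k]\<close>.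
  Its value at another \<open>\<sigma>\<close> is the same condition for \<open>f\<close> and
  \<open>\<theta>\<close> restricted along \<open>\<sigma>\<close>.\<close>

lemma nats_iff:
  assumes "sset_functor A W" "sset_functor A Z"
  shows "\<phi> \<in> nats A W Z n \<longleftrightarrow> \<phi> \<in> extensional (Obj A) \<and>
    (\<forall>a\<in>Obj A. \<phi> a \<in> smap (prod_sset (simplex n) (fobj W a)) (fobj Z a)) \<and>
    (\<forall>a\<in>Obj A. \<forall>b\<in>Obj A. \<forall>k. \<forall>\<theta>\<in>Delta_hom k n. \<forall>f\<in>simplices (Hom A a b) k. \<forall>w\<in>simplices (fobj W a) k.
       wact Z a b k f (\<phi> a k (\<theta>, w)) = \<phi> b k (\<theta>, wact W a b k f w))" (is "_ \<longleftrightarrow> ?R")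
proof
  interpret W: sset_functor A W by fact
  interpret Z: sset_functor A Z by fact
  note Z.fmap_eq_wact [simp] W.fmap_eq_wact [simp]
  {
    assume \<phi>: "\<phi> \<in> nats A W Z n"
    have "wact Z a b k f (\<phi> a k (\<theta>, w)) = \<phi> b k (\<theta>, wact W a b k f w)"
      if "a \<in> Obj A" "b \<in> Obj A" "\<theta> \<in> Delta_hom k n" "f \<in> simplices (Hom A a b) k" "w \<in> simplices (fobj W a) k"
      for a b k \<theta> f w
    proof -
      have "\<phi> a \<in> smap (prod_sset (simplex n) (fobj W a)) (fobj Z a)"
        using \<phi> that by (auto simp: nat_sset_def)
      then have c: "\<phi> a k (\<theta>, w) \<in> simplices (fobj Z a) k" using that by simp
      \<comment> \<open>Evaluation at the identity simplex, where \<open>fmap\<close> becomes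
        \<open>wact\<close>.\<close>
      have "Comp SSET (fobj W a) (fobj Z a) (fobj Z b) k (fmap Z a b k f)
              (act (map_sset (fobj W a) (fobj Z a)) k n \<theta> (\<phi> a)) k (\<lambda>i\<in>{..k}. i, w) =
            Comp SSET (fobj W a) (fobj W b) (fobj Z b) k (act (map_sset (fobj W b) (fobj Z b)) k n \<theta> (\<phi> b))
              (fmap W a b k f) k (\<lambda>i\<in>{..k}. i, w)"
        using \<phi> that by (auto simp: nat_sset_def)
      then show ?thesis using that c
        by (simp add: simplicial_set.act_id[OF W.source.hom_sset])
    qed
    then show ?R using \<phi> by (auto simp: nat_sset_def PiE_iff)
  }
  {
    assume R: ?R
    have "Comp SSET (fobj W a) (fobj Z a) (fobj Z b) k (fmap Z a b k f)
              (act (map_sset (fobj W a) (fobj Z a)) k n \<theta> (\<phi> a)) =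
            Comp SSET (fobj W a) (fobj W b) (fobj Z b) k (act (map_sset (fobj W b) (fobj Z b)) k n \<theta> (\<phi> b))
              (fmap W a b k f)"
      if h: "a \<in> Obj A" "b \<in> Obj A" "\<theta> \<in> Delta_hom k n" "f \<in> simplices (Hom A a b) k" for a b k \<theta> f
    proof (rule ext, rule extensionalityI[OF Comp_SSET_extensional Comp_SSET_extensional])
      fix j x assume "x \<in> Delta_hom j k \<times> simplices (fobj W a) j"
      then obtain \<sigma> w where x: "x = (\<sigma>, w)" "\<sigma> \<in> Delta_hom j k" "w \<in> simplices (fobj W a) j" by blast
      have f': "act (Hom A a b) j k \<sigma> f \<in> simplices (Hom A a b) j"
        by (simp add: simplicial_set.act_closed[OF W.source.hom_sset] h x)
      have "\<phi> a j (compose {..j} \<theta> \<sigma>, w) \<in> simplices (fobj Z a) j" 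
        using R h x by auto
      then show "Comp SSET (fobj W a) (fobj Z a) (fobj Z b) k (fmap Z a b k f)
              (act (map_sset (fobj W a) (fobj Z a)) k n \<theta> (\<phi> a)) j x =
            Comp SSET (fobj W a) (fobj W b) (fobj Z b) k (act (map_sset (fobj W b) (fobj Z b)) k n \<theta> (\<phi> b))
              (fmap W a b k f) j x"
        using R h x f' by simp
    qed
    then show "\<phi> \<in> nats A W Z n" using R by (auto simp: nat_sset_def PiE_iff)
  }
qed

lemma nats_simps:
  assumes "\<phi> \<in> nats A W Z n" "sset_functor A W" "sset_functor A Z" "a \<in> Obj A"
  shows nats_smap: "\<phi> a \<in> smap (prod_sset (simplex n) (fobj W a)) (fobj Z a)"
    and nats_closed: "\<theta> \<in> Delta_hom k n \<Longrightarrow> w \<in> simplices (fobj W a) k \<Longrightarrow> \<phi> a k (\<theta>, w) \<in> simplices (fobj Z a) k"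
    and nats_act: "\<theta> \<in> Delta_hom k n \<Longrightarrow> w \<in> simplices (fobj W a) k \<Longrightarrow> \<sigma> \<in> Delta_hom j k \<Longrightarrow>
      act (fobj Z a) j k \<sigma> (\<phi> a k (\<theta>, w)) = \<phi> a j (compose {..j} \<theta> \<sigma>, act (fobj W a) j k \<sigma> w)"
    and nats_wact: "\<theta> \<in> Delta_hom k n \<Longrightarrow> w \<in> simplices (fobj W a) k \<Longrightarrow> b \<in> Obj A \<Longrightarrow> f \<in> simplices (Hom A a b) k \<Longrightarrow>
      wact Z a b k f (\<phi> a k (\<theta>, w)) = \<phi> b k (\<theta>, wact W a b k f w)"
proof -
  show s: "\<phi> a \<in> smap (prod_sset (simplex n) (fobj W a)) (fobj Z a)"
    using assms by (simp add: nats_iff)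
  show "\<theta> \<in> Delta_hom k n \<Longrightarrow> w \<in> simplices (fobj W a) k \<Longrightarrow> \<phi> a k (\<theta>, w) \<in> simplices (fobj Z a) k"
    by (rule smap_closed[OF s]) simp
  show "\<theta> \<in> Delta_hom k n \<Longrightarrow> w \<in> simplices (fobj W a) k \<Longrightarrow> \<sigma> \<in> Delta_hom j k \<Longrightarrow>
      act (fobj Z a) j k \<sigma> (\<phi> a k (\<theta>, w)) = \<phi> a j (compose {..j} \<theta> \<sigma>, act (fobj W a) j k \<sigma> w)"
    using smap_act[OF s, of \<sigma> j k "(\<theta>, w)"] by simp
  show "\<theta> \<in> Delta_hom k n \<Longrightarrow> w \<in> simplices (fobj W a) k \<Longrightarrow> b \<in> Obj A \<Longrightarrow> f \<in> simplices (Hom A a b) k \<Longrightarrow>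
      wact Z a b k f (\<phi> a k (\<theta>, w)) = \<phi> b k (\<theta>, wact W a b k f w)"
    using assms by (simp add: nats_iff)
qed

lemma nats_eqI:
  assumes "\<phi> \<in> nats A W Z n" "\<psi> \<in> nats A W Z' n"
    and "\<And>a k \<theta> w. a \<in> Obj A \<Longrightarrow> \<theta> \<in> Delta_hom k n \<Longrightarrow> w \<in> simplices (fobj W a) k \<Longrightarrow> \<phi> a k (\<theta>, w) = \<psi> a k (\<theta>, w)"
  shows "\<phi> = \<psi>"
proof (rule extensionalityI)
  show "\<phi> \<in> extensional (Obj A)" "\<psi> \<in> extensional (Obj A)" using assms(1,2) by (auto simp: nat_sset_def PiE_iff)
  fix a assume a: "a \<in> Obj A"
  have "\<phi> a \<in> smap (prod_sset (simplex n) (fobj W a)) (fobj Z a)"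
    "\<psi> a \<in> smap (prod_sset (simplex n) (fobj W a)) (fobj Z' a)" using assms(1,2) a by (auto simp: nat_sset_def)
  then show "\<phi> a = \<psi> a"
    using assms(3)[OF a] by (intro ext[of "\<phi> a"] extensionalityI[OF smap_extensional smap_extensional]) auto
qed

text \<open>All restrictions that extensionality demands sit in this one constructor, so that cones
  are compared by \<open>mknat_cong\<close> on actual simplices.\<close>

definition mknat where
  "mknat A W n g = (\<lambda>a\<in>Obj A. \<lambda>k. \<lambda>(\<theta>, w)\<in>simplices (prod_sset (simplex n) (fobj W a)) k. g a k \<theta> w)"

lemma mknat_apply [simp]:
  "a \<in> Obj A \<Longrightarrow> \<theta> \<in> Delta_hom k n \<Longrightarrow> w \<in> simplices (fobj W a) k \<Longrightarrow> mknat A W n g a k (\<theta>, w) = g a k \<theta> w"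
  by (simp add: mknat_def)

lemma mknat_cong:
  assumes "\<And>a k \<theta> w. a \<in> Obj A \<Longrightarrow> \<theta> \<in> Delta_hom k n \<Longrightarrow> w \<in> simplices (fobj W a) k \<Longrightarrow> g a k \<theta> w = h a k \<theta> w"
  shows "mknat A W n g = mknat A W n h"
  unfolding mknat_def using assms by (intro restrict_ext ext) (auto simp: restrict_def)

lemma nats_eq_mknat:
  assumes "\<phi> \<in> nats A W Z n"
    and "\<And>a k \<theta> w. a \<in> Obj A \<Longrightarrow> \<theta> \<in> Delta_hom k n \<Longrightarrow> w \<in> simplices (fobj W a) k \<Longrightarrow> \<phi> a k (\<theta>, w) = g a k \<theta> w"
  shows "\<phi> = mknat A W n g"
proof (rule extensionalityI)
  show "\<phi> \<in> extensional (Obj A)" using assms(1) by (auto simp: nat_sset_def PiE_iff)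
  show "mknat A W n g \<in> extensional (Obj A)" by (simp add: mknat_def)
  fix a assume a: "a \<in> Obj A"
  have s: "\<phi> a \<in> smap (prod_sset (simplex n) (fobj W a)) (fobj Z a)"
    using assms(1) a by (auto simp: nat_sset_def)
  show "\<phi> a = mknat A W n g a"
  proof (intro ext[of "\<phi> a"] extensionalityI[OF smap_extensional[OF s]])
    show "mknat A W n g a k \<in> extensional (simplices (prod_sset (simplex n) (fobj W a)) k)" for k
      by (simp add: mknat_def a)
  qed (use a assms(2) in auto)
qed

lemma mknat_nats:
  assumes "sset_functor A W" "sset_functor A Z"
    and cl: "\<And>a k \<theta> w. a \<in> Obj A \<Longrightarrow> \<theta> \<in> Delta_hom k n \<Longrightarrow> w \<in> simplices (fobj W a) k \<Longrightarrow> g a k \<theta> w \<in> simplices (fobj Z a) k"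
    and ac: "\<And>a k \<theta> w j \<sigma>. a \<in> Obj A \<Longrightarrow> \<theta> \<in> Delta_hom k n \<Longrightarrow> w \<in> simplices (fobj W a) k \<Longrightarrow> \<sigma> \<in> Delta_hom j k \<Longrightarrow>
      act (fobj Z a) j k \<sigma> (g a k \<theta> w) = g a j (compose {..j} \<theta> \<sigma>) (act (fobj W a) j k \<sigma> w)"
    and wa: "\<And>a b k \<theta> w f. a \<in> Obj A \<Longrightarrow> b \<in> Obj A \<Longrightarrow> \<theta> \<in> Delta_hom k n \<Longrightarrow> w \<in> simplices (fobj W a) k \<Longrightarrow>
      f \<in> simplices (Hom A a b) k \<Longrightarrow> wact Z a b k f (g a k \<theta> w) = g b k \<theta> (wact W a b k f w)"
  shows "mknat A W n g \<in> nats A W Z n"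
proof -
  interpret W: sset_functor A W by fact
  interpret Z: sset_functor A Z by fact
  have "mknat A W n g a \<in> smap (prod_sset (simplex n) (fobj W a)) (fobj Z a)" if a: "a \<in> Obj A" for a
  proof (rule smapI)
    show "mknat A W n g a k \<in> extensional (simplices (prod_sset (simplex n) (fobj W a)) k)" for k
      by (simp add: mknat_def a)
    show "mknat A W n g a j (act (prod_sset (simplex n) (fobj W a)) j k \<sigma> x) = act (fobj Z a) j k \<sigma> (mknat A W n g a k x)"
      if "\<sigma> \<in> Delta_hom j k" "x \<in> simplices (prod_sset (simplex n) (fobj W a)) k" for j k \<sigma> x
      using that a by (auto simp: ac)
  qed (use a cl in auto)
  then show ?thesis
    unfolding nats_iff[OF assms(1,2)] using wa by (auto simp: mknat_def[of A W n g, THEN arg_cong[of _ _ "\<lambda>x. x \<in> extensional _"]])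
qed

text \<open>Precomposition of an n-simplex with a vertex. It agrees with composition with the
  degenerate n-simplex on \<open>i\<close> (\<open>Comp_degen_nats\<close>), but evaluates without
  degeneracies: \<open>const_map 0 k\<close> is the only point of \<open>simplex 0\<close> in
  dimension \<open>k\<close>.\<close>

definition ncomp where
  "ncomp A V n \<phi> i = mknat A V n (\<lambda>a k \<theta> v. \<phi> a k (\<theta>, i a k (const_map 0 k, v)))"

lemma ncomp_apply [simp]:
  "a \<in> Obj A \<Longrightarrow> \<theta> \<in> Delta_hom k n \<Longrightarrow> v \<in> simplices (fobj V a) k \<Longrightarrow>
     ncomp A V n \<phi> i a k (\<theta>, v) = \<phi> a k (\<theta>, i a k (const_map 0 k, v))"
  by (simp add: ncomp_def)

lemma ncomp_nats [simp]:
  assumes "sset_functor A V" "sset_functor A W" "sset_functor A Z" "i \<in> nats A V W 0" "\<phi> \<in> nats A W Z n"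
  shows "ncomp A V n \<phi> i \<in> nats A V Z n"
  unfolding ncomp_def using assms
  by (intro mknat_nats) (auto simp: nats_closed nats_act nats_wact)

lemma ncomp_ncomp:
  assumes "sset_functor A U" "sset_functor A V" "i \<in> nats A U V 0"
  shows "ncomp A U n (ncomp A V n \<phi> j) i = ncomp A U n \<phi> (ncomp A U 0 j i)"
  unfolding ncomp_def[of A U n] using assms
  by (intro mknat_cong) (auto simp: nats_closed)

lemma Comp_fun_scat_SSET_apply [simp]:
  "a \<in> Obj A \<Longrightarrow> \<theta> \<in> Delta_hom k n \<Longrightarrow> v \<in> simplices (fobj V a) k \<Longrightarrow>
   Comp (fun_scat A SSET) V W Z n \<phi> \<psi> a k (\<theta>, v) = \<phi> a k (\<theta>, \<psi> a k (\<theta>, v))"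
  by (simp add: fun_scat_def)

lemma Comp_fun_scat_SSET: "Comp (fun_scat A SSET) V W Z n \<phi> \<psi> = mknat A V n (\<lambda>a k \<theta> v. \<phi> a k (\<theta>, \<psi> a k (\<theta>, v)))"
  unfolding fun_scat_def mknat_def SSET_def by (auto simp: fun_eq_iff restrict_def)

lemma fun_scat_simps [simp]: "Hom (fun_scat A C) = nat_sset A C" "Obj (fun_scat A C) = {F. simplicial_functor A C F}"
  "Comp (fun_scat A (SSet \<kappa>)) = Comp (fun_scat A SSET)"
  by (auto simp: fun_scat_def fun_eq_iff)

lemma act_nat_sset_apply [simp]:
  "a \<in> Obj A \<Longrightarrow> \<sigma> \<in> Delta_hom k m \<Longrightarrow> v \<in> simplices (fobj V a) k \<Longrightarrow>
   act (nat_sset A SSET V W) m n \<theta> \<phi> a k (\<sigma>, v) = \<phi> a k (compose {..k} \<theta> \<sigma>, v)"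
  by (simp add: nat_sset_def)

lemma degen_nat_sset_apply [simp]:
  "a \<in> Obj A \<Longrightarrow> \<sigma> \<in> Delta_hom k m \<Longrightarrow> v \<in> simplices (fobj V a) k \<Longrightarrow>
   degen (nat_sset A SSET V W) m \<phi> a k (\<sigma>, v) = \<phi> a k (const_map 0 k, v)"
  by (simp add: degen_def)

lemma Comp_degen_nats:
  "Comp (fun_scat A SSET) V W Z n \<phi> (degen (nat_sset A SSET V W) n i) = ncomp A V n \<phi> i"
  unfolding Comp_fun_scat_SSET ncomp_def by (rule mknat_cong) simp

lemma Comp_nats_0:
  "Comp (fun_scat A SSET) V W Z 0 \<phi> i = ncomp A V 0 \<phi> i"
  unfolding Comp_fun_scat_SSET ncomp_def by (rule mknat_cong) (simp add: Delta_hom_0)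

section \<open>Colimits of small weights\<close>

lemma weights_iff: "simplicial_functor A (SSet \<kappa>) W \<longleftrightarrow>
   simplicial_functor A SSET W \<and> (\<forall>a\<in>Obj A. \<forall>k. small \<kappa> (simplices (fobj W a) k))"
  unfolding simplicial_functor_def by auto

text \<open>Cutting down the simplices does not suffice: the values of \<open>fmap\<close> are
  extensional maps and have to be restricted to the smaller domain.\<close>

definition subweight where
  "subweight Z T = \<lparr>fobj = (\<lambda>a. (fobj Z a)\<lparr>simplices := T a\<rparr>),
     fmap = (\<lambda>a b n f k. restrict (fmap Z a b n f k) (Delta_hom k n \<times> T a k))\<rparr>"

lemma subweight_simps [simp]:
  "simplices (fobj (subweight Z T) a) = T a" "act (fobj (subweight Z T) a) = act (fobj Z a)"
  "\<theta> \<in> Delta_hom k n \<Longrightarrow> w \<in> T a k \<Longrightarrow> fmap (subweight Z T) a b n f k (\<theta>, w) = fmap Z a b n f k (\<theta>, w)"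
  by (auto simp: subweight_def)

lemma subweight_wact [simp]: "w \<in> T a k \<Longrightarrow> wact (subweight Z T) a b k f w = wact Z a b k f w"
  by (simp add: wact_def)

text \<open>Closure under \<open>wact\<close> covers all of \<open>fmap\<close>, because
  \<open>fmap\<close> at \<open>\<theta>\<close> is the action of the restricted morphism
  \<open>act (Hom A a b) k n \<theta> f\<close>. The functor laws are inherited from
  \<open>Z\<close> on the smaller domain.\<close>

lemma subweight_functor:
  fixes Z :: "('a, 'm, 'x sset, nat \<Rightarrow> (nat \<Rightarrow> nat) \<times> 'x \<Rightarrow> 'x) sfun"
  assumes "sset_functor A Z"
    and sub: "\<And>a k. a \<in> Obj A \<Longrightarrow> T a k \<subseteq> simplices (fobj Z a) k"
    and ac: "\<And>a j k \<sigma> z. a \<in> Obj A \<Longrightarrow> \<sigma> \<in> Delta_hom j k \<Longrightarrow> z \<in> T a k \<Longrightarrow> act (fobj Z a) j k \<sigma> z \<in> T a j"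
    and wa: "\<And>a b k f z. a \<in> Obj A \<Longrightarrow> b \<in> Obj A \<Longrightarrow> f \<in> simplices (Hom A a b) k \<Longrightarrow> z \<in> T a k \<Longrightarrow> wact Z a b k f z \<in> T b k"
  shows "simplicial_functor A SSET (subweight Z T)"
proof -
  interpret Z: sset_functor A Z by fact
  note sub' = subsetD[OF sub]
  have ss: "simplicial_set (fobj (subweight Z T) a)" if a: "a \<in> Obj A" for a
    using that ac sub by (intro subsset_simplicial_set[OF _ Z.fobj_sset[OF a]]) (auto simp: subsset_def)
  have mem: "fmap Z a b n f k (\<theta>, z) \<in> T b k" if "a \<in> Obj A" "b \<in> Obj A" "f \<in> simplices (Hom A a b) n"
     "\<theta> \<in> Delta_hom k n" "z \<in> T a k" for a b n f k \<theta> z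
    using that wa[of a b "act (Hom A a b) k n \<theta> f" k z]
    by (simp add: Z.fmap_eq_wact sub' simplicial_set.act_closed[OF Z.source.hom_sset])
  have exten: "fmap (subweight Z T) a b n f k \<in> extensional (Delta_hom k n \<times> T a k)" for a b n f k
    by (simp add: subweight_def)
  have fs: "fmap (subweight Z T) a b n f \<in> smap (prod_sset (simplex n) (fobj (subweight Z T) a)) (fobj (subweight Z T) b)"
    if h: "a \<in> Obj A" "b \<in> Obj A" "f \<in> simplices (Hom A a b) n" for a b n f
  proof (rule smapI)
    fix m k \<theta> x assume t: "\<theta> \<in> Delta_hom m k" "x \<in> simplices (prod_sset (simplex n) (fobj (subweight Z T) a)) k"
    then obtain \<rho> z where x: "x = (\<rho>, z)" "\<rho> \<in> Delta_hom k n" "z \<in> T a k" by auto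
    show "fmap (subweight Z T) a b n f m (act (prod_sset (simplex n) (fobj (subweight Z T) a)) m k \<theta> x) =
        act (fobj (subweight Z T) b) m k \<theta> (fmap (subweight Z T) a b n f k x)"
      using smap_act[OF Z.fmap_smap[OF h] t(1), of x] x t h by (simp add: sub' ac)
  qed (use h mem in \<open>auto intro: exten\<close>)
  have eq: "\<phi> = \<psi>" if "\<And>k. \<phi> k \<in> extensional (Delta_hom k n \<times> T a k)" "\<And>k. \<psi> k \<in> extensional (Delta_hom k n \<times> T a k)"
    "\<And>k \<theta> z. \<theta> \<in> Delta_hom k n \<Longrightarrow> z \<in> T a k \<Longrightarrow> \<phi> k (\<theta>, z) = \<psi> k (\<theta>, z)" for \<phi> \<psi> :: "nat \<Rightarrow> (nat \<Rightarrow> nat) \<times> 'x \<Rightarrow> 'x" and n a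
    by (rule ext, rule extensionalityI[OF that(1,2)]) (use that(3) in auto)
  show ?thesis
  proof
    show "fmap (subweight Z T) a b m (act (Hom A a b) m n \<theta> f) =
        act (Hom SSET (fobj (subweight Z T) a) (fobj (subweight Z T) b)) m n \<theta> (fmap (subweight Z T) a b n f)"
      if h: "a \<in> Obj A" "b \<in> Obj A" "\<theta> \<in> Delta_hom m n" "f \<in> simplices (Hom A a b) n" for a b \<theta> m n f
    proof (rule eq[of _ m a])
      fix k show "act (Hom SSET (fobj (subweight Z T) a) (fobj (subweight Z T) b)) m n \<theta> (fmap (subweight Z T) a b n f) k
        \<in> extensional (Delta_hom k m \<times> T a k)" by (simp add: map_sset_def)
    next
      fix k \<rho> z assume t: "\<rho> \<in> Delta_hom k m" "z \<in> T a k"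
      have "fmap Z a b m (act (Hom A a b) m n \<theta> f) k (\<rho>, z) = fmap Z a b n f k (compose {..k} \<theta> \<rho>, z)"
        using h t by (simp add: Z.fmap_act sub')
      then show "fmap (subweight Z T) a b m (act (Hom A a b) m n \<theta> f) k (\<rho>, z) =
         act (Hom SSET (fobj (subweight Z T) a) (fobj (subweight Z T) b)) m n \<theta> (fmap (subweight Z T) a b n f) k (\<rho>, z)"
        using h t by simp
    qed (rule exten)
    show "fmap (subweight Z T) a a 0 (Ident A a) = Ident SSET (fobj (subweight Z T) a)" if h: "a \<in> Obj A" for a
    proof (rule eq[of _ 0 a])
      fix k show "Ident SSET (fobj (subweight Z T) a) k \<in> extensional (Delta_hom k 0 \<times> T a k)" by (simp add: SSET_def)
    next
      fix k \<rho> z assume t: "\<rho> \<in> Delta_hom k 0" "z \<in> T a k"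
      then show "fmap (subweight Z T) a a 0 (Ident A a) k (\<rho>, z) = Ident SSET (fobj (subweight Z T) a) k (\<rho>, z)"
        using h by (simp add: Z.fmap_ident sub')
    qed (rule exten)
    show "fmap (subweight Z T) a c n (Comp A a b c n g f) =
        Comp SSET (fobj (subweight Z T) a) (fobj (subweight Z T) b) (fobj (subweight Z T) c) n (fmap (subweight Z T) b c n g)
           (fmap (subweight Z T) a b n f)"
      if h: "a \<in> Obj A" "b \<in> Obj A" "c \<in> Obj A" "g \<in> simplices (Hom A b c) n" "f \<in> simplices (Hom A a b) n" for a b c n g f
    proof (rule eq[of _ n a])
      fix k show "Comp SSET (fobj (subweight Z T) a) (fobj (subweight Z T) b) (fobj (subweight Z T) c) n (fmap (subweight Z T) b c n g)
           (fmap (subweight Z T) a b n f) k \<in> extensional (Delta_hom k n \<times> T a k)" by (simp add: SSET_def)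
    next
      fix k \<rho> z assume t: "\<rho> \<in> Delta_hom k n" "z \<in> T a k"
      then show "fmap (subweight Z T) a c n (Comp A a b c n g f) k (\<rho>, z) =
        Comp SSET (fobj (subweight Z T) a) (fobj (subweight Z T) b) (fobj (subweight Z T) c) n (fmap (subweight Z T) b c n g)
           (fmap (subweight Z T) a b n f) k (\<rho>, z)"
        using h mem[of a b f n \<rho> k z] by (simp add: Z.fmap_comp sub')
    qed (rule exten)
  qed (use ss fs in auto)
qed

lemma sset_functorI: "simplicial_category A \<Longrightarrow> simplicial_functor A SSET W \<Longrightarrow> sset_functor A W"
  by (simp add: sset_functor_def)

lemma weights_sset_functor: "simplicial_category A \<Longrightarrow> simplicial_functor A (SSet \<kappa>) W \<Longrightarrow> sset_functor A W"
  by (simp add: weights_iff sset_functorI)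

text \<open>Every small family of maps from small weights to \<open>Z\<close> has a small image, so the universal property
  of a colimit of small weights extends to maps to weights that are not small.\<close>

lemma small_image_weight:
  fixes Z :: "('a, 'u, 'u sset, nat \<Rightarrow> (nat \<Rightarrow> nat) \<times> 'u \<Rightarrow> 'u) sfun"
  assumes \<kappa>: "size_cardinal \<kappa> TYPE('v)" and Z: "sset_functor A Z" and S: "small \<kappa> S"
    and W: "\<And>s. s \<in> S \<Longrightarrow> simplicial_functor A (SSet \<kappa>) (W s)"
    and \<phi>: "\<And>s. s \<in> S \<Longrightarrow> \<phi> s \<in> nats A (W s) Z n"
  obtains Z' where "simplicial_functor A (SSet \<kappa>) Z'" "\<And>s. s \<in> S \<Longrightarrow> \<phi> s \<in> nats A (W s) Z' n"
    "\<And>V. simplicial_functor A (SSet \<kappa>) V \<Longrightarrow> nats A V Z' n \<subseteq> nats A V Z n"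
proof -
  interpret Z: sset_functor A Z by fact
  have A: "simplicial_category A" by (rule Z.source.simplicial_category_axioms)
  note W' = weights_sset_functor[OF A W]
  \<comment> \<open>The union of the images. Naturality of each \<open>\<phi> s\<close> makes it
    closed under both actions, and a small union of small images is small.\<close>
  define T where "T a k = (\<Union>s\<in>S. \<phi> s a k ` (Delta_hom k n \<times> simplices (fobj (W s) a) k))" for a k
  have sub: "T a k \<subseteq> simplices (fobj Z a) k" if "a \<in> Obj A" for a k
    using that by (auto simp: T_def nats_closed[OF \<phi> W' Z])
  have ac: "act (fobj Z a) j k \<sigma> z \<in> T a j" if "a \<in> Obj A" "\<sigma> \<in> Delta_hom j k" "z \<in> T a k" for a j k \<sigma> z
  proof -
    obtain s \<theta> w where s: "s \<in> S" "\<theta> \<in> Delta_hom k n" "w \<in> simplices (fobj (W s) a) k" "z = \<phi> s a k (\<theta>, w)"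
      using \<open>z \<in> T a k\<close> by (auto simp: T_def)
    interpret Ws: sset_functor A "W s" using W' s by blast
    show ?thesis unfolding T_def using s that
      by (intro UN_I[OF s(1)] image_eqI[of _ _ "(compose {..j} \<theta> \<sigma>, act (fobj (W s) a) j k \<sigma> w)"])
         (auto simp: nats_act[OF \<phi> W' Z])
  qed
  have wa: "wact Z a b k f z \<in> T b k"
    if "a \<in> Obj A" "b \<in> Obj A" "f \<in> simplices (Hom A a b) k" "z \<in> T a k" for a b k f z
  proof -
    obtain s \<theta> w where s: "s \<in> S" "\<theta> \<in> Delta_hom k n" "w \<in> simplices (fobj (W s) a) k" "z = \<phi> s a k (\<theta>, w)"
      using \<open>z \<in> T a k\<close> by (auto simp: T_def)
    interpret Ws: sset_functor A "W s" using W' s by blast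
    show ?thesis unfolding T_def using s that
      by (intro UN_I[OF s(1)] image_eqI[of _ _ "(\<theta>, wact (W s) a b k f w)"])
         (auto simp: nats_wact[OF \<phi> W' Z])
  qed
  have fu: "simplicial_functor A SSET (subweight Z T)"
    by (rule subweight_functor[OF Z sub ac wa])
  interpret Z': sset_functor A "subweight Z T" using A fu by (rule sset_functorI)
  have Z': "sset_functor A (subweight Z T)" by unfold_locales
  show thesis
  proof
    show "simplicial_functor A (SSet \<kappa>) (subweight Z T)"
    proof -
      have "small \<kappa> (T a k)" if "a \<in> Obj A" for a k
        unfolding T_def using that W
        by (auto simp: weights_iff intro!: small_UN[OF \<kappa> S] small_image small_Times[OF \<kappa>] small_finite[OF \<kappa> finite_Delta_hom])
      then show ?thesis using fu by (simp add: weights_iff)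
    qed
    fix s assume s: "s \<in> S"
    have mem: "\<phi> s a k (\<theta>, w) \<in> T a k" if "\<theta> \<in> Delta_hom k n" "w \<in> simplices (fobj (W s) a) k" for a k \<theta> w
      using that s by (auto simp: T_def)
    have "\<phi> s = mknat A (W s) n (\<lambda>a k \<theta> w. \<phi> s a k (\<theta>, w))" by (rule nats_eq_mknat[OF \<phi>[OF s]]) simp
    also have "\<dots> \<in> nats A (W s) (subweight Z T) n"
      by (rule mknat_nats[OF W'[OF s] Z']) (auto simp: mem nats_act[OF \<phi> W' Z] nats_wact[OF \<phi> W' Z] s)
    finally show "\<phi> s \<in> nats A (W s) (subweight Z T) n" .
  next
    fix V :: "('a, 'u, 'u sset, nat \<Rightarrow> (nat \<Rightarrow> nat) \<times> 'u \<Rightarrow> 'u) sfun"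
    assume "simplicial_functor A (SSet \<kappa>) V"
    then have V: "sset_functor A V" by (rule weights_sset_functor[OF A])
    show "nats A V (subweight Z T) n \<subseteq> nats A V Z n"
    proof
      fix \<psi> assume p: "\<psi> \<in> nats A V (subweight Z T) n"
      have mem: "\<psi> a k (\<theta>, w) \<in> T a k" if "a \<in> Obj A" "\<theta> \<in> Delta_hom k n" "w \<in> simplices (fobj V a) k" for a k \<theta> w
        using nats_closed[OF p V Z'] that by simp
      have "\<psi> = mknat A V n (\<lambda>a k \<theta> w. \<psi> a k (\<theta>, w))" by (rule nats_eq_mknat[OF p]) simp
      also have "\<dots> \<in> nats A V Z n"
      proof (rule mknat_nats[OF V Z])
        fix a b k \<theta> w f
        assume h: "a \<in> Obj A" "b \<in> Obj A" "\<theta> \<in> Delta_hom k n" "w \<in> simplices (fobj V a) k" "f \<in> simplices (Hom A a b) k"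
        show "wact Z a b k f (\<psi> a k (\<theta>, w)) = \<psi> b k (\<theta>, wact V a b k f w)"
          using nats_wact[OF p V Z', of a \<theta> k w b f] h mem[OF h(1,3,4)] by simp
      qed (use nats_act[OF p V Z'] mem sub in \<open>simp_all add: subset_iff\<close>)
      finally show "\<psi> \<in> nats A V Z n" .
    qed
  qed
qed

text \<open>The weights \<open>Hom K x (F -)\<close> in which cones take values need not be small.
  Existence: the whole family \<open>\<phi>\<close> factors through one small subweight, where the
  colimit may be used. Uniqueness: two candidates have a small image in common, and
  \<open>\<phi>\<close> lies in it because it is obtained from them by composition.\<close>

lemma colimit_extends:
  fixes Z :: "('a, 'u, 'u sset, nat \<Rightarrow> (nat \<Rightarrow> nat) \<times> 'u \<Rightarrow> 'u) sfun"
  assumes \<kappa>: "size_cardinal \<kappa> TYPE('v)" and Z: "sset_functor A Z" and J: "small \<kappa> J"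
    and D: "simplicial_functor A (SSet \<kappa>) D"
    and D': "\<And>j. j \<in> J \<Longrightarrow> simplicial_functor A (SSet \<kappa>) (D' j)"
    and \<iota>: "\<And>j. j \<in> J \<Longrightarrow> \<iota> j \<in> nats A (D' j) D 0"
    and univ: "\<And>X. simplicial_functor A (SSet \<kappa>) X \<Longrightarrow> (\<And>j. j \<in> J \<Longrightarrow> \<phi> j \<in> nats A (D' j) X n) \<Longrightarrow>
      \<exists>!\<psi>. \<psi> \<in> nats A D X n \<and> (\<forall>j\<in>J. ncomp A (D' j) n \<psi> (\<iota> j) = \<phi> j)"
    and \<phi>: "\<And>j. j \<in> J \<Longrightarrow> \<phi> j \<in> nats A (D' j) Z n"
  shows "\<exists>!\<psi>. \<psi> \<in> nats A D Z n \<and> (\<forall>j\<in>J. ncomp A (D' j) n \<psi> (\<iota> j) = \<phi> j)"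
proof -
  have A: "simplicial_category A" using Z by (simp add: sset_functor_def)
  obtain Z' where "simplicial_functor A (SSet \<kappa>) Z'" "\<And>j. j \<in> J \<Longrightarrow> \<phi> j \<in> nats A (D' j) Z' n"
    "\<And>V. simplicial_functor A (SSet \<kappa>) V \<Longrightarrow> nats A V Z' n \<subseteq> nats A V Z n"
    using small_image_weight[of \<kappa> A Z J D' \<phi> n] \<kappa> Z J D' \<phi> by metis
  then have ex: "\<exists>\<psi>. \<psi> \<in> nats A D Z n \<and> (\<forall>j\<in>J. ncomp A (D' j) n \<psi> (\<iota> j) = \<phi> j)"
    using univ[of Z'] D by blast
  have "\<psi> = \<psi>'" if p: "\<psi> \<in> nats A D Z n" "\<forall>j\<in>J. ncomp A (D' j) n \<psi> (\<iota> j) = \<phi> j"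
    "\<psi>' \<in> nats A D Z n" "\<forall>j\<in>J. ncomp A (D' j) n \<psi>' (\<iota> j) = \<phi> j" for \<psi> \<psi>'
  proof -
    have sm: "small \<kappa> {\<psi>, \<psi>'}" by (rule small_finite[OF \<kappa>]) simp
    obtain X where X: "simplicial_functor A (SSet \<kappa>) X" "\<psi> \<in> nats A D X n" "\<psi>' \<in> nats A D X n"
      by (rule small_image_weight[OF \<kappa> Z sm, of "\<lambda>_. D" "\<lambda>x. x"]) (use p D in auto)
    have "\<phi> j \<in> nats A (D' j) X n" if "j \<in> J" for j
      using p(2) that ncomp_nats[OF weights_sset_functor[OF A D'] weights_sset_functor[OF A D] weights_sset_functor[OF A X(1)] \<iota> X(2)] by fastforce
    then show ?thesis using univ[OF X(1)] X p by metis
  qed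
  then show ?thesis using ex by blast
qed

lemma post_map_op_weights:
  assumes "\<psi> \<in> nats A D X n"
  shows "post_map (op_scat (weights \<kappa> A)) X D V i n \<psi> = ncomp A V n \<psi> i"
  using assms by (simp add: post_map_def op_scat_def Comp_degen_nats)

lemma op_scat_simps: "Obj (op_scat C) = Obj C" "Hom (op_scat C) a b = Hom C b a"
  "Comp (op_scat C) a b c n g f = Comp C c b a n f g"
  by (auto simp: op_scat_def)

lemma coproduct_weights:
  fixes Z :: "('a, 'u, 'u sset, nat \<Rightarrow> (nat \<Rightarrow> nat) \<times> 'u \<Rightarrow> 'u) sfun"
  assumes \<kappa>: "size_cardinal \<kappa> TYPE('v)" and Z: "sset_functor A Z" and I: "small \<kappa> I"
    and P: "is_product (op_scat (weights \<kappa> A)) I D' D \<iota>"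
    and \<phi>: "\<And>j. j \<in> I \<Longrightarrow> \<phi> j \<in> nats A (D' j) Z n"
  shows "\<exists>!\<psi>. \<psi> \<in> nats A D Z n \<and> (\<forall>j\<in>I. ncomp A (D' j) n \<psi> (\<iota> j) = \<phi> j)"
proof (rule colimit_extends[OF \<kappa> Z I _ _ _ _ \<phi>])
  show "simplicial_functor A (SSet \<kappa>) D" "\<And>j. j \<in> I \<Longrightarrow> simplicial_functor A (SSet \<kappa>) (D' j)"
    "\<And>j. j \<in> I \<Longrightarrow> \<iota> j \<in> nats A (D' j) D 0"
    using P by (auto simp: is_product_def op_scat_simps)
  fix X assume X: "simplicial_functor A (SSet \<kappa>) X" "\<And>j. j \<in> I \<Longrightarrow> \<phi> j \<in> nats A (D' j) X n"
  have "bij_betw (\<lambda>h. \<lambda>i\<in>I. post_map (op_scat (weights \<kappa> A)) X D (D' i) (\<iota> i) n h)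
        (nats A D X n) (\<Pi>\<^sub>E i\<in>I. nats A (D' i) X n)"
    using P X(1) by (auto simp: is_product_def op_scat_simps)
  then have b: "bij_betw (\<lambda>h. \<lambda>i\<in>I. ncomp A (D' i) n h (\<iota> i)) (nats A D X n) (\<Pi>\<^sub>E i\<in>I. nats A (D' i) X n)"
    by (subst (asm) bij_betw_cong) (auto simp: post_map_op_weights)
  have "restrict \<phi> I \<in> (\<Pi>\<^sub>E i\<in>I. nats A (D' i) X n)" using X(2) by auto
  then have "\<exists>!\<psi>. \<psi> \<in> nats A D X n \<and> restrict \<phi> I = (\<lambda>i\<in>I. ncomp A (D' i) n \<psi> (\<iota> i))"
    by (rule bij_betw_ex1[OF b])
  moreover have "restrict \<phi> I = (\<lambda>i\<in>I. ncomp A (D' i) n \<psi> (\<iota> i)) \<longleftrightarrow> (\<forall>j\<in>I. ncomp A (D' j) n \<psi> (\<iota> j) = \<phi> j)" for \<psi>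
    by (auto simp: fun_eq_iff restrict_def)
  ultimately show "\<exists>!\<psi>. \<psi> \<in> nats A D X n \<and> (\<forall>j\<in>I. ncomp A (D' j) n \<psi> (\<iota> j) = \<phi> j)" by simp
qed

lemma pushout_weights:
  fixes Z :: "('a, 'u, 'u sset, nat \<Rightarrow> (nat \<Rightarrow> nat) \<times> 'u \<Rightarrow> 'u) sfun"
  assumes \<kappa>: "size_cardinal \<kappa> TYPE('v)" and Z: "sset_functor A Z"
    and P: "is_pullback (op_scat (weights \<kappa> A)) V E D g d W s h"
    and v: "v \<in> nats A V Z n" and e: "e \<in> nats A E Z n" and eq: "ncomp A D n v g = ncomp A D n e d"
  shows "\<exists>!w. w \<in> nats A W Z n \<and> ncomp A V n w s = v \<and> ncomp A E n w h = e"
proof -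
  \<comment> \<open>A pushout is treated as a colimit over two legs; the apex \<open>D\<close>
    contributes no map of its own but only the compatibility \<open>eq\<close>.\<close>
  let ?D = "\<lambda>j :: bool. if j then V else E"
  let ?\<iota> = "\<lambda>j :: bool. if j then s else h"
  let ?\<phi> = "\<lambda>j :: bool. if j then v else e"
  have "\<exists>!\<psi>. \<psi> \<in> nats A W Z n \<and> (\<forall>j\<in>UNIV. ncomp A (?D j) n \<psi> (?\<iota> j) = ?\<phi> j)"
  proof (rule colimit_extends[OF \<kappa> Z])
    show "small \<kappa> (UNIV :: bool set)" by (rule small_finite[OF \<kappa>]) simp
    show "simplicial_functor A (SSet \<kappa>) W" "simplicial_functor A (SSet \<kappa>) (?D j)" "?\<iota> j \<in> nats A (?D j) W 0" for j
      using P by (auto simp: is_pullback_def op_scat_simps)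
    show "?\<phi> j \<in> nats A (?D j) Z n" for j using v e by auto
    fix X assume X: "simplicial_functor A (SSet \<kappa>) X" "\<And>j. j \<in> UNIV \<Longrightarrow> ?\<phi> j \<in> nats A (?D j) X n"
    have ve: "v \<in> nats A V X n" "e \<in> nats A E X n" using X(2)[of True] X(2)[of False] by auto
    have "bij_betw (\<lambda>h'. (post_map (op_scat (weights \<kappa> A)) X W V s n h', post_map (op_scat (weights \<kappa> A)) X W E h n h'))
        (nats A W X n)
        {(u, v) \<in> nats A V X n \<times> nats A E X n.
           post_map (op_scat (weights \<kappa> A)) X V D g n u = post_map (op_scat (weights \<kappa> A)) X E D d n v}"
      using P X(1) by (auto simp: is_pullback_def op_scat_simps)
    moreover have "{(u, v) \<in> nats A V X n \<times> nats A E X n.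
           post_map (op_scat (weights \<kappa> A)) X V D g n u = post_map (op_scat (weights \<kappa> A)) X E D d n v} =
         {(u, v) \<in> nats A V X n \<times> nats A E X n. ncomp A D n u g = ncomp A D n v d}"
      by (auto simp: post_map_op_weights)
    ultimately have b: "bij_betw (\<lambda>h'. (ncomp A V n h' s, ncomp A E n h' h))
        (nats A W X n) {(u, v) \<in> nats A V X n \<times> nats A E X n. ncomp A D n u g = ncomp A D n v d}"
      by (subst (asm) bij_betw_cong[where g = "\<lambda>h'. (ncomp A V n h' s, ncomp A E n h' h)"]) (auto simp: post_map_op_weights)
    have "(v, e) \<in> {(u, v) \<in> nats A V X n \<times> nats A E X n. ncomp A D n u g = ncomp A D n v d}"
      using ve eq by auto
    then have "\<exists>!\<psi>. \<psi> \<in> nats A W X n \<and> (v, e) = (ncomp A V n \<psi> s, ncomp A E n \<psi> h)"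
      by (rule bij_betw_ex1[OF b])
    then show "\<exists>!\<psi>. \<psi> \<in> nats A W X n \<and> (\<forall>j\<in>UNIV. ncomp A (?D j) n \<psi> (?\<iota> j) = ?\<phi> j)"
      by (simp add: all_bool_eq eq_commute[of v] eq_commute[of e])
  qed
  then show ?thesis by (simp add: all_bool_eq)
qed

lemma sequential_colimit_weights:
  fixes Z :: "('a, 'u, 'u sset, nat \<Rightarrow> (nat \<Rightarrow> nat) \<times> 'u \<Rightarrow> 'u) sfun"
  assumes \<kappa>: "size_cardinal \<kappa> TYPE('v)" and Z: "sset_functor A Z"
    and P: "is_sequential_limit (op_scat (weights \<kappa> A)) S s W c"
    and \<phi>: "\<And>j. \<phi> j \<in> nats A (S j) Z n" and eq: "\<And>j. ncomp A (S j) n (\<phi> (Suc j)) (s j) = \<phi> j"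
  shows "\<exists>!w. w \<in> nats A W Z n \<and> (\<forall>j. ncomp A (S j) n w (c j) = \<phi> j)"
proof -
  have "\<exists>!\<psi>. \<psi> \<in> nats A W Z n \<and> (\<forall>j\<in>UNIV. ncomp A (S j) n \<psi> (c j) = \<phi> j)"
  proof (rule colimit_extends[OF \<kappa> Z small_nat[OF \<kappa>] _ _ _ _ \<phi>])
    show "simplicial_functor A (SSet \<kappa>) W" "simplicial_functor A (SSet \<kappa>) (S j)" "c j \<in> nats A (S j) W 0" for j
      using P by (auto simp: is_sequential_limit_def op_scat_simps)
    fix X assume X: "simplicial_functor A (SSet \<kappa>) X" "\<And>j. j \<in> UNIV \<Longrightarrow> \<phi> j \<in> nats A (S j) X n"
    have "bij_betw (\<lambda>h j. post_map (op_scat (weights \<kappa> A)) X W (S j) (c j) n h) (nats A W X n)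
        {u. \<forall>j. u j \<in> nats A (S j) X n \<and> post_map (op_scat (weights \<kappa> A)) X (S (Suc j)) (S j) (s j) n (u (Suc j)) = u j}"
      using P X(1) by (auto simp: is_sequential_limit_def op_scat_simps)
    moreover have "{u. \<forall>j. u j \<in> nats A (S j) X n \<and> post_map (op_scat (weights \<kappa> A)) X (S (Suc j)) (S j) (s j) n (u (Suc j)) = u j} =
        {u. \<forall>j. u j \<in> nats A (S j) X n \<and> ncomp A (S j) n (u (Suc j)) (s j) = u j}"
      using post_map_op_weights[where A = A and X = X and n = n and \<kappa> = \<kappa>] by (intro Collect_cong) metis
    ultimately have b: "bij_betw (\<lambda>h j. ncomp A (S j) n h (c j)) (nats A W X n)
         {u. \<forall>j. u j \<in> nats A (S j) X n \<and> ncomp A (S j) n (u (Suc j)) (s j) = u j}"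
      by (subst (asm) bij_betw_cong[where g = "\<lambda>h j. ncomp A (S j) n h (c j)"]) (auto simp: post_map_op_weights)
    have "\<phi> \<in> {u. \<forall>j. u j \<in> nats A (S j) X n \<and> ncomp A (S j) n (u (Suc j)) (s j) = u j}"
      using X(2) eq by auto
    then have "\<exists>!\<psi>. \<psi> \<in> nats A W X n \<and> \<phi> = (\<lambda>j. ncomp A (S j) n \<psi> (c j))"
      by (rule bij_betw_ex1[OF b])
    then show "\<exists>!\<psi>. \<psi> \<in> nats A W X n \<and> (\<forall>j\<in>UNIV. ncomp A (S j) n \<psi> (c j) = \<phi> j)"
      by (metis (no_types, lifting) UNIV_I ext)
  qed
  then show ?thesis by simp
qed

section \<open>Limits in simplicial categories\<close>

context simplicial_category
begin

abbreviation hom where "hom a b n \<equiv> simplices (Hom C a b) n"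

text \<open>The value of \<open>post_map\<close> without the restriction to
  \<open>hom x a n\<close>, which would obstruct rewriting by the laws of composition.\<close>

definition post where "post x a b n f g = Comp C x a b n (degen (Hom C a b) n f) g"

lemma act_hom_closed [simp]: "a \<in> Obj C \<Longrightarrow> b \<in> Obj C \<Longrightarrow> \<theta> \<in> Delta_hom m n \<Longrightarrow> f \<in> hom a b n \<Longrightarrow> act (Hom C a b) m n \<theta> f \<in> hom a b m"
  by (rule simplicial_set.act_closed[OF hom_sset])

lemma act_hom_id [simp]: "a \<in> Obj C \<Longrightarrow> b \<in> Obj C \<Longrightarrow> f \<in> hom a b n \<Longrightarrow> act (Hom C a b) n n (\<lambda>i\<in>{..n}. i) f = f"
  by (rule simplicial_set.act_id[OF hom_sset])

lemma act_hom_act: "a \<in> Obj C \<Longrightarrow> b \<in> Obj C \<Longrightarrow> \<sigma> \<in> Delta_hom k m \<Longrightarrow> \<theta> \<in> Delta_hom m n \<Longrightarrow> f \<in> hom a b n \<Longrightarrow>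
   act (Hom C a b) k m \<sigma> (act (Hom C a b) m n \<theta> f) = act (Hom C a b) k n (compose {..k} \<theta> \<sigma>) f"
  by (rule simplicial_set.act_comp[OF hom_sset, symmetric])

lemma degen_closed [simp]: "a \<in> Obj C \<Longrightarrow> b \<in> Obj C \<Longrightarrow> f \<in> hom a b 0 \<Longrightarrow> degen (Hom C a b) n f \<in> hom a b n"
  by (simp add: degen_def)

lemma degen_0 [simp]: "a \<in> Obj C \<Longrightarrow> b \<in> Obj C \<Longrightarrow> f \<in> hom a b 0 \<Longrightarrow> degen (Hom C a b) 0 f = f"
  unfolding degen_def const_map_0_0 by (rule act_hom_id)

lemma act_degen [simp]: "a \<in> Obj C \<Longrightarrow> b \<in> Obj C \<Longrightarrow> f \<in> hom a b 0 \<Longrightarrow> \<theta> \<in> Delta_hom m n \<Longrightarrow>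
    act (Hom C a b) m n \<theta> (degen (Hom C a b) n f) = degen (Hom C a b) m f"
  by (simp add: degen_def act_hom_act)

lemma act_0_eq_degen: "act (Hom C a b) n 0 (const_map 0 n) f = degen (Hom C a b) n f"
  by (simp add: degen_def)

lemma degen_Comp: "a \<in> Obj C \<Longrightarrow> b \<in> Obj C \<Longrightarrow> c \<in> Obj C \<Longrightarrow> g \<in> hom b c 0 \<Longrightarrow> f \<in> hom a b 0 \<Longrightarrow>
   degen (Hom C a c) n (Comp C a b c 0 g f) = Comp C a b c n (degen (Hom C b c) n g) (degen (Hom C a b) n f)"
  by (simp add: degen_def comp_act)

declare comp_closed [simp] ident_closed [simp] ident_left [simp] ident_right [simp]

lemma post_closed [simp]: "x \<in> Obj C \<Longrightarrow> a \<in> Obj C \<Longrightarrow> b \<in> Obj C \<Longrightarrow> f \<in> hom a b 0 \<Longrightarrow> g \<in> hom x a n \<Longrightarrow>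
   post x a b n f g \<in> hom x b n"
  by (simp add: post_def)

lemma act_post: "x \<in> Obj C \<Longrightarrow> a \<in> Obj C \<Longrightarrow> b \<in> Obj C \<Longrightarrow> f \<in> hom a b 0 \<Longrightarrow> g \<in> hom x a n \<Longrightarrow> \<theta> \<in> Delta_hom m n \<Longrightarrow>
   act (Hom C x b) m n \<theta> (post x a b n f g) = post x a b m f (act (Hom C x a) m n \<theta> g)"
  by (simp add: post_def comp_act)

lemma Comp_0_eq_post: "a \<in> Obj C \<Longrightarrow> b \<in> Obj C \<Longrightarrow> f \<in> hom a b 0 \<Longrightarrow> Comp C x a b 0 f g = post x a b 0 f g"
  by (simp add: post_def)

lemma post_post: "x \<in> Obj C \<Longrightarrow> a \<in> Obj C \<Longrightarrow> b \<in> Obj C \<Longrightarrow> c \<in> Obj C \<Longrightarrow>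
   f \<in> hom a b 0 \<Longrightarrow> g \<in> hom b c 0 \<Longrightarrow> h \<in> hom x a n \<Longrightarrow>
   post x b c n g (post x a b n f h) = post x a c n (post a b c 0 g f) h"
  by (simp add: post_def degen_Comp comp_assoc)

lemma post_Comp: "x \<in> Obj C \<Longrightarrow> y \<in> Obj C \<Longrightarrow> a \<in> Obj C \<Longrightarrow> b \<in> Obj C \<Longrightarrow>
   f \<in> hom a b 0 \<Longrightarrow> g \<in> hom y a n \<Longrightarrow> h \<in> hom x y n \<Longrightarrow>
   post x a b n f (Comp C x y a n g h) = Comp C x y b n (post y a b n f g) h"
  by (simp add: post_def comp_assoc)

lemma Comp_post: "x \<in> Obj C \<Longrightarrow> y \<in> Obj C \<Longrightarrow> a \<in> Obj C \<Longrightarrow> b \<in> Obj C \<Longrightarrow>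
   f \<in> hom y a 0 \<Longrightarrow> g \<in> hom a b n \<Longrightarrow> h \<in> hom x y n \<Longrightarrow>
   Comp C x a b n g (post x y a n f h) = Comp C x y b n (Comp C y a b n g (degen (Hom C y a) n f)) h"
  by (simp add: post_def comp_assoc)

lemma post_Ident [simp]: "x \<in> Obj C \<Longrightarrow> a \<in> Obj C \<Longrightarrow> g \<in> hom x a n \<Longrightarrow> post x a a n (Ident C a) g = g"
  by (simp add: post_def)

lemma post_Ident_right [simp]: "x \<in> Obj C \<Longrightarrow> a \<in> Obj C \<Longrightarrow> f \<in> hom x a 0 \<Longrightarrow> post x x a 0 f (Ident C x) = f"
  using ident_right[of x a f 0] by (simp add: post_def)

lemma degen_post: "a \<in> Obj C \<Longrightarrow> b \<in> Obj C \<Longrightarrow> c \<in> Obj C \<Longrightarrow> g \<in> hom b c 0 \<Longrightarrow> f \<in> hom a b 0 \<Longrightarrow>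
   degen (Hom C a c) n (post a b c 0 g f) = post a b c n g (degen (Hom C a b) n f)"
  by (simp add: post_def degen_Comp)

lemma post_degen_Ident: "a \<in> Obj C \<Longrightarrow> b \<in> Obj C \<Longrightarrow> f \<in> hom a b 0 \<Longrightarrow>
   post a a b n f (degen (Hom C a a) n (Ident C a)) = degen (Hom C a b) n f"
  by (simp add: post_def)

lemma post_map_apply [simp]: "g \<in> hom x a n \<Longrightarrow> post_map C x a b f n g = post x a b n f g"
  by (simp add: post_map_def post_def)

lemma post_map_smap: "x \<in> Obj C \<Longrightarrow> a \<in> Obj C \<Longrightarrow> b \<in> Obj C \<Longrightarrow> f \<in> hom a b 0 \<Longrightarrow> post_map C x a b f \<in> smap (Hom C x a) (Hom C x b)"
  by (rule smapI) (auto simp: act_post, simp add: post_map_def)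

lemma product_ex1:
  assumes "is_product C I a p \<pi>" "x \<in> Obj C" "\<And>i. i \<in> I \<Longrightarrow> h i \<in> hom x (a i) n"
  shows "\<exists>!k. k \<in> hom x p n \<and> (\<forall>i\<in>I. post x p (a i) n (\<pi> i) k = h i)"
proof -
  have b: "bij_betw (\<lambda>h. \<lambda>i\<in>I. post_map C x p (a i) (\<pi> i) n h) (hom x p n) (\<Pi>\<^sub>E i\<in>I. hom x (a i) n)"
    using assms by (auto simp: is_product_def)
  have "restrict h I \<in> (\<Pi>\<^sub>E i\<in>I. hom x (a i) n)" using assms(3) by auto
  then have "\<exists>!k. k \<in> hom x p n \<and> restrict h I = (\<lambda>i\<in>I. post_map C x p (a i) (\<pi> i) n k)"
    by (rule bij_betw_ex1[OF b])
  moreover have "k \<in> hom x p n \<and> restrict h I = (\<lambda>i\<in>I. post_map C x p (a i) (\<pi> i) n k) \<longleftrightarrow>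
      k \<in> hom x p n \<and> (\<forall>i\<in>I. post x p (a i) n (\<pi> i) k = h i)" for k
    by (auto simp: fun_eq_iff restrict_def)
  ultimately show ?thesis by simp
qed

lemma productD:
  assumes "is_product C I a p \<pi>"
  shows "p \<in> Obj C" "i \<in> I \<Longrightarrow> a i \<in> Obj C" "i \<in> I \<Longrightarrow> \<pi> i \<in> hom p (a i) 0"
  using assms by (auto simp: is_product_def)

lemma pullback_ex1:
  assumes "is_pullback C a e b f g p q r" "x \<in> Obj C" "u \<in> hom x a n" "v \<in> hom x e n"
    "post x a b n f u = post x e b n g v"
  shows "\<exists>!k. k \<in> hom x p n \<and> post x p a n q k = u \<and> post x p e n r k = v"
proof -
  have b: "bij_betw (\<lambda>h. (post_map C x p a q n h, post_map C x p e r n h)) (hom x p n)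
        {(u, v) \<in> hom x a n \<times> hom x e n. post_map C x a b f n u = post_map C x e b g n v}"
    using assms by (auto simp: is_pullback_def)
  have "(u, v) \<in> {(u, v) \<in> hom x a n \<times> hom x e n. post_map C x a b f n u = post_map C x e b g n v}"
    using assms by simp
  then have "\<exists>!k. k \<in> hom x p n \<and> (u, v) = (post_map C x p a q n k, post_map C x p e r n k)"
    by (rule bij_betw_ex1[OF b])
  moreover have "k \<in> hom x p n \<and> (u, v) = (post_map C x p a q n k, post_map C x p e r n k) \<longleftrightarrow>
      k \<in> hom x p n \<and> post x p a n q k = u \<and> post x p e n r k = v" for k
    by auto
  ultimately show ?thesis by simp
qed

lemma pullbackD:
  assumes "is_pullback C a e b f g p q r"
  shows "a \<in> Obj C" "e \<in> Obj C" "b \<in> Obj C" "p \<in> Obj C" "f \<in> hom a b 0" "g \<in> hom e b 0" "q \<in> hom p a 0" "r \<in> hom p e 0"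
    "post p a b 0 f q = post p e b 0 g r"
  using assms by (auto simp: is_pullback_def Comp_0_eq_post)

lemma sequential_limit_ex1:
  assumes "is_sequential_limit C e p l \<pi>" "x \<in> Obj C" "\<And>j. u j \<in> hom x (e j) n"
    "\<And>j. post x (e (Suc j)) (e j) n (p j) (u (Suc j)) = u j"
  shows "\<exists>!k. k \<in> hom x l n \<and> (\<forall>j. post x l (e j) n (\<pi> j) k = u j)"
proof -
  have b: "bij_betw (\<lambda>h j. post_map C x l (e j) (\<pi> j) n h) (hom x l n)
        {u. \<forall>j. u j \<in> hom x (e j) n \<and> post_map C x (e (Suc j)) (e j) (p j) n (u (Suc j)) = u j}"
    using assms by (auto simp: is_sequential_limit_def)
  have "u \<in> {u. \<forall>j. u j \<in> hom x (e j) n \<and> post_map C x (e (Suc j)) (e j) (p j) n (u (Suc j)) = u j}"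
    using assms by simp
  then have "\<exists>!k. k \<in> hom x l n \<and> u = (\<lambda>j. post_map C x l (e j) (\<pi> j) n k)"
    by (rule bij_betw_ex1[OF b])
  moreover have "k \<in> hom x l n \<and> u = (\<lambda>j. post_map C x l (e j) (\<pi> j) n k) \<longleftrightarrow>
      k \<in> hom x l n \<and> (\<forall>j. post x l (e j) n (\<pi> j) k = u j)" for k
    by (auto simp: fun_eq_iff)
  ultimately show ?thesis by simp
qed

lemma sequential_limitD:
  assumes "is_sequential_limit C e p l \<pi>"
  shows "l \<in> Obj C" "e j \<in> Obj C" "p j \<in> hom (e (Suc j)) (e j) 0" "\<pi> j \<in> hom l (e j) 0"
    "post l (e (Suc j)) (e j) 0 (p j) (\<pi> (Suc j)) = \<pi> j"
proof -
  have "\<forall>j. e j \<in> Obj C \<and> p j \<in> hom (e (Suc j)) (e j) 0 \<and>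
        \<pi> j \<in> hom l (e j) 0 \<and> Comp C l (e (Suc j)) (e j) 0 (p j) (\<pi> (Suc j)) = \<pi> j"
    using assms by (auto simp: is_sequential_limit_def)
  then show "e j \<in> Obj C" "p j \<in> hom (e (Suc j)) (e j) 0" "\<pi> j \<in> hom l (e j) 0"
    "post l (e (Suc j)) (e j) 0 (p j) (\<pi> (Suc j)) = \<pi> j" by (metis Comp_0_eq_post)+
  show "l \<in> Obj C" using assms by (auto simp: is_sequential_limit_def)
qed

lemma repr_functor:
  assumes x: "x \<in> Obj C"
  shows "simplicial_functor C SSET (repr C x)"
proof
  have ext: "\<phi> = \<psi>" if "\<And>k. \<phi> k \<in> extensional (S k)" "\<And>k. \<psi> k \<in> extensional (S k)"
    "\<And>k z. z \<in> S k \<Longrightarrow> \<phi> k z = \<psi> k z" for \<phi> \<psi> :: "nat \<Rightarrow> (nat \<Rightarrow> nat) \<times> 'm \<Rightarrow> 'm" and S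
    by (rule ext, rule extensionalityI[OF that(1,2)]) (use that(3) in auto)
  show "fobj (repr C x) a \<in> Obj SSET" if "a \<in> Obj C" for a using that x by (simp add: repr_def hom_sset)
  show "fmap (repr C x) a b n f \<in> simplices (Hom SSET (fobj (repr C x) a) (fobj (repr C x) b)) n"
    if h: "a \<in> Obj C" "b \<in> Obj C" "f \<in> hom a b n" for a b f n
    unfolding SSET_simps simplices_map_sset
  proof (rule smapI)
    show "fmap (repr C x) a b n f m (act (prod_sset (simplex n) (fobj (repr C x) a)) m k \<theta> y) =
           act (fobj (repr C x) b) m k \<theta> (fmap (repr C x) a b n f k y)"
      if t: "\<theta> \<in> Delta_hom m k" "y \<in> simplices (prod_sset (simplex n) (fobj (repr C x) a)) k" for m k \<theta> y
      using t h x by (auto simp: repr_def comp_act act_hom_act)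
  qed (use h x in \<open>auto simp: repr_def\<close>)
  show "fmap (repr C x) a b m (act (Hom C a b) m n \<theta> f) =
       act (Hom SSET (fobj (repr C x) a) (fobj (repr C x) b)) m n \<theta> (fmap (repr C x) a b n f)"
    if h: "a \<in> Obj C" "b \<in> Obj C" "\<theta> \<in> Delta_hom m n" "f \<in> hom a b n" for a b \<theta> m n f
    by (rule ext[of _ "\<lambda>k. Delta_hom k m \<times> hom x a k"]) (use h x in \<open>auto simp: repr_def map_sset_def act_hom_act\<close>)
  show "fmap (repr C x) a a 0 (Ident C a) = Ident SSET (fobj (repr C x) a)" if h: "a \<in> Obj C" for a
    by (rule ext[of _ "\<lambda>k. Delta_hom k 0 \<times> hom x a k"])
       (use h x in \<open>auto simp: repr_def SSET_def Delta_hom_0 act_0_eq_degen\<close>)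
  show "fmap (repr C x) a c n (Comp C a b c n g f) = Comp SSET (fobj (repr C x) a) (fobj (repr C x) b) (fobj (repr C x) c) n
         (fmap (repr C x) b c n g) (fmap (repr C x) a b n f)"
    if h: "a \<in> Obj C" "b \<in> Obj C" "c \<in> Obj C" "g \<in> hom b c n" "f \<in> hom a b n" for a b c n g f
    by (rule ext[of _ "\<lambda>k. Delta_hom k n \<times> hom x a k"])
       (use h x in \<open>auto simp: repr_def SSET_def comp_act comp_assoc\<close>)
qed

end

lemma comp_sfun_functor:
  assumes "simplicial_functor A C F" "simplicial_functor C D G"
  shows "simplicial_functor A D (comp_sfun G F)"
proof -
  interpret F: simplicial_functor A C F by fact
  interpret G: simplicial_functor C D G by fact
  show ?thesis
    by unfold_locales (simp_all add: comp_sfun_def F.fobj_closed G.fobj_closed F.fmap_closed G.fmap_closed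
      F.fmap_act G.fmap_act F.fmap_ident G.fmap_ident F.fmap_comp G.fmap_comp)
qed

section \<open>Cones on diagrams\<close>

locale diagrams = K: simplicial_category K + A: simplicial_category A
  for K :: "('o, 'u) scat" and A :: "('a, 'u) scat"
begin

notation K.hom ("hom")

abbreviation "cones W F x n \<equiv> nats A W (comp_sfun (repr K x) F) n"

lemma comp_repr_simps [simp]: "fobj (comp_sfun (repr K x) F) a = Hom K x (fobj F a)"
  by (simp add: comp_sfun_def repr_def)

lemma comp_repr_functor:
  "simplicial_functor A K F \<Longrightarrow> x \<in> Obj K \<Longrightarrow> sset_functor A (comp_sfun (repr K x) F)"
  using comp_sfun_functor[OF _ K.repr_functor] A.simplicial_category_axioms by (simp add: sset_functor_def)

lemma wact_comp_repr [simp]: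
  assumes "simplicial_functor A K F" "x \<in> Obj K" "a \<in> Obj A" "b \<in> Obj A" "f \<in> simplices (Hom A a b) k" "g \<in> hom x (fobj F a) k"
  shows "wact (comp_sfun (repr K x) F) a b k f g = Comp K x (fobj F a) (fobj F b) k (fmap F a b k f) g"
  using assms simplicial_functor.fmap_closed[OF assms(1)] simplicial_functor.fobj_closed[OF assms(1)]
  by (simp add: wact_def comp_sfun_def repr_def)

definition weight where "weight W \<longleftrightarrow> sset_functor A W"
definition diagram where "diagram F \<longleftrightarrow> simplicial_functor A K F"

lemma diagram_obj [simp]: "diagram F \<Longrightarrow> a \<in> Obj A \<Longrightarrow> fobj F a \<in> Obj K"
  unfolding diagram_def by (rule simplicial_functor.fobj_closed)

lemma diagram_fmap [simp]: "diagram F \<Longrightarrow> a \<in> Obj A \<Longrightarrow> b \<in> Obj A \<Longrightarrow> f \<in> simplices (Hom A a b) n \<Longrightarrow>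
   fmap F a b n f \<in> hom (fobj F a) (fobj F b) n"
  unfolding diagram_def by (rule simplicial_functor.fmap_closed)

lemma cone_closed [simp]: "\<phi> \<in> cones W F x n \<Longrightarrow> weight W \<Longrightarrow> diagram F \<Longrightarrow> x \<in> Obj K \<Longrightarrow> a \<in> Obj A \<Longrightarrow>
   \<theta> \<in> Delta_hom k n \<Longrightarrow> w \<in> simplices (fobj W a) k \<Longrightarrow> \<phi> a k (\<theta>, w) \<in> hom x (fobj F a) k"
  using nats_closed[of \<phi> A W "comp_sfun (repr K x) F" n a \<theta> k w] comp_repr_functor by (simp add: weight_def diagram_def)

lemma cone_act: "\<phi> \<in> cones W F x n \<Longrightarrow> weight W \<Longrightarrow> diagram F \<Longrightarrow> x \<in> Obj K \<Longrightarrow> a \<in> Obj A \<Longrightarrow>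
   \<theta> \<in> Delta_hom k n \<Longrightarrow> w \<in> simplices (fobj W a) k \<Longrightarrow> \<sigma> \<in> Delta_hom j k \<Longrightarrow>
   act (Hom K x (fobj F a)) j k \<sigma> (\<phi> a k (\<theta>, w)) = \<phi> a j (compose {..j} \<theta> \<sigma>, act (fobj W a) j k \<sigma> w)"
  using nats_act[of \<phi> A W "comp_sfun (repr K x) F" n a \<theta> k w \<sigma> j] comp_repr_functor by (simp add: weight_def diagram_def)

lemma cone_wact: "\<phi> \<in> cones W F x n \<Longrightarrow> weight W \<Longrightarrow> diagram F \<Longrightarrow> x \<in> Obj K \<Longrightarrow> a \<in> Obj A \<Longrightarrow>
   \<theta> \<in> Delta_hom k n \<Longrightarrow> w \<in> simplices (fobj W a) k \<Longrightarrow> b \<in> Obj A \<Longrightarrow> f \<in> simplices (Hom A a b) k \<Longrightarrow>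
   Comp K x (fobj F a) (fobj F b) k (fmap F a b k f) (\<phi> a k (\<theta>, w)) = \<phi> b k (\<theta>, wact W a b k f w)"
proof -
  assume h: "\<phi> \<in> cones W F x n" "weight W" "diagram F" "x \<in> Obj K" "a \<in> Obj A" "\<theta> \<in> Delta_hom k n"
    "w \<in> simplices (fobj W a) k" "b \<in> Obj A" "f \<in> simplices (Hom A a b) k"
  have c: "\<phi> a k (\<theta>, w) \<in> hom x (fobj F a) k" by (rule cone_closed[OF h(1-7)])
  have d: "simplicial_functor A K F" and W: "sset_functor A W" using h by (simp_all add: diagram_def weight_def)
  show ?thesis
    using nats_wact[OF h(1) W comp_repr_functor[OF d h(4)] h(5-9)]
    by (simp only: wact_comp_repr[OF d h(4,5,8,9) c])
qed

lemma mknat_cones: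
  assumes "weight W" "diagram F" "x \<in> Obj K"
    and cl: "\<And>a k \<theta> w. a \<in> Obj A \<Longrightarrow> \<theta> \<in> Delta_hom k n \<Longrightarrow> w \<in> simplices (fobj W a) k \<Longrightarrow> g a k \<theta> w \<in> hom x (fobj F a) k"
    and ac: "\<And>a k \<theta> w j \<sigma>. a \<in> Obj A \<Longrightarrow> \<theta> \<in> Delta_hom k n \<Longrightarrow> w \<in> simplices (fobj W a) k \<Longrightarrow> \<sigma> \<in> Delta_hom j k \<Longrightarrow>
      act (Hom K x (fobj F a)) j k \<sigma> (g a k \<theta> w) = g a j (compose {..j} \<theta> \<sigma>) (act (fobj W a) j k \<sigma> w)"
    and wa: "\<And>a b k \<theta> w f. a \<in> Obj A \<Longrightarrow> b \<in> Obj A \<Longrightarrow> \<theta> \<in> Delta_hom k n \<Longrightarrow> w \<in> simplices (fobj W a) k \<Longrightarrow>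
      f \<in> simplices (Hom A a b) k \<Longrightarrow>
      Comp K x (fobj F a) (fobj F b) k (fmap F a b k f) (g a k \<theta> w) = g b k \<theta> (wact W a b k f w)"
  shows "mknat A W n g \<in> cones W F x n"
  using assms comp_repr_functor unfolding weight_def diagram_def
  by (intro mknat_nats) auto

lemma ncomp_cones [simp]: "weight V \<Longrightarrow> weight W \<Longrightarrow> diagram F \<Longrightarrow> x \<in> Obj K \<Longrightarrow> i \<in> nats A V W 0 \<Longrightarrow> \<phi> \<in> cones W F x n \<Longrightarrow>
   ncomp A V n \<phi> i \<in> cones V F x n"
  using comp_repr_functor unfolding weight_def diagram_def by (intro ncomp_nats[of A V W])

lemma weight_map_closed [simp]: "i \<in> nats A V W n \<Longrightarrow> weight V \<Longrightarrow> weight W \<Longrightarrow> a \<in> Obj A \<Longrightarrow>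
   \<theta> \<in> Delta_hom k n \<Longrightarrow> v \<in> simplices (fobj V a) k \<Longrightarrow> i a k (\<theta>, v) \<in> simplices (fobj W a) k"
  unfolding weight_def by (rule nats_closed)

abbreviation "pull W F l lam x n h \<equiv> cone_map K A W F l lam x n h"

lemma pull_eq: "pull W F l lam x n h = mknat A W n (\<lambda>a k \<theta> w. Comp K x l (fobj F a) k (lam a k (const_map 0 k, w)) (act (Hom K x l) k n \<theta> h))"
  unfolding cone_map_def mknat_def ..

lemma pull_apply [simp]:
  "a \<in> Obj A \<Longrightarrow> \<theta> \<in> Delta_hom k n \<Longrightarrow> w \<in> simplices (fobj W a) k \<Longrightarrow>
   pull W F l lam x n h a k (\<theta>, w) = Comp K x l (fobj F a) k (lam a k (const_map 0 k, w)) (act (Hom K x l) k n \<theta> h)"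
  by (simp add: pull_eq)

lemma pull_cones [simp]:
  assumes "weight W" "diagram F" "x \<in> Obj K" "l \<in> Obj K" "lam \<in> cones W F l 0" "h \<in> hom x l n"
  shows "pull W F l lam x n h \<in> cones W F x n"
  unfolding pull_eq using assms
  by (intro mknat_cones) (simp_all add: K.comp_act K.act_hom_act cone_act K.comp_assoc cone_wact)

lemma pull_pull:
  assumes "weight W" "diagram F" "x \<in> Obj K" "y \<in> Obj K" "l \<in> Obj K" "lam \<in> cones W F l 0" "p \<in> hom y l 0" "h \<in> hom x y n"
  shows "pull W F y (pull W F l lam y 0 p) x n h = pull W F l lam x n (K.post x y l n p h)"
  unfolding pull_eq[of W F y] pull_eq[of W F l lam x] using assms
  by (intro mknat_cong) (simp add: K.act_0_eq_degen K.comp_assoc K.act_post, simp add: K.post_def K.comp_assoc)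

lemma pull_Ident:
  assumes "weight W" "diagram F" "l \<in> Obj K" "lam \<in> cones W F l 0"
  shows "pull W F l lam l 0 (Ident K l) = lam"
  unfolding pull_eq using assms
  by (intro nats_eq_mknat[symmetric]) (simp_all add: Delta_hom_0 K.act_0_eq_degen)

lemma pull_ncomp:
  assumes "weight V" "weight W" "i \<in> nats A V W 0"
  shows "ncomp A V n (pull W F l lam x n h) i = pull V F l (ncomp A V 0 lam i) x n h"
  unfolding pull_eq[of V] ncomp_def[of A V n] using assms by (intro mknat_cong) simp

definition diag_map where "diag_map F G \<beta> \<longleftrightarrow> \<beta> \<in> simplices (nat_sset A K F G) 0"

lemma diag_map_closed [simp]: "diag_map F G \<beta> \<Longrightarrow> a \<in> Obj A \<Longrightarrow> \<beta> a \<in> hom (fobj F a) (fobj G a) 0"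
  by (auto simp: diag_map_def nat_sset_def)

lemma diag_map_natural: "diag_map F G \<beta> \<Longrightarrow> a \<in> Obj A \<Longrightarrow> b \<in> Obj A \<Longrightarrow> f \<in> simplices (Hom A a b) k \<Longrightarrow>
  Comp K (fobj F a) (fobj G a) (fobj G b) k (fmap G a b k f) (degen (Hom K (fobj F a) (fobj G a)) k (\<beta> a)) =
  Comp K (fobj F a) (fobj F b) (fobj G b) k (degen (Hom K (fobj F b) (fobj G b)) k (\<beta> b)) (fmap F a b k f)"
  by (auto simp: diag_map_def nat_sset_def Delta_hom_0 degen_def)

definition nwhisk where
  "nwhisk W F G \<beta> x n \<phi> = mknat A W n (\<lambda>a k \<theta> w. K.post x (fobj F a) (fobj G a) k (\<beta> a) (\<phi> a k (\<theta>, w)))"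

lemma nwhisk_apply [simp]:
  "a \<in> Obj A \<Longrightarrow> \<theta> \<in> Delta_hom k n \<Longrightarrow> w \<in> simplices (fobj W a) k \<Longrightarrow>
   nwhisk W F G \<beta> x n \<phi> a k (\<theta>, w) = K.post x (fobj F a) (fobj G a) k (\<beta> a) (\<phi> a k (\<theta>, w))"
  by (simp add: nwhisk_def)

lemma nwhisk_cones [simp]:
  assumes "weight W" "diagram F" "diagram G" "diag_map F G \<beta>" "x \<in> Obj K" "\<phi> \<in> cones W F x n"
  shows "nwhisk W F G \<beta> x n \<phi> \<in> cones W G x n"
  unfolding nwhisk_def using assms
proof (intro mknat_cones)
  fix a b k \<theta> w f
  assume h: "a \<in> Obj A" "b \<in> Obj A" "\<theta> \<in> Delta_hom k n" "w \<in> simplices (fobj W a) k" "f \<in> simplices (Hom A a b) k"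
  show "Comp K x (fobj G a) (fobj G b) k (fmap G a b k f) (K.post x (fobj F a) (fobj G a) k (\<beta> a) (\<phi> a k (\<theta>, w))) =
      K.post x (fobj F b) (fobj G b) k (\<beta> b) (\<phi> b k (\<theta>, wact W a b k f w))"
    using h assms by (simp add: K.Comp_post diag_map_natural cone_wact[symmetric] K.comp_assoc K.post_def)
qed (simp_all add: K.act_post cone_act)

lemma nwhisk_ncomp:
  assumes "weight V" "weight W" "i \<in> nats A V W 0"
  shows "nwhisk V F G \<beta> x n (ncomp A V n \<phi> i) = ncomp A V n (nwhisk W F G \<beta> x n \<phi>) i"
  unfolding nwhisk_def[of V] ncomp_def[of A V n "nwhisk W F G \<beta> x n \<phi>"] using assms by (intro mknat_cong) simp

lemma nwhisk_pull:
  assumes "weight W" "diagram F" "diagram G" "diag_map F G \<beta>" "x \<in> Obj K" "l \<in> Obj K" "lam \<in> cones W F l 0" "h \<in> hom x l n"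
  shows "nwhisk W F G \<beta> x n (pull W F l lam x n h) = pull W G l (nwhisk W F G \<beta> l 0 lam) x n h"
  unfolding nwhisk_def[of W F G \<beta> x] pull_eq[of W G] using assms
  by (intro mknat_cong) (simp add: K.post_Comp)

section \<open>Weighted limits\<close>

lemma weighted_limit_iff:
  assumes "weight W" "diagram F"
  shows "is_weighted_limit K A W F l lam \<longleftrightarrow> l \<in> Obj K \<and> lam \<in> cones W F l 0 \<and>
    (\<forall>x\<in>Obj K. \<forall>n. \<forall>\<phi>\<in>cones W F x n. \<exists>!h. h \<in> hom x l n \<and> pull W F l lam x n h = \<phi>)"
proof -
  have "bij_betw (pull W F l lam x n) (hom x l n) (cones W F x n) \<longleftrightarrow>
     (\<forall>\<phi>\<in>cones W F x n. \<exists>!h. h \<in> hom x l n \<and> pull W F l lam x n h = \<phi>)"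
    if "l \<in> Obj K" "lam \<in> cones W F l 0" "x \<in> Obj K" for x n
  proof -
    have "pull W F l lam x n h \<in> cones W F x n" if "h \<in> hom x l n" for h
      using that \<open>l \<in> Obj K\<close> \<open>lam \<in> cones W F l 0\<close> \<open>x \<in> Obj K\<close> assms by simp
    then show ?thesis by (intro bij_betw_iff_ex1) blast
  qed
  then show ?thesis unfolding is_weighted_limit_def fun_scat_simps by (intro conj_cong refl ball_cong all_cong1) simp
qed

lemma weighted_limitD:
  assumes "is_weighted_limit K A W F l lam"
  shows "l \<in> Obj K" "lam \<in> cones W F l 0"
  using assms by (auto simp: is_weighted_limit_def)

lemma factor_cone:
  assumes "is_weighted_limit K A W F l lam" "weight W" "diagram F" "x \<in> Obj K" "\<phi> \<in> cones W F x n"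
  shows factor_cone_closed: "factor_cone K A W F l lam x n \<phi> \<in> hom x l n"
    and pull_factor_cone: "pull W F l lam x n (factor_cone K A W F l lam x n \<phi>) = \<phi>"
proof -
  have b: "bij_betw (pull W F l lam x n) (hom x l n) (cones W F x n)"
    using assms by (auto simp: is_weighted_limit_def)
  then show "factor_cone K A W F l lam x n \<phi> \<in> hom x l n"
    "pull W F l lam x n (factor_cone K A W F l lam x n \<phi>) = \<phi>"
    unfolding factor_cone_def using assms(5)
    by (auto simp: bij_betw_def the_inv_into_into f_the_inv_into_f)
qed

lemma pull_inj:
  assumes "is_weighted_limit K A W F l lam" "x \<in> Obj K" "h \<in> hom x l n" "h' \<in> hom x l n"
    "pull W F l lam x n h = pull W F l lam x n h'"
  shows "h = h'"
  using assms unfolding is_weighted_limit_def bij_betw_def inj_on_def by blast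

lemma factor_coneI:
  assumes "is_weighted_limit K A W F l lam" "weight W" "diagram F" "x \<in> Obj K" "h \<in> hom x l n" "pull W F l lam x n h = \<phi>"
  shows "factor_cone K A W F l lam x n \<phi> = h"
proof -
  have "\<phi> \<in> cones W F x n" using assms weighted_limitD[OF assms(1)] pull_cones[of W F x l lam h n] by simp
  then show ?thesis using assms factor_cone[OF assms(1-4)] pull_inj[OF assms(1,4)] by metis
qed

lemma weighted_limit_iso:
  assumes L: "is_weighted_limit K A W F l lam" and L': "is_weighted_limit K A W F l' lam'" and "weight W" "diagram F"
  obtains k where "is_iso K l' l k" "k \<in> hom l' l 0" "pull W F l lam l' 0 k = lam'"
proof -
  note [simp] = weighted_limitD[OF L] weighted_limitD[OF L'] assms(3,4)
  define k where "k = factor_cone K A W F l lam l' 0 lam'"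
  define k' where "k' = factor_cone K A W F l' lam' l 0 lam"
  have k [simp]: "k \<in> hom l' l 0" and pk: "pull W F l lam l' 0 k = lam'"
    unfolding k_def by (auto intro: factor_cone[OF L])
  have k' [simp]: "k' \<in> hom l l' 0" and pk': "pull W F l' lam' l 0 k' = lam"
    unfolding k'_def by (auto intro: factor_cone[OF L'])
  have "K.post l l' l 0 k k' = Ident K l"
  proof (rule pull_inj[OF L])
    show "pull W F l lam l 0 (K.post l l' l 0 k k') = pull W F l lam l 0 (Ident K l)"
      by (simp add: pull_pull[symmetric] pk pk' pull_Ident)
  qed auto
  moreover have "K.post l' l l' 0 k' k = Ident K l'"
  proof (rule pull_inj[OF L'])
    show "pull W F l' lam' l' 0 (K.post l' l l' 0 k' k) = pull W F l' lam' l' 0 (Ident K l')"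
      by (simp add: pull_pull[symmetric] pk pk' pull_Ident)
  qed auto
  ultimately have "is_iso K l' l k"
    unfolding is_iso_def by (intro conjI bexI[of _ k']) (auto simp: K.Comp_0_eq_post)
  then show thesis using that k pk by blast
qed

lemma lim_weight_map_eqI:
  assumes "is_weighted_limit K A W F l lam" "weight W" "diagram F" "l' \<in> Obj K" "h \<in> hom l' l 0"
    "pull W F l lam l' 0 h = ncomp A W 0 lam' i"
  shows "lim_weight_map K A F W l lam W' l' lam' i = h"
  unfolding lim_weight_map_def Comp_nats_0 using assms by (intro factor_coneI) auto

lemma Comp_whisker:
  assumes "weight W" "diagram F" "diagram G" "diag_map F G \<alpha>" "l \<in> Obj K" "lam \<in> cones W F l 0"
  shows "Comp (fun_scat A SSET) W (comp_sfun (repr K l) F) (comp_sfun (repr K l) G) 0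
          (whisker K A F G l 0 \<alpha>) lam = nwhisk W F G \<alpha> l 0 lam"
  unfolding Comp_fun_scat_SSET nwhisk_def whisker_def using assms
  by (intro mknat_cong) (simp add: repr_def Delta_hom_0 K.post_def K.act_0_eq_degen)

lemma lim_diagram_map_eqI:
  assumes "is_weighted_limit K A W F l lam" "is_weighted_limit K A W G l' lam'" "weight W" "diagram F" "diagram G" "diag_map F G \<alpha>"
    "h \<in> hom l l' 0" "pull W G l' lam' l 0 h = nwhisk W F G \<alpha> l 0 lam"
  shows "lim_diagram_map K A W F l lam G l' lam' \<alpha> = h"
  unfolding lim_diagram_map_def using assms weighted_limitD[OF assms(1)]
  by (subst Comp_whisker) (auto intro: factor_coneI)

end

section \<open>Cotensors and free weights\<close>

context simplicial_category
begin

lemma cotensor_ex1: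
  assumes c: "is_cotensor C U a c e" and x: "x \<in> Obj C" and \<gamma>: "\<gamma> \<in> smap (prod_sset (simplex n) U) (Hom C x a)"
  shows "\<exists>!h. h \<in> hom x c n \<and> (\<forall>k. \<forall>\<theta>\<in>Delta_hom k n. \<forall>u\<in>simplices U k.
     Comp C x c a k (e k u) (act (Hom C x c) k n \<theta> h) = \<gamma> k (\<theta>, u))"
proof -
  let ?r = "\<lambda>h k. \<lambda>(\<theta>, u)\<in>simplices (prod_sset (simplex n) U) k. Comp C x c a k (e k u) (act (Hom C x c) k n \<theta> h)"
  have b: "bij_betw ?r (hom x c n) (simplices (map_sset U (Hom C x a)) n)"
    using c x by (auto simp: is_cotensor_def)
  have "\<exists>!h. h \<in> hom x c n \<and> \<gamma> = ?r h" using \<gamma> by (intro bij_betw_ex1[OF b]) simp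
  moreover have "\<gamma> = ?r h \<longleftrightarrow> (\<forall>k. \<forall>\<theta>\<in>Delta_hom k n. \<forall>u\<in>simplices U k.
     Comp C x c a k (e k u) (act (Hom C x c) k n \<theta> h) = \<gamma> k (\<theta>, u))" for h
    using smap_extensional[OF \<gamma>] by (auto simp: fun_eq_iff extensional_def restrict_def)
  ultimately show ?thesis by simp
qed

lemma cotensorD:
  assumes "is_cotensor C U a c e"
  shows "a \<in> Obj C" "c \<in> Obj C" "e \<in> smap U (Hom C c a)"
  using assms by (auto simp: is_cotensor_def)

lemma terminal_hom_eq: "is_terminal C t \<Longrightarrow> x \<in> Obj C \<Longrightarrow> f \<in> hom x t n \<Longrightarrow> g \<in> hom x t n \<Longrightarrow> f = g"
  unfolding is_terminal_def by blast

lemma terminal_hom_ex: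
  assumes "is_terminal C t" "x \<in> Obj C"
  shows "\<exists>h. h \<in> hom x t n"
proof -
  have "\<exists>!h. h \<in> hom x t n" using assms by (simp add: is_terminal_def)
  then show ?thesis by (rule ex1_implies_ex)
qed

text \<open>Into a terminal object there is exactly one simplex of each dimension from every object,
  so \<open>t\<close> is its own cotensor. This lets a plain restriction
  \<open>b^V \<rightarrow> b^U\<close> be seen as a Leibniz cotensor.\<close>

lemma cotensor_terminal:
  assumes t: "is_terminal C t" and U: "simplicial_set U"
  shows "is_cotensor C U t t (\<lambda>k. \<lambda>u\<in>simplices U k. degen (Hom C t t) k (Ident C t))"
proof -
  have [simp]: "t \<in> Obj C" using t by (simp add: is_terminal_def)
  let ?e = "\<lambda>k. \<lambda>u\<in>simplices U k. degen (Hom C t t) k (Ident C t)"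
  have e: "?e \<in> smap U (Hom C t t)"
    using U by (intro smap_restrictI) auto
  have "bij_betw (\<lambda>h k. \<lambda>(\<theta>, u)\<in>simplices (prod_sset (simplex n) U) k. Comp C x t t k (?e k u) (act (Hom C x t) k n \<theta> h))
        (hom x t n) (simplices (map_sset U (Hom C x t)) n)" if x [simp]: "x \<in> Obj C" for x n
  proof (rule bij_betw_imageI)
    let ?r = "\<lambda>h k. \<lambda>(\<theta>, u)\<in>simplices (prod_sset (simplex n) U) k. Comp C x t t k (?e k u) (act (Hom C x t) k n \<theta> h)"
    show "inj_on ?r (hom x t n)" by (intro inj_onI terminal_hom_eq[OF t that])
    have r: "?r h \<in> smap (prod_sset (simplex n) U) (Hom C x t)" if h: "h \<in> hom x t n" for h
    proof (rule smap_restrictI)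
      show "simplicial_set (prod_sset (simplex n) U)" using U by (simp add: simplicial_set_prod)
    qed (use h U in \<open>auto simp: comp_act act_hom_act\<close>)
    show "?r ` hom x t n = simplices (map_sset U (Hom C x t)) n"
    proof
      show "?r ` hom x t n \<subseteq> simplices (map_sset U (Hom C x t)) n"
        using r by (intro image_subsetI) simp
      show "simplices (map_sset U (Hom C x t)) n \<subseteq> ?r ` hom x t n"
      proof
        fix \<gamma> assume g: "\<gamma> \<in> simplices (map_sset U (Hom C x t)) n"
        obtain h where h: "h \<in> hom x t n" using terminal_hom_ex[OF t x] by blast
        have "\<gamma> = ?r h"
        proof (rule smap_eqI[OF _ r[OF h]])
          show "\<gamma> \<in> smap (prod_sset (simplex n) U) (Hom C x t)" using g by simp
          then show "\<gamma> k y = ?r h k y" if y: "y \<in> simplices (prod_sset (simplex n) U) k" for k y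
            by (intro terminal_hom_eq[OF t \<open>x \<in> Obj C\<close> smap_closed[OF _ y] smap_closed[OF r[OF h] y]])
        qed
        then show "\<gamma> \<in> ?r ` hom x t n" using h by blast
      qed
    qed
  qed
  then show ?thesis using e by (simp add: is_cotensor_def)
qed

end

section \<open>Restriction maps between cotensors\<close>

context infinity_cosmos
begin

lemma isof_hom_closed: "a \<in> Obj K \<Longrightarrow> b \<in> Obj K \<Longrightarrow> f \<in> isof a b \<Longrightarrow> f \<in> hom a b 0"
  using isof_vertex by blast

abbreviation "incl U \<equiv> (\<lambda>n. \<lambda>u\<in>simplices U n. u)"

text \<open>This is the Leibniz cotensor with \<open>b \<rightarrow> 1\<close>.\<close>

lemma isof_cotensor_restriction:
  fixes U V :: "'u sset"
  assumes U: "U \<in> Obj (SSet \<kappa>)" and V: "V \<in> Obj (SSet \<kappa>)" and UV: "subsset U V"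
    and bU: "is_cotensor K U b bU ubU" and bV: "is_cotensor K V b bV ubV"
    and bi: "is_cotensor_map K U (incl U) b b (Ident K b) bV ubV bU ubU bi"
  shows "bi \<in> isof bV bU"
proof -
  obtain t where t: "is_terminal K t" using ex_terminal by blast
  then have [simp]: "t \<in> Obj K" by (simp add: is_terminal_def)
  note [simp] = cotensorD[OF bU] cotensorD[OF bV]
  have bi' [simp]: "bi \<in> hom bV bU 0" using bi by (simp add: is_cotensor_map_def)
  note ex = terminal_hom_ex[OF t, of _ 0]
  obtain g where g [simp]: "g \<in> hom b t 0" using ex[of b] by auto
  obtain gU where gU [simp]: "gU \<in> hom bU t 0" using ex[of bU] by auto
  obtain gV where gV [simp]: "gV \<in> hom bV t 0" using ex[of bV] by auto
  have sU [simp]: "simplicial_set U" and sV [simp]: "simplicial_set V" using U V by auto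
  note teq = terminal_hom_eq[OF t]
  let ?e = "\<lambda>U k. \<lambda>u\<in>simplices U k. degen (Hom K t t) k (Ident K t)"
  \<comment> \<open>With \<open>t^U = t^V = t\<close> the pullback in the Leibniz construction
    collapses to \<open>bU\<close>, and the Leibniz map becomes \<open>bi\<close>.\<close>
  have pb: "is_pullback K bU t t gU (Ident K t) bU (Ident K bU) gU"
    unfolding is_pullback_def
  proof (intro conjI ballI allI)
    fix x n assume x [simp]: "x \<in> Obj K"
    show "bij_betw (\<lambda>h. (post_map K x bU bU (Ident K bU) n h, post_map K x bU t gU n h)) (hom x bU n)
        {(u, v). (u, v) \<in> hom x bU n \<times> hom x t n \<and> post_map K x bU t gU n u = post_map K x t t (Ident K t) n v}"
      by (subst bij_betw_iff_ex1) (auto intro: teq)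
  qed (auto simp: Comp_0_eq_post)
  show ?thesis
  proof (rule isof_leibniz_cotensor[OF U V subsset_incl[OF UV] _ _ _ _ bU bV cotensor_terminal[OF t sU] cotensor_terminal[OF t sV]
      bi _ _ _ pb])
    show "g \<in> isof b t" by (rule isof_terminal[OF _ t]) auto
    have e: "?e V \<in> smap V (Hom K t t)" "?e U \<in> smap U (Hom K t t)"
      by (rule cotensorD(3)[OF cotensor_terminal[OF t sV]], rule cotensorD(3)[OF cotensor_terminal[OF t sU]])
    show "is_cotensor_map K U (incl U) t t (Ident K t) t (?e V) t (?e U) (Ident K t)"
      using subsset_closed[OF UV] by (auto simp: is_cotensor_map_def)
    show "is_cotensor_map K U (\<lambda>n u. u) b t g bU ubU t (?e U) gU"
      unfolding is_cotensor_map_def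
    proof (intro conjI allI ballI)
      fix k u assume u [simp]: "u \<in> simplices U k"
      have [simp]: "ubU k u \<in> hom bU b k" by (rule smap_closed[OF cotensorD(3)[OF bU] u])
      show "Comp K bU t t k (?e U k u) (degen (Hom K bU t) k gU) = post_map K bU b t g k (ubU k u)"
        by (rule teq[of bU _ k]) auto
    qed simp
    show "is_cotensor_map K V (\<lambda>n u. u) b t g bV ubV t (?e V) gV"
      unfolding is_cotensor_map_def
    proof (intro conjI allI ballI)
      fix k u assume u [simp]: "u \<in> simplices V k"
      have [simp]: "ubV k u \<in> hom bV b k" by (rule smap_closed[OF cotensorD(3)[OF bV] u])
      show "Comp K bV t t k (?e V k u) (degen (Hom K bV t) k gV) = post_map K bV b t g k (ubV k u)"
        by (rule teq[of bV _ k]) auto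
    qed simp
    show "Comp K bV bU bU 0 (Ident K bU) bi = bi" by (simp add: Comp_0_eq_post)
    show "Comp K bV bU t 0 gU bi = gV" by (rule teq[of bV _ 0]) auto
  qed auto
qed

end

text \<open>An isomorphism from \<open>U \<times> Hom A a -\<close> to \<open>W\<close>, recorded by
  its restriction \<open>j\<close> to the identity of \<open>a\<close>, as in the Yoneda lemma. In
  this form no weight with pairs as simplices appears.\<close>

definition is_free where
  "is_free A W a U j \<longleftrightarrow> j \<in> smap U (fobj W a) \<and>
     (\<forall>b\<in>Obj A. \<forall>k. bij_betw (\<lambda>(u, f). wact W a b k f (j k u))
        (simplices U k \<times> simplices (Hom A a b) k) (simplices (fobj W b) k))"

context diagrams
begin

lemma diagram_fmap_Ident:
  assumes "diagram F" "a \<in> Obj A"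
  shows "fmap F a a k (degen (Hom A a a) k (Ident A a)) = degen (Hom K (fobj F a) (fobj F a)) k (Ident K (fobj F a))"
  using assms unfolding degen_def diagram_def
  by (simp add: simplicial_functor.fmap_act simplicial_functor.fmap_ident)

text \<open>Yoneda: every simplex of \<open>W b\<close> is some \<open>f\<close> applied to a
  generator \<open>j u\<close>, in exactly one way. Values on generators therefore extend by
  composition with \<open>fmap F\<close>, and naturality leaves no other choice.\<close>

lemma free_cone_ex1:
  assumes W [simp]: "weight W" and F [simp]: "diagram F" and a [simp]: "a \<in> Obj A" and U: "simplicial_set U"
    and free: "is_free A W a U j" and x [simp]: "x \<in> Obj K"
    and \<gamma>: "\<gamma> \<in> smap (prod_sset (simplex n) U) (Hom K x (fobj F a))"
  shows "\<exists>!\<phi>. \<phi> \<in> cones W F x n \<and>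
    (\<forall>k. \<forall>\<theta>\<in>Delta_hom k n. \<forall>u\<in>simplices U k. \<phi> a k (\<theta>, j k u) = \<gamma> k (\<theta>, u))"
proof -
  interpret W: sset_functor A W using W by (simp add: weight_def)
  interpret F: simplicial_functor A K F using F by (simp add: diagram_def)
  have j: "j \<in> smap U (fobj W a)" using free by (simp add: is_free_def)
  note [simp] = smap_closed[OF j]
  \<comment> \<open>\<open>g b k w\<close> is the pair of a generator and a morphism that produce
    \<open>w\<close>; the facts \<open>g_act\<close>, \<open>g_wact\<close> and \<open>g_j\<close>
    below are forced by the uniqueness of this pair.\<close>
  define g where "g b k w = the_inv_into (simplices U k \<times> simplices (Hom A a b) k) (\<lambda>(u, f). wact W a b k f (j k u)) w" for b k w
  have bij: "bij_betw (\<lambda>(u, f). wact W a b k f (j k u)) (simplices U k \<times> simplices (Hom A a b) k) (simplices (fobj W b) k)"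
    if "b \<in> Obj A" for b k using free that by (auto simp: is_free_def)
  have g_mem: "fst (g b k w) \<in> simplices U k" "snd (g b k w) \<in> simplices (Hom A a b) k" 
    and g_w: "wact W a b k (snd (g b k w)) (j k (fst (g b k w))) = w"
    if "b \<in> Obj A" "w \<in> simplices (fobj W b) k" for b k w
  proof -
    have "g b k w \<in> simplices U k \<times> simplices (Hom A a b) k"
      unfolding g_def using bij[OF that(1), of k] that(2) by (intro the_inv_into_into) (auto simp: bij_betw_def)
    then show "fst (g b k w) \<in> simplices U k" "snd (g b k w) \<in> simplices (Hom A a b) k" by auto
    have "(\<lambda>(u, f). wact W a b k f (j k u)) (g b k w) = w"
      unfolding g_def using bij[OF that(1), of k] that(2) by (intro f_the_inv_into_f) (auto simp: bij_betw_def)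
    then show "wact W a b k (snd (g b k w)) (j k (fst (g b k w))) = w" by (simp add: case_prod_beta)
  qed
  have g_eq: "g b k (wact W a b k f (j k u)) = (u, f)" if "b \<in> Obj A" "u \<in> simplices U k" "f \<in> simplices (Hom A a b) k" for b k f u
    using the_inv_into_f_f[of "\<lambda>(u, f). wact W a b k f (j k u)" "simplices U k \<times> simplices (Hom A a b) k" "(u, f)"]
      bij[OF that(1), of k] that by (simp add: g_def bij_betw_def)
  have g_act: "g b m (act (fobj W b) m k \<sigma> w) = (act U m k \<sigma> (fst (g b k w)), act (Hom A a b) m k \<sigma> (snd (g b k w)))"
    if "b \<in> Obj A" "w \<in> simplices (fobj W b) k" "\<sigma> \<in> Delta_hom m k" for b k m \<sigma> w
  proof -
    note m = g_mem[OF that(1,2)]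
    have "act (fobj W b) m k \<sigma> w = act (fobj W b) m k \<sigma> (wact W a b k (snd (g b k w)) (j k (fst (g b k w))))"
      by (simp add: g_w that)
    also have "\<dots> = wact W a b m (act (Hom A a b) m k \<sigma> (snd (g b k w))) (j m (act U m k \<sigma> (fst (g b k w))))"
      using m that by (simp add: W.act_wact smap_act[OF j])
    finally show ?thesis using m that U by (simp add: g_eq)
  qed
  have g_wact: "g c k (wact W b c k f w) = (fst (g b k w), Comp A a b c k f (snd (g b k w)))"
    if "b \<in> Obj A" "c \<in> Obj A" "f \<in> simplices (Hom A b c) k" "w \<in> simplices (fobj W b) k" for b c k f w
  proof -
    note m = g_mem[OF that(1,4)]
    have "wact W b c k f w = wact W b c k f (wact W a b k (snd (g b k w)) (j k (fst (g b k w))))"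
      by (simp add: g_w that)
    also have "\<dots> = wact W a c k (Comp A a b c k f (snd (g b k w))) (j k (fst (g b k w)))"
      using m that by (simp add: W.wact_Comp)
    finally show ?thesis using m that by (simp add: g_eq)
  qed
  have g_j: "g a k (j k u) = (u, degen (Hom A a a) k (Ident A a))" if "u \<in> simplices U k" for k u
    using g_eq[OF a that, of "degen (Hom A a a) k (Ident A a)"] that by (simp add: W.wact_Ident)
  have \<gamma>c [simp]: "\<gamma> k (\<theta>, u) \<in> hom x (fobj F a) k" if "\<theta> \<in> Delta_hom k n" "u \<in> simplices U k" for k \<theta> u
    using smap_closed[OF \<gamma>, of "(\<theta>, u)" k] that by simp
  have \<gamma>a: "act (Hom K x (fobj F a)) m k \<sigma> (\<gamma> k (\<theta>, u)) = \<gamma> m (compose {..m} \<theta> \<sigma>, act U m k \<sigma> u)"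
    if "\<theta> \<in> Delta_hom k n" "u \<in> simplices U k" "\<sigma> \<in> Delta_hom m k" for k \<theta> u m \<sigma>
    using smap_act[OF \<gamma>, of \<sigma> m k "(\<theta>, u)"] that by simp
  define \<phi> where "\<phi> = mknat A W n (\<lambda>b k \<theta> w.
     Comp K x (fobj F a) (fobj F b) k (fmap F a b k (snd (g b k w))) (\<gamma> k (\<theta>, fst (g b k w))))"
  have "\<phi> \<in> cones W F x n"
    unfolding \<phi>_def
    by (intro mknat_cones) (simp_all add: g_mem K.comp_act \<gamma>a g_act F.fmap_act g_wact K.comp_assoc F.fmap_comp)
  moreover have "\<phi> a k (\<theta>, j k u) = \<gamma> k (\<theta>, u)" if "\<theta> \<in> Delta_hom k n" "u \<in> simplices U k" for k \<theta> u
    using that by (simp add: \<phi>_def g_j diagram_fmap_Ident)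
  moreover have "\<phi>' = \<phi>''" if p: "\<phi>' \<in> cones W F x n" "\<phi>'' \<in> cones W F x n"
      "\<And>k \<theta> u. \<theta> \<in> Delta_hom k n \<Longrightarrow> u \<in> simplices U k \<Longrightarrow> \<phi>' a k (\<theta>, j k u) = \<phi>'' a k (\<theta>, j k u)" for \<phi>' \<phi>''
  proof (rule nats_eqI[OF p(1,2)])
    fix b k \<theta> w assume h: "b \<in> Obj A" "\<theta> \<in> Delta_hom k n" "w \<in> simplices (fobj W b) k"
    note m = g_mem[OF h(1,3)]
    have "\<phi>' b k (\<theta>, wact W a b k (snd (g b k w)) (j k (fst (g b k w)))) = \<phi>'' b k (\<theta>, wact W a b k (snd (g b k w)) (j k (fst (g b k w))))"
      using cone_wact[OF p(1) W F x a h(2) smap_closed[OF j m(1)] h(1) m(2)]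
        cone_wact[OF p(2) W F x a h(2) smap_closed[OF j m(1)] h(1) m(2)] p(3)[OF h(2) m(1)] by simp
    then show "\<phi>' b k (\<theta>, w) = \<phi>'' b k (\<theta>, w)" by (simp add: g_w h)
  qed
  ultimately show ?thesis by metis
qed

text \<open>The weighted limit of a free weight is the cotensor of \<open>F a\<close> by
  \<open>U\<close>: \<open>free_cone_ex1\<close> turns cones on \<open>W\<close> into maps
  \<open>simplex n \<times> U \<rightarrow> Hom K x (F a)\<close>, which is what the cotensor
  represents.\<close>

lemma free_weighted_limit:
  assumes W [simp]: "weight W" and F [simp]: "diagram F" and a [simp]: "a \<in> Obj A" and U: "simplicial_set U"
    and free: "is_free A W a U j" and c: "is_cotensor K U (fobj F a) c \<epsilon>"
  obtains lam where "is_weighted_limit K A W F c lam"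
    "\<And>k u. u \<in> simplices U k \<Longrightarrow> lam a k (const_map 0 k, j k u) = \<epsilon> k u"
proof -
  have j: "j \<in> smap U (fobj W a)" using free by (simp add: is_free_def)
  have \<epsilon>: "\<epsilon> \<in> smap U (Hom K c (fobj F a))" and c' [simp]: "c \<in> Obj K" using c by (auto simp: is_cotensor_def)
  note [simp] = smap_closed[OF \<epsilon>] smap_closed[OF j]
  \<comment> \<open>The limit cone is the free extension of the universal map
    \<open>\<epsilon>\<close>, read as a map on \<open>simplex 0 \<times> U\<close>.\<close>
  have "(\<lambda>k. \<lambda>y\<in>simplices (prod_sset (simplex 0) U) k. \<epsilon> k (snd y)) \<in> smap (prod_sset (simplex 0) U) (Hom K c (fobj F a))"
    using U \<epsilon> by (intro smap_restrictI) (auto simp: simplicial_set_prod smap_act)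
  from free_cone_ex1[OF W F a U free c' this]
  obtain lam where lam [simp]: "lam \<in> cones W F c 0" and lj: "\<And>k \<theta> u. \<theta> \<in> Delta_hom k 0 \<Longrightarrow> u \<in> simplices U k \<Longrightarrow> lam a k (\<theta>, j k u) = \<epsilon> k u"
    by auto
  have "\<exists>!h. h \<in> hom x c n \<and> pull W F c lam x n h = \<phi>" if x [simp]: "x \<in> Obj K" and \<phi> [simp]: "\<phi> \<in> cones W F x n" for x n \<phi>
  proof -
    let ?\<gamma> = "\<lambda>k. \<lambda>y\<in>simplices (prod_sset (simplex n) U) k. \<phi> a k (fst y, j k (snd y))"
    have \<gamma>: "?\<gamma> \<in> smap (prod_sset (simplex n) U) (Hom K x (fobj F a))"
      using U by (intro smap_restrictI) (auto simp: simplicial_set_prod cone_act[OF \<phi> W F x a] cone_closed[OF \<phi> W F x a] smap_act[OF j])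
    have eq: "pull W F c lam x n h = \<phi> \<longleftrightarrow> (\<forall>k. \<forall>\<theta>\<in>Delta_hom k n. \<forall>u\<in>simplices U k.
       Comp K x c (fobj F a) k (\<epsilon> k u) (act (Hom K x c) k n \<theta> h) = ?\<gamma> k (\<theta>, u))" (is "_ \<longleftrightarrow> ?R")
      if h [simp]: "h \<in> hom x c n" for h
    proof
      show "pull W F c lam x n h = \<phi> \<Longrightarrow> ?R" by (auto simp: lj)
      assume R: ?R
      have "\<forall>k. \<forall>\<theta>\<in>Delta_hom k n. \<forall>u\<in>simplices U k. pull W F c lam x n h a k (\<theta>, j k u) = ?\<gamma> k (\<theta>, u)"
        using R by (simp add: lj)
      moreover have "\<forall>k. \<forall>\<theta>\<in>Delta_hom k n. \<forall>u\<in>simplices U k. \<phi> a k (\<theta>, j k u) = ?\<gamma> k (\<theta>, u)" by simp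
      ultimately show "pull W F c lam x n h = \<phi>" using free_cone_ex1[OF W F a U free x \<gamma>]
          pull_cones[OF W F x c' lam h] \<phi> by blast
    qed
    show ?thesis using K.cotensor_ex1[OF c x \<gamma>] by (simp only: eq cong: conj_cong)
  qed
  then have "is_weighted_limit K A W F c lam" by (simp add: weighted_limit_iff)
  then show thesis using that lj by (simp add: Delta_hom_0)
qed

text \<open>The generators are the simplices that \<open>\<psi>\<close> carries to
  \<open>(d v, id)\<close>. The bijection \<open>d\<close> allows \<open>V\<close> to be a copy of
  \<open>X\<close> over another type, so that a simplex or its boundary can be replaced by a copy
  over \<open>'u\<close>.\<close>

lemma weight_iso_free:
  assumes W: "weight W" and a [simp]: "a \<in> Obj A" and X: "simplicial_set X" and V: "simplicial_set V"
    and iso: "is_weight_iso A W (times_weight X (repr A a)) \<psi>"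
    and d: "d \<in> smap V X" and bij: "\<And>k. bij_betw (d k) (simplices V k) (simplices X k)"
  obtains j where "is_free A W a V j"
    "\<And>k v. v \<in> simplices V k \<Longrightarrow> \<psi> a k (j k v) = (d k v, degen (Hom A a a) k (Ident A a))"
proof -
  interpret W: sset_functor A W using W by (simp add: weight_def)
  have tw [simp]: "fobj (times_weight X (repr A a)) b = prod_sset X (Hom A a b)" for b
    by (simp add: times_weight_def repr_def)
  have \<psi>: "\<psi> b \<in> smap (fobj W b) (prod_sset X (Hom A a b))"
    and b\<psi>: "bij_betw (\<psi> b k) (simplices (fobj W b) k) (simplices X k \<times> simplices (Hom A a b) k)"
    if "b \<in> Obj A" for b k
    using iso that by (auto simp: is_weight_iso_def)
  let ?i = "\<lambda>k. degen (Hom A a a) k (Ident A a)"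
  have "\<exists>w. w \<in> simplices (fobj W a) k \<and> \<psi> a k w = (d k v, ?i k)" if "v \<in> simplices V k" for k v
  proof -
    have "(d k v, ?i k) \<in> \<psi> a k ` simplices (fobj W a) k"
      using b\<psi>[OF a, of k] that smap_closed[OF d] by (simp add: bij_betw_def)
    then show ?thesis by auto
  qed
  note ex = someI_ex[OF this]
  define j0 where "j0 k v = (SOME w. w \<in> simplices (fobj W a) k \<and> \<psi> a k w = (d k v, ?i k))" for k v
  have j0: "\<And>k v. v \<in> simplices V k \<Longrightarrow> j0 k v \<in> simplices (fobj W a) k"
    "\<And>k v. v \<in> simplices V k \<Longrightarrow> \<psi> a k (j0 k v) = (d k v, ?i k)" using ex unfolding j0_def by blast+
  define j where "j = (\<lambda>k. \<lambda>v\<in>simplices V k. j0 k v)"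
  have jc [simp]: "j k v \<in> simplices (fobj W a) k" and \<psi>j: "\<psi> a k (j k v) = (d k v, ?i k)"
    if "v \<in> simplices V k" for k v
    using that j0 by (auto simp: j_def)
  have inj: "w = w'" if "\<psi> b k w = \<psi> b k w'" "b \<in> Obj A" "w \<in> simplices (fobj W b) k" "w' \<in> simplices (fobj W b) k" for b k w w'
    using that b\<psi>[of b k] unfolding bij_betw_def inj_on_def by blast
  have "j \<in> smap V (fobj W a)"
  proof (rule smapI)
    show "j m (act V m n \<theta> v) = act (fobj W a) m n \<theta> (j n v)" if h: "\<theta> \<in> Delta_hom m n" "v \<in> simplices V n" for m n \<theta> v
      by (rule inj[of a m]) (use h V in \<open>auto simp: \<psi>j smap_act[OF \<psi>] smap_act[OF d]\<close>)
  qed (auto simp: j_def j0)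
  moreover have "bij_betw (\<lambda>(v, f). wact W a b k f (j k v)) (simplices V k \<times> simplices (Hom A a b) k) (simplices (fobj W b) k)"
    if b [simp]: "b \<in> Obj A" for b k
  proof -
    have \<psi>w: "\<psi> b k (wact W a b k f (j k v)) = (d k v, f)" if h: "v \<in> simplices V k" "f \<in> simplices (Hom A a b) k" for v f
    proof -
      have "\<psi> b k (wact W a b k f (j k v)) = fmap (times_weight X (repr A a)) a b k f k (\<lambda>i\<in>{..k}. i, \<psi> a k (j k v))"
        unfolding wact_def using iso h by (simp add: is_weight_iso_def)
      also have "\<dots> = (d k v, f)"
        using h smap_closed[OF d] by (simp add: \<psi>j times_weight_def repr_def)
      finally show ?thesis .
    qed
    have m: "bij_betw (\<lambda>(v, f). (d k v, f)) (simplices V k \<times> simplices (Hom A a b) k) (simplices X k \<times> simplices (Hom A a b) k)"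
      using bij_betw_map_prod[OF bij[of k] bij_betw_id] by (simp add: map_prod_def id_def)
    have "bij_betw (the_inv_into (simplices (fobj W b) k) (\<psi> b k) \<circ> (\<lambda>(v, f). (d k v, f)))
       (simplices V k \<times> simplices (Hom A a b) k) (simplices (fobj W b) k)"
      by (rule bij_betw_trans[OF m bij_betw_the_inv_into[OF b\<psi>[OF b]]])
    then show ?thesis
    proof (rule bij_betw_cong[THEN iffD1, rotated])
      fix y assume "y \<in> simplices V k \<times> simplices (Hom A a b) k"
      then obtain v f where y: "y = (v, f)" "v \<in> simplices V k" "f \<in> simplices (Hom A a b) k" by auto
      have "the_inv_into (simplices (fobj W b) k) (\<psi> b k) (\<psi> b k (wact W a b k f (j k v))) = wact W a b k f (j k v)"
        using b\<psi>[OF b, of k] y by (intro the_inv_into_f_f) (auto simp: bij_betw_def)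
      then show "(the_inv_into (simplices (fobj W b) k) (\<psi> b k) \<circ> (\<lambda>(v, f). (d k v, f))) y = (case y of (v, f) \<Rightarrow> wact W a b k f (j k v))"
        using y by (simp add: \<psi>w)
    qed
  qed
  ultimately have "is_free A W a V j" by (simp add: is_free_def)
  then show thesis using that \<psi>j by blast
qed

section \<open>Projective cells as maps of free weights\<close>

lemma boundary_subsset: "subsset (boundary n) (simplex n)"
proof -
  have "compose {..m} x \<theta> ` {..m} \<noteq> {..n}" if "\<theta> \<in> Delta_hom m k" "x ` {..k} \<noteq> {..n}" "x \<in> Delta_hom k n" for m k \<theta> x
  proof -
    have "compose {..m} x \<theta> ` {..m} \<subseteq> x ` {..k}" using that(1) by (auto simp: compose_def Delta_hom_le)
    moreover have "x ` {..k} \<subseteq> {..n}" using that(3) by (auto simp: Delta_hom_le)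
    ultimately show ?thesis using that(2) by blast
  qed
  then show ?thesis by (auto simp: subsset_def boundary_def simplex_def)
qed

text \<open>A cell is a map between the free weights on \<open>boundary n\<close> and
  \<open>simplex n\<close>. The copies over \<open>'u\<close> are chosen with \<open>U\<close> a
  literal subobject of \<open>V\<close> and with matching generators, because the Leibniz property
  of the class is stated for such pairs.\<close>

lemma projective_cell_free:
  assumes \<kappa>: "size_cardinal \<kappa> TYPE('u)" and a [simp]: "a \<in> Obj A"
    and cell: "is_projective_cell \<kappa> A n a D E d"
  obtains U V :: "'u sset" and jU jV where "small_sset \<kappa> U" "small_sset \<kappa> V" "subsset U V"
    "is_free A D a U jU" "is_free A E a V jV" 
    "\<And>k u. u \<in> simplices U k \<Longrightarrow> d a k (const_map 0 k, jU k u) = jV k u"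
proof -
  obtain \<phi> \<psi> where D': "simplicial_functor A (SSet \<kappa>) D" and E': "simplicial_functor A (SSet \<kappa>) E" and d: "d \<in> nats A D E 0"
    and \<phi>: "is_weight_iso A D (times_weight (boundary n) (repr A a)) \<phi>"
    and \<psi>: "is_weight_iso A E (times_weight (simplex n) (repr A a)) \<psi>"
    and eq: "\<And>b k w. b \<in> Obj A \<Longrightarrow> w \<in> simplices (fobj D b) k \<Longrightarrow> \<psi> b k (d b k (const_map 0 k, w)) = \<phi> b k w"
    using cell by (auto simp: is_projective_cell_def)
  have D: "weight D" and E: "weight E"
    using D' E' weights_sset_functor[OF A.simplicial_category_axioms] by (auto simp: weight_def)
  have "small_sset \<kappa> (simplex n)"
    by (simp add: small_sset_def small_finite[OF \<kappa>] finite_Delta_hom)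
  from small_sset_copy[OF \<kappa> this] obtain V :: "'u sset" and e c where V: "small_sset \<kappa> V"
    and e: "e \<in> smap (simplex n) V" and c: "c \<in> smap V (simplex n)"
    and ce: "\<And>m x. x \<in> simplices (simplex n) m \<Longrightarrow> c m (e m x) = x" and ec: "\<And>m y. y \<in> simplices V m \<Longrightarrow> e m (c m y) = y"
    by metis
  have bsub: "x \<in> simplices (boundary n) m \<Longrightarrow> x \<in> simplices (simplex n) m" for x m
    by (rule subsset_closed[OF boundary_subsset])
  \<comment> \<open>Copying the boundary separately would give only an isomorphic subobject; its
    image in the copy of the simplex is an actual one.\<close>
  define U where "U = V\<lparr>simplices := \<lambda>m. e m ` simplices (boundary n) m\<rparr>"
  have U_simps: "simplices U m = e m ` simplices (boundary n) m" "act U = act V" for m by (simp_all add: U_def)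
  have UV: "subsset U V"
    unfolding subsset_def U_simps
  proof (intro conjI allI ballI)
    show "e m ` simplices (boundary n) m \<subseteq> simplices V m" for m using smap_closed[OF e] bsub by blast
    fix m k \<theta> y assume h: "\<theta> \<in> Delta_hom m k" "y \<in> e k ` simplices (boundary n) k"
    then obtain x where x: "y = e k x" "x \<in> simplices (boundary n) k" by blast
    have "act V m k \<theta> y = e m (act (simplex n) m k \<theta> x)" using smap_act[OF e h(1) bsub[OF x(2)]] x by simp
    then show "act V m k \<theta> y \<in> e m ` simplices (boundary n) m"
      using subsset_act_closed[OF boundary_subsset h(1) x(2)] by blast
  qed simp
  have sV: "simplicial_set V" using V by (simp add: small_sset_def)
  have sU: "simplicial_set U" by (rule subsset_simplicial_set[OF UV sV])
  have U: "small_sset \<kappa> U"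
    unfolding small_sset_def
  proof (intro conjI sU allI)
    fix m
    have "small \<kappa> (simplices V m)" using V by (simp add: small_sset_def)
    moreover have "simplices U m \<subseteq> simplices V m" using UV by (simp add: subsset_def)
    ultimately show "small \<kappa> (simplices U m)" by (rule small_subset)
  qed
  have sb: "simplicial_set (boundary n)" by (rule subsset_simplicial_set[OF boundary_subsset]) simp
  let ?c = "\<lambda>m. \<lambda>u\<in>simplices U m. c m u"
  have c': "?c \<in> smap U (boundary n)"
  proof (rule smap_restrictI[OF sU])
    show "c m u \<in> simplices (boundary n) m" if "u \<in> simplices U m" for m u
      using that ce bsub by (auto simp: U_simps)
    show "c m (act U m k \<theta> x) = act (boundary n) m k \<theta> (c k x)" if "\<theta> \<in> Delta_hom m k" "x \<in> simplices U k" for m k \<theta> x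
      using smap_act[OF c that(1) subsset_closed[OF UV that(2)]] by (simp add: U_simps boundary_def)
  qed
  have bV: "bij_betw (c k) (simplices V k) (simplices (simplex n) k)" for k
    by (rule bij_betw_byWitness[where f' = "e k"]) (use ce ec smap_closed[OF c] smap_closed[OF e] in auto)
  have bU: "bij_betw (?c k) (simplices U k) (simplices (boundary n) k)" for k
    by (rule bij_betw_byWitness[where f' = "e k"]) (use ce bsub in \<open>auto simp: U_simps\<close>)
  obtain jU where jU: "is_free A D a U jU"
    "\<And>k u. u \<in> simplices U k \<Longrightarrow> \<phi> a k (jU k u) = (c k u, degen (Hom A a a) k (Ident A a))"
    by (rule weight_iso_free[OF D a sb sU \<phi> c' bU]) auto
  obtain jV where jV: "is_free A E a V jV"
    "\<And>k v. v \<in> simplices V k \<Longrightarrow> \<psi> a k (jV k v) = (c k v, degen (Hom A a a) k (Ident A a))"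
    by (rule weight_iso_free[OF E a simplicial_set_simplex sV \<psi> c bV]) auto
  show thesis
  proof (rule that[OF U V UV jU(1) jV(1)])
    fix k u assume u: "u \<in> simplices U k"
    have m: "jU k u \<in> simplices (fobj D a) k" "jV k u \<in> simplices (fobj E a) k"
      using jU(1) jV(1) u subsset_closed[OF UV u] by (auto simp: is_free_def)
    have "\<psi> a k (d a k (const_map 0 k, jU k u)) = \<psi> a k (jV k u)"
      using eq[OF a m(1)] jU(2)[OF u] jV(2)[OF subsset_closed[OF UV u]] by simp
    moreover have "inj_on (\<psi> a k) (simplices (fobj E a) k)" using \<psi> by (auto simp: is_weight_iso_def bij_betw_def)
    moreover have "d a k (const_map 0 k, jU k u) \<in> simplices (fobj E a) k" using d D E m(1) by simp
    ultimately show "d a k (const_map 0 k, jU k u) = jV k u" using m(2) by (meson inj_onD)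
  qed
qed

end

section \<open>Cell induction\<close>

text \<open>Isofibrations and trivial fibrations run through one induction. Containment in
  \<open>isof\<close> supplies existence, since pullbacks and limits of towers are granted only
  along isofibrations. Of a tower only the projection to its bottom is required: it is the composite
  of all stages.\<close>

locale fibration_class = infinity_cosmos K \<kappa> isof
  for K :: "('o, 'u) scat" and \<kappa> :: "'k rel" and isof :: "'o \<Rightarrow> 'o \<Rightarrow> 'u set" +
  fixes Cl :: "'o \<Rightarrow> 'o \<Rightarrow> 'u set"
  assumes Cl_isof: "a \<in> Obj K \<Longrightarrow> b \<in> Obj K \<Longrightarrow> Cl a b \<subseteq> isof a b"
    and Cl_iso: "\<And>a b f. a \<in> Obj K \<Longrightarrow> b \<in> Obj K \<Longrightarrow> is_iso K a b f \<Longrightarrow> f \<in> Cl a b"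
    and Cl_comp: "\<And>a b c f g. a \<in> Obj K \<Longrightarrow> b \<in> Obj K \<Longrightarrow> c \<in> Obj K \<Longrightarrow> g \<in> Cl b c \<Longrightarrow> f \<in> Cl a b \<Longrightarrow>
      post a b c 0 g f \<in> Cl a c"
    and Cl_pullback: "\<And>a e b f g p q r. is_pullback K a e b f g p q r \<Longrightarrow> g \<in> Cl e b \<Longrightarrow> q \<in> Cl p a"
    and Cl_product: "\<And>(I :: 'u set) a b f p \<pi> q \<rho> h. small \<kappa> I \<Longrightarrow>
      is_product K I a p \<pi> \<Longrightarrow> is_product K I b q \<rho> \<Longrightarrow> (\<And>i. i \<in> I \<Longrightarrow> f i \<in> Cl (a i) (b i)) \<Longrightarrow>
      h \<in> simplices (Hom K p q) 0 \<Longrightarrow>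
      (\<And>i. i \<in> I \<Longrightarrow> post p q (b i) 0 (\<rho> i) h = post p (a i) (b i) 0 (f i) (\<pi> i)) \<Longrightarrow>
      h \<in> Cl p q"
    and Cl_sequential_limit: "\<And>e p l \<pi>. is_sequential_limit K e p l \<pi> \<Longrightarrow>
      (\<And>k. p k \<in> Cl (e (Suc k)) (e k)) \<Longrightarrow> \<pi> 0 \<in> Cl l (e 0)"
    and Cl_leibniz:
      "\<And>(U :: 'u sset) (V :: 'u sset) e b g eU ueU eV ueV bU ubU bV ubV ei gU bi gV p q r h.
        small_sset \<kappa> U \<Longrightarrow> small_sset \<kappa> V \<Longrightarrow> subsset U V \<Longrightarrow>
        e \<in> Obj K \<Longrightarrow> b \<in> Obj K \<Longrightarrow> g \<in> Cl e b \<Longrightarrow>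
        is_cotensor K U e eU ueU \<Longrightarrow> is_cotensor K V e eV ueV \<Longrightarrow>
        is_cotensor K U b bU ubU \<Longrightarrow> is_cotensor K V b bV ubV \<Longrightarrow>
        is_cotensor_map K U (incl U) e e (Ident K e) eV ueV eU ueU ei \<Longrightarrow>
        is_cotensor_map K U (incl U) b b (Ident K b) bV ubV bU ubU bi \<Longrightarrow>
        is_cotensor_map K U (\<lambda>n u. u) e b g eU ueU bU ubU gU \<Longrightarrow>
        is_cotensor_map K V (\<lambda>n v. v) e b g eV ueV bV ubV gV \<Longrightarrow>
        is_pullback K eU bV bU gU bi p q r \<Longrightarrow>
        h \<in> simplices (Hom K eV p) 0 \<Longrightarrow>
        post eV p eU 0 q h = ei \<Longrightarrow> post eV p bV 0 r h = gV \<Longrightarrow>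
        h \<in> Cl eV p"

locale cell_induction = fibration_class K \<kappa> isof Cl + diagrams K A
  for K :: "('o, 'u) scat" and \<kappa> :: "'k rel" and isof and Cl and A :: "('a, 'u) scat" +
  fixes F G :: "('a, 'u, 'o, 'u) sfun" and \<beta> :: "'a \<Rightarrow> 'u"
  assumes size: "size_cardinal \<kappa> TYPE('u)"
    and F [simp]: "diagram F" and G [simp]: "diagram G" and \<beta> [simp]: "diag_map F G \<beta>"
    and \<beta>_Cl: "a \<in> Obj A \<Longrightarrow> \<beta> a \<in> Cl (fobj F a) (fobj G a)"
begin

abbreviation "whisk W x n \<phi> \<equiv> nwhisk W F G \<beta> x n \<phi>"

text \<open>\<open>u\<close> represents the pairs of a map \<open>h\<close> to \<open>b\<close> and a cone \<open>\<phi>\<close> on \<open>F\<close> that restricts to \<open>v h\<close> along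
  \<open>i : V \<rightarrow> W\<close> and induces the cone \<open>w h\<close> on \<open>G\<close>. So \<open>e\<close> is the pullback along \<open>(v, w)\<close> of the Leibniz
  map \<open>{W, F} \<rightarrow> {V, F} \<times> {W, G}\<close> over \<open>{V, G}\<close>, but none of these limits needs to exist.\<close>

definition relative_limit where
  "relative_limit V W i b v w e p u \<longleftrightarrow> e \<in> Obj K \<and> p \<in> hom e b 0 \<and> u \<in> cones W F e 0 \<and>
     ncomp A V 0 u i = pull V F b v e 0 p \<and> whisk W e 0 u = pull W G b w e 0 p \<and>
     (\<forall>x n h \<phi>. x \<in> Obj K \<longrightarrow> h \<in> hom x b n \<longrightarrow> \<phi> \<in> cones W F x n \<longrightarrow>
        ncomp A V n \<phi> i = pull V F b v x n h \<longrightarrow> whisk W x n \<phi> = pull W G b w x n h \<longrightarrow>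
        (\<exists>!k. k \<in> hom x e n \<and> post x e b n p k = h \<and> pull W F e u x n k = \<phi>))"

text \<open>The equation on \<open>v\<close> and \<open>w\<close> says that they form a map from
  \<open>b\<close> to \<open>{V, F} \<times> {W, G}\<close> over \<open>{V, G}\<close>. Quantifying
  over all bases, and not only over a universal one, lets the next stage of a tower start from the
  object just constructed.\<close>

definition leib where
  "leib V W i \<longleftrightarrow> (\<forall>b v w. b \<in> Obj K \<longrightarrow> v \<in> cones V F b 0 \<longrightarrow> w \<in> cones W G b 0 \<longrightarrow>
     whisk V b 0 v = ncomp A V 0 w i \<longrightarrow> (\<exists>e p u. p \<in> Cl e b \<and> relative_limit V W i b v w e p u))"

lemma relative_limitD:
  assumes "relative_limit V W i b v w e p u"
  shows "e \<in> Obj K" "p \<in> hom e b 0" "u \<in> cones W F e 0"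
     "ncomp A V 0 u i = pull V F b v e 0 p" "whisk W e 0 u = pull W G b w e 0 p"
  using assms by (auto simp: relative_limit_def)

lemma relative_limit_ex1:
  assumes "relative_limit V W i b v w e p u" "x \<in> Obj K" "h \<in> hom x b n" "\<phi> \<in> cones W F x n"
     "ncomp A V n \<phi> i = pull V F b v x n h" "whisk W x n \<phi> = pull W G b w x n h"
  shows "\<exists>!k. k \<in> hom x e n \<and> post x e b n p k = h \<and> pull W F e u x n k = \<phi>"
  using assms unfolding relative_limit_def by blast

lemma relative_limitI:
  assumes "e \<in> Obj K" "p \<in> hom e b 0" "u \<in> cones W F e 0"
     "ncomp A V 0 u i = pull V F b v e 0 p" "whisk W e 0 u = pull W G b w e 0 p"
   and "\<And>x n h \<phi>. x \<in> Obj K \<Longrightarrow> h \<in> hom x b n \<Longrightarrow> \<phi> \<in> cones W F x n \<Longrightarrow>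
        ncomp A V n \<phi> i = pull V F b v x n h \<Longrightarrow> whisk W x n \<phi> = pull W G b w x n h \<Longrightarrow>
        \<exists>!k. k \<in> hom x e n \<and> post x e b n p k = h \<and> pull W F e u x n k = \<phi>"
  shows "relative_limit V W i b v w e p u"
  using assms unfolding relative_limit_def by blast

lemma weightI: "simplicial_functor A (SSet \<kappa>) W \<Longrightarrow> weight W"
  unfolding weight_def by (rule weights_sset_functor[OF A.simplicial_category_axioms])

text \<open>If the four limits and the pullback \<open>P\<close> exist, a compatible pair
  \<open>(v, w)\<close> is a single map \<open>y : b \<rightarrow> P\<close>. Pulling back the
  honest Leibniz map \<open>h\<close> along \<open>y\<close> gives the relative limit, and the class
  is stable under this.\<close>

lemma leib_of_limits:
  assumes [simp]: "weight D" "weight E" "d \<in> nats A D E 0"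
    and DF: "is_weighted_limit K A D F lDF cDF" and EF: "is_weighted_limit K A E F lEF cEF"
    and DG: "is_weighted_limit K A D G lDG cDG" and EG: "is_weighted_limit K A E G lEG cEG"
    and ei [simp]: "ei \<in> hom lEF lDF 0" and p_ei: "pull D F lDF cDF lEF 0 ei = ncomp A D 0 cEF d"
    and bi [simp]: "bi \<in> hom lEG lDG 0" and p_bi: "pull D G lDG cDG lEG 0 bi = ncomp A D 0 cEG d"
    and gD [simp]: "gD \<in> hom lDF lDG 0" and p_gD: "pull D G lDG cDG lDF 0 gD = whisk D lDF 0 cDF"
    and gE [simp]: "gE \<in> hom lEF lEG 0" and p_gE: "pull E G lEG cEG lEF 0 gE = whisk E lEF 0 cEF"
    and P: "is_pullback K lDF lEG lDG gD bi P q r"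
    and h [simp]: "h \<in> hom lEF P 0" "post lEF P lDF 0 q h = ei" "post lEF P lEG 0 r h = gE" and h_Cl: "h \<in> Cl lEF P"
  shows "leib D E d"
  unfolding leib_def
proof (intro allI impI)
  note [simp] = weighted_limitD[OF DF] weighted_limitD[OF EF] weighted_limitD[OF DG] weighted_limitD[OF EG]
    pullbackD(4,7,8)[OF P]
  fix b v w assume b [simp]: "b \<in> Obj K" and v [simp]: "v \<in> cones D F b 0" and w [simp]: "w \<in> cones E G b 0"
    and eq: "whisk D b 0 v = ncomp A D 0 w d"
  obtain v' where v' [simp]: "v' \<in> hom b lDF 0" and p_v': "pull D F lDF cDF b 0 v' = v"
    using factor_cone[OF DF, of b v 0] by auto
  obtain w' where w' [simp]: "w' \<in> hom b lEG 0" and p_w': "pull E G lEG cEG b 0 w' = w"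
    using factor_cone[OF EG, of b w 0] by auto
  \<comment> \<open>Maps into a limit are equal when they induce equal cones; here the cones agree
    by the compatibility of \<open>v\<close> and \<open>w\<close>.\<close>
  have "post b lDF lDG 0 gD v' = post b lEG lDG 0 bi w'"
  proof (rule pull_inj[OF DG b])
    have "pull D G lDG cDG b 0 (post b lDF lDG 0 gD v') = whisk D b 0 v"
      by (simp add: pull_pull[symmetric] p_gD p_v' nwhisk_pull[symmetric])
    also have "\<dots> = pull D G lDG cDG b 0 (post b lEG lDG 0 bi w')"
      by (simp add: eq pull_pull[symmetric] p_bi p_w' pull_ncomp[of D E, symmetric])
    finally show "pull D G lDG cDG b 0 (post b lDF lDG 0 gD v') = pull D G lDG cDG b 0 (post b lEG lDG 0 bi w')" .
  qed auto
  then obtain y where y [simp]: "y \<in> hom b P 0" "post b P lDF 0 q y = v'" "post b P lEG 0 r y = w'"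
    using pullback_ex1[OF P b, of v' 0 w'] by auto
  have "h \<in> isof lEF P" using h_Cl Cl_isof[of lEF P] by auto
  then obtain e q0 r0 where e: "is_pullback K b lEF P y h e q0 r0"
    using ex_pullback[of b lEF P y h] by auto
  note [simp] = pullbackD(4,7,8)[OF e]
  note e_eq = pullbackD(9)[OF e]
  let ?u = "pull E F lEF cEF e 0 r0"
  have "q0 \<in> Cl e b" using Cl_pullback[OF e h_Cl] .
  moreover have "relative_limit D E d b v w e q0 ?u"
  proof (rule relative_limitI)
    have "ncomp A D 0 ?u d = pull D F lDF cDF e 0 (post e lEF lDF 0 ei r0)"
      by (simp add: pull_ncomp[of D E] pull_pull[symmetric] p_ei)
    also have "post e lEF lDF 0 ei r0 = post e P lDF 0 q (post e lEF P 0 h r0)"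
      by (simp add: post_post)
    also have "\<dots> = post e b lDF 0 v' q0" by (simp add: e_eq[symmetric] post_post)
    also have "pull D F lDF cDF e 0 \<dots> = pull D F b v e 0 q0"
      by (simp add: pull_pull[symmetric] p_v')
    finally show "ncomp A D 0 ?u d = pull D F b v e 0 q0" .
    have "whisk E e 0 ?u = pull E G lEG cEG e 0 (post e lEF lEG 0 gE r0)"
      by (simp add: nwhisk_pull pull_pull[symmetric] p_gE)
    also have "post e lEF lEG 0 gE r0 = post e P lEG 0 r (post e lEF P 0 h r0)"
      by (simp add: post_post)
    also have "\<dots> = post e b lEG 0 w' q0" by (simp add: e_eq[symmetric] post_post)
    also have "pull E G lEG cEG e 0 \<dots> = pull E G b w e 0 q0"
      by (simp add: pull_pull[symmetric] p_w')
    finally show "whisk E e 0 ?u = pull E G b w e 0 q0" .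
    fix x n k \<phi> assume x [simp]: "x \<in> Obj K" and k [simp]: "k \<in> hom x b n" and \<phi> [simp]: "\<phi> \<in> cones E F x n"
      and \<phi>d: "ncomp A D n \<phi> d = pull D F b v x n k" and \<phi>w: "whisk E x n \<phi> = pull E G b w x n k"
    obtain f where f [simp]: "f \<in> hom x lEF n" and p_f: "pull E F lEF cEF x n f = \<phi>"
      using factor_cone[OF EF, of x \<phi> n] by auto
    have "post x lEF lDF n ei f = post x b lDF n v' k"
    proof (rule pull_inj[OF DF x])
      show "pull D F lDF cDF x n (post x lEF lDF n ei f) = pull D F lDF cDF x n (post x b lDF n v' k)"
        by (simp add: pull_pull[symmetric] p_ei p_v' pull_ncomp[of D E, symmetric] p_f \<phi>d)
    qed auto
    moreover have "post x lEF lEG n gE f = post x b lEG n w' k"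
    proof (rule pull_inj[OF EG x])
      show "pull E G lEG cEG x n (post x lEF lEG n gE f) = pull E G lEG cEG x n (post x b lEG n w' k)"
        by (simp add: pull_pull[symmetric] p_gE p_w' nwhisk_pull[symmetric] p_f \<phi>w)
    qed auto
    ultimately have "post x b P n y k = post x lEF P n h f"
      using pullback_ex1[OF P x, of "post x b lDF n v' k" n "post x b lEG n w' k"]
        pullbackD(9)[OF P]
      by (smt (verit) post_closed post_post pullbackD[OF P] b f h(1) h(2) h(3) k weighted_limitD(1)[OF EF] x y)
    from pullback_ex1[OF e x k f this]
    have ex: "\<exists>!m. m \<in> hom x e n \<and> post x e b n q0 m = k \<and> post x e lEF n r0 m = f" .
    have "pull E F e ?u x n m = \<phi> \<longleftrightarrow> post x e lEF n r0 m = f" if m [simp]: "m \<in> hom x e n" for m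
      using pull_inj[OF EF x, of "post x e lEF n r0 m" n f] p_f
      by (auto simp: pull_pull)
    then show "\<exists>!m. m \<in> hom x e n \<and> post x e b n q0 m = k \<and> pull E F e ?u x n m = \<phi>"
      using ex by (simp cong: conj_cong)
  qed auto
  ultimately show "\<exists>e p u. p \<in> Cl e b \<and> relative_limit D E d b v w e p u" by blast
qed

text \<open>Both weights of a cell are free on \<open>a\<close>, so all four limits are cotensors of
  \<open>F a\<close> and \<open>G a\<close>, and the induced maps between them are the cotensor
  maps. The Leibniz map of limits is thus the Leibniz cotensor of \<open>\<beta> a\<close> with
  \<open>U \<subseteq> V\<close>, which belongs to the class.\<close>

lemma leib_cell:
  assumes a [simp]: "a \<in> Obj A" and cell: "is_projective_cell \<kappa> A n a D E d"
  shows "leib D E d"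
proof -
  obtain U V :: "'u sset" and jU jV where U: "small_sset \<kappa> U" and V: "small_sset \<kappa> V" and UV: "subsset U V"
    and jU: "is_free A D a U jU" and jV: "is_free A E a V jV" 
    and dj: "\<And>k u. u \<in> simplices U k \<Longrightarrow> d a k (const_map 0 k, jU k u) = jV k u"
    by (rule projective_cell_free[OF size a cell]) (rule that)
  have [simp]: "weight D" "weight E" and d [simp]: "d \<in> nats A D E 0"
    using cell weights_sset_functor[OF A.simplicial_category_axioms] by (auto simp: is_projective_cell_def weight_def)
  note [simp] = ncomp_cones[of D E _ _ d]
  have U' [simp]: "simplicial_set U" "U \<in> Obj (SSet \<kappa>)" and V' [simp]: "simplicial_set V" "V \<in> Obj (SSet \<kappa>)"
    using U V by (auto simp: small_sset_def)
  have jUc [simp]: "u \<in> simplices U k \<Longrightarrow> jU k u \<in> simplices (fobj D a) k"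
    and jVc [simp]: "v \<in> simplices V k \<Longrightarrow> jV k v \<in> simplices (fobj E a) k" for k u v
    using jU jV by (auto simp: is_free_def)
  have [simp]: "u \<in> simplices V k" if "u \<in> simplices U k" for k u using that subsset_closed[OF UV] by blast
  obtain eU ueU where eU: "is_cotensor K U (fobj F a) eU ueU" using ex_cotensor[OF U'(2)] by (meson F a diagram_obj)
  obtain eV ueV where eV: "is_cotensor K V (fobj F a) eV ueV" using ex_cotensor[OF V'(2)] by (meson F a diagram_obj)
  obtain bU ubU where bU: "is_cotensor K U (fobj G a) bU ubU" using ex_cotensor[OF U'(2)] by (meson G a diagram_obj)
  obtain bV ubV where bV: "is_cotensor K V (fobj G a) bV ubV" using ex_cotensor[OF V'(2)] by (meson G a diagram_obj)
  obtain cDF where DF: "is_weighted_limit K A D F eU cDF" 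
      and cDF: "\<And>k u. u \<in> simplices U k \<Longrightarrow> cDF a k (const_map 0 k, jU k u) = ueU k u"
    by (rule free_weighted_limit[OF \<open>weight D\<close> F a U'(1) jU eU]) auto
  obtain cEF where EF: "is_weighted_limit K A E F eV cEF" 
      and cEF: "\<And>k u. u \<in> simplices V k \<Longrightarrow> cEF a k (const_map 0 k, jV k u) = ueV k u"
    by (rule free_weighted_limit[OF \<open>weight E\<close> F a V'(1) jV eV]) auto
  obtain cDG where DG: "is_weighted_limit K A D G bU cDG" 
      and cDG: "\<And>k u. u \<in> simplices U k \<Longrightarrow> cDG a k (const_map 0 k, jU k u) = ubU k u"
    by (rule free_weighted_limit[OF \<open>weight D\<close> G a U'(1) jU bU]) auto
  obtain cEG where EG: "is_weighted_limit K A E G bV cEG" 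
      and cEG: "\<And>k u. u \<in> simplices V k \<Longrightarrow> cEG a k (const_map 0 k, jV k u) = ubV k u"
    by (rule free_weighted_limit[OF \<open>weight E\<close> G a V'(1) jV bV]) auto
  note [simp] = weighted_limitD[OF DF] weighted_limitD[OF EF] weighted_limitD[OF DG] weighted_limitD[OF EG]
  note uc = smap_closed[OF cotensorD(3)[OF eU]] smap_closed[OF cotensorD(3)[OF eV]]
    smap_closed[OF cotensorD(3)[OF bU]] smap_closed[OF cotensorD(3)[OF bV]]
  obtain ei where ei [simp]: "ei \<in> hom eV eU 0" and p_ei: "pull D F eU cDF eV 0 ei = ncomp A D 0 cEF d"
    using factor_cone[OF DF, of eV "ncomp A D 0 cEF d" 0] by auto
  obtain bi where bi [simp]: "bi \<in> hom bV bU 0" and p_bi: "pull D G bU cDG bV 0 bi = ncomp A D 0 cEG d"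
    using factor_cone[OF DG, of bV "ncomp A D 0 cEG d" 0] by auto
  obtain gU where gU [simp]: "gU \<in> hom eU bU 0" and p_gU: "pull D G bU cDG eU 0 gU = whisk D eU 0 cDF"
    using factor_cone[OF DG, of eU "whisk D eU 0 cDF" 0] by auto
  obtain gV where gV [simp]: "gV \<in> hom eV bV 0" and p_gV: "pull E G bV cEG eV 0 gV = whisk E eV 0 cEF"
    using factor_cone[OF EG, of eV "whisk E eV 0 cEF" 0] by auto
  \<comment> \<open>Cones on free weights are read off at the generators, where \<open>dj\<close>
    identifies \<open>d\<close> with the inclusion of \<open>U\<close> in \<open>V\<close>.\<close>
  have m_ei: "is_cotensor_map K U (incl U) (fobj F a) (fobj F a) (Ident K (fobj F a)) eV ueV eU ueU ei"
    unfolding is_cotensor_map_def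
  proof (intro conjI allI ballI ei)
    fix k u assume u [simp]: "u \<in> simplices U k"
    show "Comp K eV eU (fobj F a) k (ueU k u) (degen (Hom K eV eU) k ei) =
      post_map K eV (fobj F a) (fobj F a) (Ident K (fobj F a)) k (ueV k (incl U k u))"
      using fun_cong[OF fun_cong[OF fun_cong[OF p_ei, of a], of k], of "(const_map 0 k, jU k u)"]
      by (simp add: uc cDF cEF dj act_0_eq_degen)
  qed
  have m_bi: "is_cotensor_map K U (incl U) (fobj G a) (fobj G a) (Ident K (fobj G a)) bV ubV bU ubU bi"
    unfolding is_cotensor_map_def
  proof (intro conjI allI ballI bi)
    fix k u assume u [simp]: "u \<in> simplices U k"
    show "Comp K bV bU (fobj G a) k (ubU k u) (degen (Hom K bV bU) k bi) =
      post_map K bV (fobj G a) (fobj G a) (Ident K (fobj G a)) k (ubV k (incl U k u))"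
      using fun_cong[OF fun_cong[OF fun_cong[OF p_bi, of a], of k], of "(const_map 0 k, jU k u)"]
      by (simp add: uc cDG cEG dj act_0_eq_degen)
  qed
  have m_gU: "is_cotensor_map K U (\<lambda>n u. u) (fobj F a) (fobj G a) (\<beta> a) eU ueU bU ubU gU"
    unfolding is_cotensor_map_def
  proof (intro conjI allI ballI gU)
    fix k u assume u [simp]: "u \<in> simplices U k"
    show "Comp K eU bU (fobj G a) k (ubU k u) (degen (Hom K eU bU) k gU) =
      post_map K eU (fobj F a) (fobj G a) (\<beta> a) k (ueU k u)"
      using fun_cong[OF fun_cong[OF fun_cong[OF p_gU, of a], of k], of "(const_map 0 k, jU k u)"]
      by (simp add: uc cDG cDF act_0_eq_degen)
  qed
  have m_gV: "is_cotensor_map K V (\<lambda>n u. u) (fobj F a) (fobj G a) (\<beta> a) eV ueV bV ubV gV"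
    unfolding is_cotensor_map_def
  proof (intro conjI allI ballI gV)
    fix k u assume u [simp]: "u \<in> simplices V k"
    show "Comp K eV bV (fobj G a) k (ubV k u) (degen (Hom K eV bV) k gV) =
      post_map K eV (fobj F a) (fobj G a) (\<beta> a) k (ueV k u)"
      using fun_cong[OF fun_cong[OF fun_cong[OF p_gV, of a], of k], of "(const_map 0 k, jV k u)"]
      by (simp add: uc cEG cEF act_0_eq_degen)
  qed
  \<comment> \<open>The pullback under the Leibniz map exists because one of its legs is a
    restriction of cotensors, hence an isofibration.\<close>
  have "bi \<in> isof bV bU" by (rule isof_cotensor_restriction[OF U'(2) V'(2) UV bU bV m_bi])
  then obtain P q r where P: "is_pullback K eU bV bU gU bi P q r"
    using ex_pullback[of eU bV bU gU bi] by auto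
  note [simp] = pullbackD(4,7,8)[OF P]
  have "post eV eU bU 0 gU ei = post eV bV bU 0 bi gV"
  proof (rule pull_inj[OF DG])
    show "pull D G bU cDG eV 0 (post eV eU bU 0 gU ei) = pull D G bU cDG eV 0 (post eV bV bU 0 bi gV)"
      by (simp add: pull_pull[symmetric] p_gU p_bi nwhisk_pull[symmetric] p_ei pull_ncomp[of D E, symmetric] p_gV nwhisk_ncomp[of D E])
  qed auto
  then obtain h where h: "h \<in> hom eV P 0" "post eV P eU 0 q h = ei" "post eV P bV 0 r h = gV"
    using pullback_ex1[OF P, of eV ei 0 gV] by auto
  have "h \<in> Cl eV P"
    by (rule Cl_leibniz[OF U V UV _ _ \<beta>_Cl[OF a] eU eV bU bV m_ei m_bi m_gU m_gV P h]) auto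
  with h show ?thesis
    by (intro leib_of_limits[OF _ _ d DF EF DG EG ei p_ei bi p_bi gU p_gU gV p_gV P]) auto
qed

lemma cones_sset_functor: "x \<in> Obj K \<Longrightarrow> diagram F' \<Longrightarrow> sset_functor A (comp_sfun (repr K x) F')"
  using comp_repr_functor by (simp add: diagram_def)

text \<open>A cone on a coproduct is a family of cones, so the relative limit is the fibre product
  over \<open>b\<close> of the \<open>e j\<close>. To stay within products and pullbacks in the
  class, it is formed as the pullback of the product of the maps \<open>p j\<close> along the
  diagonal of \<open>b\<close>; for empty \<open>I\<close> this gives \<open>b\<close> up to
  isomorphism.\<close>

lemma leib_coproduct:
  fixes I :: "'u set"
  assumes I: "small \<kappa> I" and D: "is_product (op_scat (weights \<kappa> A)) I D' D \<iota>D"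
    and E: "is_product (op_scat (weights \<kappa> A)) I E' E \<iota>E" and d [simp]: "d \<in> nats A D E 0"
    and d': "\<And>j. j \<in> I \<Longrightarrow> d' j \<in> nats A (D' j) (E' j) 0"
    and comm: "\<And>j. j \<in> I \<Longrightarrow> ncomp A (D' j) 0 d (\<iota>D j) = ncomp A (D' j) 0 (\<iota>E j) (d' j)"
    and leib: "\<And>j. j \<in> I \<Longrightarrow> leib (D' j) (E' j) (d' j)"
  shows "leib D E d"
  unfolding leib_def
proof (intro allI impI)
  have "simplicial_functor A (SSet \<kappa>) D" "simplicial_functor A (SSet \<kappa>) E"
    "\<And>j. j \<in> I \<Longrightarrow> simplicial_functor A (SSet \<kappa>) (D' j)" "\<And>j. j \<in> I \<Longrightarrow> simplicial_functor A (SSet \<kappa>) (E' j)"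
    and [simp]: "\<And>j. j \<in> I \<Longrightarrow> \<iota>D j \<in> nats A (D' j) D 0" "\<And>j. j \<in> I \<Longrightarrow> \<iota>E j \<in> nats A (E' j) E 0"
    using D E by (auto simp: is_product_def op_scat_simps)
  note [simp] = this(1-4)[THEN weightI]
  note [simp] = d' ncomp_cones[of D E _ _ d] ncomp_cones[of "D' j" D _ _ "\<iota>D j" for j]
    ncomp_cones[of "E' j" E _ _ "\<iota>E j" for j]
  have ws' [simp]: "j \<in> I \<Longrightarrow> sset_functor A (D' j)" "j \<in> I \<Longrightarrow> sset_functor A (E' j)" "sset_functor A D" "sset_functor A E" for j
    by (simp_all add: weight_def[symmetric])
  have nn: "ncomp A (D' j) n (ncomp A D n \<phi> d) (\<iota>D j) = ncomp A (D' j) n (ncomp A (E' j) n \<phi> (\<iota>E j)) (d' j)" if "j \<in> I" for j n and \<phi> :: "'a \<Rightarrow> nat \<Rightarrow> (nat \<Rightarrow> nat) \<times> 'u \<Rightarrow> 'u"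
    using that by (subst ncomp_ncomp[of A _ D], simp_all, subst ncomp_ncomp[of A _ "E' j"], simp_all add: comm)
  have uniqD: "\<phi> = \<phi>'" if "x \<in> Obj K" "\<phi> \<in> cones D F x n" "\<phi>' \<in> cones D F x n"
      "\<And>j. j \<in> I \<Longrightarrow> ncomp A (D' j) n \<phi> (\<iota>D j) = ncomp A (D' j) n \<phi>' (\<iota>D j)" for x n \<phi> \<phi>'
  proof -
    have "\<exists>!\<psi>. \<psi> \<in> cones D F x n \<and> (\<forall>j\<in>I. ncomp A (D' j) n \<psi> (\<iota>D j) = ncomp A (D' j) n \<phi> (\<iota>D j))"
      by (rule coproduct_weights[OF size cones_sset_functor[OF that(1) F] I D]) (simp add: that(1,2))
    then show ?thesis using that(2,3) that(4)[symmetric] by blast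
  qed
  have uniqE: "\<phi> = \<phi>'" if "x \<in> Obj K" "diagram H" "\<phi> \<in> cones E H x n" "\<phi>' \<in> cones E H x n"
      "\<And>j. j \<in> I \<Longrightarrow> ncomp A (E' j) n \<phi> (\<iota>E j) = ncomp A (E' j) n \<phi>' (\<iota>E j)" for x n \<phi> \<phi>' H
  proof -
    have "\<exists>!\<psi>. \<psi> \<in> cones E H x n \<and> (\<forall>j\<in>I. ncomp A (E' j) n \<psi> (\<iota>E j) = ncomp A (E' j) n \<phi> (\<iota>E j))"
      by (rule coproduct_weights[OF size cones_sset_functor[OF that(1,2)] I E]) (simp add: that(1-3))
    then show ?thesis using that(3,4) that(5)[symmetric] by blast
  qed
  fix b v w assume b [simp]: "b \<in> Obj K" and v [simp]: "v \<in> cones D F b 0" and w [simp]: "w \<in> cones E G b 0"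
    and eq: "whisk D b 0 v = ncomp A D 0 w d"
  let ?v = "\<lambda>j. ncomp A (D' j) 0 v (\<iota>D j)" and ?w = "\<lambda>j. ncomp A (E' j) 0 w (\<iota>E j)"
  have eq': "whisk (D' j) b 0 (?v j) = ncomp A (D' j) 0 (?w j) (d' j)" if "j \<in> I" for j
    using that nn[OF that, of 0 w] by (simp add: nwhisk_ncomp[of _ D] eq)
  have "\<forall>j. \<exists>e p u. j \<in> I \<longrightarrow> p \<in> Cl e b \<and> relative_limit (D' j) (E' j) (d' j) b (?v j) (?w j) e p u"
  proof
    fix j show "\<exists>e p u. j \<in> I \<longrightarrow> p \<in> Cl e b \<and> relative_limit (D' j) (E' j) (d' j) b (?v j) (?w j) e p u"
    proof (cases "j \<in> I")
      case True
      have "?v j \<in> cones (D' j) F b 0" "?w j \<in> cones (E' j) G b 0"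
        using True by auto
      then show ?thesis using leib[OF True, unfolded leib_def] eq'[OF True] b by blast
    qed auto
  qed
  then obtain e p u where Cl: "\<And>j. j \<in> I \<Longrightarrow> p j \<in> Cl (e j) b"
    and rl: "\<And>j. j \<in> I \<Longrightarrow> relative_limit (D' j) (E' j) (d' j) b (?v j) (?w j) (e j) (p j) (u j)" by metis
  note rD [simp] = relative_limitD(1-3)[OF rl]
  obtain P \<pi> where P: "is_product K I e P \<pi>" using ex_product[OF I, of e] by auto
  obtain Pb \<rho> where Pb: "is_product K I (\<lambda>_. b) Pb \<rho>" using ex_product[OF I, of "\<lambda>_. b"] by auto
  note [simp] = productD[OF P] productD[OF Pb]
  obtain h where h [simp]: "h \<in> hom P Pb 0" and \<rho>h: "\<And>j. j \<in> I \<Longrightarrow> post P Pb b 0 (\<rho> j) h = post P (e j) b 0 (p j) (\<pi> j)"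
    using product_ex1[OF Pb, of P "\<lambda>j. post P (e j) b 0 (p j) (\<pi> j)" 0] by auto
  obtain \<delta> where \<delta> [simp]: "\<delta> \<in> hom b Pb 0" and \<rho>\<delta>: "\<And>j. j \<in> I \<Longrightarrow> post b Pb b 0 (\<rho> j) \<delta> = Ident K b"
    using product_ex1[OF Pb, of b "\<lambda>j. Ident K b" 0] by auto
  have h_Cl: "h \<in> Cl P Pb" by (rule Cl_product[OF I P Pb Cl h \<rho>h])
  then have "h \<in> isof P Pb" using Cl_isof[of P Pb] by auto
  then obtain l q r where l: "is_pullback K b P Pb \<delta> h l q r" using ex_pullback[of b P Pb \<delta> h] by auto
  note [simp] = pullbackD(4,7,8)[OF l]
  \<comment> \<open>Pulling back along the diagonal \<open>\<delta>\<close> forces all composites to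
    \<open>b\<close> to coincide, with common value \<open>q\<close>.\<close>
  have lr: "post l P b 0 (post P (e j) b 0 (p j) (\<pi> j)) r = q" if j [simp]: "j \<in> I" for j
  proof -
    have "post l P b 0 (post P (e j) b 0 (p j) (\<pi> j)) r = post l Pb b 0 (\<rho> j) (post l P Pb 0 h r)"
      by (simp add: \<rho>h[symmetric] post_post)
    also have "\<dots> = q" by (simp add: pullbackD(9)[OF l, symmetric] post_post \<rho>\<delta>)
    finally show ?thesis .
  qed
  let ?r = "\<lambda>j. post l P (e j) 0 (\<pi> j) r"
  have pr: "post l (e j) b 0 (p j) (?r j) = q" if "j \<in> I" for j
    using lr[OF that] that by (simp add: post_post)
  \<comment> \<open>The cones \<open>u j\<close>, pulled back to \<open>l\<close>, glue to one cone
    on the coproduct \<open>E\<close>.\<close>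
  have "\<exists>!U. U \<in> cones E F l 0 \<and> (\<forall>j\<in>I. ncomp A (E' j) 0 U (\<iota>E j) = pull (E' j) F (e j) (u j) l 0 (?r j))"
    by (rule coproduct_weights[OF size cones_sset_functor I E]) auto
  then obtain U where U [simp]: "U \<in> cones E F l 0"
    and U\<iota>: "\<And>j. j \<in> I \<Longrightarrow> ncomp A (E' j) 0 U (\<iota>E j) = pull (E' j) F (e j) (u j) l 0 (?r j)" by auto
  have "relative_limit D E d b v w l q U"
  proof (rule relative_limitI)
    show "ncomp A D 0 U d = pull D F b v l 0 q"
    proof (rule uniqD[of l])
      fix j assume j [simp]: "j \<in> I"
      have "ncomp A (D' j) 0 (ncomp A D 0 U d) (\<iota>D j) = pull (D' j) F b (?v j) l 0 (post l (e j) b 0 (p j) (?r j))"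
        by (simp add: nn U\<iota> pull_ncomp[of _ "E' j"] relative_limitD(4)[OF rl] pull_pull)
      also have "\<dots> = ncomp A (D' j) 0 (pull D F b v l 0 q) (\<iota>D j)"
        by (simp add: pr pull_ncomp[of _ D])
      finally show "ncomp A (D' j) 0 (ncomp A D 0 U d) (\<iota>D j) = ncomp A (D' j) 0 (pull D F b v l 0 q) (\<iota>D j)" .
    qed auto
    show "whisk E l 0 U = pull E G b w l 0 q"
    proof (rule uniqE[of l G])
      fix j assume j [simp]: "j \<in> I"
      have "ncomp A (E' j) 0 (whisk E l 0 U) (\<iota>E j) = pull (E' j) G b (?w j) l 0 (post l (e j) b 0 (p j) (?r j))"
        by (simp add: nwhisk_ncomp[of _ E, symmetric] U\<iota> nwhisk_pull relative_limitD(5)[OF rl] pull_pull)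
      also have "\<dots> = ncomp A (E' j) 0 (pull E G b w l 0 q) (\<iota>E j)"
        by (simp add: pr pull_ncomp[of _ E])
      finally show "ncomp A (E' j) 0 (whisk E l 0 U) (\<iota>E j) = ncomp A (E' j) 0 (pull E G b w l 0 q) (\<iota>E j)" .
    qed auto
    fix x n k \<phi> assume x [simp]: "x \<in> Obj K" and k [simp]: "k \<in> hom x b n" and \<phi> [simp]: "\<phi> \<in> cones E F x n"
      and \<phi>d: "ncomp A D n \<phi> d = pull D F b v x n k" and \<phi>w: "whisk E x n \<phi> = pull E G b w x n k"
    let ?\<phi> = "\<lambda>j. ncomp A (E' j) n \<phi> (\<iota>E j)"
    have ex: "\<exists>!m. m \<in> hom x (e j) n \<and> post x (e j) b n (p j) m = k \<and> pull (E' j) F (e j) (u j) x n m = ?\<phi> j"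
      if j [simp]: "j \<in> I" for j
    proof (rule relative_limit_ex1[OF rl[OF j] x k])
      show "?\<phi> j \<in> cones (E' j) F x n" by auto
      show "ncomp A (D' j) n (?\<phi> j) (d' j) = pull (D' j) F b (?v j) x n k"
        using nn[OF j, of n \<phi>] by (simp add: \<phi>d pull_ncomp[of _ D])
      show "whisk (E' j) x n (?\<phi> j) = pull (E' j) G b (?w j) x n k"
        by (simp add: nwhisk_ncomp[of _ E] \<phi>w pull_ncomp[of _ E])
    qed
    then have "\<forall>j. \<exists>m. j \<in> I \<longrightarrow> m \<in> hom x (e j) n \<and> post x (e j) b n (p j) m = k \<and> pull (E' j) F (e j) (u j) x n m = ?\<phi> j"
      by blast
    then obtain m where m [simp]: "\<And>j. j \<in> I \<Longrightarrow> m j \<in> hom x (e j) n" and pm: "\<And>j. j \<in> I \<Longrightarrow> post x (e j) b n (p j) (m j) = k"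
      and um: "\<And>j. j \<in> I \<Longrightarrow> pull (E' j) F (e j) (u j) x n (m j) = ?\<phi> j" by metis
    \<comment> \<open>\<open>M\<close> collects the unique solutions for the summands; it will land
      in the pullback since all of them lie over the same \<open>k\<close>.\<close>
    obtain M where M': "M \<in> hom x P n \<and> (\<forall>j\<in>I. post x P (e j) n (\<pi> j) M = m j)"
      and M_uniq: "\<forall>M'. M' \<in> hom x P n \<and> (\<forall>j\<in>I. post x P (e j) n (\<pi> j) M' = m j) \<longrightarrow> M' = M"
      by (rule ex1E[OF product_ex1[OF P x m]])
    have M [simp]: "M \<in> hom x P n" and \<pi>M: "\<And>j. j \<in> I \<Longrightarrow> post x P (e j) n (\<pi> j) M = m j" using M' by auto
    have "post x b Pb n \<delta> k = post x P Pb n h M"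
    proof (rule ex1E[OF product_ex1[OF Pb x, of "\<lambda>_. k" n]])
      fix y assume y: "\<forall>z. z \<in> hom x Pb n \<and> (\<forall>i\<in>I. post x Pb b n (\<rho> i) z = k) \<longrightarrow> z = y"
      have "post x Pb b n (\<rho> j) (post x P Pb n h M) = k" if "j \<in> I" for j
        using that by (simp add: post_post \<rho>h) (simp add: post_post[symmetric] \<pi>M pm)
      moreover have "post x Pb b n (\<rho> j) (post x b Pb n \<delta> k) = k" if "j \<in> I" for j
        using that by (simp add: post_post \<rho>\<delta>)
      ultimately have "post x P Pb n h M = y" "post x b Pb n \<delta> k = y" by (auto intro!: y[rule_format])
      then show ?thesis by simp
    qed auto
    from pullback_ex1[OF l x k M this] obtain z where z [simp]: "z \<in> hom x l n" and qz: "post x l b n q z = k" and rz: "post x l P n r z = M"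
      and z_uniq: "\<And>z'. z' \<in> hom x l n \<Longrightarrow> post x l b n q z' = k \<Longrightarrow> post x l P n r z' = M \<Longrightarrow> z' = z" by blast
    have pU: "ncomp A (E' j) n (pull E F l U x n z') (\<iota>E j) = pull (E' j) F (e j) (u j) x n (post x P (e j) n (\<pi> j) (post x l P n r z'))"
      if "j \<in> I" "z' \<in> hom x l n" for j z'
      using that by (simp add: pull_ncomp[of _ E] U\<iota> pull_pull post_post)
    show "\<exists>!z. z \<in> hom x l n \<and> post x l b n q z = k \<and> pull E F l U x n z = \<phi>"
    proof (rule ex1I[of _ z], intro conjI z qz)
      show "pull E F l U x n z = \<phi>"
      proof (rule uniqE[of x F])
        show "pull E F l U x n z \<in> cones E F x n" by simp
      qed (auto simp: pU rz \<pi>M um)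
      fix z' assume z': "z' \<in> hom x l n \<and> post x l b n q z' = k \<and> pull E F l U x n z' = \<phi>"
      then have [simp]: "z' \<in> hom x l n" by simp
      have "post x P (e j) n (\<pi> j) (post x l P n r z') = m j" if j [simp]: "j \<in> I" for j
      proof -
        have "post x (e j) b n (p j) (post x P (e j) n (\<pi> j) (post x l P n r z')) = k"
          using z' lr[OF j] by (simp add: post_post)
        moreover have "pull (E' j) F (e j) (u j) x n (post x P (e j) n (\<pi> j) (post x l P n r z')) = ?\<phi> j"
          using z' pU[OF j, of z'] by simp
        moreover have "post x P (e j) n (\<pi> j) (post x l P n r z') \<in> hom x (e j) n" by simp
        ultimately show ?thesis using ex[OF j] m[OF j] pm[OF j] um[OF j] by blast
      qed
      then have "post x l P n r z' = M" by (intro M_uniq[rule_format]) auto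
      then show "z' = z" using z' by (intro z_uniq) auto
    qed
  qed auto
  moreover have "q \<in> Cl l b" by (rule Cl_pullback[OF l h_Cl])
  ultimately show "\<exists>e p u. p \<in> Cl e b \<and> relative_limit D E d b v w e p u" by blast
qed

end

section \<open>Stability under pushouts and countable composites\<close>

context cell_induction
begin

text \<open>A cone on the pushout \<open>W\<close> over a given cone on \<open>V\<close> amounts to
  a cone on \<open>E\<close> over its restriction to \<open>D\<close>. Hence the relative limit of
  \<open>D \<rightarrow> E\<close> for the restricted data serves for
  \<open>V \<rightarrow> W\<close> as well: the object \<open>e\<close> and the map \<open>p\<close>
  are unchanged.\<close>

lemma leib_pushout:
  assumes P: "is_pullback (op_scat (weights \<kappa> A)) V E D g d W s h" and leib: "leib D E d"
  shows "leib V W s"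
  unfolding leib_def
proof (intro allI impI)
  have "simplicial_functor A (SSet \<kappa>) V" "simplicial_functor A (SSet \<kappa>) E" "simplicial_functor A (SSet \<kappa>) D"
      "simplicial_functor A (SSet \<kappa>) W"
    and g [simp]: "g \<in> nats A D V 0" and d [simp]: "d \<in> nats A D E 0"
    and s [simp]: "s \<in> nats A V W 0" and h [simp]: "h \<in> nats A E W 0"
    and comm: "ncomp A D 0 s g = ncomp A D 0 h d"
    using P by (auto simp: is_pullback_def op_scat_simps Comp_nats_0)
  note [simp] = this(1-4)[THEN weightI]
  note [simp] = ncomp_cones[of D V _ _ g] ncomp_cones[of D E _ _ d] ncomp_cones[of V W _ _ s] ncomp_cones[of E W _ _ h]
  have sf [simp]: "sset_functor A V" "sset_functor A E" "sset_functor A D" "sset_functor A W"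
    by (simp_all add: weight_def[symmetric])
  have sg: "ncomp A D n (ncomp A V n \<phi> s) g = ncomp A D n (ncomp A E n \<phi> h) d" for n and \<phi> :: "'a \<Rightarrow> nat \<Rightarrow> (nat \<Rightarrow> nat) \<times> 'u \<Rightarrow> 'u"
    using ncomp_ncomp[OF sf(3,1) g, of n \<phi> s] ncomp_ncomp[OF sf(3,2) d, of n \<phi> h] by (simp add: comm)
  have uniq: "\<phi> = \<phi>'" if x: "x \<in> Obj K" and H: "diagram H" and \<phi>: "\<phi> \<in> cones W H x n" "\<phi>' \<in> cones W H x n"
      and eq: "ncomp A V n \<phi> s = ncomp A V n \<phi>' s" "ncomp A E n \<phi> h = ncomp A E n \<phi>' h" for x n \<phi> \<phi>' H
  proof -
    have "\<exists>!\<psi>. \<psi> \<in> cones W H x n \<and> ncomp A V n \<psi> s = ncomp A V n \<phi> s \<and> ncomp A E n \<psi> h = ncomp A E n \<phi> h"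
      by (rule pushout_weights[OF size cones_sset_functor[OF x H] P]) (simp_all add: x H \<phi> sg)
    then show ?thesis using \<phi> eq[symmetric] by blast
  qed
  fix b v w assume b [simp]: "b \<in> Obj K" and v [simp]: "v \<in> cones V F b 0" and w [simp]: "w \<in> cones W G b 0"
    and eq: "whisk V b 0 v = ncomp A V 0 w s"
  let ?v = "ncomp A D 0 v g" and ?w = "ncomp A E 0 w h"
  have "whisk D b 0 ?v = ncomp A D 0 ?w d" by (simp add: nwhisk_ncomp[of D V] eq sg)
  moreover have "?v \<in> cones D F b 0" "?w \<in> cones E G b 0" by simp_all
  ultimately obtain e p u where p: "p \<in> Cl e b" and rl: "relative_limit D E d b ?v ?w e p u"
    using leib b unfolding leib_def by blast
  note [simp] = relative_limitD(1-3)[OF rl]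
  \<comment> \<open>The universal cone on \<open>W\<close> is glued from the given cone on
    \<open>V\<close>, pulled back to \<open>e\<close>, and from \<open>u\<close> on
    \<open>E\<close>.\<close>
  have "\<exists>!U. U \<in> cones W F e 0 \<and> ncomp A V 0 U s = pull V F b v e 0 p \<and> ncomp A E 0 U h = u"
    by (rule pushout_weights[OF size cones_sset_functor P])
       (simp_all add: pull_ncomp[of D V] relative_limitD(4)[OF rl])
  then obtain U where U [simp]: "U \<in> cones W F e 0" and Us: "ncomp A V 0 U s = pull V F b v e 0 p" and Uh: "ncomp A E 0 U h = u"
    by blast
  have "relative_limit V W s b v w e p U"
  proof (rule relative_limitI)
    show "ncomp A V 0 U s = pull V F b v e 0 p" by fact
    show "whisk W e 0 U = pull W G b w e 0 p"
    proof (rule uniq[of e G])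
      show "whisk W e 0 U \<in> cones W G e 0" by simp
      show "ncomp A V 0 (whisk W e 0 U) s = ncomp A V 0 (pull W G b w e 0 p) s"
        by (simp add: nwhisk_ncomp[of V W, symmetric] Us nwhisk_pull eq pull_ncomp[of V W])
      show "ncomp A E 0 (whisk W e 0 U) h = ncomp A E 0 (pull W G b w e 0 p) h"
        by (simp add: nwhisk_ncomp[of E W, symmetric] Uh relative_limitD(5)[OF rl] pull_ncomp[of E W])
    qed simp_all
    fix x n k \<phi> assume x [simp]: "x \<in> Obj K" and k [simp]: "k \<in> hom x b n" and \<phi> [simp]: "\<phi> \<in> cones W F x n"
      and \<phi>d: "ncomp A V n \<phi> s = pull V F b v x n k" and \<phi>w: "whisk W x n \<phi> = pull W G b w x n k"
    have ex: "\<exists>!m. m \<in> hom x e n \<and> post x e b n p m = k \<and> pull E F e u x n m = ncomp A E n \<phi> h"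
    proof (rule relative_limit_ex1[OF rl x k])
      show "ncomp A D n (ncomp A E n \<phi> h) d = pull D F b ?v x n k"
        by (simp add: sg[symmetric] \<phi>d pull_ncomp[of D V])
      show "whisk E x n (ncomp A E n \<phi> h) = pull E G b ?w x n k"
        by (simp add: nwhisk_ncomp[of E W] \<phi>w pull_ncomp[of E W])
    qed simp
    have "pull W F e U x n m = \<phi> \<longleftrightarrow> pull E F e u x n m = ncomp A E n \<phi> h"
      if m [simp]: "m \<in> hom x e n" and pm: "post x e b n p m = k" for m
    proof
      show "pull W F e U x n m = \<phi> \<Longrightarrow> pull E F e u x n m = ncomp A E n \<phi> h"
        using pull_ncomp[of E W h n F e U x m] by (simp add: Uh)
      assume m': "pull E F e u x n m = ncomp A E n \<phi> h"
      show "pull W F e U x n m = \<phi>"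
      proof (rule uniq[of x F])
        show "pull W F e U x n m \<in> cones W F x n" by simp
        show "ncomp A V n (pull W F e U x n m) s = ncomp A V n \<phi> s"
          by (simp add: pull_ncomp[of V W] Us pull_pull pm \<phi>d)
        show "ncomp A E n (pull W F e U x n m) h = ncomp A E n \<phi> h"
          by (simp add: pull_ncomp[of E W] Uh m')
      qed simp_all
    qed
    then show "\<exists>!m. m \<in> hom x e n \<and> post x e b n p m = k \<and> pull W F e U x n m = \<phi>"
      using ex by (simp cong: conj_cong)
  qed simp_all
  with p show "\<exists>e p u. p \<in> Cl e b \<and> relative_limit V W s b v w e p u" by blast
qed

text \<open>The relative limits for the steps \<open>S j \<rightarrow> S (Suc j)\<close> form a
  tower over \<open>b\<close>, each taken over the object and the cone produced by the one before.
  The inverse limit of the tower is the relative limit for the composite, and its bottom projection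
  lies in the class.\<close>

lemma leib_sequential:
  assumes P: "is_sequential_limit (op_scat (weights \<kappa> A)) S s W c" and leib: "\<And>j. leib (S j) (S (Suc j)) (s j)"
  shows "leib (S 0) W (c 0)"
  unfolding leib_def
proof (intro allI impI)
  have sfW: "simplicial_functor A (SSet \<kappa>) W" and "\<forall>j. simplicial_functor A (SSet \<kappa>) (S j) \<and>
      s j \<in> nats A (S j) (S (Suc j)) 0 \<and> c j \<in> nats A (S j) W 0 \<and> ncomp A (S j) 0 (c (Suc j)) (s j) = c j"
    using P unfolding is_sequential_limit_def op_scat_simps fun_scat_simps nat_sset_SSet Comp_nats_0 mem_Collect_eq by blast+
  then have sfS: "\<And>j. simplicial_functor A (SSet \<kappa>) (S j)" and s [simp]: "\<And>j. s j \<in> nats A (S j) (S (Suc j)) 0"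
    and c [simp]: "\<And>j. c j \<in> nats A (S j) W 0" and cs: "\<And>j. ncomp A (S j) 0 (c (Suc j)) (s j) = c j" by blast+
  note [simp] = sfW[THEN weightI] sfS[THEN weightI]
  note [simp] = ncomp_cones[of "S j" W _ _ "c j" for j] ncomp_cones[of "S j" "S (Suc j)" _ _ "s j" for j]
  have sf [simp]: "sset_functor A (S j)" "sset_functor A W" for j
    by (simp_all add: weight_def[symmetric])
  have cs': "ncomp A (S j) n (ncomp A (S (Suc j)) n \<phi> (c (Suc j))) (s j) = ncomp A (S j) n \<phi> (c j)"
    for j n and \<phi> :: "'a \<Rightarrow> nat \<Rightarrow> (nat \<Rightarrow> nat) \<times> 'u \<Rightarrow> 'u"
    using ncomp_ncomp[OF sf(1) sf(1) s, of j n \<phi> "c (Suc j)"] by (simp add: cs)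
  have uniq: "\<phi> = \<phi>'" if x: "x \<in> Obj K" and H: "diagram H" and \<phi>: "\<phi> \<in> cones W H x n" "\<phi>' \<in> cones W H x n"
      and eq: "\<And>j. ncomp A (S j) n \<phi> (c j) = ncomp A (S j) n \<phi>' (c j)" for x n \<phi> \<phi>' H
  proof -
    have "\<exists>!\<psi>. \<psi> \<in> cones W H x n \<and> (\<forall>j. ncomp A (S j) n \<psi> (c j) = ncomp A (S j) n \<phi> (c j))"
      by (rule sequential_colimit_weights[OF size cones_sset_functor[OF x H] P]) (simp_all add: x H \<phi> cs')
    then show ?thesis using \<phi> eq[symmetric] by blast
  qed
  fix b v w assume b [simp]: "b \<in> Obj K" and v [simp]: "v \<in> cones (S 0) F b 0" and w [simp]: "w \<in> cones W G b 0"
    and eq: "whisk (S 0) b 0 v = ncomp A (S 0) 0 w (c 0)"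
  \<comment> \<open>A state is an object \<open>e\<close> over \<open>b\<close> by \<open>h\<close>,
    with a cone on \<open>S j\<close> that is compatible with the restriction of \<open>w\<close>.
    The clause for \<open>j = 0\<close> is carried along because dependent choice yields a sequence
    without naming its start.\<close>
  define Q where "Q j = (\<lambda>(e, v', h). e \<in> Obj K \<and> v' \<in> cones (S j) F e 0 \<and> h \<in> hom e b 0 \<and>
     whisk (S j) e 0 v' = ncomp A (S j) 0 (pull W G b w e 0 h) (c j) \<and> (j = 0 \<longrightarrow> e = b \<and> v' = v \<and> h = Ident K b))" for j
  define R where "R j = (\<lambda>(e, v', h) (e', v'', h'). \<exists>p. p \<in> Cl e' e \<and> h' = post e' e b 0 h p \<and>
     relative_limit (S j) (S (Suc j)) (s j) e v' (ncomp A (S (Suc j)) 0 (pull W G b w e 0 h) (c (Suc j))) e' p v'')" for j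
  have "\<exists>f. \<forall>j. Q j (f j) \<and> R j (f j) (f (Suc j))"
  proof (rule dependent_nat_choice)
    show "\<exists>t. Q 0 t" by (intro exI[of _ "(b, v, Ident K b)"]) (simp add: Q_def eq pull_Ident)
    fix t j assume "Q j t"
    then obtain e v' h where t: "t = (e, v', h)" and e [simp]: "e \<in> Obj K" and v' [simp]: "v' \<in> cones (S j) F e 0"
      and h [simp]: "h \<in> hom e b 0" and eq': "whisk (S j) e 0 v' = ncomp A (S j) 0 (pull W G b w e 0 h) (c j)"
      by (auto simp: Q_def)
    let ?w = "ncomp A (S (Suc j)) 0 (pull W G b w e 0 h) (c (Suc j))"
    have "?w \<in> cones (S (Suc j)) G e 0" "whisk (S j) e 0 v' = ncomp A (S j) 0 ?w (s j)" by (simp_all add: eq' cs')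
    then obtain e' p u where p: "p \<in> Cl e' e" and rl: "relative_limit (S j) (S (Suc j)) (s j) e v' ?w e' p u"
      using leib[of j] e v' unfolding leib_def by blast
    note [simp] = relative_limitD(1-3)[OF rl]
    have "Q (Suc j) (e', u, post e' e b 0 h p)"
      by (simp add: Q_def relative_limitD(5)[OF rl] pull_ncomp[of "S (Suc j)" W, symmetric] pull_pull)
    moreover have "R j t (e', u, post e' e b 0 h p)" using p rl by (auto simp: R_def t)
    ultimately show "\<exists>t'. Q (Suc j) t' \<and> R j t t'" by blast
  qed
  then obtain f where f: "\<And>j. Q j (f j)" "\<And>j. R j (f j) (f (Suc j))" by blast
  define e where "e j = fst (f j)" for j
  define v' where "v' j = fst (snd (f j))" for j
  define h where "h j = snd (snd (f j))" for j
  let ?w = "\<lambda>j. ncomp A (S (Suc j)) 0 (pull W G b w (e j) 0 (h j)) (c (Suc j))"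
  have fe: "f j = (e j, v' j, h j)" for j by (simp add: e_def v'_def h_def)
  have e [simp]: "e j \<in> Obj K" and v' [simp]: "v' j \<in> cones (S j) F (e j) 0" and h [simp]: "h j \<in> hom (e j) b 0"
      and eq': "whisk (S j) (e j) 0 (v' j) = ncomp A (S j) 0 (pull W G b w (e j) 0 (h j)) (c j)"
      and start: "e 0 = b" "v' 0 = v" "h 0 = Ident K b" for j
    using f(1)[of j] f(1)[of 0] by (auto simp: fe Q_def)
  have "\<forall>j. \<exists>p. p \<in> Cl (e (Suc j)) (e j) \<and> h (Suc j) = post (e (Suc j)) (e j) b 0 (h j) p \<and>
     relative_limit (S j) (S (Suc j)) (s j) (e j) (v' j) (?w j) (e (Suc j)) p (v' (Suc j))"
    using f(2) by (simp add: fe R_def)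
  then obtain p where p: "\<And>j. p j \<in> Cl (e (Suc j)) (e j)" and hp: "\<And>j. h (Suc j) = post (e (Suc j)) (e j) b 0 (h j) (p j)"
     and rl: "\<And>j. relative_limit (S j) (S (Suc j)) (s j) (e j) (v' j) (?w j) (e (Suc j)) (p j) (v' (Suc j))" by metis
  have p' [simp]: "p j \<in> hom (e (Suc j)) (e j) 0" for j by (rule relative_limitD(2)[OF rl])
  have "p j \<in> isof (e (Suc j)) (e j)" for j using p Cl_isof[of "e (Suc j)" "e j"] by auto
  then obtain l \<pi> where l: "is_sequential_limit K e p l \<pi>" using ex_sequential_limit[of e p] by auto
  note [simp] = sequential_limitD(1,4)[OF l]
  note \<pi> = sequential_limitD(5)[OF l]
  have h\<pi>: "post l (e j) b 0 (h j) (\<pi> j) = \<pi> 0" for j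
  proof (induction j)
    case 0 then show ?case using sequential_limitD(4)[OF l, of 0] by (simp add: start)
  next
    case (Suc j) then show ?case by (simp add: hp post_post[symmetric] \<pi>)
  qed
  have \<pi>0 [simp]: "\<pi> 0 \<in> hom l b 0" using sequential_limitD(4)[OF l, of 0] by (simp add: start)
  have "\<exists>!u. u \<in> cones W F l 0 \<and> (\<forall>j. ncomp A (S j) 0 u (c j) = pull (S j) F (e j) (v' j) l 0 (\<pi> j))"
    by (rule sequential_colimit_weights[OF size cones_sset_functor P])
       (simp_all add: pull_ncomp[of "S j" "S (Suc j)" for j] relative_limitD(4)[OF rl] pull_pull \<pi>)
  then obtain u where u [simp]: "u \<in> cones W F l 0"
    and uc: "\<And>j. ncomp A (S j) 0 u (c j) = pull (S j) F (e j) (v' j) l 0 (\<pi> j)" by blast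
  have "relative_limit (S 0) W (c 0) b v w l (\<pi> 0) u"
  proof (rule relative_limitI)
    show "ncomp A (S 0) 0 u (c 0) = pull (S 0) F b v l 0 (\<pi> 0)" by (simp add: uc start)
    show "whisk W l 0 u = pull W G b w l 0 (\<pi> 0)"
    proof (rule uniq[of l G])
      show "whisk W l 0 u \<in> cones W G l 0" by simp
      fix j show "ncomp A (S j) 0 (whisk W l 0 u) (c j) = ncomp A (S j) 0 (pull W G b w l 0 (\<pi> 0)) (c j)"
        by (simp add: nwhisk_ncomp[of "S j" W, symmetric] uc nwhisk_pull eq' pull_ncomp[of "S j" W, symmetric] pull_pull h\<pi>)
    qed simp_all
    fix x n k \<phi> assume x [simp]: "x \<in> Obj K" and k [simp]: "k \<in> hom x b n" and \<phi> [simp]: "\<phi> \<in> cones W F x n"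
      and \<phi>d: "ncomp A (S 0) n \<phi> (c 0) = pull (S 0) F b v x n k" and \<phi>w: "whisk W x n \<phi> = pull W G b w x n k"
    let ?\<phi> = "\<lambda>j. ncomp A (S j) n \<phi> (c j)"
    have lift: "\<exists>!m'. m' \<in> hom x (e (Suc j)) n \<and> post x (e (Suc j)) (e j) n (p j) m' = m \<and>
         pull (S (Suc j)) F (e (Suc j)) (v' (Suc j)) x n m' = ?\<phi> (Suc j)"
      if m [simp]: "m \<in> hom x (e j) n" and vm: "pull (S j) F (e j) (v' j) x n m = ?\<phi> j" and hm: "post x (e j) b n (h j) m = k" for j m
    proof (rule relative_limit_ex1[OF rl x m])
      show "ncomp A (S j) n (?\<phi> (Suc j)) (s j) = pull (S j) F (e j) (v' j) x n m" by (simp add: cs' vm)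
      show "whisk (S (Suc j)) x n (?\<phi> (Suc j)) = pull (S (Suc j)) G (e j) (?w j) x n m"
        by (simp add: nwhisk_ncomp[of "S (Suc j)" W] \<phi>w pull_ncomp[of "S (Suc j)" W, symmetric] pull_pull hm)
    qed simp
    \<comment> \<open>The same pattern for a single cone \<open>\<phi>\<close>: a compatible
      sequence of simplices that lifts \<open>k\<close> through the tower, each step determined by
      the part of \<open>\<phi>\<close> on the next weight.\<close>
    define Q' where "Q' j m \<longleftrightarrow> m \<in> hom x (e j) n \<and> pull (S j) F (e j) (v' j) x n m = ?\<phi> j \<and> post x (e j) b n (h j) m = k \<and> (j = 0 \<longrightarrow> m = k)" for j m
    have "\<exists>m. \<forall>j. Q' j (m j) \<and> post x (e (Suc j)) (e j) n (p j) (m (Suc j)) = m j"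
    proof (rule dependent_nat_choice)
      show "\<exists>m. Q' 0 m" by (intro exI[of _ k]) (simp add: Q'_def start \<phi>d)
      fix m j assume "Q' j m"
      then have m: "m \<in> hom x (e j) n" "pull (S j) F (e j) (v' j) x n m = ?\<phi> j" "post x (e j) b n (h j) m = k"
        by (auto simp: Q'_def)
      obtain m' where m': "m' \<in> hom x (e (Suc j)) n" "post x (e (Suc j)) (e j) n (p j) m' = m"
         "pull (S (Suc j)) F (e (Suc j)) (v' (Suc j)) x n m' = ?\<phi> (Suc j)"
        using lift[OF m] by blast
      then have "Q' (Suc j) m'" using m by (simp add: Q'_def hp post_post[symmetric])
      then show "\<exists>m'. Q' (Suc j) m' \<and> post x (e (Suc j)) (e j) n (p j) m' = m" using m'(2) by blast
    qed
    then obtain m where m: "\<And>j. Q' j (m j)" and pm: "\<And>j. post x (e (Suc j)) (e j) n (p j) (m (Suc j)) = m j" by blast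
    have m' [simp]: "m j \<in> hom x (e j) n" and vm: "pull (S j) F (e j) (v' j) x n (m j) = ?\<phi> j" 
      and hm: "post x (e j) b n (h j) (m j) = k" and m0: "m 0 = k" for j
      using m[of j] m[of 0] by (auto simp: Q'_def)
    have ex: "\<exists>!z. z \<in> hom x l n \<and> (\<forall>j. post x l (e j) n (\<pi> j) z = m j)"
      by (rule sequential_limit_ex1[OF l x m' pm])
    have pu: "ncomp A (S j) n (pull W F l u x n z) (c j) = pull (S j) F (e j) (v' j) x n (post x l (e j) n (\<pi> j) z)"
      if "z \<in> hom x l n" for j z
      using that by (simp add: pull_ncomp[of "S j" W] uc pull_pull)
    \<comment> \<open>Uniqueness in \<open>lift\<close> carries agreement from stage
      \<open>j\<close> to stage \<open>Suc j\<close>, so \<open>z\<close> is pinned down by its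
      component at stage 0 and by the cone it induces.\<close>
    have "(\<forall>j. post x l (e j) n (\<pi> j) z = m j) \<longleftrightarrow> post x l b n (\<pi> 0) z = k \<and> pull W F l u x n z = \<phi>" (is "?L \<longleftrightarrow> ?R")
      if z [simp]: "z \<in> hom x l n" for z
    proof
      assume L: ?L
      have "pull W F l u x n z = \<phi>"
      proof (rule uniq[of x F])
        show "pull W F l u x n z \<in> cones W F x n" by simp
      qed (simp_all add: pu L vm)
      moreover have "post x l b n (\<pi> 0) z = k" using L[rule_format, of 0] by (simp add: start m0)
      ultimately show ?R by simp
    next
      assume R: ?R
      show ?L
      proof
        fix j show "post x l (e j) n (\<pi> j) z = m j"
        proof (induction j)
          case 0 then show ?case using R by (simp add: start m0)
        next
          case (Suc j)
          have "post x (e (Suc j)) (e j) n (p j) (post x l (e (Suc j)) n (\<pi> (Suc j)) z) = m j"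
            using Suc by (simp add: post_post \<pi>)
          moreover have "pull (S (Suc j)) F (e (Suc j)) (v' (Suc j)) x n (post x l (e (Suc j)) n (\<pi> (Suc j)) z) = ?\<phi> (Suc j)"
            using pu[OF z, of "Suc j"] R by simp
          moreover have "post x l (e (Suc j)) n (\<pi> (Suc j)) z \<in> hom x (e (Suc j)) n" by simp
          ultimately show ?case using lift[OF m' vm hm, of j] pm vm m' by blast
        qed
      qed
    qed
    then show "\<exists>!z. z \<in> hom x l n \<and> post x l b n (\<pi> 0) z = k \<and> pull W F l u x n z = \<phi>"
      using ex by (simp cong: conj_cong)
  qed simp_all
  moreover have "\<pi> 0 \<in> Cl l b" using Cl_sequential_limit[OF l p] by (simp add: start)
  ultimately show "\<exists>e p u. p \<in> Cl e b \<and> relative_limit (S 0) W (c 0) b v w e p u" by blast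
qed

theorem leib_cell_complex:
  assumes "projective_cell_complex \<kappa> A V W i"
  shows "leib V W i"
proof -
  obtain S s c where S: "S 0 = V" "c 0 = i" and att: "\<And>j. is_cell_attachment \<kappa> A (S j) (S (Suc j)) (s j)"
    and lim: "is_sequential_limit (op_scat (weights \<kappa> A)) S s W c"
    using assms unfolding projective_cell_complex_def by blast
  have "leib (S j) (S (Suc j)) (s j)" for j
  proof -
    obtain D E d g h where cop: "is_coproduct_of_cells \<kappa> A D E d"
      and P: "is_pullback (op_scat (weights \<kappa> A)) (S j) E D g d (S (Suc j)) (s j) h"
      using att[of j] unfolding is_cell_attachment_def by blast
    obtain I :: "'u set" and n a D' E' d' \<iota>D \<iota>E where I: "small \<kappa> I"
      and cell: "\<And>j. j \<in> I \<Longrightarrow> a j \<in> Obj A \<and> is_projective_cell \<kappa> A (n j) (a j) (D' j) (E' j) (d' j)"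
      and D: "is_product (op_scat (weights \<kappa> A)) I D' D \<iota>D" and E: "is_product (op_scat (weights \<kappa> A)) I E' E \<iota>E"
      and comm: "\<And>j. j \<in> I \<Longrightarrow> ncomp A (D' j) 0 d (\<iota>D j) = ncomp A (D' j) 0 (\<iota>E j) (d' j)"
      and d: "d \<in> nats A D E 0"
      using cop unfolding is_coproduct_of_cells_def fun_scat_simps nat_sset_SSet Comp_nats_0 by blast
    have "d' j \<in> nats A (D' j) (E' j) 0" if "j \<in> I" for j
      using cell[OF that] by (simp add: is_projective_cell_def)
    then have "leib D E d"
      using cell by (intro leib_coproduct[OF I D E d _ comm] leib_cell) auto
    then show ?thesis by (rule leib_pushout[OF P])
  qed
  from leib_sequential[OF lim this] show ?thesis by (simp add: S)
qed

end

section \<open>From relative limits to maps between limits\<close>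

context diagrams
begin

lemma cones_empty_weight:
  assumes "simplicial_functor A (SSet \<kappa>) empty_weight" "diagram F" "x \<in> Obj K"
  shows "\<exists>!\<phi>. \<phi> \<in> cones empty_weight F x n"
proof -
  have s [simp]: "simplices (fobj empty_weight a) k = {}" for a :: 'a and k
    by (simp add: empty_weight_def empty_sset_def)
  have w: "weight empty_weight" unfolding weight_def
    by (rule weights_sset_functor[OF A.simplicial_category_axioms assms(1)])
  have "mknat A empty_weight n (\<lambda>a k \<theta> w. undefined) \<in> cones empty_weight F x n"
    using assms w by (intro mknat_cones) auto
  then show ?thesis by (intro ex1I) (auto intro: nats_eqI)
qed

end

context cell_induction
begin

text \<open>The flexible limit of a map of diagrams in the class, as the relative limit of \<open>0 \<rightarrow> W\<close> over the limit of \<open>G\<close>.\<close>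

theorem lim_diagram_map_Cl:
  assumes W: "flexible \<kappa> A W"
    and L: "is_weighted_limit K A W F l lam" and L': "is_weighted_limit K A W G l' lam'"
  shows "lim_diagram_map K A W F l lam G l' lam' \<beta> \<in> Cl l l'"
proof -
  obtain i where i: "projective_cell_complex \<kappa> A empty_weight W i" using W by (auto simp: flexible_def)
  then have e: "simplicial_functor A (SSet \<kappa>) empty_weight" and "simplicial_functor A (SSet \<kappa>) W"
    and i' [simp]: "i \<in> nats A empty_weight W 0" by (auto simp: projective_cell_complex_def)
  note [simp] = this(1,2)[THEN weightI] weighted_limitD[OF L] weighted_limitD[OF L']
  note [simp] = ncomp_cones[of empty_weight W _ _ i]
  note ee = cones_empty_weight[OF e]
  have eq: "\<phi> = \<psi>" if "\<phi> \<in> cones empty_weight H x n" "\<psi> \<in> cones empty_weight H x n" "diagram H" "x \<in> Obj K" for H x n \<phi> \<psi>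
    using ee[OF that(3,4), of n] that(1,2) by blast
  obtain v where v [simp]: "v \<in> cones empty_weight F l' 0" using ee[OF F, of l' 0] by auto
  have "whisk empty_weight l' 0 v = ncomp A empty_weight 0 lam' i" by (rule eq[of _ l' G 0]) simp_all
  then obtain e p u where p: "p \<in> Cl e l'" and rl: "relative_limit empty_weight W i l' v lam' e p u"
    using leib_cell_complex[OF i, unfolded leib_def] by (meson v weighted_limitD[OF L'])
  note [simp] = relative_limitD(1-3)[OF rl]
  \<comment> \<open>Over a limit of \<open>G\<close> with universal cone \<open>lam'\<close>, the
    base component of a cone \<open>\<phi>\<close> is no further datum: it must classify
    \<open>whisk W x n \<phi>\<close>. So the relative limit is an honest limit of
    \<open>F\<close>.\<close>
  have E: "is_weighted_limit K A W F e u"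
    unfolding weighted_limit_iff[OF \<open>weight W\<close> F]
  proof (intro conjI ballI allI)
    fix x n \<phi> assume x [simp]: "x \<in> Obj K" and \<phi> [simp]: "\<phi> \<in> cones W F x n"
    obtain k where k [simp]: "k \<in> hom x l' n" and pk: "pull W G l' lam' x n k = whisk W x n \<phi>"
      using factor_cone[OF L', of x "whisk W x n \<phi>" n] by auto
    have "\<exists>!m. m \<in> hom x e n \<and> post x e l' n p m = k \<and> pull W F e u x n m = \<phi>"
      by (rule relative_limit_ex1[OF rl x k \<phi>]) (auto intro: eq[of _ x F n] simp: pk)
    moreover have "post x e l' n p m = k" if "m \<in> hom x e n" "pull W F e u x n m = \<phi>" for m
    proof (rule pull_inj[OF L' x])
      show "pull W G l' lam' x n (post x e l' n p m) = pull W G l' lam' x n k"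
        using that by (simp add: pull_pull[symmetric] relative_limitD(5)[OF rl, symmetric] nwhisk_pull[symmetric] pk)
    qed (use that in simp_all)
    ultimately show "\<exists>!m. m \<in> hom x e n \<and> pull W F e u x n m = \<phi>" by blast
  qed simp_all
  \<comment> \<open>The given limit \<open>l\<close> need not be the constructed \<open>e\<close>;
    they differ by an isomorphism, which belongs to the class.\<close>
  obtain k where iso: "is_iso K l e k" and k [simp]: "k \<in> hom l e 0" and pk: "pull W F e u l 0 k = lam"
    by (rule weighted_limit_iso[OF E L]) auto
  have "lim_diagram_map K A W F l lam G l' lam' \<beta> = post l e l' 0 p k"
  proof (rule lim_diagram_map_eqI[OF L L' _ F G])
    show "pull W G l' lam' l 0 (post l e l' 0 p k) = whisk W l 0 lam"
      by (simp add: pull_pull[symmetric] relative_limitD(5)[OF rl, symmetric] nwhisk_pull[symmetric] pk)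
  qed simp_all
  moreover have "k \<in> Cl l e" by (rule Cl_iso[OF _ _ iso]) simp_all
  ultimately show ?thesis using p by (simp add: Cl_comp)
qed

end

section \<open>Isofibrations as a class closed under the limits of the induction\<close>

context infinity_cosmos
begin

lemma fibration_class_isof: "fibration_class K \<kappa> isof isof"
proof
  show "f \<in> isof a b" if "a \<in> Obj K" "b \<in> Obj K" "is_iso K a b f" for a b f using isof_iso[OF that] .
  show "post a b c 0 g f \<in> isof a c" if "a \<in> Obj K" "b \<in> Obj K" "c \<in> Obj K" "g \<in> isof b c" "f \<in> isof a b" for a b c f g
    using isof_comp[OF that] that isof_vertex[OF that(2,3)] by (simp add: Comp_0_eq_post subset_iff)
  show "q \<in> isof p a" if "is_pullback K a e b f g p q r" "g \<in> isof e b" for a e b f g p q r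
    using that by (rule isof_pullback)
  show "h \<in> isof p q" if "small \<kappa> I" "is_product K I a p \<pi>" "is_product K I b q \<rho>"
    "\<And>i. i \<in> I \<Longrightarrow> f i \<in> isof (a i) (b i)" "h \<in> hom p q 0"
    "\<And>i. i \<in> I \<Longrightarrow> post p q (b i) 0 (\<rho> i) h = post p (a i) (b i) 0 (f i) (\<pi> i)"
    for I :: "'u set" and a b f p \<pi> q \<rho> h
  proof (rule isof_product[OF that(1-5)])
    fix i assume i: "i \<in> I"
    note [simp] = productD[OF that(2)] productD[OF that(3)] i
    have [simp]: "f i \<in> hom (a i) (b i) 0" using that(4)[OF i] isof_vertex[of "a i" "b i"] by auto
    show "Comp K p q (b i) 0 (\<rho> i) h = Comp K p (a i) (b i) 0 (f i) (\<pi> i)"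
      using that(6)[OF i] by (simp add: Comp_0_eq_post)
  qed
  show "\<pi> 0 \<in> isof l (e 0)" if "is_sequential_limit K e p l \<pi>" "\<And>k. p k \<in> isof (e (Suc k)) (e k)" for e p l \<pi>
    by (rule isof_sequential_limit[OF that])
next
  fix U V :: "'u sset" and e b g eU ueU eV ueV bU ubU bV ubV ei gU bi gV p q r h
  assume h: "small_sset \<kappa> U" "small_sset \<kappa> V" "subsset U V" "e \<in> Obj K" "b \<in> Obj K" "g \<in> isof e b"
        "is_cotensor K U e eU ueU" "is_cotensor K V e eV ueV" "is_cotensor K U b bU ubU" "is_cotensor K V b bV ubV"
        "is_cotensor_map K U (incl U) e e (Ident K e) eV ueV eU ueU ei"
        "is_cotensor_map K U (incl U) b b (Ident K b) bV ubV bU ubU bi"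
        "is_cotensor_map K U (\<lambda>n u. u) e b g eU ueU bU ubU gU"
        "is_cotensor_map K V (\<lambda>n v. v) e b g eV ueV bV ubV gV"
        "is_pullback K eU bV bU gU bi p q r" "h \<in> hom eV p 0"
        "post eV p eU 0 q h = ei" "post eV p bV 0 r h = gV"
  note [simp] = pullbackD(4,7,8)[OF h(15)] cotensorD(2)[OF h(7)] cotensorD(2)[OF h(10)]
  have UV: "U \<in> Obj (SSet \<kappa>)" "V \<in> Obj (SSet \<kappa>)" using h(1,2) by (auto simp: small_sset_def)
  show "h \<in> isof eV p"
  proof (rule isof_leibniz_cotensor[OF UV subsset_incl[OF h(3)] _ h(4-16)])
    show "inj_on (incl U n) (simplices U n)" for n by (simp add: inj_on_def)
    show "Comp K eV p eU 0 q h = ei" "Comp K eV p bV 0 r h = gV" using h(17,18) by (simp_all add: Comp_0_eq_post)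
  qed
qed simp

end

section \<open>Existence of flexible limits and isofibrations between them\<close>

locale sized_cosmos = infinity_cosmos K \<kappa> isof
  for K :: "('o, 'u) scat" and \<kappa> :: "'k rel" and isof +
  assumes size: "size_cardinal \<kappa> TYPE('u)"

locale cosmos_diagrams = sized_cosmos K \<kappa> isof + diagrams K A
  for K :: "('o, 'u) scat" and \<kappa> :: "'k rel" and isof and A :: "('a, 'u) scat"
begin

definition const_diagram where
  "const_diagram t = \<lparr>fobj = (\<lambda>_. t), fmap = (\<lambda>a b n f. degen (Hom K t t) n (Ident K t))\<rparr>"

lemma const_diagram: "t \<in> Obj K \<Longrightarrow> diagram (const_diagram t)"
  unfolding diagram_def const_diagram_def by unfold_locales auto

text \<open>The relative limit of \<open>V \<rightarrow> W\<close> for the map from \<open>F\<close> to the terminal diagram.\<close>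

lemma extend_weighted_limit:
  assumes F [simp]: "diagram F" and i: "projective_cell_complex \<kappa> A V W i" and L: "is_weighted_limit K A V F l lam"
  obtains e p u where "is_weighted_limit K A W F e u" "p \<in> isof e l" "p \<in> hom e l 0"
    "pull V F l lam e 0 p = ncomp A V 0 u i"
proof -
  obtain t where t: "is_terminal K t" using ex_terminal by blast
  then have [simp]: "t \<in> Obj K" by (simp add: is_terminal_def)
  have "\<forall>a. \<exists>f. a \<in> Obj A \<longrightarrow> f \<in> hom (fobj F a) t 0" using terminal_hom_ex[OF t] by (meson F diagram_obj)
  then obtain \<beta> where \<beta>: "\<And>a. a \<in> Obj A \<Longrightarrow> \<beta> a \<in> hom (fobj F a) t 0" by metis
  define \<beta>' where "\<beta>' = restrict \<beta> (Obj A)"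
  have [simp]: "fobj (const_diagram t) a = t" for a :: 'a by (simp add: const_diagram_def)
  note [simp] = const_diagram[OF \<open>t \<in> Obj K\<close>]
  have "diag_map F (const_diagram t) \<beta>'"
    unfolding diag_map_def nat_sset_def
  proof (simp add: \<beta>'_def \<beta>, intro ballI allI)
    fix a b k \<theta> f assume h: "a \<in> Obj A" "b \<in> Obj A" "\<theta> \<in> Delta_hom k 0" "f \<in> simplices (Hom A a b) k"
    show "Comp K (fobj F a) t t k (fmap (const_diagram t) a b k f) (act (Hom K (fobj F a) t) k 0 \<theta> (\<beta> a)) =
        Comp K (fobj F a) (fobj F b) t k (act (Hom K (fobj F b) t) k 0 \<theta> (\<beta> b)) (fmap F a b k f)"
      by (rule terminal_hom_eq[OF t, of "fobj F a" _ k]) (use h \<beta> in \<open>simp_all add: const_diagram_def\<close>)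
  qed
  then interpret cell_induction K \<kappa> isof isof A F "const_diagram t" \<beta>'
    by (intro cell_induction.intro fibration_class_isof diagrams_axioms cell_induction_axioms.intro size F
        const_diagram[OF \<open>t \<in> Obj K\<close>])
      (simp_all add: \<beta>'_def isof_terminal[OF _ t] \<beta>)
  have "simplicial_functor A (SSet \<kappa>) V" "simplicial_functor A (SSet \<kappa>) W"
    and i' [simp]: "i \<in> nats A V W 0" using i by (auto simp: projective_cell_complex_def)
  note [simp] = this(1,2)[THEN weightI] weighted_limitD[OF L]
  note [simp] = ncomp_cones[of V W _ _ i]
  have teq: "\<phi> = \<psi>" if "\<phi> \<in> cones W' (const_diagram t) x n" "\<psi> \<in> cones W' (const_diagram t) x n" "x \<in> Obj K" "weight W'" for W' x n \<phi> \<psi>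
  proof (rule nats_eqI[OF that(1,2)])
    show "\<phi> a k (\<theta>, w) = \<psi> a k (\<theta>, w)" if "a \<in> Obj A" "\<theta> \<in> Delta_hom k n" "w \<in> simplices (fobj W' a) k" for a k \<theta> w
      using cone_closed[OF \<open>\<phi> \<in> _\<close> \<open>weight W'\<close> _ \<open>x \<in> Obj K\<close> that] cone_closed[OF \<open>\<psi> \<in> _\<close> \<open>weight W'\<close> _ \<open>x \<in> Obj K\<close> that]
      by (intro terminal_hom_eq[OF t, of x _ k]) (simp_all add: \<open>x \<in> Obj K\<close>)
  qed
  \<comment> \<open>Any choice of simplices into the terminal object is a cone, because all
    equations between such simplices hold.\<close>
  define tw where "tw = mknat A W 0 (\<lambda>a k \<theta> w. SOME f. f \<in> hom l t k)"
  have some: "(SOME f. f \<in> hom l t k) \<in> hom l t k" for k using terminal_hom_ex[OF t, of l k] by (simp add: some_in_eq ex_in_conv)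
  have tw [simp]: "tw \<in> cones W (const_diagram t) l 0"
    unfolding tw_def
  proof (rule mknat_cones)
    show "act (Hom K l (fobj (const_diagram t) a)) j k \<sigma> (SOME f. f \<in> hom l t k) = (SOME f. f \<in> hom l t j)"
      if "\<sigma> \<in> Delta_hom j k" for a :: 'a and j k \<sigma>
      by (rule terminal_hom_eq[OF t, of l _ j]) (simp_all add: some that)
    show "Comp K l (fobj (const_diagram t) a) (fobj (const_diagram t) b) k (fmap (const_diagram t) a b k f)
        (SOME f. f \<in> hom l t k) = (SOME f. f \<in> hom l t k)" for a b :: 'a and k f
      by (rule terminal_hom_eq[OF t, of l _ k]) (simp_all add: some, simp add: some const_diagram_def)
  qed (simp_all add: some)
  have "whisk V l 0 lam = ncomp A V 0 tw i" by (rule teq[of _ V l 0]) simp_all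
  then obtain e p u where p: "p \<in> isof e l" and rl: "relative_limit V W i l lam tw e p u"
    using leib_cell_complex[OF i, unfolded leib_def] by (meson tw weighted_limitD[OF L])
  note [simp] = relative_limitD(1-3)[OF rl]
  \<comment> \<open>Restriction along \<open>i\<close> fixes the component of a cone in
    \<open>l\<close>, so only a cone on \<open>W\<close> remains to be represented.\<close>
  have "is_weighted_limit K A W F e u"
    unfolding weighted_limit_iff[OF \<open>weight W\<close> F]
  proof (intro conjI ballI allI)
    fix x n \<phi> assume x [simp]: "x \<in> Obj K" and \<phi> [simp]: "\<phi> \<in> cones W F x n"
    obtain k where k [simp]: "k \<in> hom x l n" and pk: "pull V F l lam x n k = ncomp A V n \<phi> i"
      using factor_cone[OF L, of x "ncomp A V n \<phi> i" n] by auto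
    have "\<exists>!m. m \<in> hom x e n \<and> post x e l n p m = k \<and> pull W F e u x n m = \<phi>"
      by (rule relative_limit_ex1[OF rl x k \<phi>]) (auto intro: teq[of _ W x n] simp: pk)
    moreover have "post x e l n p m = k" if "m \<in> hom x e n" "pull W F e u x n m = \<phi>" for m
    proof (rule pull_inj[OF L x])
      show "pull V F l lam x n (post x e l n p m) = pull V F l lam x n k"
        using that by (simp add: pull_pull[symmetric] relative_limitD(4)[OF rl, symmetric] pull_ncomp[of V W, symmetric] pk)
    qed (use that in simp_all)
    ultimately show "\<exists>!m. m \<in> hom x e n \<and> pull W F e u x n m = \<phi>" by blast
  qed simp_all
  then show thesis using that p relative_limitD(2,4)[OF rl] by simp
qed

text \<open>The terminal object is the limit weighted by the empty weight, and a flexible weight is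
  a cell complex on the empty one; extension along this complex produces the limit.\<close>

theorem flexible_limit_exists:
  assumes F [simp]: "diagram F" and W: "flexible \<kappa> A W"
  shows "\<exists>l lam. is_weighted_limit K A W F l lam"
proof -
  obtain i where i: "projective_cell_complex \<kappa> A empty_weight W i" using W by (auto simp: flexible_def)
  then have e: "simplicial_functor A (SSet \<kappa>) empty_weight" by (auto simp: projective_cell_complex_def)
  have we: "weight empty_weight" unfolding weight_def
    by (rule weights_sset_functor[OF A.simplicial_category_axioms e])
  obtain t where t: "is_terminal K t" using ex_terminal by blast
  then have [simp]: "t \<in> Obj K" by (simp add: is_terminal_def)
  obtain lam where lam: "lam \<in> cones empty_weight F t 0" using cones_empty_weight[OF e F, of t 0] by auto
  have "is_weighted_limit K A empty_weight F t lam"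
    unfolding weighted_limit_iff[OF we F]
  proof (intro conjI ballI allI lam)
    fix x n \<phi> assume x [simp]: "x \<in> Obj K" and \<phi>: "\<phi> \<in> cones empty_weight F x n"
    have "pull empty_weight F t lam x n h = \<phi>" if "h \<in> hom x t n" for h
      using cones_empty_weight[OF e F x, of n] \<phi> pull_cones[OF we F x _ lam that] by auto
    moreover have "\<exists>!h. h \<in> hom x t n" using t by (simp add: is_terminal_def)
    ultimately show "\<exists>!h. h \<in> hom x t n \<and> pull empty_weight F t lam x n h = \<phi>" by blast
  qed simp
  from extend_weighted_limit[OF F i this] show ?thesis by metis
qed

text \<open>The extension of \<open>l\<close> along \<open>i\<close> maps to \<open>l\<close> by an
  isofibration. An arbitrary limit \<open>l'\<close> differs from this extension by an isomorphism,
  and isomorphisms are isofibrations.\<close>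

theorem lim_weight_map_isof:
  assumes F [simp]: "diagram F" and i: "projective_cell_complex \<kappa> A W W' i"
    and L: "is_weighted_limit K A W F l lam" and L': "is_weighted_limit K A W' F l' lam'"
  shows "lim_weight_map K A F W l lam W' l' lam' i \<in> isof l' l"
proof -
  have w [simp]: "weight W" "weight W'" and i' [simp]: "i \<in> nats A W W' 0"
    using i weights_sset_functor[OF A.simplicial_category_axioms] by (auto simp: projective_cell_complex_def weight_def)
  obtain e p u where E: "is_weighted_limit K A W' F e u" and p: "p \<in> isof e l" and p' [simp]: "p \<in> hom e l 0"
    and pp: "pull W F l lam e 0 p = ncomp A W 0 u i"
    by (rule extend_weighted_limit[OF F i L])
  note [simp] = weighted_limitD[OF L] weighted_limitD[OF L'] weighted_limitD[OF E]
  obtain k where iso: "is_iso K l' e k" and k [simp]: "k \<in> hom l' e 0" and pk: "pull W' F e u l' 0 k = lam'"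
    by (rule weighted_limit_iso[OF E L']) auto
  have "lim_weight_map K A F W l lam W' l' lam' i = post l' e l 0 p k"
    by (rule lim_weight_map_eqI[OF L]) (simp_all add: pull_pull[symmetric] pp pull_ncomp[of W W', symmetric] pk)
  moreover have "k \<in> isof l' e" by (rule isof_iso[OF _ _ iso]) simp_all
  ultimately show ?thesis using p fibration_class.Cl_comp[OF fibration_class_isof] by simp
qed

end

section \<open>Lifting properties\<close>

context simplicial_category
begin

text \<open>Simplexwise unique existence is automatically natural: restricting the solution for
  \<open>t\<close> gives a solution for the restriction of \<open>t\<close>. In this way universal
  properties, which speak of single simplices, also classify maps out of an arbitrary simplicial set
  \<open>T\<close>.\<close>

lemma smap_by_uniqueness:
  assumes T: "simplicial_set T" and x [simp]: "x \<in> Obj C" and p [simp]: "p \<in> Obj C"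
    and ex: "\<And>n t. t \<in> simplices T n \<Longrightarrow> \<exists>!k. k \<in> hom x p n \<and> R n t k"
    and nat: "\<And>n t k m \<theta>. t \<in> simplices T n \<Longrightarrow> \<theta> \<in> Delta_hom m n \<Longrightarrow> k \<in> hom x p n \<Longrightarrow> R n t k \<Longrightarrow>
       R m (act T m n \<theta> t) (act (Hom C x p) m n \<theta> k)"
  obtains N where "N \<in> smap T (Hom C x p)" "\<And>n t. t \<in> simplices T n \<Longrightarrow> R n t (N n t)"
proof -
  define k where "k n t = (THE k. k \<in> hom x p n \<and> R n t k)" for n t
  have k: "k n t \<in> hom x p n \<and> R n t (k n t)" if "t \<in> simplices T n" for n t
    unfolding k_def by (rule theI'[OF ex[OF that]])
  show thesis
  proof
    show "(\<lambda>n. \<lambda>t\<in>simplices T n. k n t) \<in> smap T (Hom C x p)"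
    proof (rule smap_restrictI[OF T])
      show "k n t \<in> hom x p n" if "t \<in> simplices T n" for n t using k[OF that] by blast
      fix m n \<theta> t assume h: "\<theta> \<in> Delta_hom m n" "t \<in> simplices T n"
      have t': "act T m n \<theta> t \<in> simplices T m" using T h by simp
      have "act (Hom C x p) m n \<theta> (k n t) \<in> hom x p m" "R m (act T m n \<theta> t) (act (Hom C x p) m n \<theta> (k n t))"
        using nat[OF h(2,1)] k[OF h(2)] h by auto
      then show "k m (act T m n \<theta> t) = act (Hom C x p) m n \<theta> (k n t)" using ex[OF t'] k[OF t'] by blast
    qed
  qed (use k in auto)
qed

lemma hom_smap_act: "N \<in> smap T (Hom C x a) \<Longrightarrow> t \<in> simplices T n \<Longrightarrow> \<theta> \<in> Delta_hom m n \<Longrightarrow>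
   act (Hom C x a) m n \<theta> (N n t) = N m (act T m n \<theta> t)"
  by (simp add: smap_act)

lemma smap_into_pullback:
  assumes P: "is_pullback C a e b f g p q r" and T: "simplicial_set T" and x [simp]: "x \<in> Obj C"
    and L: "L \<in> smap T (Hom C x a)" and M: "M \<in> smap T (Hom C x e)"
    and eq: "\<And>n t. t \<in> simplices T n \<Longrightarrow> post x a b n f (L n t) = post x e b n g (M n t)"
  obtains N where "N \<in> smap T (Hom C x p)" "\<And>n t. t \<in> simplices T n \<Longrightarrow> post x p a n q (N n t) = L n t"
    "\<And>n t. t \<in> simplices T n \<Longrightarrow> post x p e n r (N n t) = M n t"
proof -
  note [simp] = pullbackD(1-8)[OF P] smap_closed[OF L] smap_closed[OF M] hom_smap_act[OF L] hom_smap_act[OF M]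
  obtain N where "N \<in> smap T (Hom C x p)"
    "\<And>n t. t \<in> simplices T n \<Longrightarrow> post x p a n q (N n t) = L n t \<and> post x p e n r (N n t) = M n t"
  proof (rule smap_by_uniqueness[OF T x])
    show "\<exists>!k. k \<in> hom x p n \<and> post x p a n q k = L n t \<and> post x p e n r k = M n t" if "t \<in> simplices T n" for n t
      by (rule pullback_ex1[OF P x]) (simp_all add: that eq)
  qed (simp_all add: act_post[symmetric])
  then show thesis using that by blast
qed

lemma smap_into_product:
  assumes P: "is_product C I a p \<pi>" and T: "simplicial_set T" and x [simp]: "x \<in> Obj C"
    and L: "\<And>i. i \<in> I \<Longrightarrow> L i \<in> smap T (Hom C x (a i))"
  obtains N where "N \<in> smap T (Hom C x p)" "\<And>i n t. i \<in> I \<Longrightarrow> t \<in> simplices T n \<Longrightarrow> post x p (a i) n (\<pi> i) (N n t) = L i n t"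
proof -
  note [simp] = productD[OF P] smap_closed[OF L] hom_smap_act[OF L]
  obtain N where "N \<in> smap T (Hom C x p)"
    "\<And>n t. t \<in> simplices T n \<Longrightarrow> (\<forall>i\<in>I. post x p (a i) n (\<pi> i) (N n t) = L i n t)"
  proof (rule smap_by_uniqueness[OF T x])
    show "\<exists>!k. k \<in> hom x p n \<and> (\<forall>i\<in>I. post x p (a i) n (\<pi> i) k = L i n t)" if "t \<in> simplices T n" for n t
      by (rule product_ex1[OF P x]) (simp_all add: that)
  qed (simp_all add: act_post[symmetric])
  then show thesis using that by blast
qed

lemma smap_into_sequential_limit:
  assumes P: "is_sequential_limit C e p l \<pi>" and T: "simplicial_set T" and x [simp]: "x \<in> Obj C"
    and L: "\<And>j. L j \<in> smap T (Hom C x (e j))"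
    and eq: "\<And>j n t. t \<in> simplices T n \<Longrightarrow> post x (e (Suc j)) (e j) n (p j) (L (Suc j) n t) = L j n t"
  obtains N where "N \<in> smap T (Hom C x l)" "\<And>j n t. t \<in> simplices T n \<Longrightarrow> post x l (e j) n (\<pi> j) (N n t) = L j n t"
proof -
  note [simp] = sequential_limitD(1-4)[OF P] smap_closed[OF L] hom_smap_act[OF L]
  obtain N where "N \<in> smap T (Hom C x l)"
    "\<And>n t. t \<in> simplices T n \<Longrightarrow> (\<forall>j. post x l (e j) n (\<pi> j) (N n t) = L j n t)"
  proof (rule smap_by_uniqueness[OF T x])
    show "\<exists>!k. k \<in> hom x l n \<and> (\<forall>j. post x l (e j) n (\<pi> j) k = L j n t)" if "t \<in> simplices T n" for n t
      by (rule sequential_limit_ex1[OF P x]) (simp_all add: that eq)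
  qed (simp_all add: act_post[symmetric])
  then show thesis using that by blast
qed

lemma pullback_eqI:
  assumes P: "is_pullback C a e b f g p q r" and x: "x \<in> Obj C" and k: "k \<in> hom x p n" "k' \<in> hom x p n"
    and eq: "post x p a n q k = post x p a n q k'" "post x p e n r k = post x p e n r k'"
  shows "k = k'"
proof -
  note [simp] = pullbackD(1-8)[OF P] x k
  have "post x a b n f (post x p a n q k') = post x e b n g (post x p e n r k')"
    by (simp add: post_post pullbackD(9)[OF P])
  then have "\<exists>!z. z \<in> hom x p n \<and> post x p a n q z = post x p a n q k' \<and> post x p e n r z = post x p e n r k'"
    by (intro pullback_ex1[OF P x]) simp_all
  then show ?thesis using k eq by blast
qed

subsection \<open>Maps into cotensors\<close>

lemma cotensor_closed [simp]: "is_cotensor C U a c e \<Longrightarrow> x \<in> Obj C \<Longrightarrow> u \<in> simplices U k \<Longrightarrow> h \<in> hom x c k \<Longrightarrow>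
   Comp C x c a k (e k u) h \<in> hom x a k"
  using cotensorD by (metis comp_closed smap_closed)

lemma cotensor_act: "is_cotensor C U a c e \<Longrightarrow> x \<in> Obj C \<Longrightarrow> u \<in> simplices U k \<Longrightarrow> h \<in> hom x c k \<Longrightarrow> \<theta> \<in> Delta_hom m k \<Longrightarrow>
   act (Hom C x a) m k \<theta> (Comp C x c a k (e k u) h) = Comp C x c a m (e m (act U m k \<theta> u)) (act (Hom C x c) m k \<theta> h)"
  using cotensorD[of U a c e] smap_closed[of e U "Hom C c a" u k] by (simp add: comp_act smap_act)

text \<open>With \<open>cotensor_encode\<close> this is the adjunction between maps
  \<open>T \<rightarrow> Hom C x (a^V)\<close> and maps
  \<open>T \<times> V \<rightarrow> Hom C x a\<close> for arbitrary \<open>T\<close>; the definition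
  of a cotensor grants it when \<open>T\<close> is a simplex.\<close>

lemma cotensor_decode:
  assumes c: "is_cotensor C V a c e" and x [simp]: "x \<in> Obj C" and T: "simplicial_set T" and V: "simplicial_set V"
    and L: "L \<in> smap T (Hom C x c)"
  shows "(\<lambda>n. \<lambda>y\<in>simplices (prod_sset T V) n. Comp C x c a n (e n (snd y)) (L n (fst y))) \<in> smap (prod_sset T V) (Hom C x a)"
proof (rule smap_restrictI)
  show "simplicial_set (prod_sset T V)" using T V by (rule simplicial_set_prod)
qed (use smap_closed[OF L] in \<open>auto simp: cotensor_closed[OF c] cotensor_act[OF c] hom_smap_act[OF L]\<close>)

text \<open>A simplex \<open>t\<close> of \<open>T\<close> is a map from \<open>simplex n\<close>,
  along which \<open>f\<close> is pulled back. The cotensor classifies the result, and uniqueness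
  makes the classifying simplices natural in \<open>t\<close>.\<close>

lemma cotensor_encode:
  assumes c: "is_cotensor C V a c e" and x [simp]: "x \<in> Obj C" and T: "simplicial_set T" and V: "simplicial_set V"
    and f: "f \<in> smap (prod_sset T V) (Hom C x a)"
  obtains L where "L \<in> smap T (Hom C x c)"
    "\<And>n t v. t \<in> simplices T n \<Longrightarrow> v \<in> simplices V n \<Longrightarrow> Comp C x c a n (e n v) (L n t) = f n (t, v)"
proof -
  note [simp] = cotensorD(1,2)[OF c]
  interpret T: simplicial_set T by fact
  interpret V: simplicial_set V by fact
  have fa: "act (Hom C x a) m k \<theta> (f k (t, v)) = f m (act T m k \<theta> t, act V m k \<theta> v)"
    if "t \<in> simplices T k" "v \<in> simplices V k" "\<theta> \<in> Delta_hom m k" for t v k m \<theta>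
    using hom_smap_act[OF f, of "(t, v)" k \<theta> m] that by simp
  have fc: "f k (t, v) \<in> hom x a k" if "t \<in> simplices T k" "v \<in> simplices V k" for t v k
    using smap_closed[OF f, of "(t, v)" k] that by simp
  obtain L where L: "L \<in> smap T (Hom C x c)"
    "\<And>n t. t \<in> simplices T n \<Longrightarrow> (\<forall>k. \<forall>\<theta>\<in>Delta_hom k n. \<forall>v\<in>simplices V k.
       Comp C x c a k (e k v) (act (Hom C x c) k n \<theta> (L n t)) = f k (act T k n \<theta> t, v))"
  proof (rule smap_by_uniqueness[OF T x])
    fix n t assume t: "t \<in> simplices T n"
    let ?\<gamma> = "\<lambda>k. \<lambda>y\<in>simplices (prod_sset (simplex n) V) k. f k (act T k n (fst y) t, snd y)"
    have "?\<gamma> \<in> smap (prod_sset (simplex n) V) (Hom C x a)"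
      by (rule smap_restrictI[OF simplicial_set_prod[OF simplicial_set_simplex V]]) (use t in \<open>auto simp: fa fc T.act_comp T.act_closed V.act_closed\<close>)
    from cotensor_ex1[OF c x this] show "\<exists>!h. h \<in> hom x c n \<and> (\<forall>k. \<forall>\<theta>\<in>Delta_hom k n. \<forall>v\<in>simplices V k.
       Comp C x c a k (e k v) (act (Hom C x c) k n \<theta> h) = f k (act T k n \<theta> t, v))" by simp
  qed (auto simp: act_hom_act T.act_comp[symmetric])
  have "Comp C x c a n (e n v) (L n t) = f n (t, v)" if "t \<in> simplices T n" "v \<in> simplices V n" for n t v
    using L(2)[OF that(1), rule_format, of "\<lambda>i\<in>{..n}. i" n v] that smap_closed[OF L(1) that(1)] by (simp add: T.act_id)
  then show thesis using that L(1) by blast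
qed

text \<open>The test runs over simplices of \<open>T\<close> and \<open>V\<close> of equal dimension
  only; the \<open>\<theta>\<close> of the universal property is absorbed by passing to the
  restriction of \<open>t\<close> along \<open>\<theta>\<close>.\<close>

lemma cotensor_smap_eqI:
  assumes c: "is_cotensor C V a c e" and x [simp]: "x \<in> Obj C" and T: "simplicial_set T" and V: "simplicial_set V"
    and L: "L \<in> smap T (Hom C x c)" and L': "L' \<in> smap T (Hom C x c)"
    and eq: "\<And>n t v. t \<in> simplices T n \<Longrightarrow> v \<in> simplices V n \<Longrightarrow> Comp C x c a n (e n v) (L n t) = Comp C x c a n (e n v) (L' n t)"
    and t: "t \<in> simplices T n"
  shows "L n t = L' n t"
proof -
  note [simp] = cotensorD(1,2)[OF c]
  let ?\<gamma> = "\<lambda>k. \<lambda>y\<in>simplices (prod_sset (simplex n) V) k. Comp C x c a k (e k (snd y)) (act (Hom C x c) k n (fst y) (L n t))"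
  have "?\<gamma> \<in> smap (prod_sset (simplex n) V) (Hom C x a)"
    by (rule smap_restrictI[OF simplicial_set_prod[OF simplicial_set_simplex V]])
      (use t smap_closed[OF L] in \<open>auto simp: cotensor_closed[OF c] cotensor_act[OF c] act_hom_act\<close>)
  note ex = cotensor_ex1[OF c x this]
  have "Comp C x c a k (e k v) (act (Hom C x c) k n \<theta> (L' n t)) = Comp C x c a k (e k v) (act (Hom C x c) k n \<theta> (L n t))"
    if "\<theta> \<in> Delta_hom k n" "v \<in> simplices V k" for k \<theta> v
    using eq[of "act T k n \<theta> t" k v] that t T by (simp add: hom_smap_act[OF L] hom_smap_act[OF L'])
  then show ?thesis using ex smap_closed[OF L t] smap_closed[OF L' t] by auto
qed

end

subsection \<open>Pushout products\<close>

text \<open>The union of \<open>S \<times> V\<close> and \<open>T \<times> U\<close>, the domain of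
  the pushout product of two inclusions. Forming it inside \<open>T \<times> V\<close> avoids
  quotients.\<close>

definition pushout_prod :: "'s sset \<Rightarrow> 's sset \<Rightarrow> 't sset \<Rightarrow> 't sset \<Rightarrow> ('s \<times> 't) sset" where
  "pushout_prod S T U V = (prod_sset T V)\<lparr>simplices := \<lambda>m. {(t, y) \<in> simplices T m \<times> simplices V m.
     t \<in> simplices S m \<or> y \<in> simplices U m}\<rparr>"

lemma pushout_prod_simps [simp]:
  "(t, y) \<in> simplices (pushout_prod S T U V) m \<longleftrightarrow>
     t \<in> simplices T m \<and> y \<in> simplices V m \<and> (t \<in> simplices S m \<or> y \<in> simplices U m)"
  "act (pushout_prod S T U V) = act (prod_sset T V)"
  by (auto simp: pushout_prod_def)

lemma pushout_prod_subsset: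
  assumes "subsset S T" "subsset U V" "simplicial_set T" "simplicial_set V"
  shows "subsset (pushout_prod S T U V) (prod_sset T V)"
  using assms subsset_act_closed[OF assms(1)] subsset_act_closed[OF assms(2)] unfolding subsset_def[of "pushout_prod S T U V"]
  by (auto simp: pushout_prod_def)

lemma pushout_prod_glue:
  assumes S: "subsset S T" and U: "subsset U V" and T: "simplicial_set T" and V: "simplicial_set V"
    and f: "f \<in> smap (prod_sset S V) X" and g: "g \<in> smap (prod_sset T U) X"
    and eq: "\<And>m t y. t \<in> simplices S m \<Longrightarrow> y \<in> simplices U m \<Longrightarrow> f m (t, y) = g m (t, y)"
  obtains u where "u \<in> smap (pushout_prod S T U V) X"
    "\<And>m t y. t \<in> simplices S m \<Longrightarrow> y \<in> simplices V m \<Longrightarrow> u m (t, y) = f m (t, y)"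
    "\<And>m t y. t \<in> simplices T m \<Longrightarrow> y \<in> simplices U m \<Longrightarrow> u m (t, y) = g m (t, y)"
proof -
  have s: "simplicial_set (pushout_prod S T U V)"
    using pushout_prod_subsset[OF S U T V] simplicial_set_prod[OF T V] by (rule subsset_simplicial_set)
  let ?u = "\<lambda>m y. if fst y \<in> simplices S m then f m y else g m y"
  have fc: "f m (t, y) \<in> simplices X m" if "t \<in> simplices S m" "y \<in> simplices V m" for m t y
    using smap_closed[OF f, of "(t, y)" m] that by simp
  have gc: "g m (t, y) \<in> simplices X m" if "t \<in> simplices T m" "y \<in> simplices U m" for m t y
    using smap_closed[OF g, of "(t, y)" m] that by simp
  have fa: "act X m k \<theta> (f k (t, y)) = f m (act T m k \<theta> t, act V m k \<theta> y)"
    if "t \<in> simplices S k" "y \<in> simplices V k" "\<theta> \<in> Delta_hom m k" for m k \<theta> t y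
    using smap_act[OF f that(3), of "(t, y)"] that by (simp add: subsset_act[OF S])
  have ga: "act X m k \<theta> (g k (t, y)) = g m (act T m k \<theta> t, act V m k \<theta> y)"
    if "t \<in> simplices T k" "y \<in> simplices U k" "\<theta> \<in> Delta_hom m k" for m k \<theta> t y
    using smap_act[OF g that(3), of "(t, y)"] that by (simp add: subsset_act[OF U])
  have "(\<lambda>m. \<lambda>y\<in>simplices (pushout_prod S T U V) m. ?u m y) \<in> smap (pushout_prod S T U V) X"
  proof (rule smap_restrictI[OF s])
    show "?u m y \<in> simplices X m" if "y \<in> simplices (pushout_prod S T U V) m" for m y
      using that by (cases y) (auto simp: fc gc)
    fix m n \<theta> x assume h: "\<theta> \<in> Delta_hom m n" "x \<in> simplices (pushout_prod S T U V) n"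
    obtain t y where x: "x = (t, y)" by (cases x)
    show "?u m (act (pushout_prod S T U V) m n \<theta> x) = act X m n \<theta> (?u n x)"
    proof (cases "t \<in> simplices S n")
      case True then show ?thesis using h x by (simp add: fa subsset_act_closed[OF S])
    next
      case False
      then have "y \<in> simplices U n" using h x by auto
      then have "act V m n \<theta> y \<in> simplices U m" using h(1) by (simp add: subsset_act_closed[OF U])
      then show ?thesis using False h x \<open>y \<in> simplices U n\<close> by (simp add: ga eq)
    qed
  qed
  moreover have "t \<in> simplices S m \<Longrightarrow> t \<in> simplices T m" "y \<in> simplices U m \<Longrightarrow> y \<in> simplices V m" for t y m
    using subsset_closed[OF S] subsset_closed[OF U] by blast+
  ultimately show thesis using that eq by (auto simp: restrict_def)
qed

text \<open>An isomorphism of pairs carries lifting problems back and forth. It mediates between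
  simplicial sets over \<open>nat \<Rightarrow> nat\<close> and their copies over
  \<open>'u\<close>.\<close>

lemma rlp_transport:
  assumes e: "e \<in> smap T T'" and d: "d \<in> smap T' T" and de: "\<And>n t. t \<in> simplices T n \<Longrightarrow> d n (e n t) = t"
    and S: "subsset S T" and S': "subsset S' T'" and T: "simplicial_set T" "simplicial_set T'"
    and eS: "\<And>n t. t \<in> simplices S n \<Longrightarrow> e n t \<in> simplices S' n" and dS: "\<And>n t. t \<in> simplices S' n \<Longrightarrow> d n t \<in> simplices S n"
    and r: "rlp S' T' E B p"
    and ed: "\<And>n t. t \<in> simplices T' n \<Longrightarrow> e n (d n t) = t"
  shows "rlp S T E B p"
  unfolding rlp_def
proof (intro ballI impI)
  fix u v assume u: "u \<in> smap S E" and v: "v \<in> smap T B" and eq: "\<forall>m. \<forall>s\<in>simplices S m. p m (u m s) = v m s"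
  have d': "(\<lambda>n. \<lambda>t\<in>simplices S' n. d n t) \<in> smap S' S"
    by (rule smap_restrictI[OF subsset_simplicial_set[OF S' T(2)]])
      (auto simp: dS subsset_act[OF S] subsset_act[OF S'] smap_act[OF d] subsset_closed[OF S'])
  have u': "(\<lambda>n. \<lambda>t\<in>simplices S' n. u n (d n t)) \<in> smap S' E"
    using smap_compose[OF d' u subsset_simplicial_set[OF S' T(2)]] by (simp cong: restrict_cong)
  have v': "(\<lambda>n. \<lambda>t\<in>simplices T' n. v n (d n t)) \<in> smap T' B"
    by (rule smap_compose[OF d v T(2)])
  obtain w where w: "w \<in> smap T' E" and wu: "\<And>m s. s \<in> simplices S' m \<Longrightarrow> w m s = u m (d m s)"
    and pw: "\<And>m t. t \<in> simplices T' m \<Longrightarrow> p m (w m t) = v m (d m t)"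
  proof -
    have "\<forall>m. \<forall>s\<in>simplices S' m. p m ((\<lambda>t\<in>simplices S' m. u m (d m t)) s) = (\<lambda>t\<in>simplices T' m. v m (d m t)) s"
      using eq subsset_closed[OF S'] dS by auto
    then obtain w where "w \<in> smap T' E" "\<forall>m. \<forall>s\<in>simplices S' m. w m s = (\<lambda>t\<in>simplices S' m. u m (d m t)) s"
      "\<forall>m. \<forall>t\<in>simplices T' m. p m (w m t) = (\<lambda>t\<in>simplices T' m. v m (d m t)) t"
      using r[unfolded rlp_def, rule_format, OF u' v'] by blast
    then show thesis using that[of w] by auto
  qed
  have "(\<lambda>n. \<lambda>t\<in>simplices T n. w n (e n t)) \<in> smap T E" by (rule smap_compose[OF e w T(1)])
  moreover have "w m (e m s) = u m s" if "s \<in> simplices S m" for m s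
    using wu[OF eS[OF that]] de[OF subsset_closed[OF S that]] by simp
  moreover have "p m (w m (e m t)) = v m t" if "t \<in> simplices T m" for m t
    using pw[OF smap_closed[OF e that]] de[OF that] by simp
  ultimately show "\<exists>w\<in>smap T E. (\<forall>m. \<forall>s\<in>simplices S m. w m s = u m s) \<and> (\<forall>m. \<forall>t\<in>simplices T m. p m (w m t) = v m t)"
    using subsset_closed[OF S] by (intro bexI[of _ "\<lambda>n. \<lambda>t\<in>simplices T n. w n (e n t)"]) auto
qed

section \<open>Lifting properties of functors and their stability under limits\<close>

context simplicial_category
begin

text \<open>Imposed on all hom simplicial sets at once, the property passes to enriched limits,
  since \<open>Hom C x -\<close> turns these into limits of simplicial sets.\<close>

definition lifts where
  "lifts S T e b p \<longleftrightarrow> (\<forall>x\<in>Obj C. rlp S T (Hom C x e) (Hom C x b) (post_map C x e b p))"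

lemma liftsD:
  assumes l: "lifts S T e b p" and S: "subsset S T" and x: "x \<in> Obj C" and u: "u \<in> smap S (Hom C x e)" and v: "v \<in> smap T (Hom C x b)"
    and eq: "\<And>m s. s \<in> simplices S m \<Longrightarrow> post x e b m p (u m s) = v m s"
  obtains w where "w \<in> smap T (Hom C x e)" "\<And>m s. s \<in> simplices S m \<Longrightarrow> w m s = u m s"
    "\<And>m t. t \<in> simplices T m \<Longrightarrow> post x e b m p (w m t) = v m t"
proof -
  have "\<forall>m. \<forall>s\<in>simplices S m. post_map C x e b p m (u m s) = v m s"
    using eq smap_closed[OF u] by auto
  then obtain w where w: "w \<in> smap T (Hom C x e)" "\<forall>m. \<forall>s\<in>simplices S m. w m s = u m s"
    "\<forall>m. \<forall>t\<in>simplices T m. post_map C x e b p m (w m t) = v m t"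
    using l x u v unfolding lifts_def rlp_def by blast
  have "post x e b m p (w m t) = v m t" if "t \<in> simplices T m" for m t
    using w(3)[rule_format, OF that] smap_closed[OF w(1) that] by simp
  then show thesis using that[of w] w(1,2) by auto
qed

lemma liftsI:
  assumes "\<And>x u v. x \<in> Obj C \<Longrightarrow> u \<in> smap S (Hom C x e) \<Longrightarrow> v \<in> smap T (Hom C x b) \<Longrightarrow>
    (\<And>m s. s \<in> simplices S m \<Longrightarrow> post x e b m p (u m s) = v m s) \<Longrightarrow>
    \<exists>w\<in>smap T (Hom C x e). (\<forall>m. \<forall>s\<in>simplices S m. w m s = u m s) \<and> (\<forall>m. \<forall>t\<in>simplices T m. post x e b m p (w m t) = v m t)"
  shows "lifts S T e b p"
  unfolding lifts_def rlp_def
proof (intro ballI impI)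
  fix x u v assume h: "x \<in> Obj C" "u \<in> smap S (Hom C x e)" "v \<in> smap T (Hom C x b)"
    "\<forall>m. \<forall>s\<in>simplices S m. post_map C x e b p m (u m s) = v m s"
  have "post x e b m p (u m s) = v m s" if "s \<in> simplices S m" for m s
    using h(4)[rule_format, OF that] smap_closed[OF h(2) that] by simp
  from assms[OF h(1-3) this] obtain w where "w\<in>smap T (Hom C x e)" "\<forall>m. \<forall>s\<in>simplices S m. w m s = u m s"
    "\<forall>m. \<forall>t\<in>simplices T m. post x e b m p (w m t) = v m t" by blast
  then show "\<exists>w\<in>smap T (Hom C x e). (\<forall>m. \<forall>s\<in>simplices S m. w m s = u m s) \<and> (\<forall>m. \<forall>t\<in>simplices T m. post_map C x e b p m (w m t) = v m t)"
    using smap_closed[of w T "Hom C x e"] by (intro bexI[of _ w]) auto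
qed

text \<open>The problem is pushed forward to \<open>g\<close>, solved there, and the solution is
  paired with \<open>v\<close>; agreement with \<open>u\<close> on \<open>S\<close> holds because it
  holds after both projections.\<close>

lemma lifts_pullback:
  assumes P: "is_pullback C a e b f g p q r" and S: "subsset S T" and T: "simplicial_set T" and l: "lifts S T e b g"
  shows "lifts S T p a q"
proof (rule liftsI)
  note [simp] = pullbackD(1-8)[OF P]
  fix x u v assume x [simp]: "x \<in> Obj C" and u: "u \<in> smap S (Hom C x p)" and v: "v \<in> smap T (Hom C x a)"
    and eq: "\<And>m s. s \<in> simplices S m \<Longrightarrow> post x p a m q (u m s) = v m s"
  note [simp] = smap_closed[OF u] smap_closed[OF v] hom_smap_act[OF u] hom_smap_act[OF v]
  have sS: "simplicial_set S" by (rule subsset_simplicial_set[OF S T])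
  have u': "(\<lambda>m. \<lambda>s\<in>simplices S m. post x p e m r (u m s)) \<in> smap S (Hom C x e)"
    by (rule smap_restrictI[OF sS]) (simp_all add: act_post)
  have v': "(\<lambda>m. \<lambda>s\<in>simplices T m. post x a b m f (v m s)) \<in> smap T (Hom C x b)"
    by (rule smap_restrictI[OF T]) (simp_all add: act_post)
  obtain w where w: "w \<in> smap T (Hom C x e)" and wS: "\<And>m s. s \<in> simplices S m \<Longrightarrow> w m s = post x p e m r (u m s)"
    and wT: "\<And>m t. t \<in> simplices T m \<Longrightarrow> post x e b m g (w m t) = post x a b m f (v m t)"
    by (rule liftsD[OF l S x u' v'])
       (auto simp: subsset_closed[OF S] eq[symmetric] post_post pullbackD(9)[OF P])
  obtain N where N: "N \<in> smap T (Hom C x p)" "\<And>n t. t \<in> simplices T n \<Longrightarrow> post x p a n q (N n t) = v n t"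
    "\<And>n t. t \<in> simplices T n \<Longrightarrow> post x p e n r (N n t) = w n t"
    by (rule smap_into_pullback[OF P T x v w]) (auto simp: wT)
  have "N m s = u m s" if "s \<in> simplices S m" for m s
    by (rule pullback_eqI[OF P x, of _ m]) (use that N subsset_closed[OF S that] in \<open>simp_all add: eq wS\<close>)
  then show "\<exists>w\<in>smap T (Hom C x p). (\<forall>m. \<forall>s\<in>simplices S m. w m s = u m s) \<and> (\<forall>m. \<forall>t\<in>simplices T m. post x p a m q (w m t) = v m t)"
    using N by (intro bexI[of _ N]) auto
qed

text \<open>The lifts in the factors are chosen independently; a product asks for no compatibility
  between them.\<close>

lemma lifts_product:
  assumes P: "is_product C I a p \<pi>" and Q: "is_product C I b q \<rho>" and S: "subsset S T" and T: "simplicial_set T"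
    and l: "\<And>i. i \<in> I \<Longrightarrow> lifts S T (a i) (b i) (f i)" and f [simp]: "\<And>i. i \<in> I \<Longrightarrow> f i \<in> hom (a i) (b i) 0"
    and h [simp]: "h \<in> hom p q 0" and comm: "\<And>i. i \<in> I \<Longrightarrow> post p q (b i) 0 (\<rho> i) h = post p (a i) (b i) 0 (f i) (\<pi> i)"
  shows "lifts S T p q h"
proof (rule liftsI)
  note [simp] = productD[OF P] productD[OF Q]
  fix x u v assume x [simp]: "x \<in> Obj C" and u: "u \<in> smap S (Hom C x p)" and v: "v \<in> smap T (Hom C x q)"
    and eq: "\<And>m s. s \<in> simplices S m \<Longrightarrow> post x p q m h (u m s) = v m s"
  note [simp] = smap_closed[OF u] smap_closed[OF v] hom_smap_act[OF u] hom_smap_act[OF v]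
  have sS: "simplicial_set S" by (rule subsset_simplicial_set[OF S T])
  have "\<forall>i. \<exists>w. i \<in> I \<longrightarrow> w \<in> smap T (Hom C x (a i)) \<and> (\<forall>m. \<forall>s\<in>simplices S m. w m s = post x p (a i) m (\<pi> i) (u m s)) \<and>
    (\<forall>m. \<forall>t\<in>simplices T m. post x (a i) (b i) m (f i) (w m t) = post x q (b i) m (\<rho> i) (v m t))"
  proof
    fix i show "\<exists>w. i \<in> I \<longrightarrow> w \<in> smap T (Hom C x (a i)) \<and> (\<forall>m. \<forall>s\<in>simplices S m. w m s = post x p (a i) m (\<pi> i) (u m s)) \<and>
      (\<forall>m. \<forall>t\<in>simplices T m. post x (a i) (b i) m (f i) (w m t) = post x q (b i) m (\<rho> i) (v m t))"
    proof (cases "i \<in> I")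
      case True
      note [simp] = True
      have u': "(\<lambda>m. \<lambda>s\<in>simplices S m. post x p (a i) m (\<pi> i) (u m s)) \<in> smap S (Hom C x (a i))"
        by (rule smap_restrictI[OF sS]) (simp_all add: act_post)
      have v': "(\<lambda>m. \<lambda>s\<in>simplices T m. post x q (b i) m (\<rho> i) (v m s)) \<in> smap T (Hom C x (b i))"
        by (rule smap_restrictI[OF T]) (simp_all add: act_post)
      obtain w where "w \<in> smap T (Hom C x (a i))" "\<And>m s. s \<in> simplices S m \<Longrightarrow> w m s = post x p (a i) m (\<pi> i) (u m s)"
        "\<And>m t. t \<in> simplices T m \<Longrightarrow> post x (a i) (b i) m (f i) (w m t) = post x q (b i) m (\<rho> i) (v m t)"
        by (rule liftsD[OF l[OF True] S x u' v'])
           (auto simp: subsset_closed[OF S] eq[symmetric] post_post comm)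
      then show ?thesis by (intro exI[of _ w]) blast
    qed simp
  qed
  then obtain w where w: "\<And>i. i \<in> I \<Longrightarrow> w i \<in> smap T (Hom C x (a i))"
    and wS: "\<And>i m s. i \<in> I \<Longrightarrow> s \<in> simplices S m \<Longrightarrow> w i m s = post x p (a i) m (\<pi> i) (u m s)"
    and wT: "\<And>i m t. i \<in> I \<Longrightarrow> t \<in> simplices T m \<Longrightarrow> post x (a i) (b i) m (f i) (w i m t) = post x q (b i) m (\<rho> i) (v m t)"
    by metis
  obtain N where N: "N \<in> smap T (Hom C x p)" and N\<pi>: "\<And>i n t. i \<in> I \<Longrightarrow> t \<in> simplices T n \<Longrightarrow> post x p (a i) n (\<pi> i) (N n t) = w i n t"
    using smap_into_product[OF P T x w] by blast
  have eqI: "k = k'" if "is_product C I a' p' \<pi>'" "k \<in> hom x p' n" "k' \<in> hom x p' n"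
     "\<And>i. i \<in> I \<Longrightarrow> post x p' (a' i) n (\<pi>' i) k = post x p' (a' i) n (\<pi>' i) k'" for a' p' \<pi>' k k' n
  proof -
    have "\<exists>!z. z \<in> hom x p' n \<and> (\<forall>i\<in>I. post x p' (a' i) n (\<pi>' i) z = post x p' (a' i) n (\<pi>' i) k')"
      by (rule product_ex1[OF that(1) x]) (use productD[OF that(1)] that(3) in simp)
    then show ?thesis using that(2-4) by blast
  qed
  have "N m s = u m s" if s: "s \<in> simplices S m" for m s
    by (rule eqI[OF P, of _ m]) (use s subsset_closed[OF S s] smap_closed[OF N] in \<open>simp_all add: N\<pi> wS\<close>)
  moreover have "post x p q m h (N m t) = v m t" if t: "t \<in> simplices T m" for m t
  proof (rule eqI[OF Q])
    show "post x q (b i) m (\<rho> i) (post x p q m h (N m t)) = post x q (b i) m (\<rho> i) (v m t)" if [simp]: "i \<in> I" for i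
      using t smap_closed[OF N t] wT[OF that t] by (simp add: post_post comm) (simp add: post_post[symmetric] N\<pi>)
  qed (use t smap_closed[OF N t] in simp_all)
  ultimately show "\<exists>w\<in>smap T (Hom C x p). (\<forall>m. \<forall>s\<in>simplices S m. w m s = u m s) \<and> (\<forall>m. \<forall>t\<in>simplices T m. post x p q m h (w m t) = v m t)"
    using N by (intro bexI[of _ N]) auto
qed

text \<open>The lift is built up the tower: each stage solves a problem over the lift found at the
  stage before. This makes the lifts compatible, so that they define a map to the limit.\<close>

lemma lifts_sequential_limit:
  assumes P: "is_sequential_limit C e p l \<pi>" and S: "subsset S T" and T: "simplicial_set T"
    and lp: "\<And>k. lifts S T (e (Suc k)) (e k) (p k)"
  shows "lifts S T l (e 0) (\<pi> 0)"
proof (rule liftsI)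
  note [simp] = sequential_limitD(1-4)[OF P]
  fix x u v assume x [simp]: "x \<in> Obj C" and u: "u \<in> smap S (Hom C x l)" and v: "v \<in> smap T (Hom C x (e 0))"
    and eq: "\<And>m s. s \<in> simplices S m \<Longrightarrow> post x l (e 0) m (\<pi> 0) (u m s) = v m s"
  note [simp] = smap_closed[OF u] smap_closed[OF v] hom_smap_act[OF u] hom_smap_act[OF v]
  have sS: "simplicial_set S" by (rule subsset_simplicial_set[OF S T])
  have uk: "(\<lambda>m. \<lambda>s\<in>simplices S m. post x l (e k) m (\<pi> k) (u m s)) \<in> smap S (Hom C x (e k))" for k
    by (rule smap_restrictI[OF sS]) (simp_all add: act_post)
  \<comment> \<open>The clause for \<open>k = 0\<close> pins the bottom of the chosen sequence to
    the given \<open>v\<close>.\<close>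
  define Q where "Q k w \<longleftrightarrow> w \<in> smap T (Hom C x (e k)) \<and> (\<forall>m. \<forall>s\<in>simplices S m. w m s = post x l (e k) m (\<pi> k) (u m s)) \<and>
     (k = 0 \<longrightarrow> w = v)" for k w
  have "\<exists>w. \<forall>k. Q k (w k) \<and> (\<forall>m. \<forall>t\<in>simplices T m. post x (e (Suc k)) (e k) m (p k) (w (Suc k) m t) = w k m t)"
  proof (rule dependent_nat_choice)
    show "\<exists>w. Q 0 w" using v eq by (auto simp: Q_def)
    fix w k assume w: "Q k w"
    then have w1: "w \<in> smap T (Hom C x (e k))"
      and w2: "\<And>m s. s \<in> simplices S m \<Longrightarrow> w m s = post x l (e k) m (\<pi> k) (u m s)" by (auto simp: Q_def)
    obtain w' where "w' \<in> smap T (Hom C x (e (Suc k)))"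
      "\<And>m s. s \<in> simplices S m \<Longrightarrow> w' m s = (\<lambda>s\<in>simplices S m. post x l (e (Suc k)) m (\<pi> (Suc k)) (u m s)) s"
      "\<And>m t. t \<in> simplices T m \<Longrightarrow> post x (e (Suc k)) (e k) m (p k) (w' m t) = w m t"
      by (rule liftsD[OF lp S x uk w1]) (simp_all add: w2 post_post sequential_limitD(5)[OF P])
    then show "\<exists>w'. Q (Suc k) w' \<and> (\<forall>m. \<forall>t\<in>simplices T m. post x (e (Suc k)) (e k) m (p k) (w' m t) = w m t)"
      by (intro exI[of _ w']) (auto simp: Q_def)
  qed
  then obtain W where W': "\<And>k. Q k (W k)"
    and pW: "\<And>k m t. t \<in> simplices T m \<Longrightarrow> post x (e (Suc k)) (e k) m (p k) (W (Suc k) m t) = W k m t" by blast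
  have W0: "W 0 = v" and W: "W k \<in> smap T (Hom C x (e k))"
    and WS: "s \<in> simplices S m \<Longrightarrow> W k m s = post x l (e k) m (\<pi> k) (u m s)" for k m s
    using W'[of 0] W'[of k] by (auto simp: Q_def)
  obtain N where N: "N \<in> smap T (Hom C x l)" and N\<pi>: "\<And>k n t. t \<in> simplices T n \<Longrightarrow> post x l (e k) n (\<pi> k) (N n t) = W k n t"
    by (rule smap_into_sequential_limit[OF P T x W pW]) (assumption | rule that)+
  have "N m s = u m s" if s: "s \<in> simplices S m" for m s
  proof -
    have "\<exists>!z. z \<in> hom x l m \<and> (\<forall>k. post x l (e k) m (\<pi> k) z = post x l (e k) m (\<pi> k) (u m s))"
      by (rule sequential_limit_ex1[OF P x]) (simp_all add: s post_post sequential_limitD(5)[OF P])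
    moreover have "post x l (e k) m (\<pi> k) (N m s) = post x l (e k) m (\<pi> k) (u m s)" for k
      using N\<pi>[OF subsset_closed[OF S s]] WS[OF s] by simp
    moreover have "N m s \<in> hom x l m" "u m s \<in> hom x l m"
      using smap_closed[OF N subsset_closed[OF S s]] s by simp_all
    ultimately show ?thesis by blast
  qed
  then show "\<exists>w\<in>smap T (Hom C x l). (\<forall>m. \<forall>s\<in>simplices S m. w m s = u m s) \<and> (\<forall>m. \<forall>t\<in>simplices T m. post x l (e 0) m (\<pi> 0) (w m t) = v m t)"
    using N N\<pi> W0 by (intro bexI[of _ N]) auto
qed

end

section \<open>Leibniz cotensors and lifting\<close>

context simplicial_category
begin

lemma cotensor_eqI:
  assumes c: "is_cotensor C V a c e" and x [simp]: "x \<in> Obj C" and V: "simplicial_set V"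
    and h [simp]: "h \<in> hom x c n" and h' [simp]: "h' \<in> hom x c n"
    and eq: "\<And>k \<theta> v. \<theta> \<in> Delta_hom k n \<Longrightarrow> v \<in> simplices V k \<Longrightarrow>
      Comp C x c a k (e k v) (act (Hom C x c) k n \<theta> h) = Comp C x c a k (e k v) (act (Hom C x c) k n \<theta> h')"
  shows "h = h'"
proof -
  note [simp] = cotensorD(1,2)[OF c]
  let ?\<gamma> = "\<lambda>k. \<lambda>y\<in>simplices (prod_sset (simplex n) V) k. Comp C x c a k (e k (snd y)) (act (Hom C x c) k n (fst y) h)"
  have "?\<gamma> \<in> smap (prod_sset (simplex n) V) (Hom C x a)"
    by (rule smap_restrictI[OF simplicial_set_prod[OF simplicial_set_simplex V]])
      (use V in \<open>auto simp: cotensor_closed[OF c] cotensor_act[OF c] act_hom_act\<close>)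
  from cotensor_ex1[OF c x this]
  have "\<exists>!z. z \<in> hom x c n \<and> (\<forall>k. \<forall>\<theta>\<in>Delta_hom k n. \<forall>v\<in>simplices V k.
      Comp C x c a k (e k v) (act (Hom C x c) k n \<theta> z) = Comp C x c a k (e k v) (act (Hom C x c) k n \<theta> h))"
    by simp
  then show ?thesis using h h' eq[symmetric] by blast
qed

lemma cotensor_map_ex:
  assumes aV: "is_cotensor C V a aV eaV" and bU: "is_cotensor C U b bU ebU" and i: "i \<in> smap U V" and f [simp]: "f \<in> hom a b 0"
    and U: "simplicial_set U"
  obtains m where "is_cotensor_map C U i a b f aV eaV bU ebU m"
proof -
  note [simp] = cotensorD(1,2)[OF aV] cotensorD(1,2)[OF bU]
  note e = smap_closed[OF cotensorD(3)[OF aV]] hom_smap_act[OF cotensorD(3)[OF aV]]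
  let ?\<gamma> = "\<lambda>k. \<lambda>y\<in>simplices (prod_sset (simplex 0) U) k. post aV a b k f (eaV k (i k (snd y)))"
  have "?\<gamma> \<in> smap (prod_sset (simplex 0) U) (Hom C aV b)"
    by (rule smap_restrictI[OF simplicial_set_prod[OF simplicial_set_simplex U]])
      (use U smap_closed[OF i] in \<open>auto simp: e act_post smap_act[OF i]\<close>)
  from ex1_implies_ex[OF cotensor_ex1[OF bU _ this]]
  obtain m where "m \<in> hom aV bU 0" "\<forall>k. \<forall>\<theta>\<in>Delta_hom k 0. \<forall>u\<in>simplices U k. Comp C aV bU b k (ebU k u) (act (Hom C aV bU) k 0 \<theta> m) = ?\<gamma> k (\<theta>, u)"
    by auto
  then have "is_cotensor_map C U i a b f aV eaV bU ebU m"
    using smap_closed[OF i] by (auto simp: is_cotensor_map_def Delta_hom_0 act_0_eq_degen e)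
  then show thesis by (rule that)
qed

text \<open>The defining equation of a cotensor map concerns the universal map out of
  \<open>aV\<close>; composing with \<open>z\<close> gives it on generalized elements, the form
  needed in hom simplicial sets.\<close>

lemma cotensor_map_Comp:
  assumes m: "is_cotensor_map C U i a b f aV eaV bU ebU m" and aV: "is_cotensor C V a aV eaV" and bU: "is_cotensor C U b bU ebU"
    and i: "\<And>k u. u \<in> simplices U k \<Longrightarrow> i k u \<in> simplices V k" and f [simp]: "f \<in> hom a b 0"
    and x [simp]: "x \<in> Obj C" and u [simp]: "u \<in> simplices U k" and z [simp]: "z \<in> hom x aV k"
  shows "Comp C x bU b k (ebU k u) (post x aV bU k m z) = post x a b k f (Comp C x aV a k (eaV k (i k u)) z)"
proof -
  note [simp] = cotensorD(1,2)[OF aV] cotensorD(1,2)[OF bU] i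
    smap_closed[OF cotensorD(3)[OF aV]] smap_closed[OF cotensorD(3)[OF bU]]
  have [simp]: "m \<in> hom aV bU 0" using m by (simp add: is_cotensor_map_def)
  have "Comp C aV bU b k (ebU k u) (degen (Hom C aV bU) k m) = post aV a b k f (eaV k (i k u))"
    using m u by (auto simp: is_cotensor_map_def)
  then show ?thesis by (simp add: Comp_post post_Comp)
qed

end

locale leibniz_map = infinity_cosmos K \<kappa> isof
  for K :: "('o, 'u) scat" and \<kappa> :: "'k rel" and isof +
  fixes U V :: "'u sset" and e b g eU ueU eV ueV bU ubU bV ubV ei gU bi gV P q r h
  assumes U: "small_sset \<kappa> U" and V: "small_sset \<kappa> V" and UV: "subsset U V"
    and e [simp]: "e \<in> Obj K" and b [simp]: "b \<in> Obj K" and g [simp]: "g \<in> hom e b 0"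
    and eU: "is_cotensor K U e eU ueU" and eV: "is_cotensor K V e eV ueV"
    and bU: "is_cotensor K U b bU ubU" and bV: "is_cotensor K V b bV ubV"
    and ei: "is_cotensor_map K U (incl U) e e (Ident K e) eV ueV eU ueU ei"
    and bi: "is_cotensor_map K U (incl U) b b (Ident K b) bV ubV bU ubU bi"
    and gU: "is_cotensor_map K U (\<lambda>n u. u) e b g eU ueU bU ubU gU"
    and gV: "is_cotensor_map K V (\<lambda>n v. v) e b g eV ueV bV ubV gV"
    and P: "is_pullback K eU bV bU gU bi P q r"
    and h [simp]: "h \<in> hom eV P 0" and qh: "post eV P eU 0 q h = ei" and rh: "post eV P bV 0 r h = gV"
begin

lemma objs [simp]: "eU \<in> Obj K" "eV \<in> Obj K" "bU \<in> Obj K" "bV \<in> Obj K" "P \<in> Obj K"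
  using cotensorD(2)[OF eU] cotensorD(2)[OF eV] cotensorD(2)[OF bU] cotensorD(2)[OF bV] pullbackD(4)[OF P] by auto

lemma maps [simp]: "ei \<in> hom eV eU 0" "bi \<in> hom bV bU 0" "gU \<in> hom eU bU 0" "gV \<in> hom eV bV 0" "q \<in> hom P eU 0" "r \<in> hom P bV 0"
  using ei bi gU gV pullbackD[OF P] by (auto simp: is_cotensor_map_def)

lemma ssets [simp]: "simplicial_set U" "simplicial_set V"
  using U V by (auto simp: small_sset_def)

lemma U_V [simp]: "y \<in> simplices U k \<Longrightarrow> y \<in> simplices V k"
  by (rule subsset_closed[OF UV])

lemmas cl [simp] = cotensor_closed[OF eU] cotensor_closed[OF eV] cotensor_closed[OF bU] cotensor_closed[OF bV]

lemma ev:
  assumes [simp]: "x \<in> Obj K"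
  shows ev_ei: "y \<in> simplices U k \<Longrightarrow> z \<in> hom x eV k \<Longrightarrow> Comp K x eU e k (ueU k y) (post x eV eU k ei z) = Comp K x eV e k (ueV k y) z"
    and ev_bi: "y \<in> simplices U k \<Longrightarrow> z' \<in> hom x bV k \<Longrightarrow> Comp K x bU b k (ubU k y) (post x bV bU k bi z') = Comp K x bV b k (ubV k y) z'"
    and ev_gU: "y \<in> simplices U k \<Longrightarrow> z'' \<in> hom x eU k \<Longrightarrow> Comp K x bU b k (ubU k y) (post x eU bU k gU z'') = post x e b k g (Comp K x eU e k (ueU k y) z'')"
    and ev_gV: "v \<in> simplices V k \<Longrightarrow> z \<in> hom x eV k \<Longrightarrow> Comp K x bV b k (ubV k v) (post x eV bV k gV z) = post x e b k g (Comp K x eV e k (ueV k v) z)"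
  using cotensor_map_Comp[OF ei eV eU _ ident_closed[OF e] assms, of y k z]
    cotensor_map_Comp[OF bi bV bU _ ident_closed[OF b] assms, of y k z']
    cotensor_map_Comp[OF gU eU bU _ g assms, of y k z'']
    cotensor_map_Comp[OF gV eV bV _ g assms, of v k z]
  by simp_all

text \<open>The two-variable adjunction between product and cotensor: a map from \<open>T\<close> to
  \<open>e^V\<close> is a map from \<open>T \<times> V\<close> to \<open>e\<close>, so a lifting
  problem of \<open>S \<subseteq> T\<close> against the Leibniz cotensor \<open>h\<close> is a
  problem of the pushout product against \<open>g\<close>, and solutions correspond.\<close>

theorem lifts_iff:
  assumes S: "subsset S T" and T: "simplicial_set T"
  shows "lifts S T eV P h \<longleftrightarrow> lifts (pushout_prod S T U V) (prod_sset T V) e b g"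
proof
  have sS: "simplicial_set S" by (rule subsset_simplicial_set[OF S T])
  have ST: "s \<in> simplices S m \<Longrightarrow> s \<in> simplices T m" for s m by (rule subsset_closed[OF S])
  have pp: "subsset (pushout_prod S T U V) (prod_sset T V)" by (rule pushout_prod_subsset[OF S UV T ssets(2)])
  have qh': "post x P eU n q (post x eV P n h z) = post x eV eU n ei z" if "x \<in> Obj K" "z \<in> hom x eV n" for x n z
    using that by (simp add: post_post qh)
  have rh': "post x P bV n r (post x eV P n h z) = post x eV bV n gV z" if "x \<in> Obj K" "z \<in> hom x eV n" for x n z
    using that by (simp add: post_post rh)
  have pb: "post x eU bU n gU (post x P eU n q z) = post x bV bU n bi (post x P bV n r z)" if "x \<in> Obj K" "z \<in> hom x P n" for x n z
    using that by (simp add: post_post pullbackD(9)[OF P])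
  {
    assume l: "lifts (pushout_prod S T U V) (prod_sset T V) e b g"
    show "lifts S T eV P h"
    proof (rule liftsI)
      fix x u v assume x [simp]: "x \<in> Obj K" and u: "u \<in> smap S (Hom K x eV)" and v: "v \<in> smap T (Hom K x P)"
        and eq: "\<And>m s. s \<in> simplices S m \<Longrightarrow> post x eV P m h (u m s) = v m s"
      note [simp] = smap_closed[OF u] smap_closed[OF v]
      \<comment> \<open>The problem for \<open>h\<close> unfolds into three maps: \<open>u\<close>
        gives one on \<open>S \<times> V\<close>, and the two projections of \<open>v\<close> give
        one on \<open>T \<times> U\<close> and, downstairs, one on \<open>T \<times> V\<close>. The
        first two glue on the pushout product.\<close>
      let ?f = "\<lambda>n. \<lambda>y\<in>simplices (prod_sset S V) n. Comp K x eV e n (ueV n (snd y)) (u n (fst y))"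
      have f: "?f \<in> smap (prod_sset S V) (Hom K x e)" by (rule cotensor_decode[OF eV x sS ssets(2) u])
      let ?v1 = "\<lambda>n. \<lambda>t\<in>simplices T n. post x P eU n q (v n t)"
      have v1: "?v1 \<in> smap T (Hom K x eU)"
        by (rule smap_restrictI[OF T]) (simp_all add: act_post hom_smap_act[OF v])
      let ?v2 = "\<lambda>n. \<lambda>t\<in>simplices T n. post x P bV n r (v n t)"
      have v2: "?v2 \<in> smap T (Hom K x bV)"
        by (rule smap_restrictI[OF T]) (simp_all add: act_post hom_smap_act[OF v])
      let ?g = "\<lambda>n. \<lambda>y\<in>simplices (prod_sset T U) n. Comp K x eU e n (ueU n (snd y)) (?v1 n (fst y))"
      have g': "?g \<in> smap (prod_sset T U) (Hom K x e)" by (rule cotensor_decode[OF eU x T ssets(1) v1])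
      let ?B = "\<lambda>n. \<lambda>y\<in>simplices (prod_sset T V) n. Comp K x bV b n (ubV n (snd y)) (?v2 n (fst y))"
      have B: "?B \<in> smap (prod_sset T V) (Hom K x b)" by (rule cotensor_decode[OF bV x T ssets(2) v2])
      obtain w where w: "w \<in> smap (pushout_prod S T U V) (Hom K x e)"
        and wf: "\<And>m t y. t \<in> simplices S m \<Longrightarrow> y \<in> simplices V m \<Longrightarrow> w m (t, y) = ?f m (t, y)"
        and wg: "\<And>m t y. t \<in> simplices T m \<Longrightarrow> y \<in> simplices U m \<Longrightarrow> w m (t, y) = ?g m (t, y)"
      proof (rule pushout_prod_glue[OF S UV T ssets(2) f g'])
        show "?f m (t, y) = ?g m (t, y)" if "t \<in> simplices S m" "y \<in> simplices U m" for m t y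
          using that ST[OF that(1)] by (simp add: eq[symmetric] qh' ev_ei)
      qed (rule that)
      have "post x e b m g (w m s) = ?B m s" if "s \<in> simplices (pushout_prod S T U V) m" for m s
      proof -
        obtain t y where s: "s = (t, y)" by (cases s)
        with that have ty: "t \<in> simplices T m" "y \<in> simplices V m" "t \<in> simplices S m \<or> y \<in> simplices U m" by auto
        from ty(3) show ?thesis
        proof
          assume "t \<in> simplices S m"
          then show ?thesis using ty s by (simp add: wf eq[symmetric] rh' ev_gV)
        next
          assume y: "y \<in> simplices U m"
          then show ?thesis using ty s by (simp add: wg ev_gU[symmetric] pb ev_bi)
        qed
      qed
      then obtain W where W: "W \<in> smap (prod_sset T V) (Hom K x e)"
        and Ww: "\<And>m s. s \<in> simplices (pushout_prod S T U V) m \<Longrightarrow> W m s = w m s"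
        and WB: "\<And>m y. y \<in> simplices (prod_sset T V) m \<Longrightarrow> post x e b m g (W m y) = ?B m y"
        using liftsD[OF l pp x w B] by blast
      obtain L where L: "L \<in> smap T (Hom K x eV)"
        and LW: "\<And>n t v. t \<in> simplices T n \<Longrightarrow> v \<in> simplices V n \<Longrightarrow> Comp K x eV e n (ueV n v) (L n t) = W n (t, v)"
        by (rule cotensor_encode[OF eV x T ssets(2) W]) (rule that)
      note [simp] = smap_closed[OF L]
      have "(\<lambda>n. \<lambda>t\<in>simplices S n. L n t) n s = u n s" if s: "s \<in> simplices S n" for n s
        by (rule cotensor_smap_eqI[OF eV x sS ssets(2) smap_restrict_subsset[OF S L] u _ s])
           (simp add: LW ST Ww wf)
      then have Lu: "L m s = u m s" if "s \<in> simplices S m" for m s using that by simp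
      \<comment> \<open>Equality in the pullback is tested on both projections, and there by
        evaluation: on \<open>U\<close> with values in \<open>e\<close>, on \<open>V\<close> with
        values in \<open>b\<close>.\<close>
      have "post x eV P m h (L m t) = v m t" if t: "t \<in> simplices T m" for m t
      proof (rule pullback_eqI[OF P x])
        have L1: "(\<lambda>n. \<lambda>t\<in>simplices T n. post x eV eU n ei (L n t)) \<in> smap T (Hom K x eU)"
          by (rule smap_restrictI[OF T]) (simp_all add: act_post hom_smap_act[OF L])
        have "(\<lambda>n. \<lambda>t\<in>simplices T n. post x eV eU n ei (L n t)) m t = ?v1 m t"
          by (rule cotensor_smap_eqI[OF eU x T ssets(1) L1 v1 _ t]) (simp add: ev_ei LW Ww wg)
        then show "post x P eU m q (post x eV P m h (L m t)) = post x P eU m q (v m t)" using t by (simp add: qh')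
        have L2: "(\<lambda>n. \<lambda>t\<in>simplices T n. post x eV bV n gV (L n t)) \<in> smap T (Hom K x bV)"
          by (rule smap_restrictI[OF T]) (simp_all add: act_post hom_smap_act[OF L])
        have "(\<lambda>n. \<lambda>t\<in>simplices T n. post x eV bV n gV (L n t)) m t = ?v2 m t"
          by (rule cotensor_smap_eqI[OF bV x T ssets(2) L2 v2 _ t]) (simp add: ev_gV LW WB)
        then show "post x P bV m r (post x eV P m h (L m t)) = post x P bV m r (v m t)" using t by (simp add: rh')
      qed (use t in simp_all)
      with L Lu show "\<exists>w\<in>smap T (Hom K x eV). (\<forall>m. \<forall>s\<in>simplices S m. w m s = u m s) \<and> (\<forall>m. \<forall>t\<in>simplices T m. post x eV P m h (w m t) = v m t)"
        by (intro bexI[of _ L]) auto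
    qed
  }
  {
    assume l: "lifts S T eV P h"
    show "lifts (pushout_prod S T U V) (prod_sset T V) e b g"
    proof (rule liftsI)
      fix x u B assume x [simp]: "x \<in> Obj K" and u: "u \<in> smap (pushout_prod S T U V) (Hom K x e)" and B: "B \<in> smap (prod_sset T V) (Hom K x b)"
        and eq: "\<And>m s. s \<in> simplices (pushout_prod S T U V) m \<Longrightarrow> post x e b m g (u m s) = B m s"
      \<comment> \<open>In the other direction \<open>u\<close> is restricted to the two halves of
        the pushout product, and each half is transposed separately.\<close>
      have uS: "(\<lambda>m. \<lambda>y\<in>simplices (prod_sset S V) m. u m y) \<in> smap (prod_sset S V) (Hom K x e)"
      proof (rule smap_restrictI[OF simplicial_set_prod[OF sS ssets(2)]])
        show "u n y \<in> hom x e n" if "y \<in> simplices (prod_sset S V) n" for n y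
          using that by (cases y) (simp add: smap_closed[OF u] ST)
        show "u m (act (prod_sset S V) m n \<theta> y) = act (Hom K x e) m n \<theta> (u n y)"
          if "\<theta> \<in> Delta_hom m n" "y \<in> simplices (prod_sset S V) n" for m n \<theta> y
          using that smap_act[OF u that(1), of y] by (cases y) (simp add: ST subsset_act[OF S])
      qed
      have uT: "(\<lambda>m. \<lambda>y\<in>simplices (prod_sset T U) m. u m y) \<in> smap (prod_sset T U) (Hom K x e)"
      proof (rule smap_restrictI[OF simplicial_set_prod[OF T ssets(1)]])
        show "u n y \<in> hom x e n" if "y \<in> simplices (prod_sset T U) n" for n y
          using that by (cases y) (simp add: smap_closed[OF u])
        show "u m (act (prod_sset T U) m n \<theta> y) = act (Hom K x e) m n \<theta> (u n y)"
          if "\<theta> \<in> Delta_hom m n" "y \<in> simplices (prod_sset T U) n" for m n \<theta> y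
          using that smap_act[OF u that(1), of y] by (cases y) (simp add: subsset_act[OF UV])
      qed
      obtain f where f: "f \<in> smap S (Hom K x eV)"
        and fu: "\<And>n t v. t \<in> simplices S n \<Longrightarrow> v \<in> simplices V n \<Longrightarrow> Comp K x eV e n (ueV n v) (f n t) = u n (t, v)"
        by (rule cotensor_encode[OF eV x sS ssets(2) uS]) auto
      obtain g' where g': "g' \<in> smap T (Hom K x eU)"
        and gu: "\<And>n t v. t \<in> simplices T n \<Longrightarrow> v \<in> simplices U n \<Longrightarrow> Comp K x eU e n (ueU n v) (g' n t) = u n (t, v)"
        by (rule cotensor_encode[OF eU x T ssets(1) uT]) auto
      obtain B' where B': "B' \<in> smap T (Hom K x bV)"
        and BB: "\<And>n t v. t \<in> simplices T n \<Longrightarrow> v \<in> simplices V n \<Longrightarrow> Comp K x bV b n (ubV n v) (B' n t) = B n (t, v)"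
        by (rule cotensor_encode[OF bV x T ssets(2) B]) (rule that)
      note [simp] = smap_closed[OF f] smap_closed[OF g'] smap_closed[OF B']
      have 1: "(\<lambda>n. \<lambda>t\<in>simplices T n. post x eU bU n gU (g' n t)) \<in> smap T (Hom K x bU)"
        by (rule smap_restrictI[OF T]) (simp_all add: act_post hom_smap_act[OF g'])
      have 2: "(\<lambda>n. \<lambda>t\<in>simplices T n. post x bV bU n bi (B' n t)) \<in> smap T (Hom K x bU)"
        by (rule smap_restrictI[OF T]) (simp_all add: act_post hom_smap_act[OF B'])
      have 12: "post x eU bU n gU (g' n t) = post x bV bU n bi (B' n t)" if t: "t \<in> simplices T n" for n t
        using cotensor_smap_eqI[OF bU x T ssets(1) 1 2 _ t] t by (simp add: ev_gU ev_bi gu BB eq)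
      obtain N where N: "N \<in> smap T (Hom K x P)" and qN: "\<And>n t. t \<in> simplices T n \<Longrightarrow> post x P eU n q (N n t) = g' n t"
        and rN: "\<And>n t. t \<in> simplices T n \<Longrightarrow> post x P bV n r (N n t) = B' n t"
        by (rule smap_into_pullback[OF P T x g' B' 12]) (assumption, rule that)
      have hf: "post x eV P m h (f m s) = N m s" if s: "s \<in> simplices S m" for m s
      proof (rule pullback_eqI[OF P x])
        have 1: "(\<lambda>n. \<lambda>t\<in>simplices S n. post x eV eU n ei (f n t)) \<in> smap S (Hom K x eU)"
          by (rule smap_restrictI[OF sS]) (simp_all add: act_post hom_smap_act[OF f])
        have "post x eV eU m ei (f m s) = g' m s"
          using cotensor_smap_eqI[OF eU x sS ssets(1) 1 smap_restrict_subsset[OF S g'] _ s] s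
          by (simp add: ev_ei fu gu ST)
        then show "post x P eU m q (post x eV P m h (f m s)) = post x P eU m q (N m s)" using s by (simp add: qh' qN ST)
        have 2: "(\<lambda>n. \<lambda>t\<in>simplices S n. post x eV bV n gV (f n t)) \<in> smap S (Hom K x bV)"
          by (rule smap_restrictI[OF sS]) (simp_all add: act_post hom_smap_act[OF f])
        have "post x eV bV m gV (f m s) = B' m s"
          using cotensor_smap_eqI[OF bV x sS ssets(2) 2 smap_restrict_subsset[OF S B'] _ s] s
          by (simp add: ev_gV fu BB ST eq)
        then show "post x P bV m r (post x eV P m h (f m s)) = post x P bV m r (N m s)" using s by (simp add: rh' rN ST)
      qed (use s ST[OF s] smap_closed[OF N] in simp_all)
      obtain w where w: "w \<in> smap T (Hom K x eV)" and wf: "\<And>m s. s \<in> simplices S m \<Longrightarrow> w m s = f m s"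
        and wN: "\<And>m t. t \<in> simplices T m \<Longrightarrow> post x eV P m h (w m t) = N m t"
        by (rule liftsD[OF l S x f N hf]) (assumption, rule that)
      note [simp] = smap_closed[OF w]
      let ?W = "\<lambda>n. \<lambda>y\<in>simplices (prod_sset T V) n. Comp K x eV e n (ueV n (snd y)) (w n (fst y))"
      have W: "?W \<in> smap (prod_sset T V) (Hom K x e)" by (rule cotensor_decode[OF eV x T ssets(2) w])
      have "?W m s = u m s" if "s \<in> simplices (pushout_prod S T U V) m" for m s
      proof -
        obtain t y where s: "s = (t, y)" by (cases s)
        with that have ty: "t \<in> simplices T m" "y \<in> simplices V m" "t \<in> simplices S m \<or> y \<in> simplices U m" by auto
        from ty(3) show ?thesis
        proof
          assume "t \<in> simplices S m"
          then show ?thesis using ty s by (simp add: wf fu)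
        next
          assume y: "y \<in> simplices U m"
          have "Comp K x eV e m (ueV m y) (w m t) = Comp K x eU e m (ueU m y) (post x P eU m q (post x eV P m h (w m t)))"
            using ty y by (simp add: qh' ev_ei)
          then show ?thesis using ty y s by (simp add: wN qN gu)
        qed
      qed
      moreover have "post x e b m g (?W m s) = B m s" if sm: "s \<in> simplices (prod_sset T V) m" for m s
      proof -
        obtain t y where s: "s = (t, y)" "t \<in> simplices T m" "y \<in> simplices V m" using sm by auto
        have "post x e b m g (Comp K x eV e m (ueV m y) (w m t)) = Comp K x bV b m (ubV m y) (post x P bV m r (post x eV P m h (w m t)))"
          using s by (simp add: rh' ev_gV)
        then show ?thesis using s by (simp add: wN rN BB)
      qed
      ultimately show "\<exists>w\<in>smap (prod_sset T V) (Hom K x e). (\<forall>m. \<forall>s\<in>simplices (pushout_prod S T U V) m. w m s = u m s) \<and>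
          (\<forall>m. \<forall>t\<in>simplices (prod_sset T V) m. post x e b m g (w m t) = B m t)"
        using W by (intro bexI[of _ ?W]) auto
    qed
  }
qed

lemma h_isof:
  assumes "g \<in> isof e b"
  shows "h \<in> isof eV P"
  using fibration_class.Cl_leibniz[OF fibration_class_isof U V UV e b assms eU eV bU bV ei bi gU gV P h qh rh] .

end

lemma image_subsset:
  assumes S: "subsset S T" and e: "e \<in> smap T T'"
  shows "subsset (T'\<lparr>simplices := \<lambda>n. e n ` simplices S n\<rparr>) T'"
  unfolding subsset_def
proof (intro conjI allI ballI)
  show "simplices (T'\<lparr>simplices := \<lambda>n. e n ` simplices S n\<rparr>) n \<subseteq> simplices T' n" for n
    using smap_closed[OF e] subsset_closed[OF S] by auto
  fix m n \<theta> y assume h: "\<theta> \<in> Delta_hom m n" "y \<in> simplices (T'\<lparr>simplices := \<lambda>n. e n ` simplices S n\<rparr>) n"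
  then obtain x where x: "y = e n x" "x \<in> simplices S n" by auto
  have "act T' m n \<theta> y = e m (act T m n \<theta> x)" using smap_act[OF e h(1) subsset_closed[OF S x(2)]] x by simp
  then show "act T' m n \<theta> y \<in> simplices (T'\<lparr>simplices := \<lambda>n. e n ` simplices S n\<rparr>) m"
    using subsset_act_closed[OF S h(1) x(2)] by auto
qed simp

lemma small_subsset: "subsset S T \<Longrightarrow> small_sset \<kappa> T \<Longrightarrow> small_sset \<kappa> S"
  unfolding small_sset_def using subsset_simplicial_set small_subset by (metis subsset_def)

lemma endpoint_subsset: "e \<in> {0, 1} \<Longrightarrow> subsset (iso_nerve_endpoint e) iso_nerve"
  by (auto simp: subsset_def iso_nerve_endpoint_def const_map_iso_nerve)

lemma simplices_endpoint [simp]: "simplices (iso_nerve_endpoint e) n = {const_map e n}"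
  by (simp add: iso_nerve_endpoint_def)

lemma prod_map_smap:
  assumes f: "f \<in> smap T T'" and S: "simplicial_set S" and T: "simplicial_set T"
  shows "(\<lambda>n. \<lambda>y\<in>simplices (prod_sset S T) n. (fst y, f n (snd y))) \<in> smap (prod_sset S T) (prod_sset S T')"
  by (rule smap_restrictI[OF simplicial_set_prod[OF S T]]) (use f in \<open>auto simp: smap_act[OF f] smap_closed[OF f]\<close>)

section \<open>Leibniz cotensors in a cosmos and homotopy lifting\<close>

context sized_cosmos
begin

text \<open>The pullback is formed along the restriction \<open>bi\<close>, which is an isofibration
  for every \<open>b\<close>; so Leibniz cotensors exist for all functors \<open>g\<close>.\<close>

lemma leibniz_map_ex:
  fixes U V :: "'u sset"
  assumes U: "small_sset \<kappa> U" and V: "small_sset \<kappa> V" and UV: "subsset U V" and e: "e \<in> Obj K" and b: "b \<in> Obj K" and g: "g \<in> hom e b 0"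
  obtains eU ueU eV ueV bU ubU bV ubV ei gU bi gV P q r h where
    "leibniz_map K \<kappa> isof U V e b g eU ueU eV ueV bU ubU bV ubV ei gU bi gV P q r h"
proof -
  have U': "U \<in> Obj (SSet \<kappa>)" "simplicial_set U" and V': "V \<in> Obj (SSet \<kappa>)" "simplicial_set V" using U V by (auto simp: small_sset_def)
  obtain eU ueU where eU: "is_cotensor K U e eU ueU" using ex_cotensor[OF U'(1) e] by blast
  obtain eV ueV where eV: "is_cotensor K V e eV ueV" using ex_cotensor[OF V'(1) e] by blast
  obtain bU ubU where bU: "is_cotensor K U b bU ubU" using ex_cotensor[OF U'(1) b] by blast
  obtain bV ubV where bV: "is_cotensor K V b bV ubV" using ex_cotensor[OF V'(1) b] by blast
  note [simp] = cotensorD(1,2)[OF eU] cotensorD(1,2)[OF eV] cotensorD(1,2)[OF bU] cotensorD(1,2)[OF bV] g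
  obtain ei where ei: "is_cotensor_map K U (incl U) e e (Ident K e) eV ueV eU ueU ei"
    by (rule cotensor_map_ex[OF eV eU subsset_incl[OF UV] _ U'(2)]) auto
  obtain bi where bi: "is_cotensor_map K U (incl U) b b (Ident K b) bV ubV bU ubU bi"
    by (rule cotensor_map_ex[OF bV bU subsset_incl[OF UV] _ U'(2)]) auto
  have id: "incl U \<in> smap U U" "incl V \<in> smap V V" using U' V' by (auto intro: smap_restrictI)
  obtain gU where gU': "is_cotensor_map K U (incl U) e b g eU ueU bU ubU gU"
    by (rule cotensor_map_ex[OF eU bU id(1) g U'(2)])
  obtain gV where gV': "is_cotensor_map K V (incl V) e b g eV ueV bV ubV gV"
    by (rule cotensor_map_ex[OF eV bV id(2) g V'(2)])
  have gU: "is_cotensor_map K U (\<lambda>n u. u) e b g eU ueU bU ubU gU" and gV: "is_cotensor_map K V (\<lambda>n v. v) e b g eV ueV bV ubV gV"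
    using gU' gV' by (simp_all add: is_cotensor_map_def)
  have [simp]: "ei \<in> hom eV eU 0" "bi \<in> hom bV bU 0" "gU \<in> hom eU bU 0" "gV \<in> hom eV bV 0"
    using ei bi gU gV by (auto simp: is_cotensor_map_def)
  have "bi \<in> isof bV bU" by (rule isof_cotensor_restriction[OF U'(1) V'(1) UV bU bV bi])
  then obtain P q r where P: "is_pullback K eU bV bU gU bi P q r" using ex_pullback[of eU bV bU gU bi] by auto
  note UV' [simp] = subsset_closed[OF UV]
  have [simp]: "u \<in> simplices U k \<Longrightarrow> ueV k u \<in> hom eV e k" for u k
    using smap_closed[OF cotensorD(3)[OF eV]] UV' by blast
  \<comment> \<open>Both composites evaluate on \<open>U\<close> to \<open>g\<close> after the
    evaluation of \<open>eV\<close>.\<close>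
  have "post eV eU bU 0 gU ei = post eV bV bU 0 bi gV"
  proof (rule cotensor_eqI[OF bU _ U'(2)])
    fix k \<theta> u assume h: "\<theta> \<in> Delta_hom k 0" and u: "u \<in> simplices U k"
    note [simp] = u
    have "Comp K eV bU b k (ubU k u) (post eV eU bU k gU (degen (Hom K eV eU) k ei)) =
       post eV e b k g (Comp K eV eU e k (ueU k u) (post eV eV eU k ei (degen (Hom K eV eV) k (Ident K eV))))"
      using cotensor_map_Comp[OF gU eU bU _ g, of eV u k] by (simp add: post_degen_Ident)
    also have "\<dots> = post eV e b k g (ueV k u)"
      using cotensor_map_Comp[OF ei eV eU, of eV u k "degen (Hom K eV eV) k (Ident K eV)"] by simp
    also have "\<dots> = Comp K eV bV b k (ubV k u) (degen (Hom K eV bV) k gV)"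
      using cotensor_map_Comp[OF gV eV bV _ g, of eV u k "degen (Hom K eV eV) k (Ident K eV)"] by (simp add: post_degen_Ident)
    also have "\<dots> = Comp K eV bU b k (ubU k u) (post eV bV bU k bi (degen (Hom K eV bV) k gV))"
      using cotensor_map_Comp[OF bi bV bU, of eV u k "degen (Hom K eV bV) k gV"] cotensor_closed[OF bV, of eV u k "degen (Hom K eV bV) k gV"]
      by simp
    finally show "Comp K eV bU b k (ubU k u) (act (Hom K eV bU) k 0 \<theta> (post eV eU bU 0 gU ei)) =
        Comp K eV bU b k (ubU k u) (act (Hom K eV bU) k 0 \<theta> (post eV bV bU 0 bi gV))"
      using h by (simp add: Delta_hom_0 act_0_eq_degen degen_post)
  qed simp_all
  then obtain h where h: "h \<in> hom eV P 0" "post eV P eU 0 q h = ei" "post eV P bV 0 r h = gV"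
    using pullback_ex1[OF P, of eV ei 0 gV] by auto
  have "leibniz_map K \<kappa> isof U V e b g eU ueU eV ueV bU ubU bV ubV ei gU bi gV P q r h"
    by (intro leibniz_map.intro infinity_cosmos_axioms leibniz_map_axioms.intro U V UV e b g eU eV bU bV ei bi gU gV P h)
  then show thesis by (rule that)
qed

text \<open>Homotopy lifting: the adjoint form of the right lifting property of a Leibniz cotensor against an endpoint.\<close>

theorem isof_homotopy_lifting:
  assumes e [simp]: "e \<in> Obj K" and b [simp]: "b \<in> Obj K" and p: "p \<in> isof e b" and T: "small_sset \<kappa> T" and S: "subsset S T" and \<epsilon>: "\<epsilon> \<in> {0, 1}"
  shows "lifts (pushout_prod (iso_nerve_endpoint \<epsilon>) iso_nerve S T) (prod_sset iso_nerve T) e b p"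
proof -
  have sT: "simplicial_set T" using T by (simp add: small_sset_def)
  \<comment> \<open>Cotensors require simplicial sets over \<open>'u\<close>; \<open>T\<close> and
    its subobject \<open>S\<close> are copied together, so that the copy of \<open>S\<close> is
    again a subobject.\<close>
  obtain T' :: "'u sset" and en de where T': "small_sset \<kappa> T'" and en: "en \<in> smap T T'" and de: "de \<in> smap T' T"
    and dee: "\<And>n x. x \<in> simplices T n \<Longrightarrow> de n (en n x) = x" and ende: "\<And>n y. y \<in> simplices T' n \<Longrightarrow> en n (de n y) = y"
    using small_sset_copy[OF size T] by metis
  have sT': "simplicial_set T'" using T' by (simp add: small_sset_def)
  define S' where "S' = T'\<lparr>simplices := \<lambda>n. en n ` simplices S n\<rparr>"
  have S'1: "subsset S' T'" unfolding S'_def by (rule image_subsset[OF S en])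
  obtain eU ueU eV ueV bU ubU bV ubV ei gU bi gV P q r h where
    lm: "leibniz_map K \<kappa> isof S' T' e b p eU ueU eV ueV bU ubU bV ubV ei gU bi gV P q r h"
    using leibniz_map_ex[OF small_subsset[OF S'1 T'] T' S'1 e b isof_hom_closed[OF e b p]] by blast
  interpret L: leibniz_map K \<kappa> isof S' T' e b p eU ueU eV ueV bU ubU bV ubV ei gU bi gV P q r h by fact
  \<comment> \<open>The Leibniz cotensor \<open>h\<close> is an isofibration and hence lifts
    endpoints of the interval in every hom; transposing this yields the claim for the
    copies.\<close>
  have "qcat_isofibration (Hom K x eV) (Hom K x P) (post_map K x eV P h)" if "x \<in> Obj K" for x
    by (rule isof_hom[OF that]) (simp_all add: L.h_isof p)
  then have "lifts (iso_nerve_endpoint \<epsilon>) iso_nerve eV P h"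
    using \<epsilon> unfolding lifts_def qcat_isofibration_def by blast
  then have l: "lifts (pushout_prod (iso_nerve_endpoint \<epsilon>) iso_nerve S' T') (prod_sset iso_nerve T') e b p"
    by (simp add: L.lifts_iff[OF endpoint_subsset[OF \<epsilon>]])
  note [simp] = smap_closed[OF en] smap_closed[OF de] dee
  have S'm: "y \<in> simplices S' n \<longleftrightarrow> (\<exists>x\<in>simplices S n. y = en n x)" for y n by (auto simp: S'_def)
  have [simp]: "s \<in> simplices S n \<Longrightarrow> s \<in> simplices T n" for s n by (rule subsset_closed[OF S])
  show ?thesis
    unfolding lifts_def
  proof
    fix x assume x: "x \<in> Obj K"
    show "rlp (pushout_prod (iso_nerve_endpoint \<epsilon>) iso_nerve S T) (prod_sset iso_nerve T) (Hom K x e) (Hom K x b) (post_map K x e b p)"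
    proof (rule rlp_transport[OF prod_map_smap[OF en simplicial_set_iso_nerve sT] prod_map_smap[OF de simplicial_set_iso_nerve sT']])
      show "rlp (pushout_prod (iso_nerve_endpoint \<epsilon>) iso_nerve S' T') (prod_sset iso_nerve T') (Hom K x e) (Hom K x b) (post_map K x e b p)"
        using l x by (simp add: lifts_def)
      show "subsset (pushout_prod (iso_nerve_endpoint \<epsilon>) iso_nerve S T) (prod_sset iso_nerve T)"
        by (rule pushout_prod_subsset[OF endpoint_subsset[OF \<epsilon>] S simplicial_set_iso_nerve sT])
      show "subsset (pushout_prod (iso_nerve_endpoint \<epsilon>) iso_nerve S' T') (prod_sset iso_nerve T')"
        by (rule pushout_prod_subsset[OF endpoint_subsset[OF \<epsilon>] S'1 simplicial_set_iso_nerve sT'])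
    qed (auto simp: S'm simplicial_set_prod sT sT' ende)
  qed
qed

end

section \<open>Homotopies and equivalences\<close>

lemma iso_nerve_value: "t \<in> simplices iso_nerve n \<Longrightarrow> i \<le> n \<Longrightarrow> t i = 0 \<or> t i = 1"
  unfolding simplices_iso_nerve by (auto dest: PiE_mem)

lemma iso_nerve_eqI: "t \<in> simplices iso_nerve n \<Longrightarrow> t' \<in> simplices iso_nerve n \<Longrightarrow> (\<And>i. i \<le> n \<Longrightarrow> t i = t' i) \<Longrightarrow> t = t'"
  unfolding simplices_iso_nerve by (rule PiE_ext) auto

text \<open>Simplices of \<open>iso_nerve\<close> are arbitrary functions to \<open>{0, 1}\<close>,
  so any function of the endpoints acts on them pointwise. \<open>inot\<close> reverses the
  interval, and the multiplication \<open>imul\<close> contracts it to its endpoint 0. The nerve of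
  a single arrow would not admit the reversal.\<close>

definition inot where "inot n t = (\<lambda>i\<in>{..n}. 1 - t i :: nat)"
definition imul where "imul n s t = (\<lambda>i\<in>{..n}. s i * t i :: nat)"

lemma inot_closed [simp]: "t \<in> simplices iso_nerve n \<Longrightarrow> inot n t \<in> simplices iso_nerve n"
  using iso_nerve_value[of t n] by (auto simp: inot_def simplices_iso_nerve)

lemma imul_closed [simp]:
  assumes "s \<in> simplices iso_nerve n" "t \<in> simplices iso_nerve n"
  shows "imul n s t \<in> simplices iso_nerve n"
  unfolding simplices_iso_nerve imul_def
proof (rule PiE_I)
  fix i assume "i \<in> {..n}"
  then show "(\<lambda>i\<in>{..n}. s i * t i) i \<in> {0, 1}"
    using iso_nerve_value[OF assms(1), of i] iso_nerve_value[OF assms(2), of i] by auto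
qed simp

lemma inot_act: "\<theta> \<in> Delta_hom m n \<Longrightarrow> inot m (compose {..m} t \<theta>) = compose {..m} (inot n t) \<theta>"
  by (auto simp: inot_def compose_def fun_eq_iff Delta_hom_le)

lemma imul_act: "\<theta> \<in> Delta_hom m n \<Longrightarrow> imul m (compose {..m} s \<theta>) (compose {..m} t \<theta>) = compose {..m} (imul n s t) \<theta>"
  by (auto simp: imul_def compose_def fun_eq_iff Delta_hom_le)

lemma const_map_closed [simp]: "const_map 0 n \<in> simplices iso_nerve n" "const_map (Suc 0) n \<in> simplices iso_nerve n"
  using const_map_iso_nerve[of 0 n] const_map_iso_nerve[of 1 n] by simp_all

lemma const_map_neq [simp]: "const_map 0 n \<noteq> const_map (Suc 0) n" "const_map (Suc 0) n \<noteq> const_map 0 n"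
proof -
  have "const_map 0 n 0 \<noteq> const_map (Suc 0) n 0" by simp
  then show "const_map 0 n \<noteq> const_map (Suc 0) n" "const_map (Suc 0) n \<noteq> const_map 0 n" by metis+
qed

lemma inot_const [simp]: "inot n (const_map 0 n) = const_map (Suc 0) n" "inot n (const_map (Suc 0) n) = const_map 0 n"
  by (auto simp: inot_def const_map_def fun_eq_iff)

lemma imul_const [simp]:
  assumes "t \<in> simplices iso_nerve n"
  shows "imul n (const_map 0 n) t = const_map 0 n" "imul n t (const_map 0 n) = const_map 0 n"
    "imul n (const_map (Suc 0) n) t = t" "imul n t (const_map (Suc 0) n) = t"
proof -
  show "imul n (const_map 0 n) t = const_map 0 n" by (rule iso_nerve_eqI[of _ n]) (use assms in \<open>simp_all, simp add: imul_def\<close>)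
  show "imul n t (const_map 0 n) = const_map 0 n" by (rule iso_nerve_eqI[of _ n]) (use assms in \<open>simp_all, simp add: imul_def\<close>)
  show "imul n (const_map (Suc 0) n) t = t" by (rule iso_nerve_eqI[of _ n]) (use assms in \<open>simp_all, simp add: imul_def\<close>)
  show "imul n t (const_map (Suc 0) n) = t" by (rule iso_nerve_eqI[of _ n]) (use assms in \<open>simp_all, simp add: imul_def\<close>)
qed

definition iso_bd :: "(nat \<Rightarrow> nat) sset" where
  "iso_bd = iso_nerve \<lparr>simplices := \<lambda>m. {const_map 0 m, const_map 1 m}\<rparr>"

lemma simplices_iso_bd [simp]: "simplices iso_bd n = {const_map 0 n, const_map (Suc 0) n}"
  by (simp add: iso_bd_def)

lemma iso_bd_subsset: "subsset iso_bd iso_nerve"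
  by (auto simp: subsset_def iso_bd_def)

lemma simplicial_set_iso_bd [simp]: "simplicial_set iso_bd"
  by (rule subsset_simplicial_set[OF iso_bd_subsset]) simp

lemma act_iso_bd [simp]: "act iso_bd k m \<sigma> \<theta> = compose {..k} \<theta> \<sigma>"
  by (simp add: iso_bd_def)

lemma box_sides:
  assumes T: "simplicial_set T" and A: "A \<in> smap T X" and B: "B \<in> smap T X"
  shows "(\<lambda>n. \<lambda>y\<in>simplices (prod_sset T iso_bd) n. if snd y = const_map 0 n then A n (fst y) else B n (fst y)) \<in> smap (prod_sset T iso_bd) X"
  by (rule smap_restrictI[OF simplicial_set_prod[OF T simplicial_set_iso_bd]])
    (auto simp: smap_closed[OF A] smap_closed[OF B] smap_act[OF A] smap_act[OF B])

section \<open>The homotopy relation on functors and homotopy equivalences\<close>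

context sized_cosmos
begin

lemma hom_sset' [simp]: "a \<in> Obj K \<Longrightarrow> b \<in> Obj K \<Longrightarrow> simplicial_set (Hom K a b)"
  by (rule hom_sset)

lemma small_iso_nerve: "small_sset \<kappa> iso_nerve"
  unfolding small_sset_def simplices_iso_nerve by (auto intro!: small_finite[OF size] finite_PiE)

lemma smap_iso_const: "H \<in> smap iso_nerve (Hom K x a) \<Longrightarrow> \<epsilon> \<in> {0, 1} \<Longrightarrow> H n (const_map \<epsilon> n) = degen (Hom K x a) n (H 0 (const_map \<epsilon> 0))"
  using smap_act[of H iso_nerve "Hom K x a" "const_map 0 n" n 0 "const_map \<epsilon> 0"] const_map_iso_nerve[of \<epsilon> 0]
  by (simp add: degen_def)

text \<open>A single homotopy along the interval. By constants, reversal and box filling it is an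
  equivalence relation, so no zigzags occur.\<close>

definition path where
  "path x a f g \<longleftrightarrow> (\<exists>H\<in>smap iso_nerve (Hom K x a). H 0 (const_map 0 0) = f \<and> H 0 (const_map 1 0) = g)"

lemma path_smap:
  assumes "path x a f g" and \<Phi>: "\<Phi> \<in> smap (Hom K x a) (Hom K y b)"
  shows "path y b (\<Phi> 0 f) (\<Phi> 0 g)"
proof -
  obtain H where H: "H \<in> smap iso_nerve (Hom K x a)" "H 0 (const_map 0 0) = f" "H 0 (const_map 1 0) = g"
    using assms by (auto simp: path_def)
  show ?thesis unfolding path_def
    by (rule bexI[OF _ smap_compose[OF H(1) \<Phi> simplicial_set_iso_nerve]]) (use H in simp)
qed

lemma const_smap:
  assumes [simp]: "simplicial_set T" "x \<in> Obj K" "a \<in> Obj K" "f \<in> hom x a 0"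
  shows "(\<lambda>n. \<lambda>t\<in>simplices T n. degen (Hom K x a) n f) \<in> smap T (Hom K x a)"
  by (rule smap_restrictI) auto

lemma path_refl:
  assumes [simp]: "x \<in> Obj K" "a \<in> Obj K" "f \<in> hom x a 0"
  shows "path x a f f"
  unfolding path_def by (rule bexI[OF _ const_smap[OF simplicial_set_iso_nerve assms]]) simp

lemma inot_smap: "H \<in> smap iso_nerve X \<Longrightarrow> (\<lambda>n. \<lambda>t\<in>simplices iso_nerve n. H n (inot n t)) \<in> smap iso_nerve X"
  by (rule smap_restrictI) (simp_all add: smap_closed[of H iso_nerve X] inot_act smap_act[of H iso_nerve X, symmetric])

lemma path_sym:
  assumes "path x a f g"
  shows "path x a g f"
proof -
  obtain H where H: "H \<in> smap iso_nerve (Hom K x a)" "H 0 (const_map 0 0) = f" "H 0 (const_map 1 0) = g"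
    using assms by (auto simp: path_def)
  show ?thesis unfolding path_def by (rule bexI[OF _ inot_smap[OF H(1)]]) (use H in simp)
qed

lemma path_closed: "path x a f g \<Longrightarrow> f \<in> hom x a 0 \<and> g \<in> hom x a 0"
  unfolding path_def using smap_closed[of _ iso_nerve "Hom K x a"] by auto

lemma path_post: "path x a f g \<Longrightarrow> x \<in> Obj K \<Longrightarrow> a \<in> Obj K \<Longrightarrow> b \<in> Obj K \<Longrightarrow> p \<in> hom a b 0 \<Longrightarrow>
   path x b (post x a b 0 p f) (post x a b 0 p g)"
  using path_smap[OF _ post_map_smap[of x a b p]] path_closed[of x a f g] by fastforce

lemma pre_smap:
  assumes [simp]: "x \<in> Obj K" "y \<in> Obj K" "a \<in> Obj K" "k \<in> hom x y 0"
  shows "(\<lambda>n. \<lambda>z\<in>hom y a n. Comp K x y a n z (degen (Hom K x y) n k)) \<in> smap (Hom K y a) (Hom K x a)"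
  by (rule smap_restrictI) (simp_all add: comp_act)

lemma path_pre: "path y a f g \<Longrightarrow> x \<in> Obj K \<Longrightarrow> y \<in> Obj K \<Longrightarrow> a \<in> Obj K \<Longrightarrow> k \<in> hom x y 0 \<Longrightarrow>
   path x a (post x y a 0 f k) (post x y a 0 g k)"
  using path_smap[OF _ pre_smap[of x y a k]] path_closed[of y a f g] by (force simp: Comp_0_eq_post)

text \<open>In a square with coordinates \<open>(r, t)\<close> the side \<open>r = 0\<close> is
  \<open>H\<close>, and the sides \<open>t = 0\<close> and \<open>t = 1\<close> are \<open>A\<close>
  and \<open>B\<close>, all over \<open>T\<close>. Together they form a map on
  \<open>{0} \<times> I \<union> I \<times> {0, 1}\<close>; homotopy lifting against this inclusion
  fills the square over \<open>T\<close>, and \<open>D\<close> is the side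
  \<open>r = 1\<close>.\<close>

lemma fill_box:
  assumes e [simp]: "e \<in> Obj K" and b [simp]: "b \<in> Obj K" and p: "p \<in> isof e b" and x [simp]: "x \<in> Obj K"
    and H: "H \<in> smap iso_nerve (Hom K x e)" and A: "A \<in> smap iso_nerve (Hom K x e)" and B: "B \<in> smap iso_nerve (Hom K x e)"
    and T: "T \<in> smap (prod_sset iso_nerve iso_nerve) (Hom K x b)"
    and HA: "\<And>n. H n (const_map 0 n) = A n (const_map 0 n)" and HB: "\<And>n. H n (const_map (Suc 0) n) = B n (const_map 0 n)"
    and pH: "\<And>n t. t \<in> simplices iso_nerve n \<Longrightarrow> post x e b n p (H n t) = T n (const_map 0 n, t)"
    and pA: "\<And>n t. t \<in> simplices iso_nerve n \<Longrightarrow> post x e b n p (A n t) = T n (t, const_map 0 n)"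
    and pB: "\<And>n t. t \<in> simplices iso_nerve n \<Longrightarrow> post x e b n p (B n t) = T n (t, const_map (Suc 0) n)"
  obtains D where "D \<in> smap iso_nerve (Hom K x e)" "D 0 (const_map 0 0) = A 0 (const_map (Suc 0) 0)"
    "D 0 (const_map (Suc 0) 0) = B 0 (const_map (Suc 0) 0)"
    "\<And>n t. t \<in> simplices iso_nerve n \<Longrightarrow> post x e b n p (D n t) = T n (const_map (Suc 0) n, t)"
proof -
  let ?E = "iso_nerve_endpoint 0"
  have E: "subsset ?E iso_nerve" by (rule endpoint_subsset) simp
  have sE: "simplicial_set ?E" by (rule subsset_simplicial_set[OF E]) simp
  have f: "(\<lambda>n. \<lambda>y\<in>simplices (prod_sset ?E iso_nerve) n. H n (snd y)) \<in> smap (prod_sset ?E iso_nerve) (Hom K x e)"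
    by (rule smap_restrictI[OF simplicial_set_prod[OF sE simplicial_set_iso_nerve]])
       (auto simp: smap_closed[OF H] hom_smap_act[OF H] subsset_act[OF E])
  have l: "lifts (pushout_prod ?E iso_nerve iso_bd iso_nerve) (prod_sset iso_nerve iso_nerve) e b p"
    by (rule isof_homotopy_lifting[OF e b p small_iso_nerve iso_bd_subsset]) simp
  obtain u where u: "u \<in> smap (pushout_prod ?E iso_nerve iso_bd iso_nerve) (Hom K x e)"
    and uf: "\<And>m y. y \<in> simplices iso_nerve m \<Longrightarrow> u m (const_map 0 m, y) = H m y"
    and ug: "\<And>m t. t \<in> simplices iso_nerve m \<Longrightarrow> u m (t, const_map 0 m) = A m t"
      "\<And>m t. t \<in> simplices iso_nerve m \<Longrightarrow> u m (t, const_map (Suc 0) m) = B m t"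
    by (rule pushout_prod_glue[OF E iso_bd_subsset simplicial_set_iso_nerve simplicial_set_iso_nerve f
           box_sides[OF simplicial_set_iso_nerve A B]])
       (auto simp: HA HB)
  have "post x e b m p (u m s) = T m s" if "s \<in> simplices (pushout_prod ?E iso_nerve iso_bd iso_nerve) m" for m s
    using that by (cases s) (auto simp: uf ug pH pA pB)
  then obtain w where w: "w \<in> smap (prod_sset iso_nerve iso_nerve) (Hom K x e)"
    and wu: "\<And>m s. s \<in> simplices (pushout_prod ?E iso_nerve iso_bd iso_nerve) m \<Longrightarrow> w m s = u m s"
    and wT: "\<And>m t. t \<in> simplices (prod_sset iso_nerve iso_nerve) m \<Longrightarrow> post x e b m p (w m t) = T m t"
    using liftsD[OF l pushout_prod_subsset[OF E iso_bd_subsset simplicial_set_iso_nerve simplicial_set_iso_nerve] x u T] by blast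
  let ?D = "\<lambda>n. \<lambda>t\<in>simplices iso_nerve n. w n (const_map (Suc 0) n, t)"
  show thesis
  proof
    show "?D \<in> smap iso_nerve (Hom K x e)"
      by (rule smap_restrictI) (simp_all add: smap_closed[OF w] hom_smap_act[OF w])
    show "?D 0 (const_map 0 0) = A 0 (const_map (Suc 0) 0)" "?D 0 (const_map (Suc 0) 0) = B 0 (const_map (Suc 0) 0)"
      by (simp_all add: wu ug)
    show "post x e b n p (?D n t) = T n (const_map (Suc 0) n, t)" if "t \<in> simplices iso_nerve n" for n t
      using that by (simp add: wT)
  qed
qed

text \<open>A box over the terminal object: one side runs from \<open>f\<close> to \<open>g\<close>,
  its neighbours are constant at \<open>f\<close> and run from \<open>g\<close> to \<open>h\<close>.
  The filled side then goes from \<open>f\<close> to \<open>h\<close>.\<close>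

lemma path_trans:
  assumes fg: "path x a f g" and gh: "path x a g h" and x [simp]: "x \<in> Obj K" and a [simp]: "a \<in> Obj K"
  shows "path x a f h"
proof -
  obtain H where H: "H \<in> smap iso_nerve (Hom K x a)" "H 0 (const_map 0 0) = f" "H 0 (const_map 1 0) = g"
    using fg by (auto simp: path_def)
  obtain B where B: "B \<in> smap iso_nerve (Hom K x a)" "B 0 (const_map 0 0) = g" "B 0 (const_map 1 0) = h"
    using gh by (auto simp: path_def)
  have f [simp]: "f \<in> hom x a 0" using path_closed[OF fg] by simp
  obtain t where t: "is_terminal K t" using ex_terminal by blast
  then have [simp]: "t \<in> Obj K" by (simp add: is_terminal_def)
  obtain p where p [simp]: "p \<in> hom a t 0" using terminal_hom_ex[OF t a, of 0] by blast
  obtain z where z [simp]: "z \<in> hom x t 0" using terminal_hom_ex[OF t x, of 0] by blast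
  have pi: "p \<in> isof a t" by (rule isof_terminal[OF a t p])
  have T: "(\<lambda>n. \<lambda>y\<in>simplices (prod_sset iso_nerve iso_nerve) n. degen (Hom K x t) n z) \<in> smap (prod_sset iso_nerve iso_nerve) (Hom K x t)"
    by (rule const_smap) (simp_all add: simplicial_set_prod)
  have A: "(\<lambda>n. \<lambda>y\<in>simplices iso_nerve n. degen (Hom K x a) n f) \<in> smap iso_nerve (Hom K x a)"
    by (rule const_smap) simp_all
  have eq: "post x a t n p k = degen (Hom K x t) n z" if "k \<in> hom x a n" for k n
    by (rule terminal_hom_eq[OF t x, of _ n]) (use that in simp_all)
  have Hc: "H n (const_map 0 n) = degen (Hom K x a) n f" "H n (const_map (Suc 0) n) = degen (Hom K x a) n g" for n
    using smap_iso_const[OF H(1), of 0 n] smap_iso_const[OF H(1), of 1 n] H(2,3) by simp_all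
  have Bc: "B n (const_map 0 n) = degen (Hom K x a) n g" for n
    using smap_iso_const[OF B(1), of 0 n] B(2) by simp
  obtain D where "D \<in> smap iso_nerve (Hom K x a)" "D 0 (const_map 0 0) = f" "D 0 (const_map (Suc 0) 0) = h"
    by (rule fill_box[OF a _ pi x H(1) A B(1) T])
      (use B(3) smap_closed[OF H(1)] smap_closed[OF B(1)] in \<open>simp_all add: eq Hc Bc\<close>)
  then show ?thesis by (auto simp: path_def)
qed

text \<open>A homotopy equivalence internal to \<open>K\<close>, whose inverse is a functor of
  \<open>K\<close>. Unlike \<open>equivs\<close>, which quantifies over all \<open>x\<close>, it
  consists of a few simplices and is easily composed and transported.\<close>

definition hequiv where
  "hequiv a b f \<longleftrightarrow> f \<in> hom a b 0 \<and>
     (\<exists>g\<in>hom b a 0. path a a (Ident K a) (post a b a 0 g f) \<and> path b b (post b a b 0 f g) (Ident K b))"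

text \<open>\<open>qcat_equivalence\<close> is required for each \<open>x\<close> without
  naturality, so the inverses obtained at \<open>x = a\<close> and \<open>x = b\<close> are
  unrelated. The inverse \<open>g\<close> is the image of \<open>Ident K b\<close>, which settles
  \<open>f g\<close>; for \<open>g f\<close> the homotopy from \<open>f g f\<close> to
  \<open>f\<close> is carried back by the inverse \<open>G'\<close> at \<open>x = a\<close>.\<close>

lemma equivs_imp_hequiv:
  assumes a [simp]: "a \<in> Obj K" and b [simp]: "b \<in> Obj K" and f: "f \<in> equivs K a b"
  shows "hequiv a b f"
proof -
  have f' [simp]: "f \<in> hom a b 0" and q: "\<And>x. x \<in> Obj K \<Longrightarrow> qcat_equivalence (Hom K x a) (Hom K x b) (post_map K x a b f)"
    using f by (auto simp: equivs_def)
  obtain G H' where G: "G \<in> smap (Hom K b b) (Hom K b a)" and H': "H' \<in> smap (prod_sset iso_nerve (Hom K b b)) (Hom K b b)"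
    and H'e: "\<And>n y. y \<in> hom b b n \<Longrightarrow> H' n (const_map 0 n, y) = post_map K b a b f n (G n y) \<and> H' n (const_map 1 n, y) = y"
    using q[OF b] unfolding qcat_equivalence_def by blast
  obtain G' H where G': "G' \<in> smap (Hom K a b) (Hom K a a)" and H: "H \<in> smap (prod_sset iso_nerve (Hom K a a)) (Hom K a a)"
    and He: "\<And>n y. y \<in> hom a a n \<Longrightarrow> H n (const_map 0 n, y) = y \<and> H n (const_map 1 n, y) = G' n (post_map K a a b f n y)"
    using q[OF a] unfolding qcat_equivalence_def by blast
  have ev: "\<exists>L\<in>smap iso_nerve (Hom K x c). \<forall>t\<in>simplices iso_nerve 0. L 0 t = M 0 (t, y)"
    if M: "M \<in> smap (prod_sset iso_nerve (Hom K x c)) (Hom K x c)" and [simp]: "x \<in> Obj K" "c \<in> Obj K" "y \<in> hom x c 0" for M x c y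
  proof
    show "(\<lambda>n. \<lambda>t\<in>simplices iso_nerve n. M n (t, degen (Hom K x c) n y)) \<in> smap iso_nerve (Hom K x c)"
      by (rule smap_restrictI) (simp_all add: smap_closed[OF M] hom_smap_act[OF M])
  qed simp
  define g where "g = G 0 (Ident K b)"
  have g [simp]: "g \<in> hom b a 0" unfolding g_def by (rule smap_closed[OF G]) simp
  have fg: "path b b (post b a b 0 f g) (Ident K b)"
  proof -
    obtain L where L: "L \<in> smap iso_nerve (Hom K b b)" "\<forall>t\<in>simplices iso_nerve 0. L 0 t = H' 0 (t, Ident K b)"
      using ev[OF H', of "Ident K b"] by auto
    show ?thesis unfolding path_def by (rule bexI[OF _ L(1)]) (use L(2) H'e[of "Ident K b" 0] in \<open>simp add: g_def[symmetric]\<close>)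
  qed
  have id: "path a a y (G' 0 (post a a b 0 f y))" if y: "y \<in> hom a a 0" for y
  proof -
    obtain L where L: "L \<in> smap iso_nerve (Hom K a a)" "\<forall>t\<in>simplices iso_nerve 0. L 0 t = H 0 (t, y)"
      using ev[OF H a a y] by blast
    show ?thesis unfolding path_def by (rule bexI[OF _ L(1)]) (use L(2) He[of y 0] y in simp)
  qed
  have "path a b (post a a b 0 f (post a b a 0 g f)) f"
    using path_pre[OF fg, of a f] by (simp add: post_post)
  then have "path a a (G' 0 (post a a b 0 f (post a b a 0 g f))) (G' 0 f)"
    by (rule path_smap[OF _ G'])
  \<comment> \<open>The chain of homotopies is \<open>id\<close>, \<open>G' f\<close>,
    \<open>G' (f g f)\<close>, \<open>g f\<close>; its outer links are instances of the homotopy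
    from \<open>y\<close> to \<open>G' (f y)\<close>.\<close>
  then have "path a a (G' 0 f) (G' 0 (post a a b 0 f (post a b a 0 g f)))" by (rule path_sym)
  moreover have "path a a (Ident K a) (G' 0 f)" using id[of "Ident K a"] by simp
  moreover have "path a a (G' 0 (post a a b 0 f (post a b a 0 g f))) (post a b a 0 g f)"
    by (rule path_sym[OF id]) simp
  ultimately have "path a a (Ident K a) (post a b a 0 g f)" by (meson path_trans a)
  then show ?thesis using fg g f' unfolding hequiv_def by blast
qed

text \<open>A homotopy between endofunctors of \<open>c\<close> acts on every
  \<open>Hom K x c\<close> by composition, so homotopy inverses in \<open>K\<close> give homotopy
  inverses on all homs.\<close>

lemma hequiv_imp_equivs:
  assumes a [simp]: "a \<in> Obj K" and b [simp]: "b \<in> Obj K" and f: "hequiv a b f"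
  shows "f \<in> equivs K a b"
proof -
  obtain g where f' [simp]: "f \<in> hom a b 0" and g [simp]: "g \<in> hom b a 0"
    and gf: "path a a (Ident K a) (post a b a 0 g f)" and fg: "path b b (post b a b 0 f g) (Ident K b)"
    using f by (auto simp: hequiv_def)
  have ext: "\<exists>M\<in>smap (prod_sset iso_nerve (Hom K x c)) (Hom K x c). \<forall>n. \<forall>y\<in>hom x c n.
      M n (const_map 0 n, y) = post x c c n u y \<and> M n (const_map 1 n, y) = post x c c n v y"
    if p: "path c c u v" and [simp]: "x \<in> Obj K" "c \<in> Obj K" for x c u v
  proof -
    obtain J where J: "J \<in> smap iso_nerve (Hom K c c)" and J01: "J 0 (const_map 0 0) = u" "J 0 (const_map (Suc 0) 0) = v"
      using p by (auto simp: path_def)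
    let ?M = "\<lambda>n. \<lambda>y\<in>simplices (prod_sset iso_nerve (Hom K x c)) n. Comp K x c c n (J n (fst y)) (snd y)"
    have "?M \<in> smap (prod_sset iso_nerve (Hom K x c)) (Hom K x c)"
      by (rule smap_restrictI) (auto simp: simplicial_set_prod smap_closed[OF J] comp_act hom_smap_act[OF J])
    then show ?thesis
      using smap_iso_const[OF J, of 0] smap_iso_const[OF J, of 1] J01 by (intro bexI[of _ ?M]) (auto simp: post_def)
  qed
  have "qcat_equivalence (Hom K x a) (Hom K x b) (post_map K x a b f)" if x [simp]: "x \<in> Obj K" for x
    unfolding qcat_equivalence_def
  proof (intro conjI)
    obtain M where M: "M \<in> smap (prod_sset iso_nerve (Hom K x a)) (Hom K x a)"
      "\<And>n y. y \<in> hom x a n \<Longrightarrow> M n (const_map 0 n, y) = y \<and> M n (const_map 1 n, y) = post x a a n (post a b a 0 g f) y"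
      using ext[OF gf x a] by auto
    obtain M' where M': "M' \<in> smap (prod_sset iso_nerve (Hom K x b)) (Hom K x b)"
      "\<And>n y. y \<in> hom x b n \<Longrightarrow> M' n (const_map 0 n, y) = post x b b n (post b a b 0 f g) y \<and> M' n (const_map 1 n, y) = y"
      using ext[OF fg x b] by auto
    show "\<exists>g\<in>smap (Hom K x b) (Hom K x a). \<exists>H\<in>smap (prod_sset iso_nerve (Hom K x a)) (Hom K x a).
       \<exists>H'\<in>smap (prod_sset iso_nerve (Hom K x b)) (Hom K x b).
          (\<forall>n. \<forall>y\<in>hom x a n. H n (const_map 0 n, y) = y \<and> H n (const_map 1 n, y) = g n (post_map K x a b f n y)) \<and>
          (\<forall>n. \<forall>y\<in>hom x b n. H' n (const_map 0 n, y) = post_map K x a b f n (g n y) \<and> H' n (const_map 1 n, y) = y)"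
    proof (rule bexI[of _ "post_map K x b a g"], rule bexI[OF _ M(1)], rule bexI[OF _ M'(1)])
      show "(\<forall>n. \<forall>y\<in>hom x a n. M n (const_map 0 n, y) = y \<and> M n (const_map 1 n, y) = post_map K x b a g n (post_map K x a b f n y)) \<and>
          (\<forall>n. \<forall>y\<in>hom x b n. M' n (const_map 0 n, y) = post_map K x a b f n (post_map K x b a g n y) \<and> M' n (const_map 1 n, y) = y)"
        using M(2) M'(2) by (simp add: post_post)
    qed (simp add: post_map_smap)
  qed (simp_all add: hom_quasi_category post_map_smap)
  then show ?thesis by (simp add: equivs_def)
qed

lemma equivs_iff: "a \<in> Obj K \<Longrightarrow> b \<in> Obj K \<Longrightarrow> f \<in> equivs K a b \<longleftrightarrow> hequiv a b f"
  using equivs_imp_hequiv hequiv_imp_equivs by blast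

lemma hequiv_comp:
  assumes [simp]: "a \<in> Obj K" "b \<in> Obj K" "c \<in> Obj K" and f: "hequiv a b f" and g: "hequiv b c g"
  shows "hequiv a c (post a b c 0 g f)"
proof -
  obtain f' where [simp]: "f \<in> hom a b 0" "f' \<in> hom b a 0" and f1: "path a a (Ident K a) (post a b a 0 f' f)"
    and f2: "path b b (post b a b 0 f f') (Ident K b)" using f by (auto simp: hequiv_def)
  obtain g' where [simp]: "g \<in> hom b c 0" "g' \<in> hom c b 0" and g1: "path b b (Ident K b) (post b c b 0 g' g)"
    and g2: "path c c (post c b c 0 g g') (Ident K c)" using g by (auto simp: hequiv_def)
  have "path a a (post a b a 0 f' f) (post a c a 0 (post c b a 0 f' g') (post a b c 0 g f))"
    using path_post[OF path_pre[OF g1, of a f], of a f'] by (simp add: post_post)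
  from path_trans[OF f1 this] have 1: "path a a (Ident K a) (post a c a 0 (post c b a 0 f' g') (post a b c 0 g f))" by simp
  have "path c c (post c a c 0 (post a b c 0 g f) (post c b a 0 f' g')) (post c b c 0 g g')"
    using path_post[OF path_pre[OF f2, of c g'], of c g] by (simp add: post_post)
  from path_trans[OF this g2] have "path c c (post c a c 0 (post a b c 0 g f) (post c b a 0 f' g')) (Ident K c)" by simp
  with 1 show ?thesis unfolding hequiv_def by (intro conjI bexI[of _ "post c b a 0 f' g'"]) simp_all
qed

text \<open>An inverse of \<open>f\<close> is also an inverse of any functor homotopic to
  \<open>f\<close>.\<close>

lemma hequiv_path:
  assumes [simp]: "a \<in> Obj K" "b \<in> Obj K" and f: "hequiv a b f" and p: "path a b f f'"
  shows "hequiv a b f'"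
proof -
  obtain g where [simp]: "f \<in> hom a b 0" "g \<in> hom b a 0" and f1: "path a a (Ident K a) (post a b a 0 g f)"
    and f2: "path b b (post b a b 0 f g) (Ident K b)" using f by (auto simp: hequiv_def)
  have [simp]: "f' \<in> hom a b 0" using path_closed[OF p] by simp
  have "path a a (Ident K a) (post a b a 0 g f')" by (rule path_trans[OF f1 path_post[OF p]]) simp_all
  moreover have "path b b (post b a b 0 f' g) (Ident K b)" by (rule path_trans[OF path_sym[OF path_pre[OF p]] f2]) simp_all
  ultimately show ?thesis unfolding hequiv_def by (intro conjI bexI[of _ g]) simp_all
qed

text \<open>\<open>s\<close> is homotopic to the inverse \<open>g\<close> of \<open>q\<close>, since
  \<open>s ~ (g q) s = g (q s) = g\<close>; hence \<open>s q ~ g q ~ id\<close>.\<close>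

lemma hequiv_section:
  assumes [simp]: "a \<in> Obj K" "b \<in> Obj K" and q: "hequiv b a q" and s [simp]: "s \<in> hom a b 0" and qs: "post a b a 0 q s = Ident K a"
  shows "hequiv a b s"
proof -
  obtain g where [simp]: "q \<in> hom b a 0" "g \<in> hom a b 0" and q1: "path b b (Ident K b) (post b a b 0 g q)"
    and q2: "path a a (post a b a 0 q g) (Ident K a)" using q by (auto simp: hequiv_def)
  have "path a b s (post a b b 0 (post b a b 0 g q) s)" using path_pre[OF q1, of a s] by simp
  also have "post a b b 0 (post b a b 0 g q) s = g"
  proof -
    have "post a b b 0 (post b a b 0 g q) s = post a a b 0 g (post a b a 0 q s)" by (simp add: post_post)
    then show ?thesis by (simp add: qs)
  qed
  finally have "path a b s g" .
  then have "path b b (post b a b 0 s q) (post b a b 0 g q)" by (rule path_pre) simp_all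
  from path_trans[OF this path_sym[OF q1]] have 1: "path b b (post b a b 0 s q) (Ident K b)" by simp
  show ?thesis unfolding hequiv_def
    using 1 path_refl[of a a "Ident K a"] by (intro conjI bexI[of _ q]) (simp_all add: qs)
qed

lemma hequiv_iso: "a \<in> Obj K \<Longrightarrow> b \<in> Obj K \<Longrightarrow> is_iso K a b f \<Longrightarrow> hequiv a b f"
  unfolding is_iso_def hequiv_def using path_refl by (metis Comp_0_eq_post ident_closed)

section \<open>Trivial fibrations\<close>

text \<open>A trivial fibration has a section and a fibrewise homotopy from the identity to its composite with
  the section: concatenate a homotopy \<open>H : id \<rightarrow> s p\<close> with the reverse of \<open>s p H\<close>; the result lies over
  a null homotopic path, and filling a box over \<open>p H (t (1 - s))\<close> makes it fibrewise.\<close>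

lemma triv_fib_section:
  assumes e [simp]: "e \<in> Obj K" and b [simp]: "b \<in> Obj K" and p: "p \<in> isof e b" and he: "hequiv e b p"
  obtains s D where "s \<in> hom b e 0" "post b e b 0 p s = Ident K b" "D \<in> smap iso_nerve (Hom K e e)"
    "D 0 (const_map 0 0) = Ident K e" "D 0 (const_map (Suc 0) 0) = post e b e 0 s p"
    "\<And>n t. t \<in> simplices iso_nerve n \<Longrightarrow> post e e b n p (D n t) = degen (Hom K e b) n p"
proof -
  obtain g where [simp]: "p \<in> hom e b 0" "g \<in> hom b e 0" and p1: "path e e (Ident K e) (post e b e 0 g p)"
    and p2: "path b b (post b e b 0 p g) (Ident K b)" using he by (auto simp: hequiv_def)
  obtain H1 where H1: "H1 \<in> smap iso_nerve (Hom K b b)" "H1 0 (const_map 0 0) = post b e b 0 p g" "H1 0 (const_map 1 0) = Ident K b"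
    using p2 by (auto simp: path_def)
  let ?E = "iso_nerve_endpoint 0"
  have E: "subsset ?E iso_nerve" by (rule endpoint_subsset) simp
  have sE: "simplicial_set ?E" by (rule subsset_simplicial_set[OF E]) simp
  have lE: "lifts ?E iso_nerve e b p"
    using isof_hom[OF _ e b p] by (auto simp: lifts_def qcat_isofibration_def)
  \<comment> \<open>The inverse \<open>g\<close> is a section only up to the homotopy
    \<open>H1\<close>. The lift of \<open>H1\<close> along \<open>p\<close> that starts at
    \<open>g\<close> ends at a strict section.\<close>
  have "post b e b m p (degen (Hom K b e) m g) = H1 m (const_map 0 m)" for m
    using smap_iso_const[OF H1(1), of 0 m] by (simp add: H1(2) degen_post)
  then obtain L where L: "L \<in> smap iso_nerve (Hom K b e)" "\<And>m. L m (const_map 0 m) = degen (Hom K b e) m g"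
    "\<And>m t. t \<in> simplices iso_nerve m \<Longrightarrow> post b e b m p (L m t) = H1 m t"
    by (rule_tac liftsD[OF lE E b const_smap[OF sE b e \<open>g \<in> _\<close>] H1(1)]) auto
  define s where "s = L 0 (const_map (Suc 0) 0)"
  have s [simp]: "s \<in> hom b e 0" unfolding s_def by (rule smap_closed[OF L(1)]) simp
  have ps: "post b e b 0 p s = Ident K b" using L(3)[of "const_map (Suc 0) 0" 0] H1(3) by (simp add: s_def)
  have "path b e g s" unfolding path_def using L(1) L(2)[of 0] by (intro bexI[OF _ L(1)]) (simp add: s_def)
  then have "path e e (Ident K e) (post e b e 0 s p)"
    by (intro path_trans[OF p1 path_pre]) simp_all
  then obtain H where H: "H \<in> smap iso_nerve (Hom K e e)" and H0: "H 0 (const_map 0 0) = Ident K e" and H1': "H 0 (const_map (Suc 0) 0) = post e b e 0 s p"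
    by (auto simp: path_def)
  note [simp] = smap_closed[OF H]
  let ?sp = "post e b e 0 s p"
  have psp: "post e e b n p (post e e e n ?sp k) = post e e b n p k" if "k \<in> hom e e n" for k n
  proof -
    have "post e e b n p (post e e e n ?sp k) = post e b b n (post b e b 0 p s) (post e e b n p k)"
      using that by (simp add: post_post)
    then show ?thesis using that by (simp add: ps)
  qed
  have spsp: "post e e e 0 ?sp ?sp = ?sp"
  proof -
    have "post e e e 0 ?sp ?sp = post e b e 0 s (post e b b 0 (post b e b 0 p s) p)" by (simp add: post_post)
    then show ?thesis by (simp add: ps)
  qed
  have A: "(\<lambda>n. \<lambda>t\<in>simplices iso_nerve n. degen (Hom K e e) n (Ident K e)) \<in> smap iso_nerve (Hom K e e)"
    by (rule const_smap) simp_all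
  have B: "(\<lambda>n. \<lambda>t\<in>simplices iso_nerve n. post e e e n ?sp (H n (inot n t))) \<in> smap iso_nerve (Hom K e e)"
    by (rule smap_restrictI) (simp_all add: act_post hom_smap_act[OF H] inot_act)
  \<comment> \<open>With \<open>r\<close> and \<open>t\<close> the two coordinates, the base of the
    square is \<open>p H (t (1 - r))\<close>. At \<open>r = 0\<close> it is \<open>p H\<close>, at
    \<open>t = 0\<close> constant at \<open>p\<close>; at \<open>t = 1\<close> it is
    \<open>p H (1 - r)\<close>, which the composite of \<open>s p\<close> with the reversed
    \<open>H\<close> covers since \<open>p s = id\<close>. At \<open>r = 1\<close> it is constant,
    so the filled side is fibrewise.\<close>
  have T: "(\<lambda>n. \<lambda>y\<in>simplices (prod_sset iso_nerve iso_nerve) n. post e e b n p (H n (imul n (snd y) (inot n (fst y)))))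
     \<in> smap (prod_sset iso_nerve iso_nerve) (Hom K e b)"
    by (rule smap_restrictI) (auto simp: simplicial_set_prod act_post hom_smap_act[OF H] inot_act imul_act)
  have Hc: "H n (const_map 0 n) = degen (Hom K e e) n (Ident K e)" "H n (const_map (Suc 0) n) = degen (Hom K e e) n ?sp" for n
    using smap_iso_const[OF H, of 0 n] smap_iso_const[OF H, of 1 n] by (simp_all add: H0 H1')
  obtain D where D: "D \<in> smap iso_nerve (Hom K e e)" "D 0 (const_map 0 0) = Ident K e" "D 0 (const_map (Suc 0) 0) = ?sp"
    "\<And>n t. t \<in> simplices iso_nerve n \<Longrightarrow> post e e b n p (D n t) = degen (Hom K e b) n p"
  proof (rule fill_box[OF e b p e H A B T])
    fix D assume "D \<in> smap iso_nerve (Hom K e e)" 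
     "D 0 (const_map 0 0) = (\<lambda>t\<in>simplices iso_nerve 0. degen (Hom K e e) 0 (Ident K e)) (const_map (Suc 0) 0)"
     "D 0 (const_map (Suc 0) 0) = (\<lambda>t\<in>simplices iso_nerve 0. post e e e 0 ?sp (H 0 (inot 0 t))) (const_map (Suc 0) 0)"
     "\<And>n t. t \<in> simplices iso_nerve n \<Longrightarrow> post e e b n p (D n t) =
       (\<lambda>y\<in>simplices (prod_sset iso_nerve iso_nerve) n. post e e b n p (H n (imul n (snd y) (inot n (fst y))))) (const_map (Suc 0) n, t)"
    then show thesis by (intro that[of D]) (simp_all add: H0 Hc post_degen_Ident)
  qed (simp_all add: Hc psp spsp degen_post[symmetric])
  show thesis by (rule that[OF s ps D])
qed

text \<open>\<open>s v\<close> solves the problem up to a fibrewise homotopy: on \<open>S\<close>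
  the homotopy \<open>D u\<close> leads from \<open>u\<close> to \<open>s p u = s v\<close>.
  Homotopy lifting from endpoint 1 extends it over \<open>T\<close> with \<open>s v\<close> as its
  end, and the other end, at endpoint 0, is a strict solution.\<close>

theorem triv_fib_lifts:
  assumes e [simp]: "e \<in> Obj K" and b [simp]: "b \<in> Obj K" and p: "p \<in> isof e b" and he: "hequiv e b p"
    and T: "small_sset \<kappa> T" and S: "subsset S T"
  shows "lifts S T e b p"
proof (rule liftsI)
  fix x u v assume x [simp]: "x \<in> Obj K" and u: "u \<in> smap S (Hom K x e)" and v: "v \<in> smap T (Hom K x b)"
    and eq: "\<And>m s. s \<in> simplices S m \<Longrightarrow> post x e b m p (u m s) = v m s"
  have sT: "simplicial_set T" using T by (simp add: small_sset_def)
  have sS: "simplicial_set S" by (rule subsset_simplicial_set[OF S sT])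
  have p' [simp]: "p \<in> hom e b 0" by (rule isof_hom_closed[OF e b p])
  note [simp] = smap_closed[OF u] smap_closed[OF v] subsset_closed[OF S]
  obtain s D where s [simp]: "s \<in> hom b e 0" and ps: "post b e b 0 p s = Ident K b" and D: "D \<in> smap iso_nerve (Hom K e e)"
    and D01: "D 0 (const_map 0 0) = Ident K e" "D 0 (const_map (Suc 0) 0) = post e b e 0 s p"
    and pD: "\<And>n t. t \<in> simplices iso_nerve n \<Longrightarrow> post e e b n p (D n t) = degen (Hom K e b) n p"
    using triv_fib_section[OF e b p he] by blast
  note [simp] = smap_closed[OF D]
  have Dc: "D n (const_map 0 n) = degen (Hom K e e) n (Ident K e)" "D n (const_map (Suc 0) n) = degen (Hom K e e) n (post e b e 0 s p)" for n
    using smap_iso_const[OF D, of 0 n] smap_iso_const[OF D, of 1 n] by (simp_all add: D01)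
  let ?E = "iso_nerve_endpoint 1"
  have E: "subsset ?E iso_nerve" by (rule endpoint_subsset) simp
  have sE: "simplicial_set ?E" by (rule subsset_simplicial_set[OF E]) simp
  let ?f = "\<lambda>n. \<lambda>y\<in>simplices (prod_sset ?E T) n. post x b e n s (v n (snd y))"
  have f: "?f \<in> smap (prod_sset ?E T) (Hom K x e)"
    by (rule smap_restrictI[OF simplicial_set_prod[OF sE sT]]) (auto simp: act_post hom_smap_act[OF v])
  let ?g = "\<lambda>n. \<lambda>y\<in>simplices (prod_sset iso_nerve S) n. Comp K x e e n (D n (fst y)) (u n (snd y))"
  have g: "?g \<in> smap (prod_sset iso_nerve S) (Hom K x e)"
    by (rule smap_restrictI[OF simplicial_set_prod[OF simplicial_set_iso_nerve sS]]) (auto simp: comp_act hom_smap_act[OF u] hom_smap_act[OF D])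
  let ?B = "\<lambda>n. \<lambda>y\<in>simplices (prod_sset iso_nerve T) n. v n (snd y)"
  have B: "?B \<in> smap (prod_sset iso_nerve T) (Hom K x b)"
    by (rule smap_restrictI[OF simplicial_set_prod[OF simplicial_set_iso_nerve sT]]) (auto simp: hom_smap_act[OF v])
  have l: "lifts (pushout_prod ?E iso_nerve S T) (prod_sset iso_nerve T) e b p"
    by (rule isof_homotopy_lifting[OF e b p T S]) simp
  \<comment> \<open>Agreement on the overlap \<open>{1} \<times> S\<close>, where \<open>D\<close>
    ends at \<open>s p\<close> and \<open>p u = v\<close>.\<close>
  have psp: "post x b e m s (v m y) = Comp K x e e m (D m (const_map (Suc 0) m)) (u m y)" if "y \<in> simplices S m" for m y
    using that by (simp add: Dc post_def[symmetric] eq[symmetric] post_post)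
  obtain w where w: "w \<in> smap (pushout_prod ?E iso_nerve S T) (Hom K x e)"
    and wf: "\<And>m t. t \<in> simplices T m \<Longrightarrow> w m (const_map (Suc 0) m, t) = post x b e m s (v m t)"
    and wg: "\<And>m t y. t \<in> simplices iso_nerve m \<Longrightarrow> y \<in> simplices S m \<Longrightarrow> w m (t, y) = Comp K x e e m (D m t) (u m y)"
    by (rule pushout_prod_glue[OF E S simplicial_set_iso_nerve sT f g]) (auto simp: psp)
  have "post x e b m p (w m y) = ?B m y" if "y \<in> simplices (pushout_prod ?E iso_nerve S T) m" for m y
  proof -
    obtain t z where y: "y = (t, z)" by (cases y)
    have tz: "t \<in> simplices iso_nerve m" "z \<in> simplices T m" "t = const_map 1 m \<or> z \<in> simplices S m" using that y by auto
    from tz(3) show ?thesis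
    proof
      assume "t = const_map 1 m" then show ?thesis using tz y by (simp add: wf post_post ps)
    next
      assume "z \<in> simplices S m" then show ?thesis using tz y by (simp add: wg post_Comp pD) (simp add: post_def[symmetric] eq)
    qed
  qed
  then obtain W where W: "W \<in> smap (prod_sset iso_nerve T) (Hom K x e)"
    and Ww: "\<And>m y. y \<in> simplices (pushout_prod ?E iso_nerve S T) m \<Longrightarrow> W m y = w m y"
    and WB: "\<And>m y. y \<in> simplices (prod_sset iso_nerve T) m \<Longrightarrow> post x e b m p (W m y) = ?B m y"
    using liftsD[OF l pushout_prod_subsset[OF E S simplicial_set_iso_nerve sT] x w B] by blast
  let ?W = "\<lambda>n. \<lambda>t\<in>simplices T n. W n (const_map 0 n, t)"
  have "?W \<in> smap T (Hom K x e)"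
    by (rule smap_restrictI[OF sT]) (simp_all add: smap_closed[OF W] hom_smap_act[OF W])
  moreover have "?W m y = u m y" if "y \<in> simplices S m" for m y
    using that by (simp add: Ww wg Dc)
  moreover have "post x e b m p (?W m t) = v m t" if "t \<in> simplices T m" for m t
    using that by (simp add: WB)
  ultimately show "\<exists>w\<in>smap T (Hom K x e). (\<forall>m. \<forall>s\<in>simplices S m. w m s = u m s) \<and> (\<forall>m. \<forall>t\<in>simplices T m. post x e b m p (w m t) = v m t)"
    by (intro bexI[of _ ?W]) auto
qed

definition empty_simplex :: "(nat \<Rightarrow> nat) sset" where
  "empty_simplex = simplex 0 \<lparr>simplices := \<lambda>_. {}\<rparr>"

lemma empty_simplex_subsset: "subsset empty_simplex (simplex 0)"
  by (simp add: subsset_def empty_simplex_def)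

text \<open>The two inclusions that are needed to recover an equivalence. Being lifting properties,
  they pass to limits, whereas inverses and homotopies chosen for the single members of a limit
  diagram need not fit together.\<close>

definition triv_lifts where
  "triv_lifts e b p \<longleftrightarrow> lifts empty_simplex (simplex 0) e b p \<and> lifts iso_bd iso_nerve e b p"

text \<open>The section lifts \<open>Ident K b\<close> along the inclusion of the empty set into a
  point. Since \<open>p s = id\<close>, the pair \<open>(id, s p)\<close> lies over the constant
  homotopy at \<open>p\<close>, and a lift of that homotopy connects \<open>id\<close> to
  \<open>s p\<close>.\<close>

lemma triv_lifts_hequiv:
  assumes e [simp]: "e \<in> Obj K" and b [simp]: "b \<in> Obj K" and p [simp]: "p \<in> hom e b 0" and l: "triv_lifts e b p"
  shows "hequiv e b p"
proof -
  have l1: "lifts empty_simplex (simplex 0) e b p" and l2: "lifts iso_bd iso_nerve e b p" using l by (auto simp: triv_lifts_def)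
  have "(\<lambda>n. \<lambda>x\<in>simplices empty_simplex n. undefined) \<in> smap empty_simplex (Hom K b e)"
    by (rule smapI) (simp_all add: empty_simplex_def)
  moreover have "(\<lambda>n. \<lambda>t\<in>simplices (simplex 0) n. degen (Hom K b b) n (Ident K b)) \<in> smap (simplex 0) (Hom K b b)"
    by (rule const_smap) simp_all
  ultimately obtain w where w: "w \<in> smap (simplex 0) (Hom K b e)"
    and pw: "\<And>m t. t \<in> simplices (simplex 0) m \<Longrightarrow> post b e b m p (w m t) = (\<lambda>t\<in>simplices (simplex 0) m. degen (Hom K b b) m (Ident K b)) t"
    by (rule liftsD[OF l1 empty_simplex_subsset b]) (simp_all add: empty_simplex_def)
  define s where "s = w 0 (const_map 0 0)"
  have s [simp]: "s \<in> hom b e 0" unfolding s_def by (rule smap_closed[OF w]) simp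
  have ps: "post b e b 0 p s = Ident K b" using pw[of "const_map 0 0" 0] by (simp add: s_def)
  let ?u = "\<lambda>n. \<lambda>y\<in>simplices iso_bd n. degen (Hom K e e) n (if y = const_map 0 n then Ident K e else post e b e 0 s p)"
  have u: "?u \<in> smap iso_bd (Hom K e e)" by (rule smap_restrictI) auto
  have v: "(\<lambda>n. \<lambda>t\<in>simplices iso_nerve n. degen (Hom K e b) n p) \<in> smap iso_nerve (Hom K e b)"
    by (rule const_smap) simp_all
  have psp: "post e e b 0 p (post e b e 0 s p) = p"
  proof -
    have "post e e b 0 p (post e b e 0 s p) = post e b b 0 (post b e b 0 p s) p" by (simp add: post_post)
    then show ?thesis by (simp add: ps)
  qed
  obtain D where D: "D \<in> smap iso_nerve (Hom K e e)" "\<And>m y. y \<in> simplices iso_bd m \<Longrightarrow> D m y = ?u m y"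
    by (rule liftsD[OF l2 iso_bd_subsset e u v]) (auto simp: degen_post[symmetric] psp)
  have "path e e (Ident K e) (post e b e 0 s p)"
    unfolding path_def by (rule bexI[OF _ D(1)]) (simp add: D(2))
  then show ?thesis unfolding hequiv_def using path_refl[of b b "Ident K b"] by (intro conjI bexI[of _ s]) (simp_all add: ps)
qed

lemma triv_fibs_iff:
  assumes e [simp]: "e \<in> Obj K" and b [simp]: "b \<in> Obj K"
  shows "p \<in> triv_fibs K isof e b \<longleftrightarrow> p \<in> isof e b \<and> triv_lifts e b p"
proof -
  have "small_sset \<kappa> (simplex 0)" by (simp add: small_sset_def small_finite[OF size] finite_Delta_hom)
  then have "hequiv e b p \<Longrightarrow> p \<in> isof e b \<Longrightarrow> triv_lifts e b p"
    unfolding triv_lifts_def by (intro conjI triv_fib_lifts small_iso_nerve empty_simplex_subsset iso_bd_subsset e b)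
  then show ?thesis
    using triv_lifts_hequiv[OF e b] isof_hom_closed[OF e b] by (auto simp: triv_fibs_def equivs_iff)
qed

lemma small_prod: "small_sset \<kappa> T \<Longrightarrow> small_sset \<kappa> V \<Longrightarrow> small_sset \<kappa> (prod_sset T V)"
  by (auto simp: small_sset_def simplicial_set_prod small_Times[OF size])

text \<open>Closure under limits combines that of isofibrations with that of lifting properties. For
  Leibniz cotensors the test inclusions turn into their pushout products with
  \<open>U \<subseteq> V\<close>; these are small inclusions again, so \<open>triv_fib_lifts\<close>
  applies to them.\<close>

lemma fibration_class_triv_fibs: "fibration_class K \<kappa> isof (triv_fibs K isof)"
proof -
  interpret I: fibration_class K \<kappa> isof isof by (rule fibration_class_isof)
  let ?C = "triv_fibs K isof"
  note s = empty_simplex_subsset simplicial_set_simplex iso_bd_subsset simplicial_set_iso_nerve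
  have s0: "small_sset \<kappa> (simplex 0)" by (simp add: small_sset_def small_finite[OF size] finite_Delta_hom)
  show ?thesis
  proof
    show "?C a b \<subseteq> isof a b" for a b by (auto simp: triv_fibs_def)
    show "f \<in> ?C a b" if "a \<in> Obj K" "b \<in> Obj K" "is_iso K a b f" for a b f
      using that by (simp add: triv_fibs_def equivs_iff hequiv_iso isof_iso)
    show "post a b c 0 g f \<in> ?C a c" if "a \<in> Obj K" "b \<in> Obj K" "c \<in> Obj K" "g \<in> ?C b c" "f \<in> ?C a b" for a b c f g
      using that by (auto simp: triv_fibs_def equivs_iff hequiv_comp I.Cl_comp)
    show "q \<in> ?C p a" if P: "is_pullback K a e b f g p q r" and g: "g \<in> ?C e b" for a e b f g p q r
      using g pullbackD(1-4)[OF P] I.Cl_pullback[OF P] lifts_pullback[OF P s(1,2)] lifts_pullback[OF P s(3,4)]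
      by (auto simp: triv_fibs_iff triv_lifts_def)
    show "h \<in> ?C p q" if I: "small \<kappa> I" and P: "is_product K I a p \<pi>" and Q: "is_product K I b q \<rho>"
      and f: "\<And>i. i \<in> I \<Longrightarrow> f i \<in> ?C (a i) (b i)" and h: "h \<in> hom p q 0"
      and c: "\<And>i. i \<in> I \<Longrightarrow> post p q (b i) 0 (\<rho> i) h = post p (a i) (b i) 0 (f i) (\<pi> i)"
      for I :: "'u set" and a b f p \<pi> q \<rho> h
    proof -
      have f': "f i \<in> isof (a i) (b i)" "f i \<in> hom (a i) (b i) 0" "triv_lifts (a i) (b i) (f i)" if "i \<in> I" for i
        using f[OF that] that productD[OF P] productD[OF Q] isof_hom_closed by (auto simp: triv_fibs_iff)
      have "h \<in> isof p q" by (rule I.Cl_product[OF I P Q f'(1) h c])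
      moreover have "triv_lifts p q h" unfolding triv_lifts_def
        using f' by (intro conjI lifts_product[OF P Q s(1,2) _ _ h c] lifts_product[OF P Q s(3,4) _ _ h c]) (auto simp: triv_lifts_def)
      ultimately show ?thesis using productD(1)[OF P] productD(1)[OF Q] by (simp add: triv_fibs_iff)
    qed
    show "\<pi> 0 \<in> ?C l (e 0)" if P: "is_sequential_limit K e p l \<pi>" and p: "\<And>k. p k \<in> ?C (e (Suc k)) (e k)" for e p l \<pi>
    proof -
      have p': "p k \<in> isof (e (Suc k)) (e k)" "triv_lifts (e (Suc k)) (e k) (p k)" for k
        using p[of k] sequential_limitD(2)[OF P] by (auto simp: triv_fibs_iff)
      then show ?thesis
        using sequential_limitD(1,2)[OF P] I.Cl_sequential_limit[OF P p'(1)] lifts_sequential_limit[OF P s(1,2)] lifts_sequential_limit[OF P s(3,4)]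
        by (simp add: triv_fibs_iff triv_lifts_def)
    qed
  next
    fix U V :: "'u sset" and e b g eU ueU eV ueV bU ubU bV ubV ei gU bi gV p q r h
    assume h: "small_sset \<kappa> U" "small_sset \<kappa> V" "subsset U V" "e \<in> Obj K" "b \<in> Obj K" "g \<in> ?C e b"
        "is_cotensor K U e eU ueU" "is_cotensor K V e eV ueV" "is_cotensor K U b bU ubU" "is_cotensor K V b bV ubV"
        "is_cotensor_map K U (incl U) e e (Ident K e) eV ueV eU ueU ei"
        "is_cotensor_map K U (incl U) b b (Ident K b) bV ubV bU ubU bi"
        "is_cotensor_map K U (\<lambda>n u. u) e b g eU ueU bU ubU gU"
        "is_cotensor_map K V (\<lambda>n v. v) e b g eV ueV bV ubV gV"
        "is_pullback K eU bV bU gU bi p q r" "h \<in> hom eV p 0"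
        "post eV p eU 0 q h = ei" "post eV p bV 0 r h = gV"
    have g: "g \<in> isof e b" "hequiv e b g" using h(4-6) by (auto simp: triv_fibs_def equivs_iff)
    interpret L: leibniz_map K \<kappa> isof U V e b g eU ueU eV ueV bU ubU bV ubV ei gU bi gV p q r h
      by (intro leibniz_map.intro infinity_cosmos_axioms leibniz_map_axioms.intro isof_hom_closed[OF h(4,5) g(1)] h(1-5,7-))
    have "lifts S T eV p h" if S: "subsset S T" and T: "small_sset \<kappa> T" for S T :: "(nat \<Rightarrow> nat) sset"
    proof -
      have sT: "simplicial_set T" using T by (simp add: small_sset_def)
      have "lifts (pushout_prod S T U V) (prod_sset T V) e b g"
        by (rule triv_fib_lifts[OF h(4,5) g small_prod[OF T h(2)] pushout_prod_subsset[OF S h(3) sT L.ssets(2)]])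
      then show ?thesis using L.lifts_iff[OF S sT] by simp
    qed
    then show "h \<in> ?C eV p"
      using L.h_isof[OF g(1)] s s0 small_iso_nerve by (simp add: triv_fibs_iff triv_lifts_def)
  qed
qed

end

section \<open>Path objects\<close>

context simplicial_category
begin

lemma pullback_sym:
  assumes P: "is_pullback C a e b f g p q r"
  shows "is_pullback C e a b g f p r q"
  unfolding is_pullback_def
proof (intro conjI ballI allI)
  note [simp] = pullbackD(1-8)[OF P]
  show "Comp C p e b 0 g r = Comp C p a b 0 f q" using pullbackD(9)[OF P] by (simp add: Comp_0_eq_post)
  fix x n assume x [simp]: "x \<in> Obj C"
  show "bij_betw (\<lambda>h. (post_map C x p e r n h, post_map C x p a q n h)) (hom x p n)
     {(u, v). (u, v) \<in> hom x e n \<times> hom x a n \<and> post_map C x e b g n u = post_map C x a b f n v}"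
  proof (subst bij_betw_iff_ex1)
    show "(\<lambda>h. (post_map C x p e r n h, post_map C x p a q n h)) ` hom x p n \<subseteq>
       {(u, v). (u, v) \<in> hom x e n \<times> hom x a n \<and> post_map C x e b g n u = post_map C x a b f n v}"
      by (auto simp: post_post pullbackD(9)[OF P])
    show "\<forall>y\<in>{(u, v). (u, v) \<in> hom x e n \<times> hom x a n \<and> post_map C x e b g n u = post_map C x a b f n v}.
        \<exists>!z. z \<in> hom x p n \<and> (post_map C x p e r n z, post_map C x p a q n z) = y"
    proof clarify
      fix u v assume h: "u \<in> hom x e n" "v \<in> hom x a n" "post_map C x e b g n u = post_map C x a b f n v"
      have "\<exists>!z. z \<in> hom x p n \<and> post x p a n q z = v \<and> post x p e n r z = u"
        by (rule pullback_ex1[OF P x]) (use h in simp_all)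
      then show "\<exists>!z. z \<in> hom x p n \<and> (post_map C x p e r n z, post_map C x p a q n z) = (u, v)"
        by (simp add: conj_commute cong: conj_cong)
    qed
  qed
qed (use pullbackD[OF P] in simp_all)

text \<open>\<open>P\<close> represents pairs of a map \<open>h\<close> to \<open>a\<close> and a homotopy in \<open>b\<close> that starts at \<open>\<alpha> h\<close>.\<close>

definition is_path_object where
  "is_path_object a b \<alpha> P q \<epsilon> \<longleftrightarrow> P \<in> Obj C \<and> q \<in> hom P a 0 \<and> \<epsilon> \<in> smap iso_nerve (Hom C P b) \<and>
     (\<forall>n. \<epsilon> n (const_map 0 n) = degen (Hom C P b) n (post P a b 0 \<alpha> q)) \<and>
     (\<forall>x\<in>Obj C. \<forall>n. \<forall>h\<in>hom x a n. \<forall>\<gamma>\<in>smap (prod_sset (simplex n) iso_nerve) (Hom C x b).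
        (\<forall>m. \<forall>\<theta>\<in>Delta_hom m n. \<gamma> m (\<theta>, const_map 0 m) = post x a b m \<alpha> (act (Hom C x a) m n \<theta> h)) \<longrightarrow>
        (\<exists>!k. k \<in> hom x P n \<and> post x P a n q k = h \<and>
           (\<forall>m. \<forall>\<theta>\<in>Delta_hom m n. \<forall>t\<in>simplices iso_nerve m.
              Comp C x P b m (\<epsilon> m t) (act (Hom C x P) m n \<theta> k) = \<gamma> m (\<theta>, t))))"

lemma path_objectD:
  assumes "is_path_object a b \<alpha> P q \<epsilon>"
  shows "P \<in> Obj C" "q \<in> hom P a 0" "\<epsilon> \<in> smap iso_nerve (Hom C P b)"
     "\<epsilon> n (const_map 0 n) = degen (Hom C P b) n (post P a b 0 \<alpha> q)"
  using assms by (auto simp: is_path_object_def)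

lemma path_object_ex1:
  assumes P: "is_path_object a b \<alpha> P q \<epsilon>" and x: "x \<in> Obj C" and h: "h \<in> hom x a n"
    and cl: "\<And>m \<theta> t. \<theta> \<in> Delta_hom m n \<Longrightarrow> t \<in> simplices iso_nerve m \<Longrightarrow> \<gamma> m \<theta> t \<in> hom x b m"
    and ac: "\<And>m \<theta> t k \<sigma>. \<theta> \<in> Delta_hom m n \<Longrightarrow> t \<in> simplices iso_nerve m \<Longrightarrow> \<sigma> \<in> Delta_hom k m \<Longrightarrow>
       act (Hom C x b) k m \<sigma> (\<gamma> m \<theta> t) = \<gamma> k (compose {..k} \<theta> \<sigma>) (compose {..k} t \<sigma>)"
    and st: "\<And>m \<theta>. \<theta> \<in> Delta_hom m n \<Longrightarrow> \<gamma> m \<theta> (const_map 0 m) = post x a b m \<alpha> (act (Hom C x a) m n \<theta> h)"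
  shows "\<exists>!k. k \<in> hom x P n \<and> post x P a n q k = h \<and>
           (\<forall>m. \<forall>\<theta>\<in>Delta_hom m n. \<forall>t\<in>simplices iso_nerve m.
              Comp C x P b m (\<epsilon> m t) (act (Hom C x P) m n \<theta> k) = \<gamma> m \<theta> t)"
proof -
  let ?\<gamma> = "\<lambda>m. \<lambda>y\<in>simplices (prod_sset (simplex n) iso_nerve) m. \<gamma> m (fst y) (snd y)"
  have \<gamma>: "?\<gamma> \<in> smap (prod_sset (simplex n) iso_nerve) (Hom C x b)"
    by (rule smap_restrictI) (auto simp: simplicial_set_prod cl ac)
  have st': "\<forall>m. \<forall>\<theta>\<in>Delta_hom m n. ?\<gamma> m (\<theta>, const_map 0 m) = post x a b m \<alpha> (act (Hom C x a) m n \<theta> h)"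
    by (simp add: st)
  note rep = P[unfolded is_path_object_def, THEN conjunct2, THEN conjunct2, THEN conjunct2, THEN conjunct2]
  show ?thesis
    using rep[THEN bspec, OF x, THEN spec, of n, THEN bspec, OF h, THEN bspec, OF \<gamma>, THEN mp, OF st'] by simp
qed

lemma path_object_eqI:
  assumes P: "is_path_object a b \<alpha> P q \<epsilon>" and x [simp]: "x \<in> Obj C" and a [simp]: "a \<in> Obj C" and b [simp]: "b \<in> Obj C"
    and \<alpha> [simp]: "\<alpha> \<in> hom a b 0"
    and k: "k \<in> hom x P n" "k' \<in> hom x P n" and q: "post x P a n q k = post x P a n q k'"
    and eq: "\<And>m \<theta> t. \<theta> \<in> Delta_hom m n \<Longrightarrow> t \<in> simplices iso_nerve m \<Longrightarrow>
       Comp C x P b m (\<epsilon> m t) (act (Hom C x P) m n \<theta> k) = Comp C x P b m (\<epsilon> m t) (act (Hom C x P) m n \<theta> k')"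
  shows "k = k'"
proof -
  note [simp] = path_objectD(1,2)[OF P] smap_closed[OF path_objectD(3)[OF P]] k
  have "\<exists>!z. z \<in> hom x P n \<and> post x P a n q z = post x P a n q k \<and>
           (\<forall>m. \<forall>\<theta>\<in>Delta_hom m n. \<forall>t\<in>simplices iso_nerve m.
              Comp C x P b m (\<epsilon> m t) (act (Hom C x P) m n \<theta> z) = Comp C x P b m (\<epsilon> m t) (act (Hom C x P) m n \<theta> k))"
    by (rule path_object_ex1[OF P x])
       (simp_all add: comp_act hom_smap_act[OF path_objectD(3)[OF P]] act_hom_act path_objectD(4)[OF P] degen_post act_post,
        simp add: post_def degen_Comp comp_assoc)
  then show ?thesis using k q[symmetric] eq[symmetric] by blast
qed

end

context sized_cosmos
begin

text \<open>The mapping path space of \<open>\<alpha>\<close>, formed as the pullback of the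
  restriction of \<open>b^I\<close> to both endpoints along \<open>(\<alpha> x1, x2)\<close> on
  \<open>X = a \<times> b\<close>. Using both endpoints at once makes the map to \<open>a\<close>
  and the evaluation at endpoint 1 isofibrations: each is the isofibration \<open>q'\<close>
  followed by a projection of the product.\<close>

lemma path_object_ex:
  assumes a [simp]: "a \<in> Obj K" and b [simp]: "b \<in> Obj K" and \<alpha> [simp]: "\<alpha> \<in> hom a b 0"
  obtains P q \<epsilon> where "is_path_object a b \<alpha> P q \<epsilon>" "q \<in> isof P a" "\<epsilon> 0 (const_map 1 0) \<in> isof P b"
proof -
  interpret I: fibration_class K \<kappa> isof isof by (rule fibration_class_isof)
  obtain t where t: "is_terminal K t" using ex_terminal by blast
  then have [simp]: "t \<in> Obj K" by (simp add: is_terminal_def)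
  obtain fa where fa [simp]: "fa \<in> hom a t 0" using terminal_hom_ex[OF t a, of 0] by blast
  obtain fb where fb [simp]: "fb \<in> hom b t 0" using terminal_hom_ex[OF t b, of 0] by blast
  have fai: "fa \<in> isof a t" and fbi: "fb \<in> isof b t" by (rule isof_terminal[OF _ t]; simp)+
  \<comment> \<open>The binary product as a pullback over the terminal object, which shows that both
    projections are isofibrations.\<close>
  obtain X x1 x2 where X: "is_pullback K a b t fa fb X x1 x2" using ex_pullback[OF a b _ fa fbi] by auto
  note [simp] = pullbackD(4,7,8)[OF X]
  have x1i: "x1 \<in> isof X a" by (rule isof_pullback[OF X fbi])
  have x2i: "x2 \<in> isof X b" by (rule isof_pullback[OF pullback_sym[OF X] fai])
  obtain T' :: "'u sset" and en de where T': "small_sset \<kappa> T'" and en: "en \<in> smap iso_nerve T'" and de: "de \<in> smap T' iso_nerve"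
    and dee: "\<And>n x. x \<in> simplices iso_nerve n \<Longrightarrow> de n (en n x) = x" and ende: "\<And>n y. y \<in> simplices T' n \<Longrightarrow> en n (de n y) = y"
    using small_sset_copy[OF size small_iso_nerve] by metis
  define S' where "S' = T'\<lparr>simplices := \<lambda>n. en n ` simplices iso_bd n\<rparr>"
  have S'1: "subsset S' T'" unfolding S'_def by (rule image_subsset[OF iso_bd_subsset en])
  have sT' [simp]: "simplicial_set T'" using T' by (simp add: small_sset_def)
  have sS' [simp]: "simplicial_set S'" by (rule subsset_simplicial_set[OF S'1 sT'])
  have S'm: "u \<in> simplices S' n \<longleftrightarrow> u = en n (const_map 0 n) \<or> u = en n (const_map (Suc 0) n)" for u n
    by (auto simp: S'_def)
  have o: "T' \<in> Obj (SSet \<kappa>)" "S' \<in> Obj (SSet \<kappa>)" using T' small_subsset[OF S'1 T'] by (auto simp: small_sset_def)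
  obtain c \<epsilon>c where c: "is_cotensor K T' b c \<epsilon>c" using ex_cotensor[OF o(1) b] by blast
  obtain bd \<epsilon>b where bd: "is_cotensor K S' b bd \<epsilon>b" using ex_cotensor[OF o(2) b] by blast
  note [simp] = cotensorD(1,2)[OF c] cotensorD(1,2)[OF bd] smap_closed[OF en] smap_closed[OF de] dee
    smap_closed[OF cotensorD(3)[OF c]] smap_closed[OF cotensorD(3)[OF bd]]
  have S'T' [simp]: "u \<in> simplices S' n \<Longrightarrow> u \<in> simplices T' n" for u n by (rule subsset_closed[OF S'1])
  obtain \<rho> where \<rho>: "is_cotensor_map K S' (incl S') b b (Ident K b) c \<epsilon>c bd \<epsilon>b \<rho>"
    by (rule cotensor_map_ex[OF c bd subsset_incl[OF S'1] _ sS']) auto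
  have \<rho>i: "\<rho> \<in> isof c bd" by (rule isof_cotensor_restriction[OF o(2,1) S'1 bd c \<rho>])
  then have [simp]: "\<rho> \<in> hom c bd 0" by (intro isof_hom_closed) simp_all
  have \<rho>c: "Comp K x bd b m (\<epsilon>b m u) (post x c bd m \<rho> z) = Comp K x c b m (\<epsilon>c m u) z"
    if [simp]: "x \<in> Obj K" "u \<in> simplices S' m" "z \<in> hom x c m" for x m u z
    using cotensor_map_Comp[OF \<rho> c bd _ ident_closed[OF b], of x u m z] cotensor_closed[OF c, of x u m z] by simp
  \<comment> \<open>The map from \<open>X\<close> to the cotensor by the endpoints:
    \<open>\<alpha> x1\<close> at endpoint 0 and \<open>x2\<close> at endpoint 1. Each simplex of
    \<open>S'\<close> is a copy of a constant one, and \<open>de\<close> tells which.\<close>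
  let ?g = "\<lambda>m u. degen (Hom K X b) m (if de m u = const_map 0 m then post X a b 0 \<alpha> x1 else x2)"
  have actde: "de k (act S' k m \<sigma> u) = const_map 0 k \<longleftrightarrow> de m u = const_map 0 m"
    if "\<sigma> \<in> Delta_hom k m" "u \<in> simplices S' m" for k m \<sigma> u
    using that smap_act[OF de that(1) S'T'[OF that(2)]] by (auto simp: S'm subsset_act[OF S'1])
  have "(\<lambda>m. \<lambda>y\<in>simplices (prod_sset (simplex 0) S') m. ?g m (snd y)) \<in> smap (prod_sset (simplex 0) S') (Hom K X b)"
    by (rule smap_restrictI) (auto simp: simplicial_set_prod actde)
  from ex1_implies_ex[OF cotensor_ex1[OF bd _ this]]
  obtain y where y [simp]: "y \<in> hom X bd 0" and y': "\<And>m \<theta> u. \<theta> \<in> Delta_hom m 0 \<Longrightarrow> u \<in> simplices S' m \<Longrightarrow>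
     Comp K X bd b m (\<epsilon>b m u) (act (Hom K X bd) m 0 \<theta> y) = ?g m u" by auto
  have yg: "Comp K X bd b m (\<epsilon>b m u) (degen (Hom K X bd) m y) = ?g m u" if "u \<in> simplices S' m" for m u
    using y'[of "const_map 0 m" m u] that by (simp add: act_0_eq_degen)
  have yc: "Comp K x bd b m (\<epsilon>b m u) (post x X bd m y z) = 
      post x X b m (if de m u = const_map 0 m then post X a b 0 \<alpha> x1 else x2) z"
    if [simp]: "x \<in> Obj K" "u \<in> simplices S' m" "z \<in> hom x X m" for x m u z
    using yg[of u m] by (simp add: Comp_post) (simp add: post_def)
  obtain P q' r' where P: "is_pullback K X c bd y \<rho> P q' r'" using ex_pullback[OF _ _ _ y \<rho>i] by auto
  note [simp] = pullbackD(4,7,8)[OF P]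
  have q'i: "q' \<in> isof P X" by (rule isof_pullback[OF P \<rho>i])
  let ?q = "post P X a 0 x1 q'"
  let ?\<epsilon> = "\<lambda>n. \<lambda>t\<in>simplices iso_nerve n. Comp K P c b n (\<epsilon>c n (en n t)) (degen (Hom K P c) n r')"
  have \<epsilon>: "?\<epsilon> \<in> smap iso_nerve (Hom K P b)"
    by (rule smap_restrictI) (simp_all add: cotensor_closed[OF c] cotensor_act[OF c] smap_act[OF en, symmetric])
  have \<epsilon>bd: "Comp K P c b n (\<epsilon>c n u) (degen (Hom K P c) n r') =
      degen (Hom K P b) n (post P X b 0 (if de n u = const_map 0 n then post X a b 0 \<alpha> x1 else x2) q')" if "u \<in> simplices S' n" for n u
  proof -
    have "Comp K P c b n (\<epsilon>c n u) (degen (Hom K P c) n r') = Comp K P bd b n (\<epsilon>b n u) (post P c bd n \<rho> (degen (Hom K P c) n r'))"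
      using that by (simp add: \<rho>c)
    also have "post P c bd n \<rho> (degen (Hom K P c) n r') = post P X bd n y (degen (Hom K P X) n q')"
      by (simp add: degen_post[symmetric] pullbackD(9)[OF P])
    also have "Comp K P bd b n (\<epsilon>b n u) \<dots> = degen (Hom K P b) n (post P X b 0 (if de n u = const_map 0 n then post X a b 0 \<alpha> x1 else x2) q')"
      using that by (simp add: yc degen_post)
    finally show ?thesis .
  qed
  have \<epsilon>01: "?\<epsilon> n (const_map 0 n) = degen (Hom K P b) n (post P a b 0 \<alpha> ?q)" "?\<epsilon> n (const_map (Suc 0) n) = degen (Hom K P b) n (post P X b 0 x2 q')" for n
    using \<epsilon>bd[of "en n (const_map 0 n)" n] \<epsilon>bd[of "en n (const_map (Suc 0) n)" n] by (simp_all add: S'm post_post)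
  have ev: "Comp K x P b m (?\<epsilon> m t) z = Comp K x c b m (\<epsilon>c m (en m t)) (post x P c m r' z)"
    if [simp]: "x \<in> Obj K" "t \<in> simplices iso_nerve m" "z \<in> hom x P m" for x m t z
    by (simp add: Comp_post)
  have "is_path_object a b \<alpha> P ?q ?\<epsilon>"
    unfolding is_path_object_def
  proof (intro conjI allI ballI impI \<epsilon> \<epsilon>01)
    fix x n h \<gamma> assume x [simp]: "x \<in> Obj K" and h [simp]: "h \<in> hom x a n" and \<gamma>: "\<gamma> \<in> smap (prod_sset (simplex n) iso_nerve) (Hom K x b)"
      and st: "\<forall>m. \<forall>\<theta>\<in>Delta_hom m n. \<gamma> m (\<theta>, const_map 0 m) = post x a b m \<alpha> (act (Hom K x a) m n \<theta> h)"
    have \<gamma>c [simp]: "\<gamma> m (\<theta>, t) \<in> hom x b m" if "\<theta> \<in> Delta_hom m n" "t \<in> simplices iso_nerve m" for m \<theta> t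
      using smap_closed[OF \<gamma>, of "(\<theta>, t)" m] that by simp
    have \<gamma>a: "act (Hom K x b) k m \<sigma> (\<gamma> m (\<theta>, t)) = \<gamma> k (compose {..k} \<theta> \<sigma>, compose {..k} t \<sigma>)"
      if "\<theta> \<in> Delta_hom m n" "t \<in> simplices iso_nerve m" "\<sigma> \<in> Delta_hom k m" for m \<theta> t k \<sigma>
      using hom_smap_act[OF \<gamma>, of "(\<theta>, t)" m \<sigma> k] that by simp
    \<comment> \<open>The second coordinate in \<open>X\<close> has to be the value of the homotopy
      at endpoint 1.\<close>
    let ?h2 = "\<gamma> n (\<lambda>i\<in>{..n}. i, const_map (Suc 0) n)"
    have "post x a t n fa h = post x b t n fb ?h2" by (rule terminal_hom_eq[OF t x, of _ n]) simp_all
    then obtain z where z [simp]: "z \<in> hom x X n" "post x X a n x1 z = h" "post x X b n x2 z = ?h2"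
      using pullback_ex1[OF X x, of h n ?h2] by auto
    have "(\<lambda>m. \<lambda>y\<in>simplices (prod_sset (simplex n) T') m. \<gamma> m (fst y, de m (snd y))) \<in> smap (prod_sset (simplex n) T') (Hom K x b)"
      by (rule smap_restrictI) (auto simp: simplicial_set_prod \<gamma>a smap_act[OF de])
    from ex1_implies_ex[OF cotensor_ex1[OF c x this]]
    obtain w where w [simp]: "w \<in> hom x c n" and w': "\<And>m \<theta> u. \<theta> \<in> Delta_hom m n \<Longrightarrow> u \<in> simplices T' m \<Longrightarrow>
        Comp K x c b m (\<epsilon>c m u) (act (Hom K x c) m n \<theta> w) = \<gamma> m (\<theta>, de m u)" by auto
    have "post x X bd n y z = post x c bd n \<rho> w"
    proof (rule cotensor_eqI[OF bd x sS'])
      fix m \<theta> u assume [simp]: "\<theta> \<in> Delta_hom m n" "u \<in> simplices S' m"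
      have "act (Hom K x b) m n \<theta> ?h2 = \<gamma> m (\<theta>, const_map (Suc 0) m)" by (simp add: \<gamma>a)
      moreover have "post x X b m x2 (act (Hom K x X) m n \<theta> z) = act (Hom K x b) m n \<theta> ?h2"
        by (simp add: act_post[symmetric])
      moreover have "post x X b m (post X a b 0 \<alpha> x1) (act (Hom K x X) m n \<theta> z) = \<gamma> m (\<theta>, const_map 0 m)"
        by (simp add: st post_post[symmetric]) (simp add: act_post[symmetric])
      moreover have "de m u = const_map 0 m \<or> de m u = const_map (Suc 0) m" using \<open>u \<in> simplices S' m\<close> by (auto simp: S'm)
      ultimately show "Comp K x bd b m (\<epsilon>b m u) (act (Hom K x bd) m n \<theta> (post x X bd n y z)) =
         Comp K x bd b m (\<epsilon>b m u) (act (Hom K x bd) m n \<theta> (post x c bd n \<rho> w))"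
        by (auto simp: act_post yc \<rho>c w')
    qed simp_all
    then obtain k where k [simp]: "k \<in> hom x P n" "post x P X n q' k = z" "post x P c n r' k = w"
      using pullback_ex1[OF P x, of z n w] by auto
    show "\<exists>!k. k \<in> hom x P n \<and> post x P a n ?q k = h \<and>
           (\<forall>m. \<forall>\<theta>\<in>Delta_hom m n. \<forall>t\<in>simplices iso_nerve m.
              Comp K x P b m (?\<epsilon> m t) (act (Hom K x P) m n \<theta> k) = \<gamma> m (\<theta>, t))"
    proof (rule ex1I[of _ k], intro conjI allI ballI)
      show "post x P a n ?q k = h" by (simp add: post_post[symmetric])
      fix m \<theta> t assume [simp]: "\<theta> \<in> Delta_hom m n" "t \<in> simplices iso_nerve m"
      show "Comp K x P b m (?\<epsilon> m t) (act (Hom K x P) m n \<theta> k) = \<gamma> m (\<theta>, t)"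
        by (simp only: ev x \<open>t \<in> _\<close> act_hom_closed \<open>\<theta> \<in> _\<close> k pullbackD(4)[OF P]) (simp add: act_post[symmetric] w')
    next
      fix k' assume "k' \<in> hom x P n \<and> post x P a n ?q k' = h \<and>
           (\<forall>m. \<forall>\<theta>\<in>Delta_hom m n. \<forall>t\<in>simplices iso_nerve m.
              Comp K x P b m (?\<epsilon> m t) (act (Hom K x P) m n \<theta> k') = \<gamma> m (\<theta>, t))"
      then have k' [simp]: "k' \<in> hom x P n" and qk': "post x P a n ?q k' = h" and ek': "\<And>m \<theta> t. \<theta> \<in> Delta_hom m n \<Longrightarrow> t \<in> simplices iso_nerve m \<Longrightarrow>
              Comp K x P b m (?\<epsilon> m t) (act (Hom K x P) m n \<theta> k') = \<gamma> m (\<theta>, t)" by blast+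
      \<comment> \<open>The coordinates of \<open>k'\<close> in \<open>X\<close> are recovered from
        \<open>h\<close> and from endpoint 1 of its homotopy; evaluation on the interval gives the
        coordinate in the cotensor.\<close>
      have e1: "post x P X n q' k' = z"
      proof (rule pullback_eqI[OF X x])
        show "post x X a n x1 (post x P X n q' k') = post x X a n x1 z" using qk' by (simp add: post_post)
        have "post x X b n x2 (post x P X n q' k') = Comp K x P b n (?\<epsilon> n (const_map (Suc 0) n)) k'"
          unfolding \<epsilon>01 by (simp add: post_post) (simp add: post_def)
        also have "\<dots> = ?h2" using ek'[of "\<lambda>i\<in>{..n}. i" n "const_map (Suc 0) n"] by simp
        finally show "post x X b n x2 (post x P X n q' k') = post x X b n x2 z" by simp
      qed simp_all
      have e2: "post x P c n r' k' = w"
      proof (rule cotensor_eqI[OF c x sT'])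
        fix m \<theta> u assume [simp]: "\<theta> \<in> Delta_hom m n" "u \<in> simplices T' m"
        have "Comp K x c b m (\<epsilon>c m (en m (de m u))) (post x P c m r' (act (Hom K x P) m n \<theta> k')) = \<gamma> m (\<theta>, de m u)"
          using ek'[of \<theta> m "de m u"] ev[of x "de m u" m "act (Hom K x P) m n \<theta> k'"] by simp
        then show "Comp K x c b m (\<epsilon>c m u) (act (Hom K x c) m n \<theta> (post x P c n r' k')) = Comp K x c b m (\<epsilon>c m u) (act (Hom K x c) m n \<theta> w)"
          by (simp add: ende w' act_post)
      qed simp_all
      show "k' = k" by (rule pullback_eqI[OF P x k' k(1)]) (simp_all add: e1 e2)
    qed simp_all
  qed simp_all
  moreover have "?q \<in> isof P a" by (rule I.Cl_comp[OF _ _ _ x1i q'i]) simp_all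
  moreover have "?\<epsilon> 0 (const_map 1 0) \<in> isof P b"
  proof -
    have "post P X b 0 x2 q' \<in> isof P b" by (rule I.Cl_comp[OF _ _ _ x2i q'i]) simp_all
    moreover have "degen (Hom K P b) 0 (post P X b 0 x2 q') = post P X b 0 x2 q'" by simp
    ultimately show ?thesis using \<epsilon>01(2)[of 0] by simp
  qed
  ultimately show thesis by (rule that)
qed

text \<open>The section is the constant homotopy at \<open>\<alpha>\<close>. The path object
  contracts onto it by shortening homotopies: \<open>N t\<close> replaces
  \<open>\<epsilon> \<tau>\<close> by \<open>\<epsilon> (t \<tau>)\<close>, which is constant for
  \<open>t = 0\<close> and unchanged for \<open>t = 1\<close>.\<close>

lemma path_object_section:
  assumes P: "is_path_object a b \<alpha> P q \<epsilon>" and a [simp]: "a \<in> Obj K" and b [simp]: "b \<in> Obj K" and \<alpha> [simp]: "\<alpha> \<in> hom a b 0"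
  obtains s where "s \<in> hom a P 0" "post a P a 0 q s = Ident K a"
    "\<And>m t. t \<in> simplices iso_nerve m \<Longrightarrow> Comp K a P b m (\<epsilon> m t) (degen (Hom K a P) m s) = degen (Hom K a b) m \<alpha>"
    "hequiv P a q"
proof -
  note [simp] = path_objectD(1,2)[OF P] smap_closed[OF path_objectD(3)[OF P]]
  note \<epsilon>a = hom_smap_act[OF path_objectD(3)[OF P]] and \<epsilon>0 = path_objectD(4)[OF P]
  have "\<exists>!k. k \<in> hom a P 0 \<and> post a P a 0 q k = Ident K a \<and>
           (\<forall>m. \<forall>\<theta>\<in>Delta_hom m 0. \<forall>t\<in>simplices iso_nerve m.
              Comp K a P b m (\<epsilon> m t) (act (Hom K a P) m 0 \<theta> k) = degen (Hom K a b) m \<alpha>)"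
    by (rule path_object_ex1[OF P a]) (simp_all add: Delta_hom_0 act_0_eq_degen post_degen_Ident)
  then obtain s where s [simp]: "s \<in> hom a P 0" and qs: "post a P a 0 q s = Ident K a"
    and s': "\<And>m \<theta> t. \<theta> \<in> Delta_hom m 0 \<Longrightarrow> t \<in> simplices iso_nerve m \<Longrightarrow>
       Comp K a P b m (\<epsilon> m t) (act (Hom K a P) m 0 \<theta> s) = degen (Hom K a b) m \<alpha>" by blast
  have \<epsilon>s: "Comp K a P b m (\<epsilon> m t) (degen (Hom K a P) m s) = degen (Hom K a b) m \<alpha>" if "t \<in> simplices iso_nerve m" for m t
    using s'[of "const_map 0 m" m t] that by (simp add: act_0_eq_degen)
  obtain N where N: "N \<in> smap iso_nerve (Hom K P P)" and R: "\<And>n t. t \<in> simplices iso_nerve n \<Longrightarrow>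
     post P P a n q (N n t) = degen (Hom K P a) n q \<and> (\<forall>m. \<forall>\<theta>\<in>Delta_hom m n. \<forall>\<tau>\<in>simplices iso_nerve m.
       Comp K P P b m (\<epsilon> m \<tau>) (act (Hom K P P) m n \<theta> (N n t)) = \<epsilon> m (imul m (compose {..m} t \<theta>) \<tau>))"
  proof (rule smap_by_uniqueness[OF simplicial_set_iso_nerve path_objectD(1)[OF P] path_objectD(1)[OF P]])
    fix n t assume t [simp]: "t \<in> simplices iso_nerve n"
    have tc [simp]: "compose {..m} t \<theta> \<in> simplices iso_nerve m" if "\<theta> \<in> Delta_hom m n" for m \<theta>
      using simplicial_set.act_closed[OF simplicial_set_iso_nerve that t] by simp
    show "\<exists>!k. k \<in> hom P P n \<and> post P P a n q k = degen (Hom K P a) n q \<and> (\<forall>m. \<forall>\<theta>\<in>Delta_hom m n. \<forall>\<tau>\<in>simplices iso_nerve m.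
       Comp K P P b m (\<epsilon> m \<tau>) (act (Hom K P P) m n \<theta> k) = \<epsilon> m (imul m (compose {..m} t \<theta>) \<tau>))"
      by (rule path_object_ex1[OF P]) (simp_all add: \<epsilon>a imul_act[symmetric] compose_Delta_assoc \<epsilon>0 degen_post)
  next
    fix n t k m \<theta> assume t: "t \<in> simplices iso_nerve n" and \<theta>: "\<theta> \<in> Delta_hom m n" and k: "k \<in> hom P P n"
      and R: "post P P a n q k = degen (Hom K P a) n q \<and> (\<forall>m. \<forall>\<theta>\<in>Delta_hom m n. \<forall>\<tau>\<in>simplices iso_nerve m.
       Comp K P P b m (\<epsilon> m \<tau>) (act (Hom K P P) m n \<theta> k) = \<epsilon> m (imul m (compose {..m} t \<theta>) \<tau>))"
    then show "post P P a m q (act (Hom K P P) m n \<theta> k) = degen (Hom K P a) m q \<and> (\<forall>j. \<forall>\<sigma>\<in>Delta_hom j m. \<forall>\<tau>\<in>simplices iso_nerve j.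
       Comp K P P b j (\<epsilon> j \<tau>) (act (Hom K P P) j m \<sigma> (act (Hom K P P) m n \<theta> k)) = \<epsilon> j (imul j (compose {..j} (act iso_nerve m n \<theta> t) \<sigma>) \<tau>))"
      by (auto simp: act_post[symmetric] act_hom_act compose_Delta_assoc)
  qed (rule that)
  \<comment> \<open>Multiplication by 0 leaves only the starting value \<open>\<alpha> q\<close>,
    and this is the homotopy described by \<open>s q\<close>.\<close>
  have N0: "N 0 (const_map 0 0) = post P a P 0 s q"
  proof (rule path_object_eqI[OF P _ a b \<alpha>])
    show "N 0 (const_map 0 0) \<in> hom P P 0" by (rule smap_closed[OF N]) simp
    show "post P P a 0 q (N 0 (const_map 0 0)) = post P P a 0 q (post P a P 0 s q)"
      using R[of "const_map 0 0" 0] by (simp add: post_post qs)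
    fix m \<theta> t assume h: "\<theta> \<in> Delta_hom m 0" "t \<in> simplices iso_nerve m"
    have "Comp K P P b m (\<epsilon> m t) (act (Hom K P P) m 0 \<theta> (N 0 (const_map 0 0))) = degen (Hom K P b) m (post P a b 0 \<alpha> q)"
      using R[of "const_map 0 0" 0] h by (simp add: \<epsilon>0)
    also have "\<dots> = Comp K P P b m (\<epsilon> m t) (post P a P m s (degen (Hom K P a) m q))"
      using h by (simp add: Comp_post \<epsilon>s degen_post) (simp add: post_def)
    finally show "Comp K P P b m (\<epsilon> m t) (act (Hom K P P) m 0 \<theta> (N 0 (const_map 0 0))) =
        Comp K P P b m (\<epsilon> m t) (act (Hom K P P) m 0 \<theta> (post P a P 0 s q))"
      using h by (simp add: Delta_hom_0 act_0_eq_degen degen_post)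
  qed simp_all
  have N1: "N 0 (const_map (Suc 0) 0) = Ident K P"
  proof (rule path_object_eqI[OF P _ a b \<alpha>])
    show "N 0 (const_map (Suc 0) 0) \<in> hom P P 0" by (rule smap_closed[OF N]) simp
    show "post P P a 0 q (N 0 (const_map (Suc 0) 0)) = post P P a 0 q (Ident K P)"
      using R[of "const_map (Suc 0) 0" 0] by simp
    fix m \<theta> t assume h: "\<theta> \<in> Delta_hom m 0" "t \<in> simplices iso_nerve m"
    then show "Comp K P P b m (\<epsilon> m t) (act (Hom K P P) m 0 \<theta> (N 0 (const_map (Suc 0) 0))) =
        Comp K P P b m (\<epsilon> m t) (act (Hom K P P) m 0 \<theta> (Ident K P))"
      using R[of "const_map (Suc 0) 0" 0] by (simp add: Delta_hom_0 act_0_eq_degen)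
  qed simp_all
  have "path P P (post P a P 0 s q) (Ident K P)" unfolding path_def by (rule bexI[OF _ N]) (simp add: N0 N1)
  then have "hequiv P a q"
    unfolding hequiv_def using path_sym path_refl[of a a "Ident K a"] by (intro conjI bexI[of _ s]) (simp_all add: qs)
  then show thesis using that[OF s qs \<epsilon>s] by blast
qed

end

section \<open>The diagram of path objects\<close>

context diagrams
begin

lemma diagram_act: "diagram F \<Longrightarrow> a \<in> Obj A \<Longrightarrow> b \<in> Obj A \<Longrightarrow> \<theta> \<in> Delta_hom m n \<Longrightarrow> f \<in> simplices (Hom A a b) n \<Longrightarrow>
   act (Hom K (fobj F a) (fobj F b)) m n \<theta> (fmap F a b n f) = fmap F a b m (act (Hom A a b) m n \<theta> f)"
  unfolding diagram_def by (simp add: simplicial_functor.fmap_act)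

lemma diagram_Ident: "diagram F \<Longrightarrow> a \<in> Obj A \<Longrightarrow> fmap F a a 0 (Ident A a) = Ident K (fobj F a)"
  unfolding diagram_def by (rule simplicial_functor.fmap_ident)

lemma diagram_Comp: "diagram F \<Longrightarrow> a \<in> Obj A \<Longrightarrow> b \<in> Obj A \<Longrightarrow> c \<in> Obj A \<Longrightarrow> g \<in> simplices (Hom A b c) n \<Longrightarrow>
   f \<in> simplices (Hom A a b) n \<Longrightarrow>
   fmap F a c n (Comp A a b c n g f) = Comp K (fobj F a) (fobj F b) (fobj F c) n (fmap F b c n g) (fmap F a b n f)"
  unfolding diagram_def by (rule simplicial_functor.fmap_comp)

lemma diag_mapI:
  assumes "\<And>a. a \<in> Obj A \<Longrightarrow> \<beta> a \<in> hom (fobj F a) (fobj G a) 0"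
    and "\<And>a b k f. a \<in> Obj A \<Longrightarrow> b \<in> Obj A \<Longrightarrow> f \<in> simplices (Hom A a b) k \<Longrightarrow>
      Comp K (fobj F a) (fobj G a) (fobj G b) k (fmap G a b k f) (degen (Hom K (fobj F a) (fobj G a)) k (\<beta> a)) =
      Comp K (fobj F a) (fobj F b) (fobj G b) k (degen (Hom K (fobj F b) (fobj G b)) k (\<beta> b)) (fmap F a b k f)"
  shows "diag_map F G (restrict \<beta> (Obj A))"
  using assms by (auto simp: diag_map_def nat_sset_def Delta_hom_0 K.act_0_eq_degen)

end

text \<open>The path objects are an arbitrary choice, made separately for each \<open>a\<close>;
  their functoriality is derived from the universal property.\<close>

locale path_diagram = cosmos_diagrams K \<kappa> isof A
  for K :: "('o, 'u) scat" and \<kappa> :: "'k rel" and isof and A :: "('a, 'u) scat" +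
  fixes F G :: "('a, 'u, 'o, 'u) sfun" and \<alpha> :: "'a \<Rightarrow> 'u" and P q \<epsilon>
  assumes F [simp]: "diagram F" and G [simp]: "diagram G" and \<alpha> [simp]: "diag_map F G \<alpha>"
    and P: "a \<in> Obj A \<Longrightarrow> is_path_object (fobj F a) (fobj G a) (\<alpha> a) (P a) (q a) (\<epsilon> a)"
begin

lemmas P_simps [simp] = path_objectD(1,2)[OF P] smap_closed[OF path_objectD(3)[OF P]]
lemmas \<epsilon>_act = hom_smap_act[OF path_objectD(3)[OF P]]
lemmas \<epsilon>_0 = path_objectD(4)[OF P]
lemmas P_eqI = path_object_eqI[OF P]

text \<open>The map induced by \<open>f\<close> applies \<open>F f\<close> to the first coordinate
  and \<open>G f\<close> to the homotopy. Stated for simplices \<open>f\<close> of all dimensions it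
  gives an enriched action; \<open>\<theta>\<close> runs through the restrictions of
  \<open>f\<close>, as the universal property of \<open>P b\<close> demands.\<close>

definition is_pmap where
  "is_pmap a b n f k \<longleftrightarrow> k \<in> hom (P a) (P b) n \<and>
     post (P a) (P b) (fobj F b) n (q b) k = Comp K (P a) (fobj F a) (fobj F b) n (fmap F a b n f) (degen (Hom K (P a) (fobj F a)) n (q a)) \<and>
     (\<forall>m. \<forall>\<theta>\<in>Delta_hom m n. \<forall>t\<in>simplices iso_nerve m.
        Comp K (P a) (P b) (fobj G b) m (\<epsilon> b m t) (act (Hom K (P a) (P b)) m n \<theta> k) =
        Comp K (P a) (fobj G a) (fobj G b) m (act (Hom K (fobj G a) (fobj G b)) m n \<theta> (fmap G a b n f)) (\<epsilon> a m t))"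

text \<open>The required homotopy, \<open>G f\<close> after \<open>\<epsilon> a\<close>, starts at
  \<open>G f \<alpha> q = \<alpha> F f q\<close> by naturality of \<open>\<alpha>\<close>; so the
  universal property of \<open>P b\<close> applies.\<close>

lemma is_pmap_ex1:
  assumes [simp]: "a \<in> Obj A" "b \<in> Obj A" "f \<in> simplices (Hom A a b) n"
  shows "\<exists>!k. is_pmap a b n f k"
  unfolding is_pmap_def
proof (rule path_object_ex1[OF P])
  fix m \<theta> assume [simp]: "\<theta> \<in> Delta_hom m n"
  let ?f = "act (Hom A a b) m n \<theta> f"
  have "Comp K (P a) (fobj G a) (fobj G b) m (fmap G a b m ?f) (post (P a) (fobj F a) (fobj G a) m (\<alpha> a) (degen (Hom K (P a) (fobj F a)) m (q a))) =
     post (P a) (fobj F b) (fobj G b) m (\<alpha> b) (Comp K (P a) (fobj F a) (fobj F b) m (fmap F a b m ?f) (degen (Hom K (P a) (fobj F a)) m (q a)))"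
    using diag_map_natural[OF \<alpha>, of a b ?f m] by (simp add: Comp_post post_Comp) (simp add: post_def)
  then show "Comp K (P a) (fobj G a) (fobj G b) m (act (Hom K (fobj G a) (fobj G b)) m n \<theta> (fmap G a b n f)) (\<epsilon> a m (const_map 0 m)) =
      post (P a) (fobj F b) (fobj G b) m (\<alpha> b) (act (Hom K (P a) (fobj F b)) m n \<theta>
        (Comp K (P a) (fobj F a) (fobj F b) n (fmap F a b n f) (degen (Hom K (P a) (fobj F a)) n (q a))))"
    by (simp add: diagram_act \<epsilon>_0 degen_post comp_act)
qed (simp_all add: comp_act act_hom_act \<epsilon>_act)

definition pmap where "pmap a b n f = (THE k. is_pmap a b n f k)"

lemma pmap: "a \<in> Obj A \<Longrightarrow> b \<in> Obj A \<Longrightarrow> f \<in> simplices (Hom A a b) n \<Longrightarrow> is_pmap a b n f (pmap a b n f)"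
  unfolding pmap_def by (rule theI'[OF is_pmap_ex1])

lemma pmapD:
  assumes "a \<in> Obj A" "b \<in> Obj A" "f \<in> simplices (Hom A a b) n"
  shows pmap_closed [simp]: "pmap a b n f \<in> hom (P a) (P b) n"
    and q_pmap: "post (P a) (P b) (fobj F b) n (q b) (pmap a b n f) =
      Comp K (P a) (fobj F a) (fobj F b) n (fmap F a b n f) (degen (Hom K (P a) (fobj F a)) n (q a))"
    and \<epsilon>_pmap: "\<theta> \<in> Delta_hom m n \<Longrightarrow> t \<in> simplices iso_nerve m \<Longrightarrow>
      Comp K (P a) (P b) (fobj G b) m (\<epsilon> b m t) (act (Hom K (P a) (P b)) m n \<theta> (pmap a b n f)) =
      Comp K (P a) (fobj G a) (fobj G b) m (act (Hom K (fobj G a) (fobj G b)) m n \<theta> (fmap G a b n f)) (\<epsilon> a m t)"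
  using pmap[OF assms] unfolding is_pmap_def by blast+

lemma pmap_eqI: "a \<in> Obj A \<Longrightarrow> b \<in> Obj A \<Longrightarrow> f \<in> simplices (Hom A a b) n \<Longrightarrow> is_pmap a b n f k \<Longrightarrow> pmap a b n f = k"
  using is_pmap_ex1 pmap by blast

definition pdiag where "pdiag = \<lparr>fobj = P, fmap = pmap\<rparr>"

lemma pdiag_simps [simp]: "fobj pdiag = P" "fmap pdiag = pmap"
  by (simp_all add: pdiag_def)

text \<open>Each functor law holds because both sides satisfy \<open>is_pmap\<close> for the same
  morphism, and only one simplex does.\<close>

lemma pdiag_diagram [simp]: "diagram pdiag"
  unfolding diagram_def
proof
  show "fmap pdiag a b m (act (Hom A a b) m n \<theta> f) = act (Hom K (fobj pdiag a) (fobj pdiag b)) m n \<theta> (fmap pdiag a b n f)"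
    if [simp]: "a \<in> Obj A" "b \<in> Obj A" "\<theta> \<in> Delta_hom m n" "f \<in> simplices (Hom A a b) n" for a b \<theta> m n f
  proof -
    have "is_pmap a b m (act (Hom A a b) m n \<theta> f) (act (Hom K (P a) (P b)) m n \<theta> (pmap a b n f))"
      unfolding is_pmap_def
      by (intro conjI allI ballI)
        (simp_all add: act_post[symmetric] q_pmap comp_act diagram_act act_hom_act \<epsilon>_pmap A.act_hom_act)
    then show ?thesis by (simp add: pmap_eqI)
  qed
  show "fmap pdiag a a 0 (Ident A a) = Ident K (fobj pdiag a)" if [simp]: "a \<in> Obj A" for a
  proof -
    have "is_pmap a a 0 (Ident A a) (Ident K (P a))"
      unfolding is_pmap_def by (intro conjI allI ballI) (simp_all add: diagram_Ident Comp_0_eq_post Delta_hom_0 act_0_eq_degen)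
    then show ?thesis by (simp add: pmap_eqI)
  qed
  show "fmap pdiag a c n (Comp A a b c n g f) = Comp K (fobj pdiag a) (fobj pdiag b) (fobj pdiag c) n (fmap pdiag b c n g) (fmap pdiag a b n f)"
    if [simp]: "a \<in> Obj A" "b \<in> Obj A" "c \<in> Obj A" "g \<in> simplices (Hom A b c) n" "f \<in> simplices (Hom A a b) n" for a b c g n f
  proof -
    have "is_pmap a c n (Comp A a b c n g f) (Comp K (P a) (P b) (P c) n (pmap b c n g) (pmap a b n f))"
      unfolding is_pmap_def
    proof (intro conjI allI ballI)
      have "post (P a) (P c) (fobj F c) n (q c) (Comp K (P a) (P b) (P c) n (pmap b c n g) (pmap a b n f)) =
          Comp K (P a) (fobj F b) (fobj F c) n (fmap F b c n g) (post (P a) (P b) (fobj F b) n (q b) (pmap a b n f))"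
        by (simp add: post_Comp q_pmap[of b c g n]) (simp add: post_def comp_assoc)
      also have "\<dots> = Comp K (P a) (fobj F a) (fobj F c) n (fmap F a c n (Comp A a b c n g f)) (degen (Hom K (P a) (fobj F a)) n (q a))"
        using q_pmap[of a b f n] by (simp add: diagram_Comp comp_assoc[symmetric])
      finally show "post (P a) (P c) (fobj F c) n (q c) (Comp K (P a) (P b) (P c) n (pmap b c n g) (pmap a b n f)) =
          Comp K (P a) (fobj F a) (fobj F c) n (fmap F a c n (Comp A a b c n g f)) (degen (Hom K (P a) (fobj F a)) n (q a))" .
      fix m \<theta> t assume [simp]: "\<theta> \<in> Delta_hom m n" "t \<in> simplices iso_nerve m"
      have "Comp K (P a) (P c) (fobj G c) m (\<epsilon> c m t) (Comp K (P a) (P b) (P c) m (act (Hom K (P b) (P c)) m n \<theta> (pmap b c n g)) (act (Hom K (P a) (P b)) m n \<theta> (pmap a b n f))) =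
         Comp K (P a) (fobj G b) (fobj G c) m (act (Hom K (fobj G b) (fobj G c)) m n \<theta> (fmap G b c n g))
          (Comp K (P a) (P b) (fobj G b) m (\<epsilon> b m t) (act (Hom K (P a) (P b)) m n \<theta> (pmap a b n f)))"
        by (simp add: comp_assoc \<epsilon>_pmap[of b c g n])
      also have "\<dots> = Comp K (P a) (fobj G a) (fobj G c) m (act (Hom K (fobj G a) (fobj G c)) m n \<theta> (fmap G a c n (Comp A a b c n g f))) (\<epsilon> a m t)"
        by (simp add: \<epsilon>_pmap diagram_Comp comp_act comp_assoc[symmetric])
      finally show "Comp K (P a) (P c) (fobj G c) m (\<epsilon> c m t) (act (Hom K (P a) (P c)) m n \<theta> (Comp K (P a) (P b) (P c) n (pmap b c n g) (pmap a b n f))) =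
         Comp K (P a) (fobj G a) (fobj G c) m (act (Hom K (fobj G a) (fobj G c)) m n \<theta> (fmap G a c n (Comp A a b c n g f))) (\<epsilon> a m t)"
        by (simp add: comp_act)
    qed simp
    then show ?thesis by (simp add: pmap_eqI)
  qed
qed simp_all

lemma q_diag_map: "diag_map pdiag F (restrict q (Obj A))"
  by (rule diag_mapI) (simp_all add: q_pmap[unfolded post_def, symmetric])

definition ev where "ev a = \<epsilon> a 0 (const_map (Suc 0) 0)"

lemma ev_closed [simp]: "a \<in> Obj A \<Longrightarrow> ev a \<in> hom (P a) (fobj G a) 0"
  by (simp add: ev_def)

lemma \<epsilon>_1: "a \<in> Obj A \<Longrightarrow> \<epsilon> a n (const_map (Suc 0) n) = degen (Hom K (P a) (fobj G a)) n (ev a)"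
  using smap_iso_const[OF path_objectD(3)[OF P], of a 1 n] by (simp add: ev_def)

lemma ev_diag_map: "diag_map pdiag G (restrict ev (Obj A))"
proof (rule diag_mapI)
  fix a b k f assume [simp]: "a \<in> Obj A" "b \<in> Obj A" "f \<in> simplices (Hom A a b) k"
  show "Comp K (fobj pdiag a) (fobj G a) (fobj G b) k (fmap G a b k f) (degen (Hom K (fobj pdiag a) (fobj G a)) k (ev a)) =
      Comp K (fobj pdiag a) (fobj pdiag b) (fobj G b) k (degen (Hom K (fobj pdiag b) (fobj G b)) k (ev b)) (fmap pdiag a b k f)"
    using \<epsilon>_pmap[of a b f k "\<lambda>i\<in>{..k}. i" k "const_map (Suc 0) k"] by (simp add: \<epsilon>_1)
qed simp

text \<open>Naturality is checked in \<open>P b\<close> by its two coordinates: over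
  \<open>F\<close> since \<open>q s = id\<close>, and on homotopies since both sides are constant at
  \<open>G f \<alpha> = \<alpha> F f\<close>.\<close>

lemma section_diag_map:
  assumes s: "\<And>a. a \<in> Obj A \<Longrightarrow> s a \<in> hom (fobj F a) (P a) 0" "\<And>a. a \<in> Obj A \<Longrightarrow> post (fobj F a) (P a) (fobj F a) 0 (q a) (s a) = Ident K (fobj F a)"
    and \<epsilon>s: "\<And>a m t. a \<in> Obj A \<Longrightarrow> t \<in> simplices iso_nerve m \<Longrightarrow>
      Comp K (fobj F a) (P a) (fobj G a) m (\<epsilon> a m t) (degen (Hom K (fobj F a) (P a)) m (s a)) = degen (Hom K (fobj F a) (fobj G a)) m (\<alpha> a)"
  shows "diag_map F pdiag (restrict s (Obj A))"
proof (rule diag_mapI)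
  note [simp] = s(1)
  have qs: "Comp K (fobj F a) (P a) (fobj F a) k (degen (Hom K (P a) (fobj F a)) k (q a)) (degen (Hom K (fobj F a) (P a)) k (s a)) =
     degen (Hom K (fobj F a) (fobj F a)) k (Ident K (fobj F a))" if "a \<in> Obj A" for a k
    using that by (simp add: degen_Comp[symmetric] Comp_0_eq_post s(2))
  fix a b k f assume [simp]: "a \<in> Obj A" "b \<in> Obj A" "f \<in> simplices (Hom A a b) k"
  let ?s = "\<lambda>a k. degen (Hom K (fobj F a) (P a)) k (s a)"
  have "Comp K (fobj F a) (P a) (P b) k (pmap a b k f) (?s a k) = Comp K (fobj F a) (fobj F b) (P b) k (?s b k) (fmap F a b k f)"
  proof (rule P_eqI[of b "fobj F a"])
    show "post (fobj F a) (P b) (fobj F b) k (q b) (Comp K (fobj F a) (P a) (P b) k (pmap a b k f) (?s a k)) =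
        post (fobj F a) (P b) (fobj F b) k (q b) (Comp K (fobj F a) (fobj F b) (P b) k (?s b k) (fmap F a b k f))"
      by (simp add: post_Comp q_pmap comp_assoc[symmetric] qs) (simp add: post_def comp_assoc qs)
    fix m \<theta> t assume [simp]: "\<theta> \<in> Delta_hom m k" "t \<in> simplices iso_nerve m"
    let ?f = "act (Hom A a b) m k \<theta> f"
    have "Comp K (fobj F a) (P b) (fobj G b) m (\<epsilon> b m t) (Comp K (fobj F a) (P a) (P b) m (act (Hom K (P a) (P b)) m k \<theta> (pmap a b k f)) (?s a m)) =
        Comp K (fobj F a) (fobj G a) (fobj G b) m (fmap G a b m ?f) (Comp K (fobj F a) (P a) (fobj G a) m (\<epsilon> a m t) (?s a m))"
      by (simp add: comp_assoc \<epsilon>_pmap diagram_act)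
    also have "\<dots> = Comp K (fobj F a) (fobj F b) (fobj G b) m (degen (Hom K (fobj F b) (fobj G b)) m (\<alpha> b)) (fmap F a b m ?f)"
      by (simp add: \<epsilon>s diag_map_natural)
    also have "\<dots> = Comp K (fobj F a) (P b) (fobj G b) m (\<epsilon> b m t) (Comp K (fobj F a) (fobj F b) (P b) m (?s b m) (fmap F a b m ?f))"
      by (simp add: comp_assoc \<epsilon>s)
    finally show "Comp K (fobj F a) (P b) (fobj G b) m (\<epsilon> b m t) (act (Hom K (fobj F a) (P b)) m k \<theta> (Comp K (fobj F a) (P a) (P b) k (pmap a b k f) (?s a k))) =
        Comp K (fobj F a) (P b) (fobj G b) m (\<epsilon> b m t) (act (Hom K (fobj F a) (P b)) m k \<theta> (Comp K (fobj F a) (fobj F b) (P b) k (?s b k) (fmap F a b k f)))"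
      by (simp add: comp_act diagram_act)
  qed simp_all
  then show "Comp K (fobj F a) (fobj pdiag a) (fobj pdiag b) k (fmap pdiag a b k f) (degen (Hom K (fobj F a) (fobj pdiag a)) k (s a)) =
      Comp K (fobj F a) (fobj F b) (fobj pdiag b) k (degen (Hom K (fobj F b) (fobj pdiag b)) k (s b)) (fmap F a b k f)" by simp
qed (simp add: s(1))

end

section \<open>Equivalences of diagrams\<close>

context cosmos_diagrams
begin

lemma lim_diagram_map:
  assumes L: "is_weighted_limit K A W F l lam" and L': "is_weighted_limit K A W G l' lam'" and [simp]: "weight W" "diagram F" "diagram G" "diag_map F G \<alpha>"
  shows lim_diagram_map_closed: "lim_diagram_map K A W F l lam G l' lam' \<alpha> \<in> hom l l' 0"
    and pull_lim_diagram_map: "pull W G l' lam' l 0 (lim_diagram_map K A W F l lam G l' lam' \<alpha>) = nwhisk W F G \<alpha> l 0 lam"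
  unfolding lim_diagram_map_def using weighted_limitD[OF L]
  by (simp_all add: Comp_whisker factor_cone[OF L'])

lemma lim_diagram_map_in_class:
  assumes "fibration_class K \<kappa> isof Cl" "diagram F" "diagram G" "diag_map F G \<alpha>" "\<And>a. a \<in> Obj A \<Longrightarrow> \<alpha> a \<in> Cl (fobj F a) (fobj G a)"
    "flexible \<kappa> A W" "is_weighted_limit K A W F l lam" "is_weighted_limit K A W G l' lam'"
  shows "lim_diagram_map K A W F l lam G l' lam' \<alpha> \<in> Cl l l'"
  by (rule cell_induction.lim_diagram_map_Cl[OF cell_induction.intro[OF assms(1) diagrams_axioms cell_induction_axioms.intro[OF size assms(2-5)]] assms(6-8)])

text \<open>Ken Brown's factorization: an objectwise equivalence is a section of a trivial fibration from the
  diagram of path objects followed by a trivial fibration.\<close>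

theorem lim_diagram_map_equiv:
  assumes F [simp]: "diagram F" and G [simp]: "diagram G" and \<alpha> [simp]: "diag_map F G \<alpha>"
    and eq: "\<And>a. a \<in> Obj A \<Longrightarrow> \<alpha> a \<in> equivs K (fobj F a) (fobj G a)"
    and W: "flexible \<kappa> A W" and L: "is_weighted_limit K A W F l lam" and L': "is_weighted_limit K A W G l' lam'"
  shows "lim_diagram_map K A W F l lam G l' lam' \<alpha> \<in> equivs K l l'"
proof -
  have [simp]: "weight W" using W weights_sset_functor[OF A.simplicial_category_axioms]
    by (auto simp: flexible_def projective_cell_complex_def weight_def)
  \<comment> \<open>One predicate bundles all components, so that path object and section are chosen
    together for each \<open>a\<close>.\<close>
  define Z where "Z a P q \<epsilon> s \<longleftrightarrow> is_path_object (fobj F a) (fobj G a) (\<alpha> a) P q \<epsilon> \<and> q \<in> isof P (fobj F a) \<and>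
     \<epsilon> 0 (const_map 1 0) \<in> isof P (fobj G a) \<and> s \<in> hom (fobj F a) P 0 \<and> post (fobj F a) P (fobj F a) 0 q s = Ident K (fobj F a) \<and>
     (\<forall>m. \<forall>t\<in>simplices iso_nerve m. Comp K (fobj F a) P (fobj G a) m (\<epsilon> m t) (degen (Hom K (fobj F a) P) m s) = degen (Hom K (fobj F a) (fobj G a)) m (\<alpha> a)) \<and>
     hequiv P (fobj F a) q" for a P q \<epsilon> s
  have "\<exists>P q \<epsilon> s. Z a P q \<epsilon> s" if "a \<in> Obj A" for a
  proof -
    have o: "fobj F a \<in> Obj K" "fobj G a \<in> Obj K" "\<alpha> a \<in> hom (fobj F a) (fobj G a) 0" using that by simp_all
    obtain P q \<epsilon> where P: "is_path_object (fobj F a) (fobj G a) (\<alpha> a) P q \<epsilon>" "q \<in> isof P (fobj F a)" "\<epsilon> 0 (const_map 1 0) \<in> isof P (fobj G a)"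
      by (rule path_object_ex[OF o])
    obtain s where "s \<in> hom (fobj F a) P 0" "post (fobj F a) P (fobj F a) 0 q s = Ident K (fobj F a)"
      "\<And>m t. t \<in> simplices iso_nerve m \<Longrightarrow> Comp K (fobj F a) P (fobj G a) m (\<epsilon> m t) (degen (Hom K (fobj F a) P) m s) = degen (Hom K (fobj F a) (fobj G a)) m (\<alpha> a)"
      "hequiv P (fobj F a) q"
      using path_object_section[OF P(1) o] by blast
    with P show ?thesis unfolding Z_def by blast
  qed
  then obtain P q \<epsilon> s where "\<And>a. a \<in> Obj A \<Longrightarrow> Z a (P a) (q a) (\<epsilon> a) (s a)" by metis
  then have P: "\<And>a. a \<in> Obj A \<Longrightarrow> is_path_object (fobj F a) (fobj G a) (\<alpha> a) (P a) (q a) (\<epsilon> a)"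
    and qi: "\<And>a. a \<in> Obj A \<Longrightarrow> q a \<in> isof (P a) (fobj F a)" and ei: "\<And>a. a \<in> Obj A \<Longrightarrow> \<epsilon> a 0 (const_map 1 0) \<in> isof (P a) (fobj G a)"
    and s: "\<And>a. a \<in> Obj A \<Longrightarrow> s a \<in> hom (fobj F a) (P a) 0" and qs: "\<And>a. a \<in> Obj A \<Longrightarrow> post (fobj F a) (P a) (fobj F a) 0 (q a) (s a) = Ident K (fobj F a)"
    and \<epsilon>s: "\<And>a m t. a \<in> Obj A \<Longrightarrow> t \<in> simplices iso_nerve m \<Longrightarrow>
       Comp K (fobj F a) (P a) (fobj G a) m (\<epsilon> a m t) (degen (Hom K (fobj F a) (P a)) m (s a)) = degen (Hom K (fobj F a) (fobj G a)) m (\<alpha> a)"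
    and hq: "\<And>a. a \<in> Obj A \<Longrightarrow> hequiv (P a) (fobj F a) (q a)"
    unfolding Z_def by blast+
  interpret D: path_diagram K \<kappa> isof A F G \<alpha> P q \<epsilon> by unfold_locales (simp_all add: P)
  let ?q = "restrict q (Obj A)" and ?ev = "restrict D.ev (Obj A)" and ?s = "restrict s (Obj A)"
  have dm [simp]: "diag_map D.pdiag F ?q" "diag_map D.pdiag G ?ev" "diag_map F D.pdiag ?s"
    using D.q_diag_map D.ev_diag_map D.section_diag_map[OF s qs \<epsilon>s] by simp_all
  note [simp] = s
  have q_triv: "?q a \<in> triv_fibs K isof (fobj D.pdiag a) (fobj F a)" if "a \<in> Obj A" for a
    using that qi hq by (simp add: triv_fibs_def equivs_iff)
  \<comment> \<open>\<open>\<epsilon> a\<close> itself is a homotopy from \<open>\<alpha> q\<close>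
    to \<open>ev\<close>, and \<open>\<alpha> q\<close> is a composite of equivalences.\<close>
  have "hequiv (P a) (fobj G a) (D.ev a)" if a [simp]: "a \<in> Obj A" for a
  proof (rule hequiv_path)
    have "hequiv (fobj F a) (fobj G a) (\<alpha> a)" using eq[OF a] by (simp add: equivs_iff)
    then show "hequiv (P a) (fobj G a) (post (P a) (fobj F a) (fobj G a) 0 (\<alpha> a) (q a))"
      by (intro hequiv_comp hq) simp_all
    show "path (P a) (fobj G a) (post (P a) (fobj F a) (fobj G a) 0 (\<alpha> a) (q a)) (D.ev a)"
      unfolding path_def by (rule bexI[OF _ path_objectD(3)[OF P[OF a]]]) (simp add: D.ev_def D.\<epsilon>_0)
  qed simp_all
  then have ev_triv: "?ev a \<in> triv_fibs K isof (fobj D.pdiag a) (fobj G a)" if "a \<in> Obj A" for a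
    using that ei by (simp add: triv_fibs_def equivs_iff D.ev_def)
  obtain lP lamP where LP: "is_weighted_limit K A W D.pdiag lP lamP" using flexible_limit_exists[OF D.pdiag_diagram W] by blast
  note [simp] = weighted_limitD[OF L] weighted_limitD[OF L'] weighted_limitD[OF LP]
  let ?Q = "lim_diagram_map K A W D.pdiag lP lamP F l lam ?q"
  let ?E = "lim_diagram_map K A W D.pdiag lP lamP G l' lam' ?ev"
  let ?S = "lim_diagram_map K A W F l lam D.pdiag lP lamP ?s"
  have "?Q \<in> triv_fibs K isof lP l" by (rule lim_diagram_map_in_class[OF fibration_class_triv_fibs _ _ dm(1) q_triv W LP L]) simp_all
  then have hQ: "hequiv lP l ?Q" by (simp add: triv_fibs_def equivs_iff)
  have "?E \<in> triv_fibs K isof lP l'" by (rule lim_diagram_map_in_class[OF fibration_class_triv_fibs _ _ dm(2) ev_triv W LP L']) simp_all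
  then have hE: "hequiv lP l' ?E" by (simp add: triv_fibs_def equivs_iff)
  have Q [simp]: "?Q \<in> hom lP l 0" and pQ: "pull W F l lam lP 0 ?Q = nwhisk W D.pdiag F ?q lP 0 lamP"
    using lim_diagram_map[OF LP L] by simp_all
  have E [simp]: "?E \<in> hom lP l' 0" and pE: "pull W G l' lam' lP 0 ?E = nwhisk W D.pdiag G ?ev lP 0 lamP"
    using lim_diagram_map[OF LP L'] by simp_all
  have S [simp]: "?S \<in> hom l lP 0" and pS: "pull W D.pdiag lP lamP l 0 ?S = nwhisk W F D.pdiag ?s l 0 lam"
    using lim_diagram_map[OF L LP] by simp_all
  \<comment> \<open>The constant homotopy at \<open>\<alpha>\<close> also ends at
    \<open>\<alpha>\<close>; this is the factorization of \<open>\<alpha>\<close>.\<close>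
  have evs: "post (fobj F a) (P a) (fobj G a) 0 (D.ev a) (s a) = \<alpha> a" if [simp]: "a \<in> Obj A" for a
  proof -
    have "Comp K (fobj F a) (P a) (fobj G a) 0 (D.ev a) (degen (Hom K (fobj F a) (P a)) 0 (s a)) = degen (Hom K (fobj F a) (fobj G a)) 0 (\<alpha> a)"
      unfolding D.ev_def by (rule \<epsilon>s) simp_all
    then show ?thesis by (simp add: Comp_0_eq_post)
  qed
  note [simp] = cone_closed[of lam W l F 0]
  \<comment> \<open>The induced map \<open>?S\<close> is a section of the equivalence
    \<open>?Q\<close>, because \<open>q s = id\<close> on components; hence it is an equivalence
    although the components of \<open>s\<close> need not be isofibrations.\<close>
  have "nwhisk W D.pdiag F ?q l 0 (nwhisk W F D.pdiag ?s l 0 lam) = lam"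
    by (rule nats_eqI[OF nwhisk_cones weighted_limitD(2)[OF L]]) (simp_all add: post_post qs)
  then have "post l lP l 0 ?Q ?S = Ident K l"
    by (intro pull_inj[OF L, of l _ 0]) (simp_all add: pull_pull[symmetric] pQ nwhisk_pull[symmetric] pS pull_Ident)
  then have "hequiv l lP ?S" by (intro hequiv_section[OF _ _ hQ]) simp_all
  then have "hequiv l l' (post l lP l' 0 ?E ?S)" by (intro hequiv_comp hE) simp_all
  moreover have "lim_diagram_map K A W F l lam G l' lam' \<alpha> = post l lP l' 0 ?E ?S"
  proof (rule lim_diagram_map_eqI[OF L L'])
    have "nwhisk W D.pdiag G ?ev l 0 (nwhisk W F D.pdiag ?s l 0 lam) = nwhisk W F G \<alpha> l 0 lam"
      by (rule nats_eqI[OF nwhisk_cones nwhisk_cones]) (simp_all add: post_post evs)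
    then show "pull W G l' lam' l 0 (post l lP l' 0 ?E ?S) = nwhisk W F G \<alpha> l 0 lam"
      by (simp add: pull_pull[symmetric] pE nwhisk_pull[symmetric] pS)
  qed simp_all
  ultimately show ?thesis by (simp add: equivs_iff)
qed

section \<open>The bifunctor of flexible limits\<close>

lemma lim_bimap_cone:
  assumes "weight W" "weight W'" "diagram F" "diagram G" "i \<in> nats A W W' n" "lam' \<in> cones W' F l' 0" "l' \<in> Obj K"
  shows "Comp (fun_scat A SSET) W (comp_sfun (repr K l') F) (comp_sfun (repr K l') G) n (whisker K A F G l' n \<alpha>)
      (Comp (fun_scat A SSET) W W' (comp_sfun (repr K l') F) n (degen (Hom (fun_scat A SSET) W' (comp_sfun (repr K l') F)) n lam') i) =
    mknat A W n (\<lambda>a k \<theta> w. Comp K l' (fobj F a) (fobj G a) k (act (Hom K (fobj F a) (fobj G a)) k n \<theta> (\<alpha> a))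
       (lam' a k (const_map 0 k, i a k (\<theta>, w))))"
  unfolding Comp_fun_scat_SSET whisker_def using assms
  by (intro mknat_cong) (simp add: repr_def)

text \<open>The induced simplex is described by its components: \<open>lam\<close> after it equals
  \<open>\<alpha>\<close> after \<open>lam'\<close> after \<open>i\<close>, in every dimension. The
  work lies in showing that the right side is a cone on \<open>W\<close>, which uses naturality of
  \<open>\<alpha>\<close>, \<open>lam'\<close> and \<open>i\<close>.\<close>

lemma lim_bimap:
  assumes W [simp]: "weight W" and W' [simp]: "weight W'" and F [simp]: "diagram F" and G [simp]: "diagram G"
    and L': "is_weighted_limit K A W' F l' lam'" and L: "is_weighted_limit K A W G l lam"
    and i: "i \<in> nats A W W' n" and \<alpha>: "\<alpha> \<in> simplices (nat_sset A K F G) n"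
  shows lim_bimap_closed: "lim_bimap K A W' F l' lam' W G l lam n i \<alpha> \<in> hom l' l n"
    and lim_bimap_Comp: "a \<in> Obj A \<Longrightarrow> \<theta> \<in> Delta_hom k n \<Longrightarrow> w \<in> simplices (fobj W a) k \<Longrightarrow>
      Comp K l' l (fobj G a) k (lam a k (const_map 0 k, w)) (act (Hom K l' l) k n \<theta> (lim_bimap K A W' F l' lam' W G l lam n i \<alpha>)) =
      Comp K l' (fobj F a) (fobj G a) k (act (Hom K (fobj F a) (fobj G a)) k n \<theta> (\<alpha> a)) (lam' a k (const_map 0 k, i a k (\<theta>, w)))"
proof -
  note [simp] = weighted_limitD[OF L] weighted_limitD[OF L']
  have [simp]: "\<alpha> a \<in> hom (fobj F a) (fobj G a) n" if "a \<in> Obj A" for a using that \<alpha> by (auto simp: nat_sset_def)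
  have \<alpha>n: "Comp K (fobj F a) (fobj G a) (fobj G b) k (fmap G a b k f) (act (Hom K (fobj F a) (fobj G a)) k n \<theta> (\<alpha> a)) =
      Comp K (fobj F a) (fobj F b) (fobj G b) k (act (Hom K (fobj F b) (fobj G b)) k n \<theta> (\<alpha> b)) (fmap F a b k f)"
    if "a \<in> Obj A" "b \<in> Obj A" "\<theta> \<in> Delta_hom k n" "f \<in> simplices (Hom A a b) k" for a b \<theta> k f
    using that \<alpha> by (auto simp: nat_sset_def)
  note [simp] = weight_map_closed[OF i W W'] cone_closed[of lam' W' l' F 0]
  note i' = nats_act[OF i W[unfolded weight_def] W'[unfolded weight_def]] nats_wact[OF i W[unfolded weight_def] W'[unfolded weight_def]]
  let ?\<phi> = "mknat A W n (\<lambda>a k \<theta> w. Comp K l' (fobj F a) (fobj G a) k (act (Hom K (fobj F a) (fobj G a)) k n \<theta> (\<alpha> a))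
       (lam' a k (const_map 0 k, i a k (\<theta>, w))))"
  have \<phi>: "?\<phi> \<in> cones W G l' n"
  proof (rule mknat_cones)
    fix a b k \<theta> w f assume [simp]: "a \<in> Obj A" "b \<in> Obj A" "\<theta> \<in> Delta_hom k n" "w \<in> simplices (fobj W a) k" "f \<in> simplices (Hom A a b) k"
    have "Comp K l' (fobj G a) (fobj G b) k (fmap G a b k f) (Comp K l' (fobj F a) (fobj G a) k (act (Hom K (fobj F a) (fobj G a)) k n \<theta> (\<alpha> a))
       (lam' a k (const_map 0 k, i a k (\<theta>, w)))) =
      Comp K l' (fobj F b) (fobj G b) k (act (Hom K (fobj F b) (fobj G b)) k n \<theta> (\<alpha> b)) (Comp K l' (fobj F a) (fobj F b) k (fmap F a b k f)
       (lam' a k (const_map 0 k, i a k (\<theta>, w))))"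
      by (simp add: comp_assoc \<alpha>n)
    then show "Comp K l' (fobj G a) (fobj G b) k (fmap G a b k f) (Comp K l' (fobj F a) (fobj G a) k (act (Hom K (fobj F a) (fobj G a)) k n \<theta> (\<alpha> a))
       (lam' a k (const_map 0 k, i a k (\<theta>, w)))) =
      Comp K l' (fobj F b) (fobj G b) k (act (Hom K (fobj F b) (fobj G b)) k n \<theta> (\<alpha> b)) (lam' b k (const_map 0 k, i b k (\<theta>, wact W a b k f w)))"
      by (simp add: cone_wact[OF weighted_limitD(2)[OF L']] i')
  qed (simp_all add: comp_act act_hom_act cone_act[OF weighted_limitD(2)[OF L']] i')
  have eq: "lim_bimap K A W' F l' lam' W G l lam n i \<alpha> = factor_cone K A W G l lam l' n ?\<phi>"
    unfolding lim_bimap_def Let_def using i by (simp add: lim_bimap_cone del: fun_scat_simps)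
  show "lim_bimap K A W' F l' lam' W G l lam n i \<alpha> \<in> hom l' l n"
    unfolding eq by (rule factor_cone_closed[OF L]) (simp_all add: \<phi>)
  have "pull W G l lam l' n (lim_bimap K A W' F l' lam' W G l lam n i \<alpha>) = ?\<phi>"
    unfolding eq by (rule pull_factor_cone[OF L]) (simp_all add: \<phi>)
  from fun_cong[OF fun_cong[OF fun_cong[OF this, of a], of k], of "(\<theta>, w)"]
  show "Comp K l' l (fobj G a) k (lam a k (const_map 0 k, w)) (act (Hom K l' l) k n \<theta> (lim_bimap K A W' F l' lam' W G l lam n i \<alpha>)) =
      Comp K l' (fobj F a) (fobj G a) k (act (Hom K (fobj F a) (fobj G a)) k n \<theta> (\<alpha> a)) (lam' a k (const_map 0 k, i a k (\<theta>, w)))"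
    if "a \<in> Obj A" "\<theta> \<in> Delta_hom k n" "w \<in> simplices (fobj W a) k" using that by simp
qed

text \<open>The converse of \<open>lim_bimap_Comp\<close>; with it every law of the bifunctor
  becomes a comparison of components.\<close>

lemma lim_bimap_eqI:
  assumes W [simp]: "weight W" and F [simp]: "diagram F" and G [simp]: "diagram G" and l' [simp]: "l' \<in> Obj K"
    and L: "is_weighted_limit K A W G l lam" and h: "h \<in> hom l' l n"
    and eq: "\<And>a k \<theta> w. a \<in> Obj A \<Longrightarrow> \<theta> \<in> Delta_hom k n \<Longrightarrow> w \<in> simplices (fobj W a) k \<Longrightarrow>
      Comp K l' l (fobj G a) k (lam a k (const_map 0 k, w)) (act (Hom K l' l) k n \<theta> h) =
      Comp K l' (fobj F a) (fobj G a) k (act (Hom K (fobj F a) (fobj G a)) k n \<theta> (\<alpha> a)) (lam' a k (const_map 0 k, i a k (\<theta>, w)))"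
    and cl: "\<And>a k \<theta> w. a \<in> Obj A \<Longrightarrow> \<theta> \<in> Delta_hom k n \<Longrightarrow> w \<in> simplices (fobj W a) k \<Longrightarrow> lam' a k (const_map 0 k, i a k (\<theta>, w)) \<in> hom l' (fobj F a) k"
    and cl': "\<And>a k \<theta> w. a \<in> Obj A \<Longrightarrow> \<theta> \<in> Delta_hom k n \<Longrightarrow> w \<in> simplices (fobj W a) k \<Longrightarrow> i a k (\<theta>, w) \<in> simplices (fobj W' a) k"
  shows "lim_bimap K A W' F l' lam' W G l lam n i \<alpha> = h"
  unfolding lim_bimap_def Let_def
proof (rule factor_coneI[OF L W G l' h])
  show "pull W G l lam l' n h =
    Comp (fun_scat A SSET) W (comp_sfun (repr K l') F) (comp_sfun (repr K l') G) n (whisker K A F G l' n \<alpha>)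
      (Comp (fun_scat A SSET) W W' (comp_sfun (repr K l') F) n (degen (Hom (fun_scat A SSET) W' (comp_sfun (repr K l') F)) n lam') i)"
    unfolding Comp_fun_scat_SSET whisker_def pull_eq
    by (rule mknat_cong) (simp add: repr_def eq cl cl')
qed

text \<open>The chosen limits satisfy no coherence among themselves. The functor laws hold because
  simplices into a limit are determined by their components, and the components of both sides agree
  by the laws of composition in \<open>K\<close>.\<close>

theorem flexible_limit_bifunctor:
  assumes L: "\<And>W F. flexible \<kappa> A W \<Longrightarrow> diagram F \<Longrightarrow> is_weighted_limit K A W F (L W F) (Lam W F)"
  obtains B where "simplicial_functor (prod_scat (op_scat (Flex \<kappa> A)) (fun_scat A K)) K B"
    "\<And>W F. fobj B (W, F) = L W F"
    "\<And>W W' F G n i \<alpha>. fmap B (W', F) (W, G) n (i, \<alpha>) = lim_bimap K A W' F (L W' F) (Lam W' F) W G (L W G) (Lam W G) n i \<alpha>"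
proof -
  let ?b = "\<lambda>W' F W G. lim_bimap K A W' F (L W' F) (Lam W' F) W G (L W G) (Lam W G)"
  let ?B = "\<lparr>fobj = (\<lambda>(W, F). L W F), fmap = (\<lambda>(W', F) (W, G) n (i, \<alpha>). ?b W' F W G n i \<alpha>)\<rparr>"
  have fw [simp]: "weight W" if "flexible \<kappa> A W" for W
    using that weights_sset_functor[OF A.simplicial_category_axioms] by (auto simp: flexible_def projective_cell_complex_def weight_def)
  have FObj: "Obj (Flex \<kappa> A) = {W. flexible \<kappa> A W}" by (auto simp: Flex_def full_sub_def flexible_def projective_cell_complex_def)
  have FHom: "Hom (Flex \<kappa> A) = nat_sset A SSET" "Comp (Flex \<kappa> A) = Comp (fun_scat A SSET)" "Ident (Flex \<kappa> A) = Ident (fun_scat A (SSet \<kappa>))"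
    by (simp_all add: Flex_def full_sub_def)
  have [simp]: "L W F \<in> Obj K" "Lam W F \<in> cones W F (L W F) 0" if "flexible \<kappa> A W" "diagram F" for W F
    using weighted_limitD[OF L[OF that]] by simp_all
  let ?C = "prod_scat (op_scat (Flex \<kappa> A)) (fun_scat A K)"
  have CObj: "(W, F) \<in> Obj ?C \<longleftrightarrow> flexible \<kappa> A W \<and> diagram F" for W F
    by (simp add: prod_scat_def op_scat_def FObj diagram_def)
  have CHom: "Hom ?C (W', F) (W, G) = prod_sset (nat_sset A SSET W W') (nat_sset A K F G)" for W W' F G
    by (simp add: prod_scat_def op_scat_def FHom)
  have CComp: "Comp ?C (W1, F1) (W2, F2) (W3, F3) n (j, \<beta>) (i, \<alpha>) = (Comp (fun_scat A SSET) W3 W2 W1 n i j, Comp (fun_scat A K) F1 F2 F3 n \<beta> \<alpha>)"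
    for W1 W2 W3 F1 F2 F3 n i j \<alpha> \<beta> by (simp add: prod_scat_def op_scat_def FHom)
  have \<alpha>c [simp]: "\<alpha> a \<in> hom (fobj F a) (fobj G a) n" if "\<alpha> \<in> simplices (nat_sset A K F G) n" "a \<in> Obj A" for F G :: "('a, 'u, 'o, 'u) sfun" and \<alpha> n a
    using that by (auto simp: nat_sset_def)
  have "simplicial_functor ?C K ?B"
  proof
    fix a assume "a \<in> Obj ?C"
    then show "fobj ?B a \<in> Obj K" by (cases a) (simp add: CObj)
  next
    fix x y f n assume x: "x \<in> Obj ?C" "y \<in> Obj ?C" "f \<in> simplices (Hom ?C x y) n"
    obtain W' F W G i \<alpha> where o: "x = (W', F)" "y = (W, G)" "f = (i, \<alpha>)" by (cases x, cases y, cases f) auto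
    show "fmap ?B x y n f \<in> hom (fobj ?B x) (fobj ?B y) n"
      using x by (simp add: o CObj CHom lim_bimap_closed[OF _ _ _ _ L L])
  next
    fix x y \<theta> m n f assume x: "x \<in> Obj ?C" "y \<in> Obj ?C" "\<theta> \<in> Delta_hom m n" "f \<in> simplices (Hom ?C x y) n"
    obtain W' F W G i \<alpha> where o: "x = (W', F)" "y = (W, G)" "f = (i, \<alpha>)" by (cases x, cases y, cases f) auto
    have h [simp]: "flexible \<kappa> A W'" "diagram F" "flexible \<kappa> A W" "diagram G" and i [simp]: "i \<in> nats A W W' n" and \<alpha>: "\<alpha> \<in> simplices (nat_sset A K F G) n"
      using x by (simp_all add: o CObj CHom)
    note [simp] = lim_bimap_closed[OF fw[OF h(3)] fw[OF h(1)] h(2,4) L[OF h(1,2)] L[OF h(3,4)] i \<alpha>] \<alpha>c[OF \<alpha>] weight_map_closed[OF i fw[OF h(3)] fw[OF h(1)]]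
    note bc = lim_bimap_Comp[OF fw[OF h(3)] fw[OF h(1)] h(2,4) L[OF h(1,2)] L[OF h(3,4)] i \<alpha>]
    note [simp] = cone_closed[of "Lam W' F" W' "L W' F" F 0]
    have "?b W' F W G m (act (nat_sset A SSET W W') m n \<theta> i) (act (nat_sset A K F G) m n \<theta> \<alpha>) =
        act (Hom K (L W' F) (L W G)) m n \<theta> (?b W' F W G n i \<alpha>)"
      by (rule lim_bimap_eqI[OF _ _ _ _ L[OF h(3,4)]])
        (use x(3) in \<open>simp_all add: act_hom_act bc\<close>, simp add: nat_sset_def act_hom_act)
    then show "fmap ?B x y m (act (Hom ?C x y) m n \<theta> f) = act (Hom K (fobj ?B x) (fobj ?B y)) m n \<theta> (fmap ?B x y n f)"
      by (simp add: o CHom)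
  next
    fix x assume x: "x \<in> Obj ?C"
    obtain W F where o: "x = (W, F)" by (cases x)
    have h [simp]: "flexible \<kappa> A W" "diagram F" using x by (simp_all add: o CObj)
    note [simp] = cone_closed[of "Lam W F" W "L W F" F 0]
    have "?b W F W F 0 (\<lambda>a\<in>Obj A. Ident SSET (fobj W a)) (\<lambda>a\<in>Obj A. Ident K (fobj F a)) = Ident K (L W F)"
      by (rule lim_bimap_eqI[OF _ _ _ _ L[OF h]]) (simp_all add: Delta_hom_0 act_0_eq_degen)
    then show "fmap ?B x x 0 (Ident ?C x) = Ident K (fobj ?B x)"
      by (simp add: o prod_scat_def op_scat_def FHom) (simp add: fun_scat_def)
  next
    fix x y z n g f assume x: "x \<in> Obj ?C" "y \<in> Obj ?C" "z \<in> Obj ?C" "g \<in> simplices (Hom ?C y z) n" "f \<in> simplices (Hom ?C x y) n"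
    obtain W1 F1 W2 F2 W3 F3 i \<alpha> j \<beta> where o: "x = (W1, F1)" "y = (W2, F2)" "z = (W3, F3)" "f = (i, \<alpha>)" "g = (j, \<beta>)"
      by (cases x, cases y, cases z, cases f, cases g) auto
    have h [simp]: "flexible \<kappa> A W1" "diagram F1" "flexible \<kappa> A W2" "diagram F2" "flexible \<kappa> A W3" "diagram F3"
      and i [simp]: "i \<in> nats A W2 W1 n" and \<alpha>: "\<alpha> \<in> simplices (nat_sset A K F1 F2) n"
      and j [simp]: "j \<in> nats A W3 W2 n" and \<beta>: "\<beta> \<in> simplices (nat_sset A K F2 F3) n"
      using x by (simp_all add: o CObj CHom)
    note [simp] = \<alpha>c[OF \<alpha>] \<alpha>c[OF \<beta>] weight_map_closed[OF i fw[OF h(3)] fw[OF h(1)]] weight_map_closed[OF j fw[OF h(5)] fw[OF h(3)]]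
      lim_bimap_closed[OF fw[OF h(3)] fw[OF h(1)] h(2,4) L[OF h(1,2)] L[OF h(3,4)] i \<alpha>]
      lim_bimap_closed[OF fw[OF h(5)] fw[OF h(3)] h(4,6) L[OF h(3,4)] L[OF h(5,6)] j \<beta>]
    note b1 = lim_bimap_Comp[OF fw[OF h(3)] fw[OF h(1)] h(2,4) L[OF h(1,2)] L[OF h(3,4)] i \<alpha>]
    note b2 = lim_bimap_Comp[OF fw[OF h(5)] fw[OF h(3)] h(4,6) L[OF h(3,4)] L[OF h(5,6)] j \<beta>]
    note [simp] = cone_closed[of "Lam W1 F1" W1 "L W1 F1" F1 0] cone_closed[of "Lam W2 F2" W2 "L W2 F2" F2 0] cone_closed[of "Lam W3 F3" W3 "L W3 F3" F3 0]
    have "?b W1 F1 W3 F3 n (Comp (fun_scat A SSET) W3 W2 W1 n i j) (Comp (fun_scat A K) F1 F2 F3 n \<beta> \<alpha>) =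
        Comp K (L W1 F1) (L W2 F2) (L W3 F3) n (?b W2 F2 W3 F3 n j \<beta>) (?b W1 F1 W2 F2 n i \<alpha>)"
    proof (rule lim_bimap_eqI[OF _ _ _ _ L[OF h(5,6)]])
      fix a k \<theta> w assume [simp]: "a \<in> Obj A" "\<theta> \<in> Delta_hom k n" "w \<in> simplices (fobj W3 a) k"
      have "Comp K (L W1 F1) (L W3 F3) (fobj F3 a) k (Lam W3 F3 a k (const_map 0 k, w))
          (Comp K (L W1 F1) (L W2 F2) (L W3 F3) k (act (Hom K (L W2 F2) (L W3 F3)) k n \<theta> (?b W2 F2 W3 F3 n j \<beta>)) (act (Hom K (L W1 F1) (L W2 F2)) k n \<theta> (?b W1 F1 W2 F2 n i \<alpha>))) =
        Comp K (L W1 F1) (fobj F2 a) (fobj F3 a) k (act (Hom K (fobj F2 a) (fobj F3 a)) k n \<theta> (\<beta> a))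
          (Comp K (L W1 F1) (L W2 F2) (fobj F2 a) k (Lam W2 F2 a k (const_map 0 k, j a k (\<theta>, w))) (act (Hom K (L W1 F1) (L W2 F2)) k n \<theta> (?b W1 F1 W2 F2 n i \<alpha>)))"
        by (simp add: comp_assoc b2)
      also have "\<dots> = Comp K (L W1 F1) (fobj F1 a) (fobj F3 a) k (act (Hom K (fobj F1 a) (fobj F3 a)) k n \<theta> (Comp (fun_scat A K) F1 F2 F3 n \<beta> \<alpha> a))
         (Lam W1 F1 a k (const_map 0 k, Comp (fun_scat A SSET) W3 W2 W1 n i j a k (\<theta>, w)))"
        by (simp add: b1) (simp add: fun_scat_def comp_act comp_assoc)
      finally show "Comp K (L W1 F1) (L W3 F3) (fobj F3 a) k (Lam W3 F3 a k (const_map 0 k, w))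
          (act (Hom K (L W1 F1) (L W3 F3)) k n \<theta> (Comp K (L W1 F1) (L W2 F2) (L W3 F3) n (?b W2 F2 W3 F3 n j \<beta>) (?b W1 F1 W2 F2 n i \<alpha>))) =
        Comp K (L W1 F1) (fobj F1 a) (fobj F3 a) k (act (Hom K (fobj F1 a) (fobj F3 a)) k n \<theta> (Comp (fun_scat A K) F1 F2 F3 n \<beta> \<alpha> a))
         (Lam W1 F1 a k (const_map 0 k, Comp (fun_scat A SSET) W3 W2 W1 n i j a k (\<theta>, w)))"
        by (simp add: comp_act)
    qed simp_all
    then show "fmap ?B x z n (Comp ?C x y z n g f) = Comp K (fobj ?B x) (fobj ?B y) (fobj ?B z) n (fmap ?B y z n g) (fmap ?B x y n f)"
      by (simp add: o CComp)
  qed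
  then show thesis by (rule that) simp_all
qed

text \<open>Identifies the value of the bifunctor at \<open>(i, id)\<close> with the map
  \<open>{i, F}\<close>, so that the isofibration property of the latter carries over.\<close>

lemma lim_bimap_Ident:
  assumes i: "projective_cell_complex \<kappa> A W W' i" and F [simp]: "diagram F"
    and L: "is_weighted_limit K A W F l lam" and L': "is_weighted_limit K A W' F l' lam'"
  shows "lim_bimap K A W' F l' lam' W F l lam 0 i (Ident (fun_scat A K) F) = lim_weight_map K A F W l lam W' l' lam' i"
proof -
  have [simp]: "weight W" "weight W'" and i' [simp]: "i \<in> nats A W W' 0"
    using i weights_sset_functor[OF A.simplicial_category_axioms] by (auto simp: projective_cell_complex_def weight_def)
  note [simp] = weighted_limitD[OF L] weighted_limitD[OF L'] ncomp_cones[of W W' _ _ i] weight_map_closed[OF i' \<open>weight W\<close> \<open>weight W'\<close>]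
    cone_closed[of lam' W' l' F 0]
  have h [simp]: "lim_weight_map K A F W l lam W' l' lam' i \<in> hom l' l 0"
    and p: "pull W F l lam l' 0 (lim_weight_map K A F W l lam W' l' lam' i) = ncomp A W 0 lam' i"
    unfolding lim_weight_map_def Comp_nats_0 by (simp_all add: factor_cone[OF L])
  show ?thesis
  proof (rule lim_bimap_eqI[OF _ _ _ _ L])
    fix a k \<theta> w assume [simp]: "a \<in> Obj A" "\<theta> \<in> Delta_hom k 0" "w \<in> simplices (fobj W a) k"
    have \<theta>: "\<theta> = const_map 0 k" using \<open>\<theta> \<in> _\<close> by (simp add: Delta_hom_0)
    show "Comp K l' l (fobj F a) k (lam a k (const_map 0 k, w)) (act (Hom K l' l) k 0 \<theta> (lim_weight_map K A F W l lam W' l' lam' i)) =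
      Comp K l' (fobj F a) (fobj F a) k (act (Hom K (fobj F a) (fobj F a)) k 0 \<theta> (Ident (fun_scat A K) F a)) (lam' a k (const_map 0 k, i a k (\<theta>, w)))"
      using fun_cong[OF fun_cong[OF fun_cong[OF p, of a], of k], of "(\<theta>, w)"] cone_closed[OF weighted_limitD(2)[OF L'], of a "const_map 0 k" k "i a k (\<theta>, w)"]
      by (simp add: fun_scat_def \<theta> act_0_eq_degen)
  qed simp_all
qed

end

text \<open>Quantifying over all limits, and over all choice functions \<open>L\<close> and
  \<open>Lam\<close> for the bifunctor, makes the claims independent of which limits are
  chosen.\<close>

theorem proposition4p1p5:
  fixes \<kappa> :: "'k rel"
    and K :: "('o, 'u) scat" and isof :: "'o \<Rightarrow> 'o \<Rightarrow> 'u set"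
    and A :: "('a, 'u) scat"
  assumes size: "size_cardinal \<kappa> TYPE('u)"
    and cosmos: "infinity_cosmos K \<kappa> isof"
    and small: "small_simplicial_category \<kappa> A"
  shows
    "(\<forall>F W. simplicial_functor A K F \<longrightarrow> flexible \<kappa> A W \<longrightarrow> (\<exists>l lam. is_weighted_limit K A W F l lam)) \<and>
     (\<forall>F W W' i l lam l' lam'. simplicial_functor A K F \<longrightarrow> flexible \<kappa> A W \<longrightarrow> flexible \<kappa> A W' \<longrightarrow>
         projective_cell_complex \<kappa> A W W' i \<longrightarrow>
         is_weighted_limit K A W F l lam \<longrightarrow> is_weighted_limit K A W' F l' lam' \<longrightarrow>
         lim_weight_map K A F W l lam W' l' lam' i \<in> isof l' l) \<and>
     (\<forall>L Lam.
         (\<forall>W F. flexible \<kappa> A W \<longrightarrow> simplicial_functor A K F \<longrightarrow>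
            is_weighted_limit K A W F (L W F) (Lam W F)) \<longrightarrow>
         (\<exists>B. simplicial_functor (prod_scat (op_scat (Flex \<kappa> A)) (fun_scat A K)) K B \<and>
            (\<forall>W\<in>Obj (Flex \<kappa> A). \<forall>F\<in>Obj (fun_scat A K). fobj B (W, F) = L W F) \<and>
            (\<forall>W\<in>Obj (Flex \<kappa> A). \<forall>W'\<in>Obj (Flex \<kappa> A).
             \<forall>F\<in>Obj (fun_scat A K). \<forall>G\<in>Obj (fun_scat A K). \<forall>n.
             \<forall>i\<in>simplices (Hom (Flex \<kappa> A) W W') n. \<forall>\<alpha>\<in>simplices (Hom (fun_scat A K) F G) n.
               fmap B (W', F) (W, G) n (i, \<alpha>) =
                 lim_bimap K A W' F (L W' F) (Lam W' F) W G (L W G) (Lam W G) n i \<alpha>) \<and>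
            (\<forall>W\<in>Obj (Flex \<kappa> A). \<forall>W'\<in>Obj (Flex \<kappa> A). \<forall>F\<in>Obj (fun_scat A K).
             \<forall>i. projective_cell_complex \<kappa> A W W' i \<longrightarrow>
               fmap B (W', F) (W, F) 0 (i, Ident (fun_scat A K) F) \<in> isof (L W' F) (L W F)))) \<and>
     (\<forall>F G \<alpha> W l lam l' lam'. simplicial_functor A K F \<longrightarrow> simplicial_functor A K G \<longrightarrow>
         \<alpha> \<in> simplices (Hom (fun_scat A K) F G) 0 \<longrightarrow> flexible \<kappa> A W \<longrightarrow>
         is_weighted_limit K A W F l lam \<longrightarrow> is_weighted_limit K A W G l' lam' \<longrightarrow>
         ((\<forall>a\<in>Obj A. \<alpha> a \<in> equivs K (fobj F a) (fobj G a)) \<longrightarrow>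
            lim_diagram_map K A W F l lam G l' lam' \<alpha> \<in> equivs K l l') \<and>
         ((\<forall>a\<in>Obj A. \<alpha> a \<in> isof (fobj F a) (fobj G a)) \<longrightarrow>
            lim_diagram_map K A W F l lam G l' lam' \<alpha> \<in> isof l l') \<and>
         ((\<forall>a\<in>Obj A. \<alpha> a \<in> triv_fibs K isof (fobj F a) (fobj G a)) \<longrightarrow>
            lim_diagram_map K A W F l lam G l' lam' \<alpha> \<in> triv_fibs K isof l l'))"
proof -
  have A: "simplicial_category A" using small by (simp add: small_simplicial_category_def)
  interpret cosmos_diagrams K \<kappa> isof A
    by (intro cosmos_diagrams.intro sized_cosmos.intro sized_cosmos_axioms.intro diagrams.intro cosmos size A
      infinity_cosmos.axioms(1)[OF cosmos])
  note d = diagram_def[symmetric] and dm = diag_map_def[symmetric]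
  have bif: "\<exists>B. simplicial_functor (prod_scat (op_scat (Flex \<kappa> A)) (fun_scat A K)) K B \<and>
            (\<forall>W\<in>Obj (Flex \<kappa> A). \<forall>F\<in>Obj (fun_scat A K). fobj B (W, F) = L W F) \<and>
            (\<forall>W\<in>Obj (Flex \<kappa> A). \<forall>W'\<in>Obj (Flex \<kappa> A).
             \<forall>F\<in>Obj (fun_scat A K). \<forall>G\<in>Obj (fun_scat A K). \<forall>n.
             \<forall>i\<in>simplices (Hom (Flex \<kappa> A) W W') n. \<forall>\<alpha>\<in>simplices (Hom (fun_scat A K) F G) n.
               fmap B (W', F) (W, G) n (i, \<alpha>) =
                 lim_bimap K A W' F (L W' F) (Lam W' F) W G (L W G) (Lam W G) n i \<alpha>) \<and>
            (\<forall>W\<in>Obj (Flex \<kappa> A). \<forall>W'\<in>Obj (Flex \<kappa> A). \<forall>F\<in>Obj (fun_scat A K).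
             \<forall>i. projective_cell_complex \<kappa> A W W' i \<longrightarrow>
               fmap B (W', F) (W, F) 0 (i, Ident (fun_scat A K) F) \<in> isof (L W' F) (L W F))"
    if L: "\<forall>W F. flexible \<kappa> A W \<longrightarrow> simplicial_functor A K F \<longrightarrow> is_weighted_limit K A W F (L W F) (Lam W F)" for L Lam
  proof -
    have L': "is_weighted_limit K A W F (L W F) (Lam W F)" if "flexible \<kappa> A W" "diagram F" for W F
      using L that by (simp add: diagram_def)
    obtain B where B: "simplicial_functor (prod_scat (op_scat (Flex \<kappa> A)) (fun_scat A K)) K B"
      "\<And>W F. fobj B (W, F) = L W F"
      "\<And>W W' F G n i \<alpha>. fmap B (W', F) (W, G) n (i, \<alpha>) = lim_bimap K A W' F (L W' F) (Lam W' F) W G (L W G) (Lam W G) n i \<alpha>"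
      by (rule flexible_limit_bifunctor[OF L']) (assumption, assumption, rule that)
    have "fmap B (W', F) (W, F) 0 (i, Ident (fun_scat A K) F) \<in> isof (L W' F) (L W F)"
      if "W \<in> Obj (Flex \<kappa> A)" "W' \<in> Obj (Flex \<kappa> A)" "F \<in> Obj (fun_scat A K)" "projective_cell_complex \<kappa> A W W' i" for W W' F i
    proof -
      have h: "flexible \<kappa> A W" "flexible \<kappa> A W'" "diagram F" using that by (simp_all add: Flex_def full_sub_def diagram_def)
      show ?thesis unfolding B(3) lim_bimap_Ident[OF that(4) h(3) L'[OF h(1,3)] L'[OF h(2,3)]]
        by (rule lim_weight_map_isof[OF h(3) that(4) L'[OF h(1,3)] L'[OF h(2,3)]])
    qed
    then show ?thesis using B by (intro exI[of _ B] conjI ballI allI impI) blast+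
  qed
  show ?thesis
  proof (intro conjI allI impI)
    show "\<exists>l lam. is_weighted_limit K A W F l lam" if "simplicial_functor A K F" "flexible \<kappa> A W" for F W
      using flexible_limit_exists that unfolding d by blast
    show "lim_weight_map K A F W l lam W' l' lam' i \<in> isof l' l"
      if "simplicial_functor A K F" "projective_cell_complex \<kappa> A W W' i"
        "is_weighted_limit K A W F l lam" "is_weighted_limit K A W' F l' lam'" for F W W' i l lam l' lam'
      using lim_weight_map_isof that unfolding d by blast
  next
    fix F G \<alpha> W l lam l' lam'
    assume h: "simplicial_functor A K F" "simplicial_functor A K G" "\<alpha> \<in> simplices (Hom (fun_scat A K) F G) 0" "flexible \<kappa> A W"
      "is_weighted_limit K A W F l lam" "is_weighted_limit K A W G l' lam'"
    then have h': "diagram F" "diagram G" "diag_map F G \<alpha>" by (simp_all add: d dm)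
    show "lim_diagram_map K A W F l lam G l' lam' \<alpha> \<in> equivs K l l'" if "\<forall>a\<in>Obj A. \<alpha> a \<in> equivs K (fobj F a) (fobj G a)"
      using lim_diagram_map_equiv[OF h' _ h(4-6)] that by blast
    show "lim_diagram_map K A W F l lam G l' lam' \<alpha> \<in> isof l l'" if "\<forall>a\<in>Obj A. \<alpha> a \<in> isof (fobj F a) (fobj G a)"
      using lim_diagram_map_in_class[OF fibration_class_isof h' _ h(4-6)] that by blast
    show "lim_diagram_map K A W F l lam G l' lam' \<alpha> \<in> triv_fibs K isof l l'" if "\<forall>a\<in>Obj A. \<alpha> a \<in> triv_fibs K isof (fobj F a) (fobj G a)"
      using lim_diagram_map_in_class[OF fibration_class_triv_fibs h' _ h(4-6)] that by blast
  qed (rule bif)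
qed

end
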